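(* Let $\Bbbk$ be a field, let $R=\Bbbk\langle z_1,\ldots,z_m\rangle$ be a free associative $\Bbbk$-algebra and let $\Sigma$ be a collection of morphisms between finitely generated free right $R$-modules. Then the canonical morphism $$t_0:L^{\mathrm{dga}}_\Sigma(R)\longrightarrow R_\Sigma$$ from the derived Cohn localization to the (underived) universal Cohn localization is a quasi-isomorphism.
   Context: Algebras are associative and unital; dg algebras are $\mathbb Z$-graded, homologically, with differential of degree $-1$; ordinary algebras are regarded as dg algebras concentrated in degree $0$. $R_\Sigma$ denotes the universal (Cohn) localization of $R$ at $\Sigma$: the ring equipped with a map $\lambda_\Sigma:R\to R_\Sigma$ that is universal among ring maps $R\to S$ such that $\sigma\otimes_RS$ is an isomorphism for every $\sigma\in\Sigma$. A dg algebra $B$ under $R$ is called $\Sigma$-inverting if $\sigma\otimes^{\mathbf L}_RB$ is an isomorphism in the derived category of $B$ for every $\sigma\in\Sigma$. The derived Cohn localization $L^{\mathrm{dga}}_\Sigma(R)$ (Braun–Chuang–Lazarev) is the initial object in the full subcategory of $\Sigma$-inverting objects of the homotopy category of dg $\Bbbk$-algebras under $R$ (the derived under category). Since $R_\Sigma$, regarded as a dg algebra under $R$ via $\lambda_\Sigma$, is $\Sigma$-inverting, there is a canonical morphism $t_0:L^{\mathrm{dga}}_\Sigma(R)\to R_\Sigma$ under $R$. *)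

theory Defs
  imports "HOL-Library.Poly_Mapping" "HOL-Algebra.Algebraic_Closure_Type" "HOL-Algebra.Algebra"
begin

section \<open>Algebras\<close>

text \<open>
  The ground field is a type of class \<open>field\<close>, and \<open>ring_of_type_algebra\<close> is its HOL-Algebra
  ring.  A \<^typ>\<open>('k, 'a) module\<close> record contains a ring record and a scalar multiplication, so it
  also serves to carry an associative algebra.
\<close>

text \<open>The free algebra on \<open>z\<^sub>0, \<dots>, z\<^sub>m\<^sub>-\<^sub>1\<close>: finitely supported functions on words in
  the letters \<open>{..<m}\<close>, with the convolution product.\<close>

definition free_algebra :: "nat \<Rightarrow> ('k::field, nat list \<Rightarrow>\<^sub>0 'k) module" where
  "free_algebra m =
    \<lparr>carrier = {p. Poly_Mapping.keys p \<subseteq> lists {..<m}},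
     monoid.mult = (\<lambda>p q. \<Sum>u\<in>Poly_Mapping.keys p. \<Sum>v\<in>Poly_Mapping.keys q.
               Poly_Mapping.single (u @ v) (Poly_Mapping.lookup p u * Poly_Mapping.lookup q v)),
     one = Poly_Mapping.single [] 1,
     ring.zero = 0,
     ring.add = (+),
     module.smult = (\<lambda>c. Poly_Mapping.map ((*) c))\<rparr>"


section \<open>Right modules and tensor products\<close>

text \<open>The scalar multiplication of the record is used for a right action: in the next locale and
  everywhere below, \<open>r \<odot>\<^bsub>P\<^esub> x\<close> stands for \<open>x \<cdot> r\<close> when \<open>P\<close> is a right
  module.\<close>

locale right_module = R: ring R + P: abelian_group P
  for R :: "('r, 'n) ring_scheme" and P :: "('r, 'p, 'm) module_scheme" +
  assumes act_closed: "r \<in> carrier R \<Longrightarrow> x \<in> carrier P \<Longrightarrow> r \<odot>\<^bsub>P\<^esub> x \<in> carrier P"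
    and act_add_left: "r \<in> carrier R \<Longrightarrow> x \<in> carrier P \<Longrightarrow> y \<in> carrier P \<Longrightarrow>
      r \<odot>\<^bsub>P\<^esub> (x \<oplus>\<^bsub>P\<^esub> y) = r \<odot>\<^bsub>P\<^esub> x \<oplus>\<^bsub>P\<^esub> r \<odot>\<^bsub>P\<^esub> y"
    and act_add_right: "r \<in> carrier R \<Longrightarrow> s \<in> carrier R \<Longrightarrow> x \<in> carrier P \<Longrightarrow>
      (r \<oplus>\<^bsub>R\<^esub> s) \<odot>\<^bsub>P\<^esub> x = r \<odot>\<^bsub>P\<^esub> x \<oplus>\<^bsub>P\<^esub> s \<odot>\<^bsub>P\<^esub> x"
    and act_mult: "r \<in> carrier R \<Longrightarrow> s \<in> carrier R \<Longrightarrow> x \<in> carrier P \<Longrightarrow>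
      (r \<otimes>\<^bsub>R\<^esub> s) \<odot>\<^bsub>P\<^esub> x = s \<odot>\<^bsub>P\<^esub> (r \<odot>\<^bsub>P\<^esub> x)"
    and act_one: "x \<in> carrier P \<Longrightarrow> \<one>\<^bsub>R\<^esub> \<odot>\<^bsub>P\<^esub> x = x"

definition fg_free_right_module :: "('r, 'n) ring_scheme \<Rightarrow> ('r, 'p, 'm) module_scheme \<Rightarrow> bool" where
  "fg_free_right_module R P \<longleftrightarrow> right_module R P \<and>
    (\<exists>E. finite E \<and> E \<subseteq> carrier P \<and>
      (\<forall>x\<in>carrier P. \<exists>!c. c \<in> E \<rightarrow>\<^sub>E carrier R \<and> x = (\<Oplus>\<^bsub>P\<^esub>e\<in>E. c e \<odot>\<^bsub>P\<^esub> e)))"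

definition right_module_hom ::
    "('r, 'n) ring_scheme \<Rightarrow> ('r, 'p, 'm) module_scheme \<Rightarrow> ('r, 'q, 'l) module_scheme \<Rightarrow> ('p \<Rightarrow> 'q) set"
  where "right_module_hom R P Q = {f \<in> carrier P \<rightarrow> carrier Q.
    (\<forall>x\<in>carrier P. \<forall>y\<in>carrier P. f (x \<oplus>\<^bsub>P\<^esub> y) = f x \<oplus>\<^bsub>Q\<^esub> f y) \<and>
    (\<forall>r\<in>carrier R. \<forall>x\<in>carrier P. f (r \<odot>\<^bsub>P\<^esub> x) = r \<odot>\<^bsub>Q\<^esub> f x)}"

text \<open>A morphism together with its source and target.\<close>

type_synonym ('r, 'p) arrow = "('r, 'p) module \<times> ('r, 'p) module \<times> ('p \<Rightarrow> 'p)"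

definition fg_free_arrows :: "('r, 'n) ring_scheme \<Rightarrow> ('r, 'p) arrow set" where
  "fg_free_arrows R = {(P, Q, \<sigma>). fg_free_right_module R P \<and> fg_free_right_module R Q \<and>
    \<sigma> \<in> right_module_hom R P Q}"

text \<open>
  \<open>P \<otimes>\<^sub>R M\<close> for a right module \<open>P\<close> and an abelian group \<open>M\<close> with left \<open>R\<close>-action \<open>l\<close>: the free
  abelian group on \<open>P \<times> M\<close> modulo the subgroup \<open>tensor_rel\<close>.  Its elements are cosets.
\<close>

inductive_set tensor_rel ::
    "('r, 'n) ring_scheme \<Rightarrow> ('r, 'p, 'm) module_scheme \<Rightarrow> ('u, 'l) ring_scheme \<Rightarrow> ('r \<Rightarrow> 'u \<Rightarrow> 'u) \<Rightarrow>
      ('p \<times> 'u \<Rightarrow>\<^sub>0 int) set"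
  for R P M l where
  zero: "0 \<in> tensor_rel R P M l"
| diff: "x \<in> tensor_rel R P M l \<Longrightarrow> y \<in> tensor_rel R P M l \<Longrightarrow> x - y \<in> tensor_rel R P M l"
| add_left: "p \<in> carrier P \<Longrightarrow> q \<in> carrier P \<Longrightarrow> b \<in> carrier M \<Longrightarrow>
    frag_of (p \<oplus>\<^bsub>P\<^esub> q, b) - frag_of (p, b) - frag_of (q, b) \<in> tensor_rel R P M l"
| add_right: "p \<in> carrier P \<Longrightarrow> b \<in> carrier M \<Longrightarrow> c \<in> carrier M \<Longrightarrow>
    frag_of (p, b \<oplus>\<^bsub>M\<^esub> c) - frag_of (p, b) - frag_of (p, c) \<in> tensor_rel R P M l"
| balanced: "r \<in> carrier R \<Longrightarrow> p \<in> carrier P \<Longrightarrow> b \<in> carrier M \<Longrightarrow>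
    frag_of (r \<odot>\<^bsub>P\<^esub> p, b) - frag_of (p, l r b) \<in> tensor_rel R P M l"

definition tensor_carrier ::
    "('r, 'n) ring_scheme \<Rightarrow> ('r, 'p, 'm) module_scheme \<Rightarrow> ('u, 'l) ring_scheme \<Rightarrow> ('r \<Rightarrow> 'u \<Rightarrow> 'u) \<Rightarrow>
      ('p \<times> 'u \<Rightarrow>\<^sub>0 int) set set" where
  "tensor_carrier R P M l =
    {(+) x ` tensor_rel R P M l |x. Poly_Mapping.keys x \<subseteq> carrier P \<times> carrier M}"

text \<open>The map into \<open>P \<otimes>\<^sub>R M\<close>, given by its target data, that sends \<open>p \<otimes> b\<close> to the class of \<open>g (p, b)\<close>.\<close>

definition tensor_map ::
    "('r, 'n) ring_scheme \<Rightarrow> ('r, 'p, 'm) module_scheme \<Rightarrow> ('u, 'l) ring_scheme \<Rightarrow> ('r \<Rightarrow> 'u \<Rightarrow> 'u) \<Rightarrow>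
      ('q \<times> 'v \<Rightarrow> 'p \<times> 'u) \<Rightarrow> ('q \<times> 'v \<Rightarrow>\<^sub>0 int) set \<Rightarrow> ('p \<times> 'u \<Rightarrow>\<^sub>0 int) set" where
  "tensor_map R P M l g U =
    {frag_extend (frag_of \<circ> g) x + t |x t. x \<in> U \<and> t \<in> tensor_rel R P M l}"


section \<open>Universal (Cohn) localization\<close>

definition inverts :: "('r, 'n) ring_scheme \<Rightarrow> ('r, 'p) arrow set \<Rightarrow> ('s, 'l) ring_scheme \<Rightarrow> ('r \<Rightarrow> 's) \<Rightarrow> bool"
  where "inverts R \<Sigma> S \<phi> \<longleftrightarrow> (\<forall>(P, Q, \<sigma>)\<in>\<Sigma>. let l = (\<lambda>r b. \<phi> r \<otimes>\<^bsub>S\<^esub> b) in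
    bij_betw (tensor_map R Q S l (map_prod \<sigma> id)) (tensor_carrier R P S l) (tensor_carrier R Q S l))"

text \<open>Here, and for dg algebras below, the universal property is tested against all rings whose
  carrier lies in the type \<open>'u\<close>, which plays the role of the universe.  The universe is adequate
  when it is infinite and at least as large as the ground field: free algebras on at most \<open>|'u|\<close>
  generators, cofibrant replacements and localizations then exist within it.\<close>

definition universal_localization ::
    "('r, 'n) ring_scheme \<Rightarrow> ('r, 'p) arrow set \<Rightarrow> 'u ring \<Rightarrow> ('r \<Rightarrow> 'u) \<Rightarrow> bool" where
  "universal_localization R \<Sigma> RS lam \<longleftrightarrow>
    ring RS \<and> lam \<in> ring_hom R RS \<and> inverts R \<Sigma> RS lam \<and>
    (\<forall>(S :: 'u ring) \<phi>. ring S \<and> \<phi> \<in> ring_hom R S \<and> inverts R \<Sigma> S \<phi> \<longrightarrow>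
      (\<exists>!\<psi>. \<psi> \<in> ring_hom RS S \<and> \<psi> \<in> extensional (carrier RS) \<and>
        (\<forall>r\<in>carrier R. \<psi> (lam r) = \<phi> r)))"


section \<open>Chain complexes, dg algebras and dg modules\<close>

text \<open>
  Graded objects are families indexed by \<open>int\<close>, and \<open>dif C n\<close> goes from degree \<open>n\<close> to degree
  \<open>n - 1\<close>.  Of the record \<open>gr C n\<close> only the module structure is used.
\<close>

record ('k, 'v) cplx =
  gr :: "int \<Rightarrow> ('k, 'v) module"
  dif :: "int \<Rightarrow> 'v \<Rightarrow> 'v"

record ('k, 'u) dga = "('k, 'u) cplx" +
  mul :: "int \<Rightarrow> int \<Rightarrow> 'u \<Rightarrow> 'u \<Rightarrow> 'u"
  unit :: 'u

record ('k, 'u, 'v) dgm = "('k, 'v) cplx" +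
  act :: "int \<Rightarrow> int \<Rightarrow> 'v \<Rightarrow> 'u \<Rightarrow> 'v"

abbreviation elts :: "('k, 'v, 'm) cplx_scheme \<Rightarrow> int \<Rightarrow> 'v set" where
  "elts C n \<equiv> carrier (gr C n)"

definition linear_maps :: "('k, 'v, 'm) module_scheme \<Rightarrow> ('k, 'w, 'n) module_scheme \<Rightarrow> ('v \<Rightarrow> 'w) set" where
  "linear_maps V W = {f \<in> carrier V \<rightarrow> carrier W.
    (\<forall>x\<in>carrier V. \<forall>y\<in>carrier V. f (x \<oplus>\<^bsub>V\<^esub> y) = f x \<oplus>\<^bsub>W\<^esub> f y) \<and>
    (\<forall>c. \<forall>x\<in>carrier V. f (c \<odot>\<^bsub>V\<^esub> x) = c \<odot>\<^bsub>W\<^esub> f x)}"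

locale chain_complex =
  fixes C :: "('k::field, 'v, 'm) cplx_scheme"
  assumes gr_module: "module ring_of_type_algebra (gr C n)"
    and dif_linear: "dif C n \<in> linear_maps (gr C n) (gr C (n - 1))"
    and dif_dif: "x \<in> elts C n \<Longrightarrow> dif C (n - 1) (dif C n x) = \<zero>\<^bsub>gr C (n - 2)\<^esub>"

locale dg_algebra = chain_complex A for A :: "('k::field, 'u, 'm) dga_scheme" +
  assumes mul_linear_left: "y \<in> elts A j \<Longrightarrow> (\<lambda>x. mul A i j x y) \<in> linear_maps (gr A i) (gr A (i + j))"
    and mul_linear_right: "x \<in> elts A i \<Longrightarrow> mul A i j x \<in> linear_maps (gr A j) (gr A (i + j))"
    and mul_assoc: "x \<in> elts A i \<Longrightarrow> y \<in> elts A j \<Longrightarrow> z \<in> elts A l \<Longrightarrow>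
      mul A (i + j) l (mul A i j x y) z = mul A i (j + l) x (mul A j l y z)"
    and unit_closed: "unit A \<in> elts A 0"
    and unit_left: "x \<in> elts A i \<Longrightarrow> mul A 0 i (unit A) x = x"
    and unit_right: "x \<in> elts A i \<Longrightarrow> mul A i 0 x (unit A) = x"
    and leibniz: "x \<in> elts A i \<Longrightarrow> y \<in> elts A j \<Longrightarrow>
      dif A (i + j) (mul A i j x y) =
        mul A (i - 1) j (dif A i x) y
          \<oplus>\<^bsub>gr A (i + j - 1)\<^esub> ((- 1) powi i) \<odot>\<^bsub>gr A (i + j - 1)\<^esub> mul A i (j - 1) x (dif A j y)"

locale dg_right_module = chain_complex M
  for B :: "('k::field, 'u, 'm) dga_scheme" and M :: "('k, 'u, 'v, 'n) dgm_scheme" +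
  assumes act_linear_left: "b \<in> elts B j \<Longrightarrow> (\<lambda>x. act M i j x b) \<in> linear_maps (gr M i) (gr M (i + j))"
    and act_linear_right: "x \<in> elts M i \<Longrightarrow> act M i j x \<in> linear_maps (gr B j) (gr M (i + j))"
    and act_assoc: "x \<in> elts M i \<Longrightarrow> b \<in> elts B j \<Longrightarrow> c \<in> elts B l \<Longrightarrow>
      act M (i + j) l (act M i j x b) c = act M i (j + l) x (mul B j l b c)"
    and act_unit: "x \<in> elts M i \<Longrightarrow> act M i 0 x (unit B) = x"
    and act_leibniz: "x \<in> elts M i \<Longrightarrow> b \<in> elts B j \<Longrightarrow>
      dif M (i + j) (act M i j x b) =
        act M (i - 1) j (dif M i x) b
          \<oplus>\<^bsub>gr M (i + j - 1)\<^esub> ((- 1) powi i) \<odot>\<^bsub>gr M (i + j - 1)\<^esub> act M i (j - 1) x (dif B j b)"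

text \<open>Morphisms are extensional, so that equal morphisms are equal functions.\<close>

definition chain_maps ::
    "('k, 'v, 'm) cplx_scheme \<Rightarrow> ('k, 'w, 'n) cplx_scheme \<Rightarrow> (int \<Rightarrow> 'v \<Rightarrow> 'w) set" where
  "chain_maps C D = {f. \<forall>n. f n \<in> linear_maps (gr C n) (gr D n) \<and> f n \<in> extensional (elts C n) \<and>
    (\<forall>x\<in>elts C n. f (n - 1) (dif C n x) = dif D n (f n x))}"

definition dga_homs ::
    "('k, 'u, 'm) dga_scheme \<Rightarrow> ('k, 'v, 'n) dga_scheme \<Rightarrow> (int \<Rightarrow> 'u \<Rightarrow> 'v) set" where
  "dga_homs A B = {f \<in> chain_maps A B. f 0 (unit A) = unit B \<and>
    (\<forall>i j. \<forall>x\<in>elts A i. \<forall>y\<in>elts A j. f (i + j) (mul A i j x y) = mul B i j (f i x) (f j y))}"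

definition dgm_homs ::
    "('k, 'u, 'l) dga_scheme \<Rightarrow> ('k, 'u, 'v, 'm) dgm_scheme \<Rightarrow> ('k, 'u, 'w, 'n) dgm_scheme \<Rightarrow>
      (int \<Rightarrow> 'v \<Rightarrow> 'w) set" where
  "dgm_homs B M N = {f \<in> chain_maps M N.
    \<forall>i j. \<forall>x\<in>elts M i. \<forall>b\<in>elts B j. f (i + j) (act M i j x b) = act N i j (f i x) b}"

definition cycles :: "('k, 'v, 'm) cplx_scheme \<Rightarrow> int \<Rightarrow> 'v set" where
  "cycles C n = {x \<in> elts C n. dif C n x = \<zero>\<^bsub>gr C (n - 1)\<^esub>}"

definition boundaries :: "('k, 'v, 'm) cplx_scheme \<Rightarrow> int \<Rightarrow> 'v set" where
  "boundaries C n = dif C (n + 1) ` elts C (n + 1)"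

definition homology :: "('k, 'v, 'm) cplx_scheme \<Rightarrow> int \<Rightarrow> 'v set set" where
  "homology C n = (\<lambda>x. boundaries C n +>\<^bsub>gr C n\<^esub> x) ` cycles C n"

text \<open>The map \<open>H\<^sub>n(C) \<rightarrow> H\<^sub>n(D)\<close> induced by a chain map \<open>f\<close>; the cosets in the
  union all coincide.\<close>

definition homology_map :: "('k, 'w, 'n) cplx_scheme \<Rightarrow> (int \<Rightarrow> 'v \<Rightarrow> 'w) \<Rightarrow> int \<Rightarrow> 'v set \<Rightarrow> 'w set" where
  "homology_map D f n U = (\<Union>x\<in>U. boundaries D n +>\<^bsub>gr D n\<^esub> f n x)"

definition quasi_iso ::
    "('k, 'v, 'm) cplx_scheme \<Rightarrow> ('k, 'w, 'n) cplx_scheme \<Rightarrow> (int \<Rightarrow> 'v \<Rightarrow> 'w) \<Rightarrow> bool" where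
  "quasi_iso C D f \<longleftrightarrow> (\<forall>n. bij_betw (homology_map D f n) (homology C n) (homology D n))"

text \<open>An algebra as a dg algebra concentrated in degree \<open>0\<close>, and likewise for algebra maps.\<close>

definition concentrated :: "('k, 'u) module \<Rightarrow> ('k, 'u) dga" where
  "concentrated S =
    \<lparr>gr = (\<lambda>n. if n = 0 then S else S\<lparr>carrier := {\<zero>\<^bsub>S\<^esub>}\<rparr>),
     dif = (\<lambda>n x. \<zero>\<^bsub>S\<^esub>),
     mul = (\<lambda>i j x y. if i = 0 \<and> j = 0 then x \<otimes>\<^bsub>S\<^esub> y else \<zero>\<^bsub>S\<^esub>),
     unit = \<one>\<^bsub>S\<^esub>\<rparr>"

definition concentrated_map ::
    "('k, 'v) module \<Rightarrow> ('k, 'u) module \<Rightarrow> ('v \<Rightarrow> 'u) \<Rightarrow> int \<Rightarrow> 'v \<Rightarrow> 'u" where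
  "concentrated_map R S f n =
    (if n = 0 then restrict f (carrier R) else restrict (\<lambda>_. \<zero>\<^bsub>S\<^esub>) {\<zero>\<^bsub>R\<^esub>})"


section \<open>Localization of a category at its weak equivalences\<close>

text \<open>
  The Gabriel--Zisman construction: a morphism from \<open>a\<close> to \<open>b\<close> is a class of zigzags of morphisms
  in which the backward ones are weak equivalences.  \<open>Fwd f c\<close> is a step along \<open>f\<close> to the
  object \<open>c\<close>; \<open>Bwd w c\<close> is a step to \<open>c\<close> against a weak equivalence \<open>w\<close> with source \<open>c\<close>.
  \<open>Cmp C a g f\<close> is the composite \<open>g \<circ> f\<close>, where \<open>a\<close> is the source of \<open>f\<close>.
\<close>

record ('o, 'm) wcat =
  Ob :: "'o set"
  Hom :: "'o \<Rightarrow> 'o \<Rightarrow> 'm set"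
  Weq :: "'o \<Rightarrow> 'o \<Rightarrow> 'm set"
  Idn :: "'o \<Rightarrow> 'm"
  Cmp :: "'o \<Rightarrow> 'm \<Rightarrow> 'm \<Rightarrow> 'm"

datatype ('o, 'm) zstep = Fwd 'm 'o | Bwd 'm 'o

fun zigzag :: "('o, 'm) wcat \<Rightarrow> 'o \<Rightarrow> ('o, 'm) zstep list \<Rightarrow> 'o \<Rightarrow> bool" where
  "zigzag C a [] b \<longleftrightarrow> a \<in> Ob C \<and> a = b"
| "zigzag C a (Fwd f c # p) b \<longleftrightarrow> a \<in> Ob C \<and> c \<in> Ob C \<and> f \<in> Hom C a c \<and> zigzag C c p b"
| "zigzag C a (Bwd w c # p) b \<longleftrightarrow> a \<in> Ob C \<and> c \<in> Ob C \<and> w \<in> Weq C c a \<and> zigzag C c p b"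

inductive zigzag_eq ::
    "('o, 'm) wcat \<Rightarrow> 'o \<Rightarrow> 'o \<Rightarrow> ('o, 'm) zstep list \<Rightarrow> ('o, 'm) zstep list \<Rightarrow> bool"
  for C where
  refl: "zigzag C a p b \<Longrightarrow> zigzag_eq C a b p p"
| sym: "zigzag_eq C a b p q \<Longrightarrow> zigzag_eq C a b q p"
| trans: "zigzag_eq C a b p q \<Longrightarrow> zigzag_eq C a b q r \<Longrightarrow> zigzag_eq C a b p r"
| cong: "zigzag C a' r a \<Longrightarrow> zigzag_eq C a b p q \<Longrightarrow> zigzag C b s b' \<Longrightarrow>
    zigzag_eq C a' b' (r @ p @ s) (r @ q @ s)"
| idn: "a \<in> Ob C \<Longrightarrow> zigzag_eq C a a [Fwd (Idn C a) a] []"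
| cmp: "a \<in> Ob C \<Longrightarrow> b \<in> Ob C \<Longrightarrow> c \<in> Ob C \<Longrightarrow> f \<in> Hom C a b \<Longrightarrow> g \<in> Hom C b c \<Longrightarrow>
    zigzag_eq C a c [Fwd f b, Fwd g c] [Fwd (Cmp C a g f) c]"
| inv_right: "a \<in> Ob C \<Longrightarrow> b \<in> Ob C \<Longrightarrow> w \<in> Weq C a b \<Longrightarrow> zigzag_eq C a a [Fwd w b, Bwd w a] []"
| inv_left: "a \<in> Ob C \<Longrightarrow> b \<in> Ob C \<Longrightarrow> w \<in> Weq C a b \<Longrightarrow> zigzag_eq C b b [Bwd w a, Fwd w b] []"

definition loc_hom :: "('o, 'm) wcat \<Rightarrow> 'o \<Rightarrow> 'o \<Rightarrow> ('o, 'm) zstep list set set" where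
  "loc_hom C a b = {p. zigzag C a p b} // {(p, q). zigzag_eq C a b p q}"

text \<open>Whether the image of a morphism \<open>f\<close> of \<open>C\<close> in the localization is an isomorphism.\<close>

definition loc_iso :: "('o, 'm) wcat \<Rightarrow> 'o \<Rightarrow> 'o \<Rightarrow> 'm \<Rightarrow> bool" where
  "loc_iso C a b f \<longleftrightarrow> (\<exists>q. zigzag C b q a \<and>
    zigzag_eq C a a (Fwd f b # q) [] \<and> zigzag_eq C b b (q @ [Fwd f b]) [])"

text \<open>Initial object of the full subcategory of the localization on the objects satisfying \<open>I\<close>.\<close>

definition loc_initial :: "('o, 'm) wcat \<Rightarrow> ('o \<Rightarrow> bool) \<Rightarrow> 'o \<Rightarrow> bool" where
  "loc_initial C I a \<longleftrightarrow> a \<in> Ob C \<and> I a \<and> (\<forall>b\<in>Ob C. I b \<longrightarrow> (\<exists>!\<phi>. \<phi> \<in> loc_hom C a b))"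


section \<open>Derived category of a dg algebra and derived base change\<close>

definition dgm_cat :: "('k::field, 'u) dga \<Rightarrow> (('k, 'u, 'v) dgm, int \<Rightarrow> 'v \<Rightarrow> 'v) wcat" where
  "dgm_cat B =
    \<lparr>Ob = {M. dg_right_module B M},
     Hom = dgm_homs B,
     Weq = (\<lambda>M N. {f \<in> dgm_homs B M N. quasi_iso M N f}),
     Idn = (\<lambda>M n. restrict id (elts M n)),
     Cmp = (\<lambda>M g f n. compose (elts M n) (g n) (f n))\<rparr>"

text \<open>
  A dg algebra under \<open>R\<close> is a pair \<open>(B, \<eta>)\<close>, where \<open>\<eta>\<close> is a dg algebra map from \<open>R\<close>, concentrated in
  degree \<open>0\<close>, to \<open>B\<close>.  For a right \<open>R\<close>-module \<open>P\<close>, the dg \<open>B\<close>-module \<open>P \<otimes>\<^sub>R B\<close> is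
  \<open>P \<otimes>\<^sub>R B\<^sub>n\<close> in degree \<open>n\<close>.  It is used for free \<open>P\<close> only; these are K-projective over \<open>R\<close>, so
  that \<open>P \<otimes>\<^sub>R B\<close> is the derived tensor product.
\<close>

type_synonym ('k, 'r, 'u) dga_under = "('k, 'u) dga \<times> (int \<Rightarrow> 'r \<Rightarrow> 'u)"

definition left_act :: "('k, 'r, 'u) dga_under \<Rightarrow> int \<Rightarrow> 'r \<Rightarrow> 'u \<Rightarrow> 'u" where
  "left_act = (\<lambda>(B, \<eta>) n r b. mul B 0 n (\<eta> 0 r) b)"

definition base_change ::
    "('k, 'r) module \<Rightarrow> ('k, 'r, 'u) dga_under \<Rightarrow> ('r, 'p) module \<Rightarrow>
      ('k, 'u, ('p \<times> 'u \<Rightarrow>\<^sub>0 int) set) dgm" where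
  "base_change R U P = (let B = fst U; l = left_act U in
    \<lparr>gr = (\<lambda>n.
       \<lparr>carrier = tensor_carrier R P (gr B n) (l n),
        monoid.mult = undefined,
        one = undefined,
        ring.zero = tensor_rel R P (gr B n) (l n),
        ring.add = (\<lambda>Y Z. {y + z |y z. y \<in> Y \<and> z \<in> Z}),
        module.smult = (\<lambda>c. tensor_map R P (gr B n) (l n) (\<lambda>(p, b). (p, c \<odot>\<^bsub>gr B n\<^esub> b)))\<rparr>),
     dif = (\<lambda>n. tensor_map R P (gr B (n - 1)) (l (n - 1)) (\<lambda>(p, b). (p, dif B n b))),
     act = (\<lambda>i j Y c. tensor_map R P (gr B (i + j)) (l (i + j)) (\<lambda>(p, b). (p, mul B i j b c)) Y)\<rparr>)"

definition base_change_map ::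
    "('k, 'r) module \<Rightarrow> ('k, 'r, 'u) dga_under \<Rightarrow> ('r, 'p) arrow \<Rightarrow>
      int \<Rightarrow> ('p \<times> 'u \<Rightarrow>\<^sub>0 int) set \<Rightarrow> ('p \<times> 'u \<Rightarrow>\<^sub>0 int) set" where
  "base_change_map R U = (\<lambda>(P, Q, \<sigma>) n.
    restrict (tensor_map R Q (gr (fst U) n) (left_act U n) (map_prod \<sigma> id)) (elts (base_change R U P) n))"

definition derived_inverts ::
    "('k::field, 'r) module \<Rightarrow> ('r, 'p) arrow set \<Rightarrow> ('k, 'r, 'u) dga_under \<Rightarrow> bool" where
  "derived_inverts R \<Sigma> U \<longleftrightarrow> (\<forall>(P, Q, \<sigma>)\<in>\<Sigma>.
    loc_iso (dgm_cat (fst U)) (base_change R U P) (base_change R U Q) (base_change_map R U (P, Q, \<sigma>)))"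


section \<open>Derived Cohn localization\<close>

text \<open>
  Localizing dg algebras under \<open>R\<close> at the quasi-isomorphisms yields the derived under category when
  \<open>R\<close> is cofibrant as a dg algebra, in particular when \<open>R\<close> is free (over a field, dg algebras are
  left proper, so that it does so for every \<open>R\<close>).
\<close>

definition under_cat ::
    "('k::field, 'r) module \<Rightarrow> (('k, 'r, 'u) dga_under, int \<Rightarrow> 'u \<Rightarrow> 'u) wcat" where
  "under_cat R =
    (let homs = (\<lambda>(A, \<eta>) (B, \<theta>).
       {f \<in> dga_homs A B. \<forall>n. \<forall>r\<in>elts (concentrated R) n. f n (\<eta> n r) = \<theta> n r})
     in
     \<lparr>Ob = {(B, \<eta>). dg_algebra B \<and> \<eta> \<in> dga_homs (concentrated R) B},
      Hom = homs,
      Weq = (\<lambda>U V. {f \<in> homs U V. quasi_iso (fst U) (fst V) f}),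
      Idn = (\<lambda>U n. restrict id (elts (fst U) n)),
      Cmp = (\<lambda>U g f n. compose (elts (fst U) n) (g n) (f n))\<rparr>)"

definition derived_localization ::
    "('k::field, 'r) module \<Rightarrow> ('r, 'p) arrow set \<Rightarrow> ('k, 'r, 'u) dga_under \<Rightarrow> bool" where
  "derived_localization R \<Sigma> L \<longleftrightarrow> loc_initial (under_cat R) (derived_inverts R \<Sigma>) L"

text \<open>A ring under \<open>R\<close> as a dg algebra under \<open>R\<close>; the ground field acts through \<open>\<phi>\<close>.\<close>

definition ring_under :: "('k, 'r) module \<Rightarrow> 'u ring \<Rightarrow> ('r \<Rightarrow> 'u) \<Rightarrow> ('k, 'r, 'u) dga_under" where
  "ring_under R S \<phi> = (let A = \<lparr>carrier = carrier S, monoid.mult = monoid.mult S, one = \<one>\<^bsub>S\<^esub>, ring.zero = \<zero>\<^bsub>S\<^esub>, ring.add = ring.add S,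
      module.smult = (\<lambda>c x. \<phi> (c \<odot>\<^bsub>R\<^esub> \<one>\<^bsub>R\<^esub>) \<otimes>\<^bsub>S\<^esub> x)\<rparr>
    in (concentrated A, concentrated_map R A \<phi>))"

definition canonical_morphism ::
    "('k::field, 'r) module \<Rightarrow> ('k, 'r, 'u) dga_under \<Rightarrow> ('k, 'r, 'u) dga_under \<Rightarrow>
      (('k, 'r, 'u) dga_under, int \<Rightarrow> 'u \<Rightarrow> 'u) zstep list set" where
  "canonical_morphism R U V = (THE \<phi>. \<phi> \<in> loc_hom (under_cat R) U V)"

text \<open>The map induced on \<open>H\<^sub>n\<close> by a zigzag starting at \<open>U\<close>: backward steps, being
  quasi-isomorphisms, are inverted.\<close>

fun homology_zigzag ::
    "int \<Rightarrow> ('k, 'r, 'u) dga_under \<Rightarrow> (('k, 'r, 'u) dga_under, int \<Rightarrow> 'u \<Rightarrow> 'u) zstep list \<Rightarrow> 'u set \<Rightarrow> 'u set"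
  where
  "homology_zigzag n U [] = id"
| "homology_zigzag n U (Fwd f V # p) = homology_zigzag n V p \<circ> homology_map (fst V) f n"
| "homology_zigzag n U (Bwd w V # p) =
    homology_zigzag n V p \<circ> inv_into (homology (fst V) n) (homology_map (fst U) w n)"

definition under_quasi_iso ::
    "('k::field, 'r) module \<Rightarrow> ('k, 'r, 'u) dga_under \<Rightarrow> ('k, 'r, 'u) dga_under \<Rightarrow>
      (('k, 'r, 'u) dga_under, int \<Rightarrow> 'u \<Rightarrow> 'u) zstep list set \<Rightarrow> bool" where
  "under_quasi_iso R U V \<phi> \<longleftrightarrow> \<phi> \<in> loc_hom (under_cat R) U V \<and>
    (\<forall>p\<in>\<phi>. \<forall>n. bij_betw (homology_zigzag n U p) (homology (fst U) n) (homology (fst V) n))"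

end

theory Submission
  imports Defs
begin

text \<open>
 Let \<open>L\<close> be the derived localization and \<open>S = H\<^sub>0(L)\<close>.  Once bases are chosen, a map of free modules is a matrix
 over \<open>R\<close>, and it becomes invertible over a ring, or homotopy invertible over a dg algebra, iff the
 corresponding linear systems are uniquely solvable in the ring, respectively in homology
 (\<open>inverts_iff\<close>, \<open>derived_inverts_iff\<close>).  All dg algebras below are shown to be inverting in this form.

 In negative degrees, \<open>H\<^sub>n(L) = 0\<close>: the connective cover \<open>C\<close> of \<open>L\<close> is again inverting, so that by initiality \<open>L \<rightarrow> C \<rightarrow> L\<close>
 is the identity in the homotopy category (\<open>negative_boundary\<close>).  Hence \<open>C \<rightarrow> L\<close> is a quasi-isomorphism.

 In positive degrees, freeness of \<open>R\<close> enters: the values of a derivation on the generators are arbitrary, so that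
 the bimodule of differentials is \<open>R \<otimes> V \<otimes> R\<close>, where \<open>V\<close> has the basis \<open>v\<^sub>1, \<dots>, v\<^sub>m\<close>.  Consider the \<open>C\<close>-bimodules \<open>Y\<^sub>V = C \<otimes> V \<otimes> S\<close> and
 \<open>Y\<^sub>0 = C \<otimes> S\<close>, on which \<open>C\<close> acts from the right through \<open>C \<rightarrow> S\<close>, and the square-zero extensions \<open>X\<^sub>V = C \<oplus> Y\<^sub>V\<close> and
 \<open>X\<^sub>0 = C \<oplus> Y\<^sub>0\<close>, which are inverting because \<open>C\<close> is.  Put \<open>e = 1 \<otimes> 1\<close>.  The inner derivation of \<open>e\<close> gives an algebra map
 \<open>s: C \<rightarrow> X\<^sub>0\<close>, \<open>x \<mapsto> (x, x e - e x)\<close>, and \<open>v\<^sub>i \<mapsto> z\<^sub>i e - e z\<^sub>i\<close> gives an algebra map \<open>\<alpha>: X\<^sub>V \<rightarrow> X\<^sub>0\<close>.  These are maps under \<open>R\<close> when \<open>R\<close> maps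
 to \<open>X\<^sub>V\<close> by \<open>z\<^sub>i \<mapsto> (z\<^sub>i, v\<^sub>i)\<close> and to \<open>X\<^sub>0\<close> through \<open>s\<close>.  By initiality, \<open>L \<rightarrow> X\<^sub>V \<rightarrow> X\<^sub>0\<close> agrees on homology with
 \<open>L \<simeq> C \<rightarrow> X\<^sub>0\<close>.  For a cycle \<open>x\<close> of degree \<open>n > 0\<close> one has \<open>e x = 0\<close>, so that \<open>x \<otimes> 1\<close> is homologous to \<open>\<alpha>(w)\<close> for a cycle
 \<open>w\<close> of \<open>Y\<^sub>V\<close>.  The action \<open>C \<otimes> S \<rightarrow> H\<^sub>n(C)\<close> kills \<open>\<alpha>(w)\<close>, since \<open>(c z\<^sub>i) t = c (z\<^sub>i t)\<close>, and sends \<open>x \<otimes> 1\<close> to the class of \<open>x\<close>,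
 which therefore vanishes (\<open>boundary_if_commutator\<close>, \<open>vanishing\<close>).

 In degree \<open>0\<close>, a zigzag from \<open>L\<close> to \<open>R\<^sub>\<Sigma>\<close> induces a ring map \<open>S \<rightarrow> R\<^sub>\<Sigma>\<close> under \<open>R\<close>.  Since \<open>S\<close> inverts \<open>\<Sigma>\<close> there is a ring map
 \<open>R\<^sub>\<Sigma> \<rightarrow> S\<close> under \<open>R\<close> as well.  One composite is the identity by the universal property of \<open>R\<^sub>\<Sigma>\<close>, and the other by
 the initiality of \<open>L\<close>, because \<open>C \<rightarrow> S\<close> is a map of dg algebras under \<open>R\<close> (\<open>degree_zero\<close>).
\<close>

text \<open>The operations of a structure \<open>G\<close>, with \<open>G\<close> in brackets.\<close>

abbreviation (input) add_in ("(_ \<oplus>[_]/ _)" [65, 0, 66] 65) where "x \<oplus>[G] y \<equiv> x \<oplus>\<^bsub>G\<^esub> y"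
abbreviation (input) minus_in ("(_ \<ominus>[_]/ _)" [65, 0, 66] 65) where "x \<ominus>[G] y \<equiv> x \<ominus>\<^bsub>G\<^esub> y"
abbreviation (input) uminus_in ("\<ominus>[_] _" [0, 81] 80) where "\<ominus>[G] x \<equiv> \<ominus>\<^bsub>G\<^esub> x"
abbreviation (input) mult_in ("(_ \<otimes>[_]/ _)" [70, 0, 71] 70) where "x \<otimes>[G] y \<equiv> x \<otimes>\<^bsub>G\<^esub> y"
abbreviation (input) smult_in ("(_ \<odot>[_]/ _)" [70, 0, 71] 70) where "c \<odot>[M] x \<equiv> c \<odot>\<^bsub>M\<^esub> x"
abbreviation (input) zero_in ("\<zero>[_]") where "\<zero>[G] \<equiv> \<zero>\<^bsub>G\<^esub>"
abbreviation (input) one_in ("\<one>[_]") where "\<one>[G] \<equiv> \<one>\<^bsub>G\<^esub>"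

notation funcset (infixr "->" 60)

abbreviation "keys \<equiv> Poly_Mapping.keys"
abbreviation "lookup \<equiv> Poly_Mapping.lookup"
abbreviation "single \<equiv> Poly_Mapping.single"

section \<open>Functors on the localization at the weak equivalences\<close>

lemma zigzag_ob: "zigzag C a p b ==> a \<in> Ob C \<and> b \<in> Ob C"
 by (induction C a p b rule: zigzag.induct) auto

lemma zigzag_append: "zigzag C a p b ==> zigzag C b q c ==> zigzag C a (p @ q) c"
 by (induction C a p b rule: zigzag.induct) auto

text \<open>A functor that inverts the weak equivalences extends to zigzags, and its value on a zigzag only
 depends on the morphism that the zigzag represents.\<close>

locale wcat_functor =
 fixes C :: "('o, 'm) wcat" and Fo :: "'o => 'x set" and Fm :: "'o => 'o => 'm => 'x => 'x"
 assumes Fm_closed: "a \<in> Ob C ==> b \<in> Ob C ==> f \<in> Hom C a b ==> x \<in> Fo a ==> Fm a b f x \<in> Fo b"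
  and Fm_id: "a \<in> Ob C ==> x \<in> Fo a ==> Fm a a (Idn C a) x = x"
  and Fm_comp: "a \<in> Ob C ==> b \<in> Ob C ==> c \<in> Ob C ==> f \<in> Hom C a b ==> g \<in> Hom C b c ==> x \<in> Fo a ==>
   Fm a c (Cmp C a g f) x = Fm b c g (Fm a b f x)"
  and id_hom: "a \<in> Ob C ==> Idn C a \<in> Hom C a a"
  and comp_hom: "a \<in> Ob C ==> b \<in> Ob C ==> c \<in> Ob C ==> f \<in> Hom C a b ==> g \<in> Hom C b c ==> 
   Cmp C a g f \<in> Hom C a c"
  and Weq_hom: "w \<in> Weq C a b ==> w \<in> Hom C a b"
  and Weq_bij: "a \<in> Ob C ==> b \<in> Ob C ==> w \<in> Weq C a b ==> bij_betw (Fm a b w) (Fo a) (Fo b)"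
begin

fun zz :: "'o => ('o, 'm) zstep list => 'x => 'x" where
 "zz a [] = id"
| "zz a (Fwd f c # p) = zz c p \<circ> Fm a c f"
| "zz a (Bwd w c # p) = zz c p \<circ> inv_into (Fo c) (Fm c a w)"

lemma Bwd_closed:
 assumes "a \<in> Ob C" "c \<in> Ob C" "w \<in> Weq C c a" "x \<in> Fo a"
 shows "inv_into (Fo c) (Fm c a w) x \<in> Fo c" "Fm c a w (inv_into (Fo c) (Fm c a w) x) = x"
 using Weq_bij[OF assms(2,1,3)] assms(4) unfolding bij_betw_def
 by (auto intro: inv_into_into f_inv_into_f)

lemma zz_closed: "zigzag C a p b ==> x \<in> Fo a ==> zz a p x \<in> Fo b"
proof (induction p arbitrary: a x)
 case (Cons s p) then show ?case
  by (cases s) (auto intro!: Cons.IH Fm_closed Bwd_closed dest: zigzag_ob)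
qed auto

lemma zz_append: "zigzag C a p b ==> x \<in> Fo a ==> zz a (p @ q) x = zz b q (zz a p x)"
proof (induction p arbitrary: a x)
 case (Cons s p) then show ?case
  by (cases s) (auto simp: Cons.IH[OF _ Fm_closed] Cons.IH[OF _ Bwd_closed(1)] dest: zigzag_ob)
qed auto

lemma zigzag_eq_zz:
 "zigzag_eq C a b p q ==> zigzag C a p b \<and> zigzag C a q b \<and> (\<forall>x\<in>Fo a. zz a p x = zz a q x)"
proof (induction rule: zigzag_eq.induct)
 case (cong a' r a b p q s b')
 then show ?case
  by (auto intro!: zigzag_append simp: zz_append zz_closed
   zz_append[of _ "p @ s"] zz_append[of _ "q @ s"])
next
 case (inv_right a b w)
 then show ?case using Weq_bij[of a b w] Weq_hom[of w a b]
  by (auto simp: bij_betw_def)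
next
 case (inv_left a b w)
 then show ?case using Weq_bij[of a b w] Weq_hom[of w a b] Bwd_closed[of b a w]
  by auto
qed (auto simp: Fm_id Fm_comp id_hom comp_hom)

lemma loc_iso_bij:
 assumes "loc_iso C a b f" "f \<in> Hom C a b"
 shows "bij_betw (Fm a b f) (Fo a) (Fo b)"
proof -
 from assms obtain q where q: "zigzag C b q a" "zigzag_eq C a a (Fwd f b # q) []"
  "zigzag_eq C b b (q @ [Fwd f b]) []" unfolding loc_iso_def by blast
 have ob: "a \<in> Ob C" "b \<in> Ob C" using zigzag_ob[OF q(1)] by auto
 have 1: "zz b q (Fm a b f x) = x" if "x \<in> Fo a" for x
  using zigzag_eq_zz[OF q(2)] that by auto
 have 2: "Fm a b f (zz b q x) = x" if "x \<in> Fo b" for x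
  using zigzag_eq_zz[OF q(3)] that zz_append[OF q(1) that, of "[Fwd f b]"] by auto
 show ?thesis
  by (rule bij_betw_byWitness[where f' = "zz b q"])
   (auto simp: 1 2 intro: Fm_closed ob assms zz_closed[OF q(1)])
qed

end

lemma zigzag_eq_loc_homI:
 assumes "\<exists>!\<phi>. \<phi> \<in> loc_hom C a b" "zigzag C a p b" "zigzag C a q b"
 shows "zigzag_eq C a b p q"
proof -
 let ?E = "{(p, q). zigzag_eq C a b p q}"
 have "?E `` {p} \<in> loc_hom C a b" "?E `` {q} \<in> loc_hom C a b"
  using assms(2,3) by (auto simp: loc_hom_def quotient_def)
 then have "?E `` {p} = ?E `` {q}" using assms(1) by blast
 moreover have "q \<in> ?E `` {q}" using assms(3) by (auto intro: zigzag_eq.refl)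
 ultimately show ?thesis by auto
qed

lemma loc_hom_zigzag:
 assumes "\<phi> \<in> loc_hom C a b"
 obtains p where "zigzag C a p b" "p \<in> \<phi>" "\<And>q. q \<in> \<phi> ==> zigzag_eq C a b p q"
 using assms unfolding loc_hom_def quotient_def by (auto intro: zigzag_eq.refl)


section \<open>Vector spaces, chain complexes and their homology\<close>

abbreviation vspace :: "('k::field, 'v, 'm) module_scheme => bool" where
 "vspace V \<equiv> module ring_of_type_algebra V"

lemma vspaceI:
 fixes V :: "('k::field, 'v, 'm) module_scheme"
 assumes "abelian_group V"
  and "\<And>c x. x \<in> carrier V ==> c \<odot>[V] x \<in> carrier V"
  and "\<And>c d x. x \<in> carrier V ==> (c + d) \<odot>[V] x = c \<odot>[V] x \<oplus>[V] d \<odot>[V] x"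
  and "\<And>c x y. x \<in> carrier V ==> y \<in> carrier V ==> c \<odot>[V] (x \<oplus>[V] y) = c \<odot>[V] x \<oplus>[V] c \<odot>[V] y"
  and "\<And>c d x. x \<in> carrier V ==> (c * d) \<odot>[V] x = c \<odot>[V] (d \<odot>[V] x)"
  and "\<And>x. x \<in> carrier V ==> 1 \<odot>[V] x = x"
 shows "vspace V"
 using assms
 by (intro moduleI cring_from_type_algebra) (auto simp: ring_of_type_algebra_def)

context
 fixes V :: "('k::field, 'v, 'm) module_scheme"
 assumes V: "vspace V"
begin

interpretation M: module "ring_of_type_algebra :: 'k ring" V by (rule V)

lemma vs_group: "abelian_group V" ..

lemma vs_smult_closed: "x \<in> carrier V ==> c \<odot>[V] x \<in> carrier V"
 using M.smult_closed[of c x] by (auto simp: ring_of_type_algebra_def)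

lemma vs_distl: "x \<in> carrier V ==> (c + d) \<odot>[V] x = c \<odot>[V] x \<oplus>[V] d \<odot>[V] x"
 using M.smult_l_distr[of c d x] by (auto simp: ring_of_type_algebra_def)

lemma vs_distr: "x \<in> carrier V ==> y \<in> carrier V ==> c \<odot>[V] (x \<oplus>[V] y) = c \<odot>[V] x \<oplus>[V] c \<odot>[V] y"
 using M.smult_r_distr[of c x y] by (auto simp: ring_of_type_algebra_def)

lemma vs_assoc: "x \<in> carrier V ==> c \<odot>[V] (d \<odot>[V] x) = (c * d) \<odot>[V] x"
 using M.smult_assoc1[of c d x] by (auto simp: ring_of_type_algebra_def)

lemma vs_one: "x \<in> carrier V ==> 1 \<odot>[V] x = x"
 using M.smult_one[of x] by (auto simp: ring_of_type_algebra_def)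

lemma vs_zero_scalar: "x \<in> carrier V ==> 0 \<odot>[V] x = \<zero>[V]"
 using M.smult_l_null[of x] by (auto simp: ring_of_type_algebra_def)

lemma vs_smult_zero: "c \<odot>[V] \<zero>[V] = \<zero>[V]"
 using M.smult_r_null[of c] by (auto simp: ring_of_type_algebra_def)

lemma vs_minus: assumes x: "x \<in> carrier V" shows "\<ominus>[V] x = (- 1) \<odot>[V] x"
proof -
 have "(- 1) \<odot>[V] x \<oplus>[V] x = \<zero>[V]"
  using vs_distl[OF x, of "-1" 1] by (simp add: vs_one vs_zero_scalar x)
 then show ?thesis using x vs_smult_closed[OF x, of "-1"] by (metis M.minus_equality)
qed

end


lemma (in abelian_group) diff_eq_iff:
 "x \<in> carrier G ==> y \<in> carrier G ==> z \<in> carrier G ==> x \<ominus> y = z \<longleftrightarrow> x = y \<oplus> z"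
 by (metis a_minus_def a_comm add.inv_closed add.m_assoc r_neg r_zero)

lemma linear_mapsI:
 assumes "\<And>x. x \<in> carrier V ==> f x \<in> carrier W"
  and "\<And>x y. x \<in> carrier V ==> y \<in> carrier V ==> f (x \<oplus>[V] y) = f x \<oplus>[W] f y"
  and "\<And>c x. x \<in> carrier V ==> f (c \<odot>[V] x) = c \<odot>[W] f x"
 shows "f \<in> linear_maps V W"
 using assms by (auto simp: linear_maps_def)

lemma lin_closed: "f \<in> linear_maps V W ==> x \<in> carrier V ==> f x \<in> carrier W"
 and lin_add: "f \<in> linear_maps V W ==> x \<in> carrier V ==> y \<in> carrier V ==> f (x \<oplus>[V] y) = f x \<oplus>[W] f y"
 and lin_smult: "f \<in> linear_maps V W ==> x \<in> carrier V ==> f (c \<odot>[V] x) = c \<odot>[W] f x"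
 by (auto simp: linear_maps_def)

lemma lin_zero:
 assumes "vspace V" "vspace W" "f \<in> linear_maps V W" shows "f \<zero>[V] = \<zero>[W]"
proof -
 interpret V: module ring_of_type_algebra V by fact
 have "f (0 \<odot>[V] \<zero>[V]) = 0 \<odot>[W] f \<zero>[V]" using assms(3) by (rule lin_smult) simp
 then show ?thesis using assms by (simp add: vs_smult_zero vs_zero_scalar lin_closed)
qed

lemma lin_minus:
 assumes "vspace V" "vspace W" "f \<in> linear_maps V W" "x \<in> carrier V" shows "f (\<ominus>[V] x) = \<ominus>[W] f x"
 using assms by (simp add: vs_minus lin_smult lin_closed)

lemma lin_diff:
 assumes "vspace V" "vspace W" "f \<in> linear_maps V W" "x \<in> carrier V" "y \<in> carrier V"
 shows "f (x \<ominus>[V] y) = f x \<ominus>[W] f y"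
proof -
 interpret V: module ring_of_type_algebra V by fact
 show ?thesis using assms by (simp add: a_minus_def lin_add lin_minus)
qed

lemma lin_finsum:
 assumes "vspace V" "vspace W" "f \<in> linear_maps V W" "b \<in> E -> carrier V"
 shows "f (finsum V b E) = finsum W (%e. f (b e)) E"
proof (cases "finite E")
 interpret V: module ring_of_type_algebra V by fact
 interpret W: module ring_of_type_algebra W by fact
 case True then show ?thesis using assms(4)
 proof (induction E)
  case empty show ?case by (simp add: lin_zero assms)
 next
  case (insert e E)
  then have "b e \<in> carrier V" "b \<in> E -> carrier V" by auto
  then show ?case using insert(1-3)
   by (simp add: V.finsum_insert W.finsum_insert lin_add[OF assms(3)] lin_closed[OF assms(3)] V.finsum_closed Pi_def)
 qed
next
 interpret V: module ring_of_type_algebra V by fact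
 interpret W: module ring_of_type_algebra W by fact
 case False then show ?thesis using assms
  by (simp add: lin_zero V.finsum_infinite W.finsum_infinite)
qed

context chain_complex
begin

lemma vs [simp, intro]: "vspace (gr C n)" by (rule gr_module)
lemma ag [simp, intro]: "abelian_group (gr C n)" by (rule vs_group) simp

lemma d_lin: "dif C n \<in> linear_maps (gr C n) (gr C (n - 1))" by (rule dif_linear)
lemma d_closed [simp]: "x \<in> elts C n ==> dif C n x \<in> elts C (n - 1)" by (rule lin_closed[OF d_lin])
lemma d_closed' [simp]: "x \<in> elts C (n + 1) ==> dif C (n + 1) x \<in> elts C n" using d_closed[of x "n + 1"] by simp
lemma d_zero [simp]: "dif C n \<zero>[gr C n] = \<zero>[gr C (n - 1)]" by (rule lin_zero) (auto simp: d_lin)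
lemma d_add: "x \<in> elts C n ==> y \<in> elts C n ==> dif C n (x \<oplus>[gr C n] y) = dif C n x \<oplus>[gr C (n - 1)] dif C n y"
 by (rule lin_add[OF d_lin])
lemma d_diff: "x \<in> elts C n ==> y \<in> elts C n ==> dif C n (x \<ominus>[gr C n] y) = dif C n x \<ominus>[gr C (n - 1)] dif C n y"
 by (rule lin_diff) (auto simp: d_lin)
lemma d_smult: "x \<in> elts C n ==> dif C n (c \<odot>[gr C n] x) = c \<odot>[gr C (n - 1)] dif C n x"
 by (rule lin_smult[OF d_lin])
lemma d_d': "x \<in> elts C (n + 1) ==> dif C n (dif C (n + 1) x) = \<zero>[gr C (n - 1)]"
 using dif_dif[of x "n + 1"] by simp

lemma boundaries_iff: "x \<in> boundaries C n \<longleftrightarrow> (\<exists>u\<in>elts C (n + 1). x = dif C (n + 1) u)"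
 by (auto simp: boundaries_def)

lemma boundaries_sub_cycles: "boundaries C n \<subseteq> cycles C n"
 by (auto simp: boundaries_def cycles_def d_d')

lemma cycles_elts: "x \<in> cycles C n ==> x \<in> elts C n" by (simp add: cycles_def)
lemma boundaries_elts: "x \<in> boundaries C n ==> x \<in> elts C n" using boundaries_sub_cycles cycles_elts by blast

lemma boundaries_ops:
 "\<zero>[gr C n] \<in> boundaries C n"
 "x \<in> boundaries C n ==> y \<in> boundaries C n ==> x \<oplus>[gr C n] y \<in> boundaries C n"
 "x \<in> boundaries C n ==> c \<odot>[gr C n] x \<in> boundaries C n"
 "x \<in> boundaries C n ==> \<ominus>[gr C n] x \<in> boundaries C n"
 "x \<in> boundaries C n ==> y \<in> boundaries C n ==> x \<ominus>[gr C n] y \<in> boundaries C n"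
proof -
 interpret A: abelian_group "gr C n" by simp
 interpret B: abelian_group "gr C (n + 1)" by simp
 show 0: "\<zero>[gr C n] \<in> boundaries C n"
  using d_zero[of "n + 1"] B.zero_closed unfolding boundaries_iff by (metis add_diff_cancel_right')
 show 1: "x \<oplus>[gr C n] y \<in> boundaries C n" if "x \<in> boundaries C n" "y \<in> boundaries C n" for x y
  using that d_add[of _ "n + 1"] B.a_closed unfolding boundaries_iff by (metis add_diff_cancel_right')
 show 2: "c \<odot>[gr C n] x \<in> boundaries C n" if "x \<in> boundaries C n" for c x
  using that d_smult[of _ "n + 1"] vs_smult_closed[OF vs, of _ "n + 1"] unfolding boundaries_iff
  by (metis add_diff_cancel_right')
 show 3: "\<ominus>[gr C n] x \<in> boundaries C n" if "x \<in> boundaries C n" for x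
  using 2[OF that, of "-1"] boundaries_elts[OF that] by (simp add: vs_minus)
 show "x \<ominus>[gr C n] y \<in> boundaries C n" if "x \<in> boundaries C n" "y \<in> boundaries C n"
  using 1 3 that by (simp add: a_minus_def)
qed

lemma cycles_ops:
 "\<zero>[gr C n] \<in> cycles C n"
 "x \<in> cycles C n ==> y \<in> cycles C n ==> x \<oplus>[gr C n] y \<in> cycles C n"
 "x \<in> cycles C n ==> c \<odot>[gr C n] x \<in> cycles C n"
 "x \<in> cycles C n ==> y \<in> cycles C n ==> x \<ominus>[gr C n] y \<in> cycles C n"
proof -
 interpret A: abelian_group "gr C n" by simp
 interpret B: abelian_group "gr C (n - 1)" by simp
 show "\<zero>[gr C n] \<in> cycles C n"
  "x \<in> cycles C n ==> y \<in> cycles C n ==> x \<oplus>[gr C n] y \<in> cycles C n"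
  "x \<in> cycles C n ==> c \<odot>[gr C n] x \<in> cycles C n"
  "x \<in> cycles C n ==> y \<in> cycles C n ==> x \<ominus>[gr C n] y \<in> cycles C n"
  by (auto simp: cycles_def d_add d_smult d_diff vs_smult_closed vs_smult_zero) (auto simp: a_minus_def)
qed

definition hcls :: "int => 'v => 'v set" where
 "hcls n x = boundaries C n +>\<^bsub>gr C n\<^esub> x"

lemma hcls_iff: "z \<in> hcls n x \<longleftrightarrow> (\<exists>b\<in>boundaries C n. z = b \<oplus>[gr C n] x)"
 by (auto simp: hcls_def a_r_coset_def')

lemma hcls_eq_iff:
 assumes "x \<in> elts C n" "y \<in> elts C n"
 shows "hcls n x = hcls n y \<longleftrightarrow> x \<ominus>[gr C n] y \<in> boundaries C n"
proof -
 interpret A: abelian_group "gr C n" by simp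
 have self: "x \<in> hcls n x" unfolding hcls_iff using boundaries_ops(1) assms by force
 show ?thesis
 proof
  assume "hcls n x = hcls n y"
  with self have "x \<in> hcls n y" by simp
  then obtain b where b: "b \<in> boundaries C n" "x = b \<oplus>[gr C n] y" unfolding hcls_iff by auto
  then show "x \<ominus>[gr C n] y \<in> boundaries C n" using assms boundaries_elts[OF b(1)]
   by (simp add: a_minus_def A.a_assoc A.r_neg)
 next
  assume d: "x \<ominus>[gr C n] y \<in> boundaries C n"
  have x: "x = (x \<ominus>[gr C n] y) \<oplus>[gr C n] y" using assms by (simp add: a_minus_def A.a_assoc A.l_neg)
  have y: "y = \<ominus>[gr C n] (x \<ominus>[gr C n] y) \<oplus>[gr C n] x"
   using x A.r_neg1[of "x \<ominus>[gr C n] y" y] assms by simp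
  show "hcls n x = hcls n y"
  proof (intro Set.set_eqI iffI)
   fix z assume "z \<in> hcls n x"
   then obtain b where b: "b \<in> boundaries C n" "z = b \<oplus>[gr C n] x" unfolding hcls_iff by auto
   have "z = (b \<oplus>[gr C n] (x \<ominus>[gr C n] y)) \<oplus>[gr C n] y"
    using x b boundaries_elts[OF b(1)] boundaries_elts[OF d] assms by (metis A.a_assoc)
   then show "z \<in> hcls n y" unfolding hcls_iff using boundaries_ops(2)[OF b(1) d] by blast
  next
   fix z assume "z \<in> hcls n y"
   then obtain b where b: "b \<in> boundaries C n" "z = b \<oplus>[gr C n] y" unfolding hcls_iff by auto
   note d' = boundaries_ops(4)[OF d]
   have "z = (b \<oplus>[gr C n] \<ominus>[gr C n] (x \<ominus>[gr C n] y)) \<oplus>[gr C n] x"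
    using y b boundaries_elts[OF b(1)] boundaries_elts[OF d'] assms by (metis A.a_assoc)
   then show "z \<in> hcls n x" unfolding hcls_iff using boundaries_ops(2)[OF b(1) d'] by blast
  qed
 qed
qed

lemma homology_eq: "homology C n = hcls n ` cycles C n"
 by (auto simp: homology_def hcls_def)

lemma hcls_self: "x \<in> elts C n ==> x \<in> hcls n x"
proof -
 assume x: "x \<in> elts C n"
 interpret A: abelian_group "gr C n" by simp
 show ?thesis unfolding hcls_iff using boundaries_ops(1) x by force
qed

end

lemma chain_maps_lin: "f \<in> chain_maps C D ==> f n \<in> linear_maps (gr C n) (gr D n)"
 and chain_maps_dif: "f \<in> chain_maps C D ==> x \<in> elts C n ==> f (n - 1) (dif C n x) = dif D n (f n x)"
 and chain_maps_closed: "f \<in> chain_maps C D ==> x \<in> elts C n ==> f n x \<in> elts D n"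
 by (auto simp: chain_maps_def linear_maps_def)

lemma chain_maps_dif': "f \<in> chain_maps C D ==> x \<in> elts C (n + 1) ==> f n (dif C (n + 1) x) = dif D (n + 1) (f (n + 1) x)"
 using chain_maps_dif[of f C D x "n + 1"] by simp

context
 fixes C :: "('k::field, 'v, 'm) cplx_scheme" and D :: "('k, 'w, 'n) cplx_scheme" and f :: "int => 'v => 'w"
 assumes C: "chain_complex C" and D: "chain_complex D" and f: "f \<in> chain_maps C D"
begin

interpretation C: chain_complex C by (rule C)
interpretation D: chain_complex D by (rule D)

lemma chain_maps_cycles: "x \<in> cycles C n ==> f n x \<in> cycles D n"
 using chain_maps_dif[OF f, of x n] lin_zero[OF C.vs D.vs chain_maps_lin[OF f, of "n - 1"]] 
 by (auto simp: cycles_def chain_maps_closed[OF f])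

lemma chain_maps_boundaries: "x \<in> boundaries C n ==> f n x \<in> boundaries D n"
 using chain_maps_dif'[OF f] chain_maps_closed[OF f] by (auto simp: boundaries_def)

lemma homology_map_hcls:
 assumes "x \<in> elts C n" shows "homology_map D f n (C.hcls n x) = D.hcls n (f n x)"
proof -
 interpret A: abelian_group "gr C n" by simp
 have "D.hcls n (f n z) = D.hcls n (f n x)" if "z \<in> C.hcls n x" for z
 proof -
  from that obtain b where b: "b \<in> boundaries C n" "z = b \<oplus>[gr C n] x" unfolding C.hcls_iff by auto
  have e: "b \<in> elts C n" by (rule C.boundaries_elts[OF b(1)])
  have "f n z \<ominus>[gr D n] f n x = f n (z \<ominus>[gr C n] x)"
   using lin_diff[OF C.vs D.vs chain_maps_lin[OF f, of n]] b e assms by simp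
  also have "z \<ominus>[gr C n] x = b" using b e assms by (simp add: a_minus_def A.a_assoc A.r_neg)
  finally show ?thesis using chain_maps_boundaries[OF b(1)] b e assms
   by (subst D.hcls_eq_iff) (auto simp: chain_maps_closed[OF f])
 qed
 moreover have "x \<in> C.hcls n x" by (rule C.hcls_self[OF assms])
 ultimately show ?thesis unfolding homology_map_def D.hcls_def[symmetric] by blast
qed

lemma homology_bij_iff:
 "bij_betw (homology_map D f n) (homology C n) (homology D n) \<longleftrightarrow>
  (\<forall>x\<in>cycles C n. f n x \<in> boundaries D n --> x \<in> boundaries C n) \<and>
  (\<forall>y\<in>cycles D n. \<exists>x\<in>cycles C n. f n x \<ominus>[gr D n] y \<in> boundaries D n)" (is "?L \<longleftrightarrow> ?I \<and> ?S")
proof -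
 interpret A: abelian_group "gr C n" by simp
 interpret B: abelian_group "gr D n" by simp
 have m: "homology_map D f n (C.hcls n x) = D.hcls n (f n x)" if "x \<in> cycles C n" for x
  by (rule homology_map_hcls) (rule C.cycles_elts[OF that])
 have fz: "f n \<zero>[gr C n] = \<zero>[gr D n]" by (rule lin_zero[OF C.vs D.vs chain_maps_lin[OF f]])
 have sub: "C.hcls n x = C.hcls n y \<longleftrightarrow> x \<ominus>[gr C n] y \<in> boundaries C n"
  "D.hcls n (f n x) = D.hcls n (f n y) \<longleftrightarrow> f n (x \<ominus>[gr C n] y) \<in> boundaries D n"
  if "x \<in> cycles C n" "y \<in> cycles C n" for x y
  using that C.cycles_elts
  by (simp_all add: C.hcls_eq_iff D.hcls_eq_iff chain_maps_closed[OF f] lin_diff[OF C.vs D.vs chain_maps_lin[OF f]])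
 have "inj_on (homology_map D f n) (homology C n) \<longleftrightarrow> ?I"
 proof
  assume inj: "inj_on (homology_map D f n) (homology C n)"
  show ?I
  proof (intro ballI impI)
   fix x assume x: "x \<in> cycles C n" "f n x \<in> boundaries D n"
   have z: "x \<ominus>[gr C n] \<zero>[gr C n] = x" using C.cycles_elts[OF x(1)] by (simp add: a_minus_def)
   have "C.hcls n x = C.hcls n \<zero>[gr C n]"
    using sub(2)[OF x(1) C.cycles_ops(1)] x C.cycles_ops(1) m
    by (intro inj_onD[OF inj]) (auto simp: C.homology_eq z)
   then show "x \<in> boundaries C n" using sub(1)[OF x(1) C.cycles_ops(1)] z by simp
  qed
 next
  assume ?I then show "inj_on (homology_map D f n) (homology C n)"
   by (auto simp: inj_on_def C.homology_eq m sub C.cycles_ops)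
 qed
 moreover have "homology_map D f n ` homology C n = homology D n \<longleftrightarrow> ?S"
 proof -
  have "homology_map D f n ` homology C n \<subseteq> homology D n"
   by (auto simp: C.homology_eq D.homology_eq m chain_maps_cycles)
  moreover have "homology D n \<subseteq> homology_map D f n ` homology C n \<longleftrightarrow>
   (\<forall>y\<in>cycles D n. \<exists>x\<in>cycles C n. D.hcls n y = D.hcls n (f n x))"
  proof
   assume *: "homology D n \<subseteq> homology_map D f n ` homology C n"
   show "\<forall>y\<in>cycles D n. \<exists>x\<in>cycles C n. D.hcls n y = D.hcls n (f n x)"
   proof
    fix y assume "y \<in> cycles D n"
    then have "D.hcls n y \<in> homology_map D f n ` homology C n" using * by (auto simp: D.homology_eq)
    then show "\<exists>x\<in>cycles C n. D.hcls n y = D.hcls n (f n x)" by (auto simp: C.homology_eq m)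
   qed
  next
   assume *: "\<forall>y\<in>cycles D n. \<exists>x\<in>cycles C n. D.hcls n y = D.hcls n (f n x)"
   show "homology D n \<subseteq> homology_map D f n ` homology C n"
   proof
    fix Y assume "Y \<in> homology D n"
    then obtain y where y: "y \<in> cycles D n" "Y = D.hcls n y" by (auto simp: D.homology_eq)
    then obtain x where "x \<in> cycles C n" "Y = D.hcls n (f n x)" using * by auto
    then show "Y \<in> homology_map D f n ` homology C n" 
     unfolding C.homology_eq using m[of x] by (metis image_eqI)
   qed
  qed
  moreover have "D.hcls n y = D.hcls n (f n x) \<longleftrightarrow> f n x \<ominus>[gr D n] y \<in> boundaries D n"
   if "x \<in> cycles C n" "y \<in> cycles D n" for x y
   using that D.hcls_eq_iff[of "f n x" n y] C.cycles_elts D.cycles_elts chain_maps_closed[OF f] by metis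
  ultimately show ?thesis by auto
 qed
 ultimately show ?thesis unfolding bij_betw_def by blast
qed

end

lemma homology_map_closed:
 assumes "chain_complex C" "chain_complex D" "f \<in> chain_maps C D" "x \<in> homology C n"
 shows "homology_map D f n x \<in> homology D n"
proof -
 interpret C: chain_complex C by fact
 interpret D: chain_complex D by fact
 show ?thesis using assms
  by (auto simp: C.homology_eq D.homology_eq homology_map_hcls C.cycles_elts chain_maps_cycles)
qed

lemma chain_maps_id: assumes "chain_complex C" shows "(%n. restrict id (elts C n)) \<in> chain_maps C C"
proof -
 interpret C: chain_complex C by fact
 have "x \<oplus>[gr C n] y \<in> elts C n" if "x \<in> elts C n" "y \<in> elts C n" for x y n
  using that abelian_groupE(1)[OF C.ag] by blast
 then show ?thesis by (auto simp: chain_maps_def linear_maps_def vs_smult_closed)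
qed

lemma homology_map_id:
 assumes "chain_complex C" "x \<in> homology C n"
 shows "homology_map C (%n. restrict id (elts C n)) n x = x"
proof -
 interpret C: chain_complex C by fact
 have f: "(%n. restrict id (elts C n)) \<in> chain_maps C C" by (rule chain_maps_id[OF assms(1)])
 show ?thesis using assms(2) by (auto simp: C.homology_eq homology_map_hcls[OF C.chain_complex_axioms C.chain_complex_axioms f] C.cycles_elts)
qed

lemma homology_map_comp:
 assumes "chain_complex B" "chain_complex C" "chain_complex D" "f \<in> chain_maps B C" "g \<in> chain_maps C D"
  "x \<in> homology B n" "(%n. compose (elts B n) (g n) (f n)) \<in> chain_maps B D"
 shows "homology_map D (%n. compose (elts B n) (g n) (f n)) n x = homology_map D g n (homology_map C f n x)"
proof -
 interpret B: chain_complex B by fact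
 interpret C: chain_complex C by fact
 interpret D: chain_complex D by fact
 show ?thesis using assms
  by (auto simp: B.homology_eq homology_map_hcls B.cycles_elts chain_maps_closed compose_def)
qed

lemma chain_maps_comp:
 assumes "chain_complex B" "f \<in> chain_maps B C" "g \<in> chain_maps C D"
 shows "(%n. compose (elts B n) (g n) (f n)) \<in> chain_maps B D"
proof -
 interpret B: chain_complex B by fact
 have "x \<oplus>[gr B n] y \<in> elts B n" if "x \<in> elts B n" "y \<in> elts B n" for x y n
  using that abelian_groupE(1)[OF B.ag] by blast
 moreover have "c \<odot>[gr B n] x \<in> elts B n" if "x \<in> elts B n" for x n c
  using that by (simp add: vs_smult_closed)
 ultimately show ?thesis using assms(2,3)
  by (auto simp: chain_maps_def linear_maps_def compose_def Pi_iff)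
qed

section \<open>Coordinates on tensor products with free modules\<close>

lemma (in abelian_group) add_diff_diff: "x \<in> carrier G ==> y \<in> carrier G ==> (x \<oplus> y) \<ominus> x \<ominus> y = \<zero>"
 by (metis a_closed a_minus_def a_inv_closed diff_eq_iff r_zero r_neg)

locale left_action = R: ring R + M: abelian_group M
 for R :: "('r, 'n) ring_scheme" and M :: "('u, 'l) ring_scheme" and l :: "'r => 'u => 'u" +
 assumes l_closed: "r \<in> carrier R ==> b \<in> carrier M ==> l r b \<in> carrier M"
  and l_add_right: "r \<in> carrier R ==> b \<in> carrier M ==> c \<in> carrier M ==> l r (b \<oplus>[M] c) = l r b \<oplus>[M] l r c"
  and l_add_left: "r \<in> carrier R ==> s \<in> carrier R ==> b \<in> carrier M ==> l (r \<oplus>[R] s) b = l r b \<oplus>[M] l s b"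
  and l_mult: "r \<in> carrier R ==> s \<in> carrier R ==> b \<in> carrier M ==> l (r \<otimes>[R] s) b = l r (l s b)"
  and l_one: "b \<in> carrier M ==> l \<one>[R] b = b"
begin

lemma l_zero_left: "b \<in> carrier M ==> l \<zero>[R] b = \<zero>[M]"
 using l_add_left[of "\<zero>[R]" "\<zero>[R]" b] l_closed[of "\<zero>[R]" b] by (simp add: M.add.l_cancel_one)

lemma l_zero_right: "r \<in> carrier R ==> l r \<zero>[M] = \<zero>[M]"
 using l_add_right[of r "\<zero>[M]" "\<zero>[M]"] l_closed[of r "\<zero>[M]"] by (simp add: M.add.l_cancel_one)

end

definition basis_of :: "('r, 'n) ring_scheme => ('r, 'p, 'm) module_scheme => 'p set => bool" where
 "basis_of R P E \<longleftrightarrow> finite E \<and> E \<subseteq> carrier P \<and>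
   (\<forall>x\<in>carrier P. \<exists>!c. c \<in> E \<rightarrow>\<^sub>E carrier R \<and> x = (\<Oplus>\<^bsub>P\<^esub>e\<in>E. c e \<odot>[P] e))"

definition coef :: "('r, 'n) ring_scheme => ('r, 'p, 'm) module_scheme => 'p set => 'p => 'p => 'r" where
 "coef R P E x = (THE c. c \<in> E \<rightarrow>\<^sub>E carrier R \<and> x = (\<Oplus>\<^bsub>P\<^esub>e\<in>E. c e \<odot>[P] e))"

locale free_right_module = right_module R P
 for R :: "('r, 'n) ring_scheme" and P :: "('r, 'p, 'm) module_scheme" +
 fixes E :: "'p set"
 assumes basis: "basis_of R P E"
begin

lemma fin: "finite E" and E_sub: "E \<subseteq> carrier P" using basis by (auto simp: basis_of_def)

lemma coef: assumes "x \<in> carrier P"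
 shows "coef R P E x \<in> E \<rightarrow>\<^sub>E carrier R" "(\<Oplus>\<^bsub>P\<^esub>e\<in>E. coef R P E x e \<odot>[P] e) = x"
proof -
 have "\<exists>!c. c \<in> E \<rightarrow>\<^sub>E carrier R \<and> x = (\<Oplus>\<^bsub>P\<^esub>e\<in>E. c e \<odot>[P] e)" using basis assms by (auto simp: basis_of_def)
 from theI'[OF this] show "coef R P E x \<in> E \<rightarrow>\<^sub>E carrier R" "(\<Oplus>\<^bsub>P\<^esub>e\<in>E. coef R P E x e \<odot>[P] e) = x"
  unfolding coef_def by auto
qed

lemma coef_closed: "x \<in> carrier P ==> e \<in> E ==> coef R P E x e \<in> carrier R"
 using coef(1) by auto

lemma coef_scaled_closed:
 assumes "x \<in> carrier P" shows "(%e. coef R P E x e \<odot>[P] e) \<in> E -> carrier P"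
proof
 fix e assume "e \<in> E"
 then have "coef R P E x e \<in> carrier R" "e \<in> carrier P" using coef_closed[OF assms] E_sub by auto
 then show "coef R P E x e \<odot>[P] e \<in> carrier P" by (rule act_closed)
qed

lemma coef_unique:
 assumes "c \<in> E -> carrier R" "e \<in> E"
 shows "coef R P E (\<Oplus>\<^bsub>P\<^esub>e\<in>E. c e \<odot>[P] e) e = c e"
proof -
 let ?x = "\<Oplus>\<^bsub>P\<^esub>e\<in>E. c e \<odot>[P] e"
 have cl: "(%e. c e \<odot>[P] e) \<in> E -> carrier P"
 proof
  fix e assume "e \<in> E"
  then have "c e \<in> carrier R" "e \<in> carrier P" using assms(1) E_sub by auto
  then show "c e \<odot>[P] e \<in> carrier P" by (rule act_closed)
 qed
 have x: "?x \<in> carrier P" using cl by (rule P.finsum_closed)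
 have "restrict c E \<in> E \<rightarrow>\<^sub>E carrier R" using assms(1) by auto
 moreover have "?x = (\<Oplus>\<^bsub>P\<^esub>e\<in>E. restrict c E e \<odot>[P] e)"
  using cl by (intro P.finsum_cong') auto
 moreover have "\<exists>!c. c \<in> E \<rightarrow>\<^sub>E carrier R \<and> ?x = (\<Oplus>\<^bsub>P\<^esub>e\<in>E. c e \<odot>[P] e)"
  using basis x by (auto simp: basis_of_def)
 ultimately have "coef R P E ?x = restrict c E" unfolding coef_def by (intro the1_equality conjI)
 then show ?thesis using assms(2) by simp
qed

lemma coef_add:
 assumes "x \<in> carrier P" "y \<in> carrier P" "e \<in> E"
 shows "coef R P E (x \<oplus>[P] y) e = coef R P E x e \<oplus>[R] coef R P E y e"
proof -
 have cl: "(%e. coef R P E x e \<odot>[P] e) \<in> E -> carrier P" if "x \<in> carrier P" for x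
  by (rule coef_scaled_closed[OF that])
 have "(\<Oplus>\<^bsub>P\<^esub>e\<in>E. (coef R P E x e \<oplus>[R] coef R P E y e) \<odot>[P] e) =
  (\<Oplus>\<^bsub>P\<^esub>e\<in>E. coef R P E x e \<odot>[P] e \<oplus>[P] coef R P E y e \<odot>[P] e)"
 proof (rule P.finsum_cong'[OF HOL.refl])
  fix e assume e: "e \<in> E"
  then have "e \<in> carrier P" using E_sub by auto
  then show "(coef R P E x e \<oplus>[R] coef R P E y e) \<odot>[P] e = coef R P E x e \<odot>[P] e \<oplus>[P] coef R P E y e \<odot>[P] e"
   using coef_closed[OF assms(1) e] coef_closed[OF assms(2) e] by (rule_tac act_add_right)
 qed (use cl[OF assms(1)] cl[OF assms(2)] in blast)
 also have "\<dots> = x \<oplus>[P] y" using P.finsum_addf[OF cl cl] assms coef(2) by simp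
 finally show ?thesis
  using coef_unique[of "%e. coef R P E x e \<oplus>[R] coef R P E y e" e] assms coef_closed by auto
qed

lemma act_finsum:
 assumes "r \<in> carrier R" "f \<in> A -> carrier P" "finite A"
 shows "r \<odot>[P] (finsum P f A) = finsum P (%a. r \<odot>[P] f a) A"
proof -
 have z: "r \<odot>[P] \<zero>[P] = \<zero>[P]"
  using act_add_left[OF assms(1), of "\<zero>[P]" "\<zero>[P]"] act_closed[OF assms(1), of "\<zero>[P]"]
  by (simp add: P.add.l_cancel_one)
 from assms(3,2) show ?thesis
 proof (induction A)
  case (insert a A)
  then have "f a \<in> carrier P" "f \<in> A -> carrier P" by auto
  then show ?case using insert assms(1)
   by (simp add: P.finsum_insert act_add_left P.finsum_closed act_closed Pi_def)
 qed (simp add: z)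
qed

lemma coef_act:
 assumes "x \<in> carrier P" "r \<in> carrier R" "e \<in> E"
 shows "coef R P E (r \<odot>[P] x) e = coef R P E x e \<otimes>[R] r"
proof -
 have cl: "(%e. coef R P E x e \<odot>[P] e) \<in> E -> carrier P"
  by (rule coef_scaled_closed[OF assms(1)])
 have "(\<Oplus>\<^bsub>P\<^esub>e\<in>E. (coef R P E x e \<otimes>[R] r) \<odot>[P] e) = (\<Oplus>\<^bsub>P\<^esub>e\<in>E. r \<odot>[P] (coef R P E x e \<odot>[P] e))"
 proof (rule P.finsum_cong'[OF HOL.refl])
  fix e assume e: "e \<in> E"
  then have "e \<in> carrier P" using E_sub by auto
  then show "(coef R P E x e \<otimes>[R] r) \<odot>[P] e = r \<odot>[P] (coef R P E x e \<odot>[P] e)"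
   using coef_closed[OF assms(1) e] assms(2) by (rule_tac act_mult)
 qed (use cl act_closed[OF assms(2)] in blast)
 also have "\<dots> = r \<odot>[P] x" using act_finsum[OF assms(2) cl fin] coef(2)[OF assms(1)] by simp
 finally show ?thesis
  using coef_unique[of "%e. coef R P E x e \<otimes>[R] r" e] assms coef_closed by auto
qed

lemma act_zero_left: "x \<in> carrier P ==> \<zero>[R] \<odot>[P] x = \<zero>[P]"
 using act_add_right[of "\<zero>[R]" "\<zero>[R]" x] act_closed[of "\<zero>[R]" x] by (simp add: P.add.l_cancel_one)

lemma coef_basis:
 assumes "e \<in> E" "e' \<in> E"
 shows "coef R P E e' e = (if e = e' then \<one>[R] else \<zero>[R])"
proof -
 have "(\<Oplus>\<^bsub>P\<^esub>e\<in>E. (if e = e' then \<one>[R] else \<zero>[R]) \<odot>[P] e) = (\<Oplus>\<^bsub>P\<^esub>e\<in>E. if e' = e then e else \<zero>[P])"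
  using E_sub by (intro P.finsum_cong') (auto simp: act_one act_zero_left subset_iff)
 also have "\<dots> = e'" using P.finsum_singleton[OF assms(2) fin, of "%e. e"] E_sub by auto
 finally show ?thesis using coef_unique[of "%e. if e = e' then \<one>[R] else \<zero>[R]" e] assms by auto
qed

end

lemma fg_free_basis:
 "fg_free_right_module R P \<longleftrightarrow> (\<exists>E. free_right_module R P E)"
 by (auto simp: fg_free_right_module_def free_right_module_def free_right_module_axioms_def basis_of_def)

subsection \<open>The relations\<close>

definition cls :: "('a::ab_group_add) set => 'a => 'a set" where
 "cls T x = (+) x ` T"

context
 fixes R :: "('r, 'n) ring_scheme" and P :: "('r, 'p, 'm) module_scheme" and M :: "('u, 'l) ring_scheme"
  and l :: "'r => 'u => 'u"
begin

abbreviation (input) "T \<equiv> tensor_rel R P M l"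

lemma T_minus: "x \<in> T ==> - x \<in> T" using tensor_rel.diff[OF tensor_rel.zero, of x R P M l] by simp
lemma T_add: "x \<in> T ==> y \<in> T ==> x + y \<in> T" using tensor_rel.diff[OF _ T_minus, of x y] by simp
lemma T_sum: "(\<And>i. i \<in> I ==> f i \<in> T) ==> sum f I \<in> T"
 by (induction I rule: infinite_finite_induct) (auto intro: T_add tensor_rel.zero)

lemma T_cmul: assumes x: "x \<in> T" shows "frag_cmul n x \<in> T"
proof -
 have nat: "frag_cmul (int k) x \<in> T" for k
  by (induction k) (auto simp: frag_cmul_distrib intro: T_add tensor_rel.zero x)
 show ?thesis
 proof (cases "n \<ge> 0")
  case True then show ?thesis using nat[of "nat n"] by simp
 next
  case False then have "frag_cmul n x = - frag_cmul (int (nat (- n))) x" by simp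
  then show ?thesis using T_minus[OF nat[of "nat (- n)"]] by simp
 qed
qed

lemma T_extend: "(\<And>i. i \<in> keys x ==> t i \<in> T) ==> frag_extend t x \<in> T"
 unfolding frag_extend_def by (intro T_sum T_cmul)

lemma cls_eq_iff: "cls T x = cls T y \<longleftrightarrow> x - y \<in> T"
proof
 assume "cls T x = cls T y"
 moreover have "x \<in> cls T x" using tensor_rel.zero[of R P M l] by (force simp: cls_def)
 ultimately show "x - y \<in> T" by (auto simp: cls_def)
next
 assume d: "x - y \<in> T"
 have "z \<in> cls T y" if "z \<in> cls T x" for z
 proof -
  from that obtain t where "t \<in> T" "z = x + t" by (auto simp: cls_def)
  then have "z = y + ((x - y) + t)" "(x - y) + t \<in> T" using T_add[OF d] by auto
  then show ?thesis unfolding cls_def by blast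
 qed
 moreover have "z \<in> cls T x" if "z \<in> cls T y" for z
 proof -
  from that obtain t where "t \<in> T" "z = y + t" by (auto simp: cls_def)
  then have "z = x + (- (x - y) + t)" "- (x - y) + t \<in> T" using T_add[OF T_minus[OF d]] by auto
  then show ?thesis unfolding cls_def by blast
 qed
 ultimately show "cls T x = cls T y" by blast
qed

lemma cls_self: "x \<in> cls T x" using tensor_rel.zero[of R P M l] by (force simp: cls_def)

lemma cls_0: "cls T 0 = T" by (auto simp: cls_def)

lemma cls_add: "{y + z |y z. y \<in> cls T x \<and> z \<in> cls T x'} = cls T (x + x')"
proof (intro Set.set_eqI iffI)
 fix w assume "w \<in> {y + z |y z. y \<in> cls T x \<and> z \<in> cls T x'}"
 then obtain s t where "s \<in> T" "t \<in> T" "w = (x + s) + (x' + t)" by (auto simp: cls_def)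
 then have "w = (x + x') + (s + t)" "s + t \<in> T" by (auto intro: T_add)
 then show "w \<in> cls T (x + x')" unfolding cls_def by blast
next
 fix w assume "w \<in> cls T (x + x')"
 then obtain t where "t \<in> T" "w = (x + x') + t" by (auto simp: cls_def)
 then have "w = (x + t) + x'" "x + t \<in> cls T x" by (auto simp: cls_def)
 then show "w \<in> {y + z |y z. y \<in> cls T x \<and> z \<in> cls T x'}" using cls_self by blast
qed

lemma tensor_carrier_eq: "tensor_carrier R P M l = cls T ` {x. keys x \<subseteq> carrier P \<times> carrier M}"
 by (auto simp: tensor_carrier_def cls_def)

end

lemma tensor_map_cls:
 assumes "\<And>t. t \<in> tensor_rel R P M l ==> frag_extend (frag_of \<circ> g) t \<in> tensor_rel R' Q N k"
 shows "tensor_map R' Q N k g (cls (tensor_rel R P M l) x) = cls (tensor_rel R' Q N k) (frag_extend (frag_of \<circ> g) x)"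
proof (intro Set.set_eqI iffI)
 fix z assume "z \<in> tensor_map R' Q N k g (cls (tensor_rel R P M l) x)"
 then obtain t u where "t \<in> tensor_rel R P M l" "u \<in> tensor_rel R' Q N k"
  "z = frag_extend (frag_of \<circ> g) (x + t) + u" by (auto simp: tensor_map_def cls_def)
 then have "z = frag_extend (frag_of \<circ> g) x + (frag_extend (frag_of \<circ> g) t + u)"
  "frag_extend (frag_of \<circ> g) t + u \<in> tensor_rel R' Q N k"
  by (auto simp: frag_extend_add intro: T_add assms)
 then show "z \<in> cls (tensor_rel R' Q N k) (frag_extend (frag_of \<circ> g) x)" unfolding cls_def by blast
next
 fix z assume "z \<in> cls (tensor_rel R' Q N k) (frag_extend (frag_of \<circ> g) x)"
 then show "z \<in> tensor_map R' Q N k g (cls (tensor_rel R P M l) x)"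
  using cls_self[of x R P M l] by (auto simp: tensor_map_def cls_def)
qed

lemma frag_extend_diff_fun: "frag_extend (%i. f i - g i) x = frag_extend f x - frag_extend g x"
proof -
 have "frag_cmul n (a - b) = frag_cmul n a - frag_cmul n b" for n :: int and a b :: "'a \<Rightarrow>\<^sub>0 int"
  by (rule poly_mapping_eqI) (simp add: lookup_minus algebra_simps)
 then show ?thesis by (simp add: frag_extend_def sum_subtractf)
qed

lemma frag_extend_sum: "frag_extend f (sum g I) = (\<Sum>i\<in>I. frag_extend f (g i))"
 by (induction I rule: infinite_finite_induct) (auto simp: frag_extend_add)

lemma frag_extend_extend: "frag_extend f (frag_extend g x) = frag_extend (%i. frag_extend f (g i)) x"
 unfolding frag_extend_def[of g] frag_extend_def[of "%i. frag_extend f (g i)"]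
 by (simp add: frag_extend_sum frag_extend_cmul)

lemma frag_extend_cong: "(\<And>i. i \<in> keys x ==> f i = g i) ==> frag_extend f x = frag_extend g x"
 by (simp add: frag_extend_def)

lemma keys_frag_extend_of:
 assumes "\<And>i. i \<in> keys x ==> g i \<in> A"
 shows "keys (frag_extend (frag_of \<circ> g) x) \<subseteq> A"
 unfolding frag_extend_def
proof (intro order_trans[OF keys_sum] UN_least)
 fix i assume i: "i \<in> keys x"
 have "keys (frag_cmul (lookup x i) ((frag_of \<circ> g) i)) \<subseteq> keys (frag_of (g i))"
  unfolding comp_def by (rule keys_cmul)
 then show "keys (frag_cmul (lookup x i) ((frag_of \<circ> g) i)) \<subseteq> A"
  using assms[OF i] by (simp add: keys_frag_of subset_iff)
qed

definition linear_system :: "('u, 'l) ring_scheme => ('r => 'u => 'u) => 'e set => ('f => 'e => 'r) => ('e => 'u) => 'f => 'u" where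
 "linear_system M l E a b f = (\<Oplus>\<^bsub>M\<^esub>e\<in>E. l (a f e) (b e))"

context left_action
begin

lemma terms_closed:
 assumes "\<And>e. e \<in> E ==> a f e \<in> carrier R" "b \<in> E -> carrier M"
 shows "(%e. l (a f e) (b e)) \<in> E -> carrier M"
proof
 fix e assume "e \<in> E"
 then show "l (a f e) (b e) \<in> carrier M" using assms by (intro l_closed) auto
qed

lemma system_closed:
 assumes "\<And>e. e \<in> E ==> a f e \<in> carrier R" "b \<in> E -> carrier M"
 shows "linear_system M l E a b f \<in> carrier M"
 unfolding linear_system_def by (rule M.finsum_closed[OF terms_closed[of E a f b, OF assms]])

lemma system_cong:
 assumes "\<And>e. e \<in> E ==> a f e \<in> carrier R" "c \<in> E -> carrier M" "\<And>e. e \<in> E ==> b e = c e"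
 shows "linear_system M l E a b f = linear_system M l E a c f"
 unfolding linear_system_def
 by (rule M.finsum_cong'[OF HOL.refl terms_closed[of E a f c, OF assms(1,2)]]) (simp_all add: assms(3))

lemma system_add:
 assumes a: "\<And>e. e \<in> E ==> a f e \<in> carrier R" and b: "b \<in> E -> carrier M" and c: "c \<in> E -> carrier M"
 shows "linear_system M l E a (%e. b e \<oplus>[M] c e) f = linear_system M l E a b f \<oplus>[M] linear_system M l E a c f"
 unfolding linear_system_def
proof (rule HOL.trans[OF M.finsum_cong'[OF HOL.refl] M.finsum_addf[OF terms_closed[of E a f b, OF a b] terms_closed[of E a f c, OF a c]]])
 show "(%e. l (a f e) (b e) \<oplus>[M] l (a f e) (c e)) \<in> E -> carrier M"
  using terms_closed[of E a f, OF a b] terms_closed[of E a f, OF a c] by (auto simp: Pi_iff)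
 show "l (a f e) (b e \<oplus>[M] c e) = l (a f e) (b e) \<oplus>[M] l (a f e) (c e)" if "e \<in> E" for e
  using a[OF that] b c that by (intro l_add_right) auto
qed

lemma system_zero:
 assumes a: "\<And>e. e \<in> E ==> a f e \<in> carrier R"
 shows "linear_system M l E a (%e. \<zero>[M]) f = \<zero>[M]"
proof -
 have "linear_system M l E a (%e. \<zero>[M]) f = (\<Oplus>\<^bsub>M\<^esub>e\<in>E. \<zero>[M])"
  unfolding linear_system_def by (rule M.finsum_cong'[OF HOL.refl]) (simp_all add: l_zero_right a)
 then show ?thesis by simp
qed

lemma system_diff:
 assumes a: "\<And>e. e \<in> E ==> a f e \<in> carrier R" and b: "b \<in> E -> carrier M" and c: "c \<in> E -> carrier M"
 shows "linear_system M l E a (%e. b e \<ominus>[M] c e) f = linear_system M l E a b f \<ominus>[M] linear_system M l E a c f"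
proof -
 let ?F = "linear_system M l E a"
 have d: "(%e. b e \<ominus>[M] c e) \<in> E -> carrier M" using b c by (auto simp: Pi_iff)
 have "?F b f = ?F (%e. (b e \<ominus>[M] c e) \<oplus>[M] c e) f"
  using b c by (intro system_cong a) (auto simp: Pi_iff a_minus_def M.a_assoc M.l_neg)
 also have "\<dots> = ?F (%e. b e \<ominus>[M] c e) f \<oplus>[M] ?F c f" by (rule system_add[of E a f, OF a d c])
 finally show ?thesis
  using system_closed[of E a f, OF a d] system_closed[of E a f, OF a c] system_closed[of E a f, OF a b]
  by (metis M.diff_eq_iff M.a_comm)
qed

end

text \<open>Maps that commute with the action commute with linear systems.\<close>

lemma system_natural:
 assumes M: "left_action R M l" and N: "left_action R N k"
  and \<phi>: "\<And>x. x \<in> carrier M ==> \<phi> x \<in> carrier N"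
   "\<And>x y. x \<in> carrier M ==> y \<in> carrier M ==> \<phi> (x \<oplus>[M] y) = \<phi> x \<oplus>[N] \<phi> y"
   "\<And>r x. r \<in> carrier R ==> x \<in> carrier M ==> \<phi> (l r x) = k r (\<phi> x)"
  and E: "finite E" and a: "\<And>e. e \<in> E ==> a f e \<in> carrier R" and b: "b \<in> E -> carrier M"
 shows "\<phi> (linear_system M l E a b f) = linear_system N k E a (%e. \<phi> (b e)) f"
proof -
 interpret M: left_action R M l by fact
 interpret N: left_action R N k by fact
 have z: "\<phi> \<zero>[M] = \<zero>[N]"
  using \<phi>(2)[of "\<zero>[M]" "\<zero>[M]"] \<phi>(1)[of "\<zero>[M]"] by (simp add: N.M.add.l_cancel_one)
 have "\<phi> (\<Oplus>\<^bsub>M\<^esub>e\<in>A. l (a f e) (b e)) = (\<Oplus>\<^bsub>N\<^esub>e\<in>A. k (a f e) (\<phi> (b e)))" if "A \<subseteq> E" for A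
  using finite_subset[OF that E] that
 proof (induction A)
  case (insert x A)
  then have *: "x \<in> E" "A \<subseteq> E" by auto
  have c: "l (a f x) (b x) \<in> carrier M" "b x \<in> carrier M" "a f x \<in> carrier R" using * a b by (auto intro!: M.l_closed)
  have A: "(%e. l (a f e) (b e)) \<in> A -> carrier M" "(%e. k (a f e) (\<phi> (b e))) \<in> A -> carrier N"
   using M.terms_closed[of A a f b] N.terms_closed[of A a f "%e. \<phi> (b e)"] * a b \<phi>(1)
   by (auto simp: Pi_iff subset_iff)
  show ?case using insert c A * by (simp add: M.M.finsum_insert N.M.finsum_insert \<phi> M.M.finsum_closed N.l_closed)
 qed (simp add: z)
 then show ?thesis by (simp add: linear_system_def)
qed

definition hom_matrix :: "('r, 'n) ring_scheme => ('r, 'p, 'm) module_scheme => 'p set => ('q => 'p) => 'p => 'q => 'r" where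
 "hom_matrix R Q E' \<sigma> e' e = coef R Q E' (\<sigma> e) e'"

definition tsum :: "'p set => ('p => 'u) => ('p \<times> 'u \<Rightarrow>\<^sub>0 int)" where
 "tsum E b = (\<Sum>e\<in>E. frag_of (e, b e))"

locale tensor = P: free_right_module R P E + M: left_action R M l
 for R :: "('r, 'n) ring_scheme" and P :: "('r, 'p, 'm) module_scheme" and E
  and M :: "('u, 'l) ring_scheme" and l :: "'r => 'u => 'u"
begin

abbreviation (input) "TR \<equiv> tensor_rel R P M l"

lemma zero_left: "b \<in> carrier M ==> frag_of (\<zero>[P], b) \<in> TR"
 using T_minus[OF tensor_rel.add_left[of "\<zero>[P]" P "\<zero>[P]" b M R l]] by simp

lemma zero_right: "p \<in> carrier P ==> frag_of (p, \<zero>[M]) \<in> TR"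
 using T_minus[OF tensor_rel.add_right[of p P "\<zero>[M]" M "\<zero>[M]" R l]] by simp

lemma finsum_left:
 assumes "finite A" "f \<in> A -> carrier P" "b \<in> carrier M"
 shows "frag_of (finsum P f A, b) - (\<Sum>a\<in>A. frag_of (f a, b)) \<in> TR"
 using assms(1,2)
proof (induction A)
 case (insert a A)
 then have *: "f a \<in> carrier P" "f \<in> A -> carrier P" by auto
 from tensor_rel.add_left[OF this(1) P.P.finsum_closed[OF this(2)] assms(3)] insert *
 have "frag_of (f a \<oplus>[P] finsum P f A, b) - frag_of (f a, b) - frag_of (finsum P f A, b) \<in> TR" by blast
 from T_add[OF this insert.IH[OF *(2)]] show ?case
  using insert * by (simp add: P.P.finsum_insert Pi_def algebra_simps)
qed (use zero_left assms in simp)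

lemma finsum_right:
 assumes "finite A" "f \<in> A -> carrier M" "p \<in> carrier P"
 shows "frag_of (p, finsum M f A) - (\<Sum>a\<in>A. frag_of (p, f a)) \<in> TR"
 using assms(1,2)
proof (induction A)
 case (insert a A)
 then have *: "f a \<in> carrier M" "f \<in> A -> carrier M" by auto
 from tensor_rel.add_right[OF assms(3) this(1) M.M.finsum_closed[OF this(2)]] insert *
 have "frag_of (p, f a \<oplus>[M] finsum M f A) - frag_of (p, f a) - frag_of (p, finsum M f A) \<in> TR" by blast
 from T_add[OF this insert.IH[OF *(2)]] show ?case
  using insert * by (simp add: M.M.finsum_insert Pi_def algebra_simps)
qed (use zero_right assms in simp)

lemma expand:
 assumes "p \<in> carrier P" "b \<in> carrier M"
 shows "frag_of (p, b) - tsum E (%e. l (coef R P E p e) b) \<in> TR"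
proof -
 have cl: "(%e. coef R P E p e \<odot>[P] e) \<in> E -> carrier P"
  by (rule P.coef_scaled_closed[OF assms(1)])
 from finsum_left[OF P.fin cl assms(2)]
 have 1: "frag_of (p, b) - (\<Sum>e\<in>E. frag_of (coef R P E p e \<odot>[P] e, b)) \<in> TR"
  by (simp add: P.coef(2)[OF assms(1)])
 have 2: "(\<Sum>e\<in>E. frag_of (coef R P E p e \<odot>[P] e, b) - frag_of (e, l (coef R P E p e) b)) \<in> TR"
  using P.coef_closed[OF assms(1)] P.E_sub assms(2)
  by (intro T_sum tensor_rel.balanced) auto
 from T_add[OF 1 2] show ?thesis by (simp add: tsum_def sum_subtractf)
qed

lemma tsum_add:
 assumes "b \<in> E -> carrier M" "c \<in> E -> carrier M"
 shows "tsum E (%e. b e \<oplus>[M] c e) - tsum E b - tsum E c \<in> TR"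
proof -
 have "(\<Sum>e\<in>E. frag_of (e, b e \<oplus>[M] c e) - frag_of (e, b e) - frag_of (e, c e)) \<in> TR"
  using assms P.E_sub by (intro T_sum tensor_rel.add_right) auto
 then show ?thesis by (simp add: tsum_def sum_subtractf)
qed

lemma keys_tsum: "b \<in> E -> carrier M ==> keys (tsum E b) \<subseteq> carrier P \<times> carrier M"
 unfolding tsum_def using P.E_sub by (intro order_trans[OF keys_sum]) (auto simp: keys_frag_of)

lemma ex_tsum:
 assumes "keys x \<subseteq> carrier P \<times> carrier M"
 shows "\<exists>b\<in>E -> carrier M. x - tsum E b \<in> TR"
 using assms
proof (induction x rule: frag_induction)
 case zero
 have "- (\<Sum>e\<in>E. frag_of (e, \<zero>[M])) \<in> TR" using P.E_sub zero_right by (intro T_minus T_sum) auto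
 then show ?case by (intro bexI[of _ "%_. \<zero>[M]"]) (auto simp: tsum_def)
next
 case (one x)
 then obtain p b where x: "x = (p, b)" "p \<in> carrier P" "b \<in> carrier M" by auto
 show ?case unfolding x using expand[OF x(2,3)] M.l_closed P.coef_closed x
  by (intro bexI[of _ "%e. l (coef R P E p e) b"]) auto
next
 case (diff x y)
 then obtain b c where b: "b \<in> E -> carrier M" "x - tsum E b \<in> TR" and c: "c \<in> E -> carrier M" "y - tsum E c \<in> TR"
  by auto
 let ?d = "%e. b e \<ominus>[M] c e"
 have d: "?d \<in> E -> carrier M" using b c by auto
 have "tsum E (%e. ?d e \<oplus>[M] c e) = tsum E b"
  unfolding tsum_def using b c by (intro sum.cong) (auto simp: a_minus_def M.M.a_assoc M.M.l_neg Pi_iff)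
 with tsum_add[OF d c(1)] have "tsum E b - tsum E ?d - tsum E c \<in> TR" by simp
 from T_add[OF this tensor_rel.diff[OF b(2) c(2)]] show ?case
  by (intro bexI[OF _ d]) (simp add: algebra_simps)
qed

text \<open>The coordinates of a tensor are well defined because \<open>p \<otimes> b \<mapsto> p\<^sub>e b\<close> respects the relations.\<close>

lemma coordinate_hom:
 assumes e: "e \<in> E"
 obtains h where "h \<in> hom (free_Abelian_group (carrier P \<times> carrier M)) (add_monoid M)"
  "\<And>p b. p \<in> carrier P ==> b \<in> carrier M ==> h (frag_of (p, b)) = l (coef R P E p e) b"
  "\<And>x. x \<in> TR ==> keys x \<subseteq> carrier P \<times> carrier M \<and> h x = \<zero>[M]"
proof -
 let ?S = "carrier P \<times> carrier M"
 have cg: "comm_group (add_monoid M)" by (rule M.M.a_comm_group)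
 have "(%(p, b). l (coef R P E p e) b) ` ?S \<subseteq> carrier (add_monoid M)"
  using M.l_closed P.coef_closed e by auto
 from comm_group.free_Abelian_group_universal[OF cg this] obtain h where
  h: "h \<in> hom (free_Abelian_group ?S) (add_monoid M)"
  and hf: "\<And>x. x \<in> ?S ==> h (frag_of x) = (%(p, b). l (coef R P E p e) b) x" by blast
 have hf': "h (frag_of (p, b)) = l (coef R P E p e) b" if "p \<in> carrier P" "b \<in> carrier M" for p b
  using hf[of "(p, b)"] that by simp
 interpret h: group_hom "free_Abelian_group ?S" "add_monoid M" h
  using h by (simp add: group_hom_def group_hom_axioms_def M.M.a_group)
 have hdiff: "h (x - y) = h x \<ominus>[M] h y" if "keys x \<subseteq> ?S" "keys y \<subseteq> ?S" for x y
 proof -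
  have k: "keys (- y) \<subseteq> ?S" using that(2) by (auto simp: in_keys_iff)
  have "h (x + - y) = h x \<oplus>[M] h (- y)" using h.hom_mult[of x "- y"] that k by simp
  moreover have "h (- y) = \<ominus>[M] h y" using h.hom_inv[of y] that by (simp add: a_inv_def)
  ultimately show ?thesis by (simp add: a_minus_def)
 qed
 have kd: "keys (x - y) \<subseteq> ?S" if "keys x \<subseteq> ?S" "keys y \<subseteq> ?S" for x y :: "'p \<times> 'u \<Rightarrow>\<^sub>0 int"
  using keys_diff[of x y] that by blast
 have hc: "h x \<in> carrier M" if "keys x \<subseteq> ?S" for x
  using h.hom_closed[of x] that by simp
 have rel: "keys x \<subseteq> ?S \<and> h x = \<zero>[M]" if "x \<in> TR" for x
  using that
 proof (induction rule: tensor_rel.induct)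
  case zero show ?case using h.hom_one by simp
 next
  case (diff x y) then show ?case using kd[of x y] by (simp add: hdiff a_minus_def)
 next
  case (add_left p q b)
  then have k: "keys (frag_of (p \<oplus>[P] q, b)) \<subseteq> ?S" "keys (frag_of (p, b)) \<subseteq> ?S"
   "keys (frag_of (q, b)) \<subseteq> ?S" by (auto simp: keys_frag_of)
  have "h (frag_of (p \<oplus>[P] q, b) - frag_of (p, b) - frag_of (q, b)) =
   (l (coef R P E p e) b \<oplus>[M] l (coef R P E q e) b) \<ominus>[M] l (coef R P E p e) b \<ominus>[M] l (coef R P E q e) b"
   using add_left e P.coef_closed by (simp add: hdiff kd k hf' P.coef_add M.l_add_left)
  then show ?case using add_left e P.coef_closed kd[OF kd[OF k(1,2)] k(3)]
   by (simp add: M.M.add_diff_diff M.l_closed)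
 next
  case (add_right p b c)
  then have k: "keys (frag_of (p, b \<oplus>[M] c)) \<subseteq> ?S" "keys (frag_of (p, b)) \<subseteq> ?S"
   "keys (frag_of (p, c)) \<subseteq> ?S" by (auto simp: keys_frag_of)
  have "h (frag_of (p, b \<oplus>[M] c) - frag_of (p, b) - frag_of (p, c)) =
   (l (coef R P E p e) b \<oplus>[M] l (coef R P E p e) c) \<ominus>[M] l (coef R P E p e) b \<ominus>[M] l (coef R P E p e) c"
   using add_right e P.coef_closed by (simp add: hdiff kd k hf' M.l_add_right)
  then show ?case using add_right e P.coef_closed kd[OF kd[OF k(1,2)] k(3)]
   by (simp add: M.M.add_diff_diff M.l_closed)
 next
  case (balanced r p b)
  then have k: "keys (frag_of (r \<odot>[P] p, b)) \<subseteq> ?S" "keys (frag_of (p, l r b)) \<subseteq> ?S"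
   by (auto simp: keys_frag_of P.act_closed M.l_closed)
  have "h (frag_of (r \<odot>[P] p, b) - frag_of (p, l r b)) =
   l (coef R P E p e) (l r b) \<ominus>[M] l (coef R P E p e) (l r b)"
   using balanced e P.coef_closed by (simp add: hdiff k hf' P.act_closed P.coef_act M.l_mult M.l_closed)
  then show ?case using balanced e P.coef_closed kd[OF k]
   by (simp add: M.l_closed a_minus_def M.M.r_neg)
 qed
 show thesis by (rule that[OF h hf' rel])
qed

lemma tsum_rel_iff:
 assumes b: "b \<in> E -> carrier M"
 shows "tsum E b \<in> TR \<longleftrightarrow> (\<forall>e\<in>E. b e = \<zero>[M])"
proof
 assume "\<forall>e\<in>E. b e = \<zero>[M]"
 then show "tsum E b \<in> TR" unfolding tsum_def using P.E_sub zero_right by (intro T_sum) auto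
next
 assume t: "tsum E b \<in> TR"
 show "\<forall>e\<in>E. b e = \<zero>[M]"
 proof
  fix e assume e: "e \<in> E"
  let ?G = "free_Abelian_group (carrier P \<times> carrier M)"
  obtain h where h: "h \<in> hom ?G (add_monoid M)"
   "\<And>p b. p \<in> carrier P ==> b \<in> carrier M ==> h (frag_of (p, b)) = l (coef R P E p e) b"
   "\<And>x. x \<in> TR ==> keys x \<subseteq> carrier P \<times> carrier M \<and> h x = \<zero>[M]"
   using coordinate_hom[OF e] by metis
  interpret h: group_hom ?G "add_monoid M" h
   using h(1) by (simp add: group_hom_def group_hom_axioms_def M.M.a_group)
  have "h (tsum A b) = (\<Oplus>\<^bsub>M\<^esub>e'\<in>A. l (coef R P E e' e) (b e'))" if "A \<subseteq> E" for A
  proof -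
   have "finite A" using that P.fin finite_subset by auto
   then show ?thesis using that
   proof (induction A)
    case empty then show ?case using h.hom_one by (simp add: tsum_def)
   next
    case (insert x A)
    have kx: "keys (frag_of (x, b x)) \<subseteq> carrier P \<times> carrier M"
     "keys (tsum A b) \<subseteq> carrier P \<times> carrier M"
     unfolding tsum_def using insert P.E_sub b by (auto simp: keys_frag_of intro!: order_trans[OF keys_sum])
    have x: "x \<in> E" "x \<in> carrier P" "b x \<in> carrier M" "A \<subseteq> E" using insert P.E_sub b by auto
    have "tsum (insert x A) b = frag_of (x, b x) + tsum A b" using insert by (simp add: tsum_def)
    then have "h (tsum (insert x A) b) = h (frag_of (x, b x)) \<oplus>[M] h (tsum A b)"
     using h.hom_mult[of "frag_of (x, b x)" "tsum A b"] kx by simp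
    moreover have "(%e'. l (coef R P E e' e) (b e')) \<in> A -> carrier M"
     using x P.E_sub b e by (auto intro!: M.l_closed P.coef_closed)
    ultimately show ?case using insert x by (simp add: h(2) M.M.finsum_insert M.l_closed P.coef_closed e)
   qed
  qed
  then have "h (tsum E b) = (\<Oplus>\<^bsub>M\<^esub>e'\<in>E. l (coef R P E e' e) (b e'))" by blast
  also have "\<dots> = (\<Oplus>\<^bsub>M\<^esub>e'\<in>E. if e = e' then b e' else \<zero>[M])"
   using b by (intro M.M.finsum_cong') (auto simp: P.coef_basis e M.l_one M.l_zero_left Pi_iff)
  also have "\<dots> = b e" using M.M.finsum_singleton[OF e P.fin, of b] b by auto
  finally show "b e = \<zero>[M]" using h(3)[OF t] by simp
 qed
qed

lemma tsum_diff:
 assumes "b \<in> E -> carrier M" "c \<in> E -> carrier M"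
 shows "tsum E (%e. b e \<ominus>[M] c e) - (tsum E b - tsum E c) \<in> TR"
proof -
 let ?d = "%e. b e \<ominus>[M] c e"
 have d: "?d \<in> E -> carrier M" using assms by auto
 have "tsum E (%e. ?d e \<oplus>[M] c e) = tsum E b"
  unfolding tsum_def using assms by (intro sum.cong) (auto simp: a_minus_def M.M.a_assoc M.M.l_neg Pi_iff)
 with tsum_add[OF d assms(2)] have "tsum E b - tsum E ?d - tsum E c \<in> TR" by simp
 from T_minus[OF this] show ?thesis by (simp add: algebra_simps)
qed

lemma tsum_cong_iff:
 assumes "b \<in> E -> carrier M" "c \<in> E -> carrier M"
 shows "tsum E b - tsum E c \<in> TR \<longleftrightarrow> (\<forall>e\<in>E. b e = c e)"
proof -
 let ?d = "%e. b e \<ominus>[M] c e"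
 have d: "?d \<in> E -> carrier M" using assms by auto
 have "tsum E b - tsum E c \<in> TR \<longleftrightarrow> tsum E ?d \<in> TR"
  using T_add[OF tsum_diff[OF assms], of "tsum E b - tsum E c"]
   tensor_rel.diff[OF _ tsum_diff[OF assms], of "tsum E ?d"] by auto
 also have "\<dots> \<longleftrightarrow> (\<forall>e\<in>E. ?d e = \<zero>[M])" by (rule tsum_rel_iff[OF d])
 also have "\<dots> \<longleftrightarrow> (\<forall>e\<in>E. b e = c e)" using assms by (auto simp: M.M.diff_eq_iff Pi_iff)
 finally show ?thesis .
qed

end

text \<open>A pair of compatible maps \<open>\<sigma>\<close> and \<open>\<phi>\<close> induces \<open>\<sigma> \<otimes> \<phi>\<close>; in coordinates it is the matrix of \<open>\<sigma>\<close> applied to the values of \<open>\<phi>\<close>.\<close>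

locale tensor_functor = S: tensor R P E M l + T: tensor R Q E' N k
 for R :: "('r, 'n) ring_scheme" and P :: "('r, 'p, 'm) module_scheme" and E
  and M :: "('u, 'l) ring_scheme" and l :: "'r => 'u => 'u"
  and Q :: "('r, 'q, 'o) module_scheme" and E' and N :: "('v, 'j) ring_scheme" and k :: "'r => 'v => 'v" +
 fixes \<sigma> :: "'p => 'q" and \<phi> :: "'u => 'v"
 assumes \<sigma>: "\<sigma> \<in> right_module_hom R P Q"
  and \<phi>_closed: "b \<in> carrier M ==> \<phi> b \<in> carrier N"
  and \<phi>_add: "b \<in> carrier M ==> c \<in> carrier M ==> \<phi> (b \<oplus>[M] c) = \<phi> b \<oplus>[N] \<phi> c"
  and \<phi>_act: "r \<in> carrier R ==> b \<in> carrier M ==> \<phi> (l r b) = k r (\<phi> b)"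
begin

abbreviation (input) "ext \<equiv> frag_extend (frag_of \<circ> map_prod \<sigma> \<phi>)"

lemma ext_rel: "t \<in> tensor_rel R P M l ==> ext t \<in> tensor_rel R Q N k"
proof (induction rule: tensor_rel.induct)
 case zero show ?case by (simp add: tensor_rel.zero)
next
 case (diff x y) then show ?case by (simp add: frag_extend_diff tensor_rel.diff)
next
 case (add_left p q b)
 then show ?case using \<sigma> tensor_rel.add_left[of "\<sigma> p" Q "\<sigma> q" "\<phi> b" N R k]
  by (auto simp: frag_extend_diff right_module_hom_def \<phi>_closed)
next
 case (add_right p b c)
 then show ?case using \<sigma> tensor_rel.add_right[of "\<sigma> p" Q "\<phi> b" N "\<phi> c" R k]
  by (auto simp: frag_extend_diff right_module_hom_def \<phi>_closed \<phi>_add)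
next
 case (balanced r p b)
 then show ?case using \<sigma> tensor_rel.balanced[of r R "\<sigma> p" Q "\<phi> b" N k]
  by (auto simp: frag_extend_diff right_module_hom_def \<phi>_closed \<phi>_act)
qed

lemma map_cls: "tensor_map R Q N k (map_prod \<sigma> \<phi>) (cls (tensor_rel R P M l) x) = cls (tensor_rel R Q N k) (ext x)"
 by (rule tensor_map_cls[OF ext_rel])

lemma keys_ext: "keys x \<subseteq> carrier P \<times> carrier M ==> keys (ext x) \<subseteq> carrier Q \<times> carrier N"
 by (rule keys_frag_extend_of) (use \<sigma> in \<open>force simp: right_module_hom_def intro: \<phi>_closed\<close>)

lemma \<sigma>_E: "e \<in> E ==> \<sigma> e \<in> carrier Q"
 using \<sigma> S.P.E_sub by (auto simp: right_module_hom_def)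

lemma system_closed:
 assumes "b \<in> E -> carrier N" "f \<in> E'"
 shows "linear_system N k E (hom_matrix R Q E' \<sigma>) b f \<in> carrier N"
 unfolding linear_system_def hom_matrix_def using assms \<sigma>_E
 by (intro T.M.M.finsum_closed) (auto intro!: T.M.l_closed T.P.coef_closed)

lemma ext_tsum:
 assumes b: "b \<in> E -> carrier M"
 shows "ext (tsum E b) - tsum E' (linear_system N k E (hom_matrix R Q E' \<sigma>) (%e. \<phi> (b e))) \<in> tensor_rel R Q N k"
proof -
 let ?T = "tensor_rel R Q N k"
 let ?m = "%f e. k (coef R Q E' (\<sigma> e) f) (\<phi> (b e))"
 have m: "?m f e \<in> carrier N" if "f \<in> E'" "e \<in> E" for f e
  using that b \<sigma>_E by (auto intro!: T.M.l_closed T.P.coef_closed \<phi>_closed)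
 have "ext (tsum E b) = (\<Sum>e\<in>E. frag_of (\<sigma> e, \<phi> (b e)))" by (simp add: tsum_def frag_extend_sum)
 moreover have "(\<Sum>e\<in>E. frag_of (\<sigma> e, \<phi> (b e)) - tsum E' (%f. ?m f e)) \<in> ?T"
  using b \<sigma>_E by (intro T_sum T.expand) (auto intro!: \<phi>_closed)
 moreover have "(\<Sum>f\<in>E'. frag_of (f, \<Oplus>\<^bsub>N\<^esub>e\<in>E. ?m f e) - (\<Sum>e\<in>E. frag_of (f, ?m f e))) \<in> ?T"
  using m T.P.E_sub by (intro T_sum T.finsum_right) (auto simp: S.P.fin)
 moreover have "(\<Sum>e\<in>E. tsum E' (%f. ?m f e)) = (\<Sum>f\<in>E'. \<Sum>e\<in>E. frag_of (f, ?m f e))"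
  unfolding tsum_def by (rule sum.swap)
 ultimately show ?thesis
  using tensor_rel.diff[of "(\<Sum>e\<in>E. frag_of (\<sigma> e, \<phi> (b e)) - tsum E' (%f. ?m f e))" R Q N k
   "(\<Sum>f\<in>E'. frag_of (f, \<Oplus>\<^bsub>N\<^esub>e\<in>E. ?m f e) - (\<Sum>e\<in>E. frag_of (f, ?m f e)))"]
  by (simp add: sum_subtractf tsum_def linear_system_def hom_matrix_def)
qed

lemma map_tsum:
 assumes b: "b \<in> E -> carrier M"
 shows "tensor_map R Q N k (map_prod \<sigma> \<phi>) (cls (tensor_rel R P M l) (tsum E b)) =
  cls (tensor_rel R Q N k) (tsum E' (linear_system N k E (hom_matrix R Q E' \<sigma>) (%e. \<phi> (b e))))"
 using ext_tsum[OF b] by (simp add: map_cls cls_eq_iff)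

end

context tensor begin

lemma carrier_tsum: "tensor_carrier R P M l = (%b. cls TR (tsum E b)) ` (E -> carrier M)"
proof
 show "tensor_carrier R P M l \<subseteq> (%b. cls TR (tsum E b)) ` (E -> carrier M)"
 proof
  fix Y assume "Y \<in> tensor_carrier R P M l"
  then obtain x where x: "keys x \<subseteq> carrier P \<times> carrier M" "Y = cls TR x" by (auto simp: tensor_carrier_eq)
  from ex_tsum[OF x(1)] obtain b where "b \<in> E -> carrier M" "x - tsum E b \<in> TR" by auto
  then show "Y \<in> (%b. cls TR (tsum E b)) ` (E -> carrier M)" using x(2) by (auto simp: cls_eq_iff)
 qed
 show "(%b. cls TR (tsum E b)) ` (E -> carrier M) \<subseteq> tensor_carrier R P M l"
  unfolding tensor_carrier_eq using keys_tsum by (intro image_subsetI imageI) auto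
qed

lemma id_hom: "id \<in> right_module_hom R P P" by (auto simp: right_module_hom_def)

end

lemma bij_betw_image_iff:
 assumes "\<And>x. x \<in> A ==> F x \<in> B" "\<And>x. x \<in> A ==> t (\<alpha> x) = \<beta> (F x)"
 shows "bij_betw t (\<alpha> ` A) (\<beta> ` B) \<longleftrightarrow>
  (\<forall>x\<in>A. \<forall>x'\<in>A. \<beta> (F x) = \<beta> (F x') --> \<alpha> x = \<alpha> x') \<and> (\<forall>y\<in>B. \<exists>x\<in>A. \<beta> (F x) = \<beta> y)"
proof -
 have "inj_on t (\<alpha> ` A) \<longleftrightarrow> (\<forall>x\<in>A. \<forall>x'\<in>A. \<beta> (F x) = \<beta> (F x') --> \<alpha> x = \<alpha> x')"
  unfolding inj_on_def by (simp add: assms(2))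
 moreover have "t ` \<alpha> ` A = \<beta> ` F ` A" by (auto simp: assms(2) image_iff)
 moreover have "\<beta> ` F ` A = \<beta> ` B \<longleftrightarrow> (\<forall>y\<in>B. \<exists>x\<in>A. \<beta> (F x) = \<beta> y)"
 proof
  assume eq: "\<beta> ` F ` A = \<beta> ` B"
  show "\<forall>y\<in>B. \<exists>x\<in>A. \<beta> (F x) = \<beta> y"
  proof
   fix y assume "y \<in> B"
   then have "\<beta> y \<in> \<beta> ` F ` A" unfolding eq by (rule imageI)
   then show "\<exists>x\<in>A. \<beta> (F x) = \<beta> y" by (elim imageE) auto
  qed
 next
  assume *: "\<forall>y\<in>B. \<exists>x\<in>A. \<beta> (F x) = \<beta> y"
  have "\<beta> y \<in> \<beta> ` F ` A" if y: "y \<in> B" for y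
  proof -
   from * y obtain x where "x \<in> A" "\<beta> (F x) = \<beta> y" by blast
   then show ?thesis by (metis imageI)
  qed
  then show "\<beta> ` F ` A = \<beta> ` B" using assms(1) by auto
 qed
 ultimately show ?thesis unfolding bij_betw_def by simp
qed

text \<open>Every element of \<open>P \<otimes> M\<close> is \<open>\<Sum>e \<otimes> b\<^sub>e\<close> for a unique family \<open>b\<close>, so bijectivity is unique solvability of the system.\<close>

lemma tensor_map_bij_iff:
 assumes "tensor R P E M l" "tensor R Q E' M l" and \<sigma>: "\<sigma> \<in> right_module_hom R P Q"
 shows "bij_betw (tensor_map R Q M l (map_prod \<sigma> id)) (tensor_carrier R P M l) (tensor_carrier R Q M l) \<longleftrightarrow>
  (\<forall>b\<in>E -> carrier M. (\<forall>f\<in>E'. linear_system M l E (hom_matrix R Q E' \<sigma>) b f = \<zero>[M]) --> (\<forall>e\<in>E. b e = \<zero>[M])) \<and>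
  (\<forall>c\<in>E' -> carrier M. \<exists>b\<in>E -> carrier M. \<forall>f\<in>E'. linear_system M l E (hom_matrix R Q E' \<sigma>) b f = c f)"
  (is "bij_betw ?t ?A ?B \<longleftrightarrow> ?I \<and> ?S")
proof -
 interpret A: tensor R P E M l by fact
 interpret B: tensor R Q E' M l by fact
 interpret tensor_functor R P E M l Q E' M l \<sigma> id
  by unfold_locales (auto simp: \<sigma>)
 let ?F = "linear_system M l E (hom_matrix R Q E' \<sigma>)"
 let ?T = "tensor_rel R P M l" and ?T' = "tensor_rel R Q M l"
 have m: "?t (cls ?T (tsum E b)) = cls ?T' (tsum E' (?F b))" if "b \<in> E -> carrier M" for b
  using map_tsum[OF that] by simp
 have F: "?F b \<in> E' -> carrier M" if "b \<in> E -> carrier M" for b using system_closed that by auto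
 have mat: "hom_matrix R Q E' \<sigma> f e \<in> carrier R" if "e \<in> E" "f \<in> E'" for e f
  using that \<sigma>_E by (auto simp: hom_matrix_def intro: B.P.coef_closed)
 have Fdiff: "?F (%e. b e \<ominus>[M] c e) f = ?F b f \<ominus>[M] ?F c f" if "b \<in> E -> carrier M" "c \<in> E -> carrier M" "f \<in> E'" for b c f
  using that by (intro A.M.system_diff mat)
 have Fzero: "?F (%_. \<zero>[M]) f = \<zero>[M]" if "f \<in> E'" for f
  using that by (intro A.M.system_zero mat)
 have "bij_betw ?t ?A ?B \<longleftrightarrow>
  (\<forall>b\<in>E -> carrier M. \<forall>c\<in>E -> carrier M. (\<forall>f\<in>E'. ?F b f = ?F c f) --> (\<forall>e\<in>E. b e = c e)) \<and>
  (\<forall>c\<in>E' -> carrier M. \<exists>b\<in>E -> carrier M. \<forall>f\<in>E'. ?F b f = c f)"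
  unfolding A.carrier_tsum B.carrier_tsum
  by (subst bij_betw_image_iff[where F = ?F and \<alpha> = "%b. cls ?T (tsum E b)" and \<beta> = "%c. cls ?T' (tsum E' c)", OF F m])
   (simp_all add: cls_eq_iff A.tsum_cong_iff B.tsum_cong_iff F cong: ball_cong bex_cong)
 moreover have "(\<forall>b\<in>E -> carrier M. \<forall>c\<in>E -> carrier M. (\<forall>f\<in>E'. ?F b f = ?F c f) --> (\<forall>e\<in>E. b e = c e)) \<longleftrightarrow> ?I"
  (is "?I' \<longleftrightarrow> _")
 proof
  assume I': ?I'
  have z: "(%_. \<zero>[M]) \<in> E -> carrier M" by auto
  show ?I using bspec[OF I'[THEN bspec] z] by (simp add: Fzero)
 next
  assume I: ?I
  show ?I'
  proof (intro ballI impI)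
   fix b c e assume b: "b \<in> E -> carrier M" and c: "c \<in> E -> carrier M" and eq: "\<forall>f\<in>E'. ?F b f = ?F c f" and e: "e \<in> E"
   let ?d = "%e. b e \<ominus>[M] c e"
   have d: "?d \<in> E -> carrier M" using b c by auto
   have "\<forall>f\<in>E'. ?F ?d f = \<zero>[M]"
   proof
    fix f assume f: "f \<in> E'"
    then have "?F c f \<in> carrier M" using F[OF c] by (rule_tac funcset_mem)
    then show "?F ?d f = \<zero>[M]" using Fdiff[OF b c f] eq f by (simp add: a_minus_def A.M.M.r_neg)
   qed
   then have "?d e = \<zero>[M]" using I d e by blast
   moreover have "b e \<in> carrier M" "c e \<in> carrier M" using b c e by auto
   ultimately show "b e = c e" by (simp add: A.M.M.diff_eq_iff)
  qed
 qed
 ultimately show ?thesis by simp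
qed

section \<open>Base change along a dg algebra under \<open>R\<close>\<close>

context dg_algebra begin

lemma mul_closed [simp]: "x \<in> elts A i ==> y \<in> elts A j ==> mul A i j x y \<in> elts A (i + j)"
 by (rule lin_closed[OF mul_linear_right])
lemma mul_add_left: "x \<in> elts A i ==> x' \<in> elts A i ==> y \<in> elts A j ==>
  mul A i j (x \<oplus>[gr A i] x') y = mul A i j x y \<oplus>[gr A (i + j)] mul A i j x' y"
 using lin_add[OF mul_linear_left] by blast
lemma mul_add_right: "x \<in> elts A i ==> y \<in> elts A j ==> y' \<in> elts A j ==>
  mul A i j x (y \<oplus>[gr A j] y') = mul A i j x y \<oplus>[gr A (i + j)] mul A i j x y'"
 using lin_add[OF mul_linear_right] by blast
lemma mul_smult_left: "x \<in> elts A i ==> y \<in> elts A j ==>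
  mul A i j (c \<odot>[gr A i] x) y = c \<odot>[gr A (i + j)] mul A i j x y"
 using lin_smult[OF mul_linear_left] by blast
lemma mul_smult_right: "x \<in> elts A i ==> y \<in> elts A j ==>
  mul A i j x (c \<odot>[gr A j] y) = c \<odot>[gr A (i + j)] mul A i j x y"
 using lin_smult[OF mul_linear_right] by blast
lemma mul_zero_left: "y \<in> elts A j ==> mul A i j \<zero>[gr A i] y = \<zero>[gr A (i + j)]"
 using lin_zero[OF vs vs mul_linear_left] by blast
lemma mul_zero_right: "x \<in> elts A i ==> mul A i j x \<zero>[gr A j] = \<zero>[gr A (i + j)]"
 using lin_zero[OF vs vs mul_linear_right] by blast
lemma mul_diff_left: "x \<in> elts A i ==> x' \<in> elts A i ==> y \<in> elts A j ==>
  mul A i j (x \<ominus>[gr A i] x') y = mul A i j x y \<ominus>[gr A (i + j)] mul A i j x' y"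
 using lin_diff[OF vs vs mul_linear_left] by blast
lemma mul_diff_right: "x \<in> elts A i ==> y \<in> elts A j ==> y' \<in> elts A j ==>
  mul A i j x (y \<ominus>[gr A j] y') = mul A i j x y \<ominus>[gr A (i + j)] mul A i j x y'"
 using lin_diff[OF vs vs mul_linear_right] by blast

lemma add_closed: "x \<in> elts A i ==> x' \<in> elts A i ==> x \<oplus>[gr A i] x' \<in> elts A i"
 using abelian_groupE(1)[OF ag] by blast

lemma mul00: "x \<in> elts A 0 ==> y \<in> elts A j ==> mul A 0 j x y \<in> elts A j"
 "x \<in> elts A i ==> y \<in> elts A 0 ==> mul A i 0 x y \<in> elts A i"
 using mul_closed[of x 0 y j] mul_closed[of x i y 0] by simp_all

end

lemma dga_homsD:
 assumes "f \<in> dga_homs A B"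
 shows "f \<in> chain_maps A B" "f 0 (unit A) = unit B"
  "x \<in> elts A i ==> y \<in> elts A j ==> f (i + j) (mul A i j x y) = mul B i j (f i x) (f j y)"
  "f n \<in> linear_maps (gr A n) (gr B n)"
  "x \<in> elts A n ==> f n x \<in> elts B n"
 using assms by (auto simp: dga_homs_def chain_maps_def linear_maps_def)

locale dga_under = dg_algebra B + R: ring R
 for B :: "('k::field, 'u) dga" and R :: "('k, 'r) module" and \<eta> :: "int => 'r => 'u" +
 assumes eta: "\<eta> \<in> dga_homs (concentrated R) B"
begin

abbreviation (input) "lft \<equiv> left_act (B, \<eta>)"

lemma eta_closed: "r \<in> carrier R ==> \<eta> 0 r \<in> elts B 0"
 using dga_homsD(5)[OF eta, of r 0] by (simp add: concentrated_def)

lemma eta_add: "r \<in> carrier R ==> s \<in> carrier R ==> \<eta> 0 (r \<oplus>[R] s) = \<eta> 0 r \<oplus>[gr B 0] \<eta> 0 s"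
 using lin_add[OF dga_homsD(4)[OF eta, of 0], of r s] by (simp add: concentrated_def)

lemma eta_smult: "r \<in> carrier R ==> \<eta> 0 (c \<odot>[R] r) = c \<odot>[gr B 0] \<eta> 0 r"
 using lin_smult[OF dga_homsD(4)[OF eta, of 0], of r c] by (simp add: concentrated_def)

lemma eta_mult: "r \<in> carrier R ==> s \<in> carrier R ==> \<eta> 0 (r \<otimes>[R] s) = mul B 0 0 (\<eta> 0 r) (\<eta> 0 s)"
 using dga_homsD(3)[OF eta, of r 0 s 0] by (simp add: concentrated_def)

lemma eta_one: "\<eta> 0 \<one>[R] = unit B"
 using dga_homsD(2)[OF eta] by (simp add: concentrated_def)

lemma eta_cycle: "r \<in> carrier R ==> dif B 0 (\<eta> 0 r) = \<zero>[gr B (- 1)]"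
proof -
 assume r: "r \<in> carrier R"
 interpret M: abelian_group "gr B (-1)" by simp
 have "\<eta> (-1) \<zero>[R] = dif B 0 (\<eta> 0 r)"
  using chain_maps_dif[OF dga_homsD(1)[OF eta], of r 0] r by (simp add: concentrated_def)
 moreover have "\<eta> (-1) \<zero>[R] \<oplus>[gr B (-1)] \<eta> (-1) \<zero>[R] = \<eta> (-1) \<zero>[R]" "\<eta> (-1) \<zero>[R] \<in> elts B (-1)"
  using lin_add[OF dga_homsD(4)[OF eta, of "-1"], of "\<zero>[R]" "\<zero>[R]"] dga_homsD(5)[OF eta, of "\<zero>[R]" "-1"] 
  by (simp_all add: concentrated_def)
 ultimately show ?thesis using M.add.l_cancel_one by metis
qed

lemma lft: "lft n r b = mul B 0 n (\<eta> 0 r) b" by (simp add: left_act_def)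

lemma left_action_B: "left_action R (gr B n) (lft n)"
proof -
 interpret M: abelian_group "gr B n" by simp
 show ?thesis
 proof
  fix r b c assume "r \<in> carrier R" "b \<in> elts B n"
  then show "lft n r b \<in> elts B n" using mul00(1)[of "\<eta> 0 r" b n] by (simp add: lft eta_closed)
  show "lft n r (b \<oplus>[gr B n] c) = lft n r b \<oplus>[gr B n] lft n r c" if "c \<in> elts B n"
   using mul_add_right[of "\<eta> 0 r" 0 b n c] that \<open>r \<in> carrier R\<close> \<open>b \<in> elts B n\<close> by (simp add: lft eta_closed)
 next
  fix r s b assume "r \<in> carrier R" "s \<in> carrier R" "b \<in> elts B n"
  then show "lft n (r \<oplus>[R] s) b = lft n r b \<oplus>[gr B n] lft n s b"
   "lft n (r \<otimes>[R] s) b = lft n r (lft n s b)"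
   using mul_add_left[of "\<eta> 0 r" 0 "\<eta> 0 s" b n] mul_assoc[of "\<eta> 0 r" 0 "\<eta> 0 s" 0 b n] 
   by (simp_all add: lft eta_closed eta_add eta_mult)
 next
  fix b assume "b \<in> elts B n"
  then show "lft n \<one>[R] b = b" by (simp add: lft eta_one unit_left)
 qed
qed

lemma lft_closed: "r \<in> carrier R ==> b \<in> elts B n ==> lft n r b \<in> elts B n"
 by (rule left_action.l_closed[OF left_action_B])

lemma lft_smult: "r \<in> carrier R ==> b \<in> elts B n ==> c \<odot>[gr B n] lft n r b = lft n r (c \<odot>[gr B n] b)"
 using mul_smult_right[of "\<eta> 0 r" 0 b n c] by (simp add: lft eta_closed)

lemma lft_dif: assumes "r \<in> carrier R" "b \<in> elts B n" shows "dif B n (lft n r b) = lft (n - 1) r (dif B n b)"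
proof -
 interpret M: abelian_group "gr B (n - 1)" by simp
 have "mul B (- 1) n (\<zero>[gr B (- 1)]) b = \<zero>[gr B (- 1 + n)]" using assms by (intro mul_zero_left)
 then have "mul B (- 1) n (\<zero>[gr B (- 1)]) b = \<zero>[gr B (n - 1)]" by (simp add: algebra_simps)
 then show ?thesis
  using leibniz[of "\<eta> 0 r" 0 b n] assms lft_closed[of r "dif B n b" "n - 1"]
  by (simp add: lft eta_closed eta_cycle vs_one)
qed

lemma lft_mul: assumes "r \<in> carrier R" "b \<in> elts B i" "c \<in> elts B j"
 shows "mul B i j (lft i r b) c = lft (i + j) r (mul B i j b c)"
 using mul_assoc[of "\<eta> 0 r" 0 b i c j] assms by (simp add: lft eta_closed)

end

lemma id_right_module_hom: "id \<in> right_module_hom R P P" by (auto simp: right_module_hom_def)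

locale based_change = dga_under B R \<eta> + P: free_right_module R P E
 for B :: "('k::field, 'u) dga" and R :: "('k, 'r) module" and \<eta> and P :: "('r, 'p) module" and E
begin

abbreviation "tr n \<equiv> tensor_rel R P (gr B n) (lft n)"
abbreviation "cl n \<equiv> cls (tr n)"
abbreviation "el n \<equiv> {x. keys x \<subseteq> carrier P \<times> elts B n}"
abbreviation "ext \<phi> \<equiv> frag_extend (frag_of \<circ> map_prod (id :: 'p => 'p) \<phi>)"
abbreviation "PB \<equiv> base_change R (B, \<eta>) P"

lemma tensor_n: "tensor R P E (gr B n) (lft n)"
 by (intro tensor.intro P.free_right_module_axioms left_action_B)

lemma functor_n:
 assumes "\<And>b. b \<in> elts B n ==> \<phi> b \<in> elts B k"
  "\<And>b c. b \<in> elts B n ==> c \<in> elts B n ==> \<phi> (b \<oplus>[gr B n] c) = \<phi> b \<oplus>[gr B k] \<phi> c"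
  "\<And>r b. r \<in> carrier R ==> b \<in> elts B n ==> \<phi> (lft n r b) = lft k r (\<phi> b)"
 shows "tensor_functor R P E (gr B n) (lft n) P E (gr B k) (lft k) id \<phi>"
 using assms tensor_n
 by (intro tensor_functor.intro tensor_functor_axioms.intro id_right_module_hom) auto

lemma functor_smult: "tensor_functor R P E (gr B n) (lft n) P E (gr B n) (lft n) id (%b. c \<odot>[gr B n] b)"
 by (intro functor_n) (auto simp: vs_smult_closed vs_distr lft_smult)

lemma functor_dif: "tensor_functor R P E (gr B n) (lft n) P E (gr B (n - 1)) (lft (n - 1)) id (dif B n)"
 by (intro functor_n) (auto simp: d_add lft_dif)

lemma functor_mul: "c \<in> elts B j ==>
  tensor_functor R P E (gr B i) (lft i) P E (gr B (i + j)) (lft (i + j)) id (%b. mul B i j b c)"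
 by (intro functor_n) (auto simp: mul_add_left lft_mul)

lemma PB_elts: "elts PB n = cl n ` el n"
 by (simp add: base_change_def Let_def tensor_carrier_eq)

lemma PB_add: "cl n x \<oplus>[gr PB n] cl n y = cl n (x + y)"
 by (simp add: base_change_def Let_def cls_add)

lemma PB_zero: "\<zero>[gr PB n] = cl n 0"
 by (simp add: base_change_def Let_def cls_0)

lemma prod_fun: "(%(p, b). (p, \<phi> b)) = map_prod id \<phi>" by auto

lemma PB_smult: "c \<odot>[gr PB n] cl n x = cl n (ext (%b. c \<odot>[gr B n] b) x)"
 using tensor_functor.map_cls[OF functor_smult] by (simp add: base_change_def Let_def prod_fun)

lemma PB_dif: "dif PB n (cl n x) = cl (n - 1) (ext (dif B n) x)"
 using tensor_functor.map_cls[OF functor_dif] by (simp add: base_change_def Let_def prod_fun)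

lemma PB_act: "c \<in> elts B j ==> act PB i j (cl i x) c = cl (i + j) (ext (%b. mul B i j b c) x)"
 using tensor_functor.map_cls[OF functor_mul] by (simp add: base_change_def Let_def prod_fun)

lemma ext_closed:
 assumes "x \<in> el n" "\<And>b. b \<in> elts B n ==> \<phi> b \<in> elts B k" shows "ext \<phi> x \<in> el k"
proof -
 have "keys (ext \<phi> x) \<subseteq> carrier P \<times> elts B k"
 proof (rule keys_frag_extend_of)
  fix i assume "i \<in> keys x"
  then have "i \<in> carrier P \<times> elts B n" using assms(1) by blast
  then show "map_prod id \<phi> i \<in> carrier P \<times> elts B k" using assms(2) by auto
 qed
 then show ?thesis by simp
qed

lemma ext_ext: "ext \<phi> (ext \<psi> x) = ext (%b. \<phi> (\<psi> b)) x"
 unfolding frag_extend_extend by (rule frag_extend_cong) auto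

lemma ext_cong: "x \<in> el n ==> (\<And>b. b \<in> elts B n ==> \<phi> b = \<psi> b) ==> ext \<phi> x = ext \<psi> x"
 by (rule frag_extend_cong) auto

lemma ext_id: assumes "x \<in> el n" "\<And>b. b \<in> elts B n ==> \<phi> b = b" shows "ext \<phi> x = x"
proof -
 have "ext \<phi> x = frag_extend frag_of x" using assms by (intro frag_extend_cong) auto
 also have "\<dots> = x" using frag_expansion[of x] by simp
 finally show ?thesis .
qed

lemma ext_plus:
 assumes "x \<in> el n" "\<And>b. b \<in> elts B n ==> \<phi> b \<in> elts B k" "\<And>b. b \<in> elts B n ==> \<psi> b \<in> elts B k"
  "\<And>b. b \<in> elts B n ==> \<chi> b = \<phi> b \<oplus>[gr B k] \<psi> b"
 shows "cl k (ext \<chi> x) = cl k (ext \<phi> x) \<oplus>[gr PB k] cl k (ext \<psi> x)"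
proof -
 have "frag_extend (%i. (frag_of \<circ> map_prod id \<chi>) i - (frag_of \<circ> map_prod id \<phi>) i - (frag_of \<circ> map_prod id \<psi>) i) x \<in> tr k"
 proof (rule T_extend)
  fix i assume "i \<in> keys x"
  then obtain p b where i: "i = (p, b)" "p \<in> carrier P" "b \<in> elts B n" using assms(1) by auto
  have "frag_of (p, \<phi> b \<oplus>[gr B k] \<psi> b) - frag_of (p, \<phi> b) - frag_of (p, \<psi> b) \<in> tr k"
   using i assms by (intro tensor_rel.add_right) auto
  then show "(frag_of \<circ> map_prod id \<chi>) i - (frag_of \<circ> map_prod id \<phi>) i - (frag_of \<circ> map_prod id \<psi>) i \<in> tr k"
   using i assms by simp
 qed
 then have "ext \<chi> x - ext \<phi> x - ext \<psi> x \<in> tr k" unfolding frag_extend_diff_fun .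
 then show ?thesis by (simp add: PB_add cls_eq_iff algebra_simps)
qed

lemma ext_null:
 assumes "x \<in> el n" "\<And>b. b \<in> elts B n ==> \<phi> b = \<zero>[gr B k]"
 shows "cl k (ext \<phi> x) = \<zero>[gr PB k]"
proof -
 interpret T: tensor R P E "gr B k" "lft k" by (rule tensor_n)
 have "ext \<phi> x \<in> tr k"
  using assms by (intro T_extend) (auto intro!: T.zero_right)
 then show ?thesis by (simp add: PB_zero cls_eq_iff)
qed

lemma PB_module: "vspace (gr PB n)"
proof (rule vspaceI)
 show "abelian_group (gr PB n)"
 proof (rule abelian_groupI)
  fix Y assume "Y \<in> elts PB n"
  then obtain x where x: "x \<in> el n" "Y = cl n x" by (auto simp: PB_elts)
  then have "cl n (- x) \<in> elts PB n" by (auto simp: PB_elts in_keys_iff subset_iff intro!: imageI)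
  then show "\<exists>Z\<in>elts PB n. Z \<oplus>[gr PB n] Y = \<zero>[gr PB n]"
   by (rule rev_bexI) (simp add: x PB_add PB_zero)
  show "\<zero>[gr PB n] \<oplus>[gr PB n] Y = Y" by (simp add: x PB_add PB_zero)
 next
  show "\<zero>[gr PB n] \<in> elts PB n" unfolding PB_zero PB_elts by (rule imageI) simp
 next
  fix Y Z assume "Y \<in> elts PB n" "Z \<in> elts PB n"
  then obtain x y where x: "x \<in> el n" "Y = cl n x" "y \<in> el n" "Z = cl n y" by (auto simp: PB_elts)
  have "x + y \<in> el n" using x Poly_Mapping.keys_add[of x y] by blast
  then show "Y \<oplus>[gr PB n] Z \<in> elts PB n" by (simp add: x PB_add PB_elts)
  show "Y \<oplus>[gr PB n] Z = Z \<oplus>[gr PB n] Y" by (simp add: x PB_add add.commute)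
 next
  fix Y Z W assume "Y \<in> elts PB n" "Z \<in> elts PB n" "W \<in> elts PB n"
  then show "Y \<oplus>[gr PB n] Z \<oplus>[gr PB n] W = Y \<oplus>[gr PB n] (Z \<oplus>[gr PB n] W)"
   by (auto simp: PB_elts PB_add add.assoc)
 qed
next
 fix Y assume "Y \<in> elts PB n"
 then obtain x where x: "x \<in> el n" "Y = cl n x" by (auto simp: PB_elts)
 show "c \<odot>[gr PB n] Y \<in> elts PB n" for c
  unfolding x(2) PB_smult PB_elts by (intro imageI ext_closed[OF x(1)]) (simp add: vs_smult_closed)
 show "(c + d) \<odot>[gr PB n] Y = c \<odot>[gr PB n] Y \<oplus>[gr PB n] d \<odot>[gr PB n] Y" for c d
  unfolding x(2) PB_smult by (rule ext_plus[OF x(1)]) (simp_all add: vs_smult_closed vs_distl)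
 show "(c * d) \<odot>[gr PB n] Y = c \<odot>[gr PB n] (d \<odot>[gr PB n] Y)" for c d
  unfolding x(2) PB_smult ext_ext by (rule arg_cong[where f = "cl n"], rule ext_cong[OF x(1)]) (simp add: vs_assoc)
next
 fix c Y Z assume "Y \<in> elts PB n" "Z \<in> elts PB n"
 then show "c \<odot>[gr PB n] (Y \<oplus>[gr PB n] Z) = c \<odot>[gr PB n] Y \<oplus>[gr PB n] c \<odot>[gr PB n] Z"
  by (auto simp: PB_elts PB_add PB_smult frag_extend_add)
next
 fix Y assume "Y \<in> elts PB n"
 then obtain x where x: "x \<in> el n" "Y = cl n x" by (auto simp: PB_elts)
 show "1 \<odot>[gr PB n] Y = Y"
  unfolding x(2) PB_smult by (subst ext_id[OF x(1)]) (simp_all add: vs_one)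
qed

lemma PB_cplx: "chain_complex PB"
proof (rule chain_complex.intro)
 show "vspace (gr PB n)" for n by (rule PB_module)
 show "dif PB n \<in> linear_maps (gr PB n) (gr PB (n - 1))" for n
 proof (rule linear_mapsI)
  fix Y assume "Y \<in> elts PB n"
  then obtain x where x: "x \<in> el n" "Y = cl n x" by (auto simp: PB_elts)
  show "dif PB n Y \<in> elts PB (n - 1)"
   unfolding x(2) PB_dif PB_elts by (intro imageI ext_closed[OF x(1)]) simp
  fix c show "dif PB n (c \<odot>[gr PB n] Y) = c \<odot>[gr PB (n - 1)] dif PB n Y"
   unfolding x(2) PB_smult PB_dif ext_ext
   by (rule arg_cong[where f = "cl (n - 1)"], rule ext_cong[OF x(1)]) (simp add: d_smult)
 next
  fix Y Z assume "Y \<in> elts PB n" "Z \<in> elts PB n"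
  then show "dif PB n (Y \<oplus>[gr PB n] Z) = dif PB n Y \<oplus>[gr PB (n - 1)] dif PB n Z"
   by (auto simp: PB_elts PB_add PB_dif frag_extend_add)
 qed
 fix Y n assume "Y \<in> elts PB n"
 then obtain x where x: "x \<in> el n" "Y = cl n x" by (auto simp: PB_elts)
 show "dif PB (n - 1) (dif PB n Y) = \<zero>[gr PB (n - 2)]"
  unfolding x(2) PB_dif ext_ext using ext_null[OF x(1), of "%b. dif B (n - 1) (dif B n b)" "n - 2"] by (simp add: dif_dif)
qed

lemma PB_dgm: "dg_right_module B PB"
proof (intro dg_right_module.intro dg_right_module_axioms.intro PB_cplx)
 fix b i j assume b: "b \<in> elts B j"
 show "(%Y. act PB i j Y b) \<in> linear_maps (gr PB i) (gr PB (i + j))"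
 proof (rule linear_mapsI)
  fix Y assume "Y \<in> elts PB i"
  then obtain x where x: "x \<in> el i" "Y = cl i x" by (auto simp: PB_elts)
  show "act PB i j Y b \<in> elts PB (i + j)"
   unfolding x(2) PB_act[OF b] PB_elts by (intro imageI ext_closed[OF x(1)]) (simp add: b)
  fix c show "act PB i j (c \<odot>[gr PB i] Y) b = c \<odot>[gr PB (i + j)] act PB i j Y b"
   unfolding x(2) PB_smult PB_act[OF b] ext_ext
   by (rule arg_cong[where f = "cl (i + j)"], rule ext_cong[OF x(1)]) (simp add: mul_smult_left b)
 next
  fix Y Z assume "Y \<in> elts PB i" "Z \<in> elts PB i"
  then show "act PB i j (Y \<oplus>[gr PB i] Z) b = act PB i j Y b \<oplus>[gr PB (i + j)] act PB i j Z b"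
   by (auto simp: PB_elts PB_add PB_act b frag_extend_add)
 qed
next
 fix Y i j assume "Y \<in> elts PB i"
 then obtain x where x: "x \<in> el i" "Y = cl i x" by (auto simp: PB_elts)
 show "act PB i j Y \<in> linear_maps (gr B j) (gr PB (i + j))"
 proof (rule linear_mapsI)
  fix b assume b: "b \<in> elts B j"
  show "act PB i j Y b \<in> elts PB (i + j)"
   unfolding x(2) PB_act[OF b] PB_elts by (intro imageI ext_closed[OF x(1)]) (simp add: b)
  fix c
  have cb: "c \<odot>[gr B j] b \<in> elts B j" using b by (simp add: vs_smult_closed)
  show "act PB i j Y (c \<odot>[gr B j] b) = c \<odot>[gr PB (i + j)] act PB i j Y b"
   unfolding x(2) PB_smult PB_act[OF b] PB_act[OF cb] ext_ext
   by (rule arg_cong[where f = "cl (i + j)"], rule ext_cong[OF x(1)]) (simp add: mul_smult_right b)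
 next
  fix b c assume b: "b \<in> elts B j" and c: "c \<in> elts B j"
  show "act PB i j Y (b \<oplus>[gr B j] c) = act PB i j Y b \<oplus>[gr PB (i + j)] act PB i j Y c"
   unfolding x(2) PB_act[OF b] PB_act[OF c] PB_act[OF add_closed[OF b c]]
   by (rule ext_plus[OF x(1)]) (simp_all add: b c mul_add_right)
 qed
next
 fix Y i b j c l assume "Y \<in> elts PB i" and b: "b \<in> elts B j" and c: "c \<in> elts B l"
 then obtain x where x: "x \<in> el i" "Y = cl i x" by (auto simp: PB_elts)
 show "act PB (i + j) l (act PB i j Y b) c = act PB i (j + l) Y (mul B j l b c)"
  unfolding x(2) PB_act[OF b] PB_act[OF c] PB_act[OF mul_closed[OF b c]] ext_ext add.assoc
  by (rule arg_cong[where f = "cl (i + (j + l))"], rule ext_cong[OF x(1)]) (simp add: mul_assoc b c)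
next
 fix Y i assume "Y \<in> elts PB i"
 then obtain x where x: "x \<in> el i" "Y = cl i x" by (auto simp: PB_elts)
 show "act PB i 0 Y (unit B) = Y"
  using ext_id[OF x(1), of "%b. mul B i 0 b (unit B)"] by (simp add: x(2) PB_act unit_closed unit_right)
next
 fix Y i b j assume "Y \<in> elts PB i" and b: "b \<in> elts B j"
 then obtain x where x: "x \<in> el i" "Y = cl i x" by (auto simp: PB_elts)
 have i1: "i - 1 + j = i + j - 1" "i + (j - 1) = i + j - 1" by auto
 have e: "act PB (i - 1) j (cl (i - 1) y) b = cl (i + j - 1) (ext (%a. mul B (i - 1) j a b) y)" for y
  using PB_act[OF b, of "i - 1" y] by (simp add: i1)
 have e': "act PB i (j - 1) (cl i y) (dif B j b) = cl (i + j - 1) (ext (%a. mul B i (j - 1) a (dif B j b)) y)" for y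
  using PB_act[OF d_closed[OF b], of i y] by (simp add: i1)
 have c1: "mul B (i - 1) j (dif B i a) b \<in> elts B (i + j - 1)" "mul B i (j - 1) a (dif B j b) \<in> elts B (i + j - 1)"
  if "a \<in> elts B i" for a
  using mul_closed[OF d_closed[OF that] b] mul_closed[OF that d_closed[OF b]] by (simp_all add: i1)
 show "dif PB (i + j) (act PB i j Y b) = act PB (i - 1) j (dif PB i Y) b
   \<oplus>[gr PB (i + j - 1)] ((- 1) powi i) \<odot>[gr PB (i + j - 1)] act PB i (j - 1) Y (dif B j b)"
  unfolding x(2) PB_dif unfolding e e' unfolding PB_act[OF b] unfolding PB_dif PB_smult ext_ext
  by (rule ext_plus[OF x(1)]) (simp_all add: c1 vs_smult_closed leibniz b)
qed

end

section \<open>Homotopy invertibility in coordinates\<close>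

text \<open>The linear system with matrix \<open>a\<close> is uniquely solvable in the homology of a complex
 with a left action.\<close>

definition homology_solvable ::
  "('k, 'v, 'm) cplx_scheme => (int => 'r => 'v => 'v) => 'e set => 'f set => ('f => 'e => 'r) => int => bool" where
 "homology_solvable N l E E' a n \<longleftrightarrow>
  (\<forall>b\<in>E -> cycles N n. (\<forall>f\<in>E'. linear_system (gr N n) (l n) E a b f \<in> boundaries N n) -->
   (\<forall>e\<in>E. b e \<in> boundaries N n)) \<and>
  (\<forall>c\<in>E' -> cycles N n. \<exists>b\<in>E -> cycles N n.
   \<forall>f\<in>E'. linear_system (gr N n) (l n) E a b f \<ominus>[gr N n] c f \<in> boundaries N n)"

context based_change begin

lemma PB_tsum_elts: "elts PB n = (%b. cl n (tsum E b)) ` (E -> elts B n)"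
 using tensor.carrier_tsum[OF tensor_n] by (simp add: base_change_def Let_def)

lemma PB_dif_tsum: "dif PB n (cl n (tsum E b)) = cl (n - 1) (tsum E (%e. dif B n (b e)))"
 unfolding PB_dif by (simp add: tsum_def frag_extend_sum)

lemma cl_tsum_eq_iff:
 "b \<in> E -> elts B n ==> c \<in> E -> elts B n ==> cl n (tsum E b) = cl n (tsum E c) \<longleftrightarrow> (\<forall>e\<in>E. b e = c e)"
 unfolding cls_eq_iff by (rule tensor.tsum_cong_iff[OF tensor_n])

lemma zero_tsum: "\<zero>[gr PB n] = cl n (tsum E (%_. \<zero>[gr B n]))"
proof -
 interpret T: tensor R P E "gr B n" "lft n" by (rule tensor_n)
 have "tsum E (%_. \<zero>[gr B n]) \<in> tr n" by (subst T.tsum_rel_iff) auto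
 then have "cl n 0 = cl n (tsum E (%_. \<zero>[gr B n]))" using T_minus by (force simp: cls_eq_iff)
 then show ?thesis by (simp add: PB_zero)
qed

lemma PB_cycle_iff:
 assumes b: "b \<in> E -> elts B n"
 shows "cl n (tsum E b) \<in> cycles PB n \<longleftrightarrow> (\<forall>e\<in>E. b e \<in> cycles B n)"
proof -
 interpret M: abelian_group "gr B (n - 1)" by simp
 have d: "(%e. dif B n (b e)) \<in> E -> elts B (n - 1)" using b by (simp add: Pi_iff)
 have "cl n (tsum E b) \<in> elts PB n" using b unfolding PB_tsum_elts by (rule_tac imageI)
 moreover have "cl (n - 1) (tsum E (%e. dif B n (b e))) = \<zero>[gr PB (n - 1)] \<longleftrightarrow> (\<forall>e\<in>E. dif B n (b e) = \<zero>[gr B (n - 1)])"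
  unfolding zero_tsum by (rule cl_tsum_eq_iff[OF d]) simp
 ultimately show ?thesis using b by (auto simp: cycles_def PB_dif_tsum Pi_iff)
qed

lemma PB_boundary_iff:
 assumes b: "b \<in> E -> elts B n"
 shows "cl n (tsum E b) \<in> boundaries PB n \<longleftrightarrow> (\<forall>e\<in>E. b e \<in> boundaries B n)"
proof
 assume "cl n (tsum E b) \<in> boundaries PB n"
 then obtain c where c: "c \<in> E -> elts B (n + 1)" "cl n (tsum E b) = dif PB (n + 1) (cl (n + 1) (tsum E c))"
  unfolding boundaries_def PB_tsum_elts by auto
 have d: "(%e. dif B (n + 1) (c e)) \<in> E -> elts B n" using c(1) by (simp add: Pi_iff)
 have "cl n (tsum E b) = cl n (tsum E (%e. dif B (n + 1) (c e)))"
  using c(2) PB_dif_tsum[of "n + 1" c] by simp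
 then have "\<forall>e\<in>E. b e = dif B (n + 1) (c e)" by (simp add: cl_tsum_eq_iff[OF b d])
 then show "\<forall>e\<in>E. b e \<in> boundaries B n" using c(1) by (auto simp: boundaries_def)
next
 assume *: "\<forall>e\<in>E. b e \<in> boundaries B n"
 have "\<forall>e\<in>E. \<exists>u. u \<in> elts B (n + 1) \<and> b e = dif B (n + 1) u"
 proof
  fix e assume "e \<in> E"
  then have "b e \<in> boundaries B n" using * by blast
  then show "\<exists>u. u \<in> elts B (n + 1) \<and> b e = dif B (n + 1) u" unfolding boundaries_def by (elim imageE) auto
 qed
 then obtain u where u: "\<And>e. e \<in> E ==> u e \<in> elts B (n + 1) \<and> b e = dif B (n + 1) (u e)" by metis
 then have "cl (n + 1) (tsum E u) \<in> elts PB (n + 1)" unfolding PB_tsum_elts by (intro imageI) auto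
 moreover have "dif PB (n + 1) (cl (n + 1) (tsum E u)) = cl n (tsum E b)"
 proof -
  have "tsum E b = tsum E (%e. dif B (n + 1) (u e))" unfolding tsum_def using u by (intro sum.cong) auto
  then show ?thesis using PB_dif_tsum[of "n + 1" u] by simp
 qed
 ultimately show "cl n (tsum E b) \<in> boundaries PB n" unfolding boundaries_def by (metis imageI)
qed

lemma PB_minus:
 assumes b: "b \<in> E -> elts B n" and c: "c \<in> E -> elts B n"
 shows "cl n (tsum E b) \<ominus>[gr PB n] cl n (tsum E c) = cl n (tsum E (%e. b e \<ominus>[gr B n] c e))"
proof -
 interpret PB: abelian_group "gr PB n" by (rule vs_group[OF PB_module])
 interpret M: abelian_group "gr B n" by simp
 have d: "(%e. b e \<ominus>[gr B n] c e) \<in> E -> elts B n" using b c by auto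
 have cl: "cl n (tsum E u) \<in> elts PB n" if "u \<in> E -> elts B n" for u using that unfolding PB_tsum_elts by (rule imageI)
 have "cl n (tsum E b) = cl n (tsum E c) \<oplus>[gr PB n] cl n (tsum E (%e. b e \<ominus>[gr B n] c e))"
  unfolding PB_add cls_eq_iff using T_minus[OF tensor.tsum_diff[OF tensor_n b c]] by (simp add: algebra_simps)
 then show ?thesis using PB.diff_eq_iff[OF cl[OF b] cl[OF c] cl[OF d]] by simp
qed

end

locale based_arrow = dom: based_change B R \<eta> P E + cod: based_change B R \<eta> Q E'
 for B :: "('k::field, 'u) dga" and R :: "('k, 'r) module" and \<eta> and P :: "('r, 'p) module" and E
  and Q :: "('r, 'p) module" and E' +
 fixes \<sigma> :: "'p => 'p"
 assumes \<sigma>: "\<sigma> \<in> right_module_hom R P Q"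
begin

abbreviation "mat \<equiv> hom_matrix R Q E' \<sigma>"
abbreviation "sys n \<equiv> linear_system (gr B n) (dom.lft n) E mat"
abbreviation "\<sigma>B \<equiv> base_change_map R (B, \<eta>) (P, Q, \<sigma>)"

lemma functor_\<sigma>: "tensor_functor R P E (gr B n) (dom.lft n) Q E' (gr B n) (dom.lft n) \<sigma> id"
 using dom.tensor_n cod.tensor_n \<sigma> by (intro tensor_functor.intro tensor_functor_axioms.intro) auto

lemma mat_closed: "f \<in> E' ==> e \<in> E ==> mat f e \<in> carrier R"
 using \<sigma> dom.P.E_sub by (auto simp: hom_matrix_def right_module_hom_def intro!: cod.P.coef_closed)

lemma sys_closed: "b \<in> E -> elts B n ==> f \<in> E' ==> sys n b f \<in> elts B n"
 by (intro left_action.system_closed[OF dom.left_action_B] mat_closed)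

lemma \<sigma>B_tsum: "b \<in> E -> elts B n ==> \<sigma>B n (dom.cl n (tsum E b)) = cod.cl n (tsum E' (sys n b))"
 using tensor_functor.map_tsum[OF functor_\<sigma>, of b n] dom.PB_tsum_elts[of n]
 by (simp add: base_change_map_def)

lemma \<sigma>B_cl: "x \<in> dom.el n ==> \<sigma>B n (dom.cl n x) = cod.cl n (frag_extend (frag_of \<circ> map_prod \<sigma> id) x)"
 using tensor_functor.map_cls[OF functor_\<sigma>, of n x] dom.PB_elts[of n]
 by (simp add: base_change_map_def)

lemma ext_\<sigma>_commute: "frag_extend (frag_of \<circ> map_prod \<sigma> id) (dom.ext \<phi> x) = cod.ext \<phi> (frag_extend (frag_of \<circ> map_prod \<sigma> id) x)"
 unfolding frag_extend_extend by (rule frag_extend_cong) auto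

lemma \<sigma>B_hom: "\<sigma>B \<in> dgm_homs B dom.PB cod.PB"
proof -
 have el: "frag_extend (frag_of \<circ> map_prod \<sigma> id) x \<in> cod.el n" if "x \<in> dom.el n" for x n
  using tensor_functor.keys_ext[OF functor_\<sigma>] that by simp
 interpret PB: chain_complex dom.PB by (rule dom.PB_cplx)
 have "\<sigma>B n \<in> linear_maps (gr dom.PB n) (gr cod.PB n)" for n
 proof (rule linear_mapsI)
  fix Y assume "Y \<in> elts dom.PB n"
  then obtain x where x: "x \<in> dom.el n" "Y = dom.cl n x" by (auto simp: dom.PB_elts)
  show "\<sigma>B n Y \<in> elts cod.PB n" unfolding x(2) \<sigma>B_cl[OF x(1)] cod.PB_elts using el[OF x(1)] by (rule imageI)
  fix c
  have e: "dom.ext (%b. c \<odot>[gr B n] b) x \<in> dom.el n" by (rule dom.ext_closed[OF x(1)]) (simp add: vs_smult_closed)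
  show "\<sigma>B n (c \<odot>[gr dom.PB n] Y) = c \<odot>[gr cod.PB n] \<sigma>B n Y"
   unfolding x(2) dom.PB_smult \<sigma>B_cl[OF x(1)] \<sigma>B_cl[OF e] cod.PB_smult ext_\<sigma>_commute ..
 next
  fix Y Z assume "Y \<in> elts dom.PB n" "Z \<in> elts dom.PB n"
  then obtain x y where x: "x \<in> dom.el n" "Y = dom.cl n x" and y: "y \<in> dom.el n" "Z = dom.cl n y"
   by (auto simp: dom.PB_elts)
  have xy: "x + y \<in> dom.el n" using x y Poly_Mapping.keys_add[of x y] by blast
  show "\<sigma>B n (Y \<oplus>[gr dom.PB n] Z) = \<sigma>B n Y \<oplus>[gr cod.PB n] \<sigma>B n Z"
   unfolding x(2) y(2) dom.PB_add \<sigma>B_cl[OF x(1)] \<sigma>B_cl[OF y(1)] \<sigma>B_cl[OF xy] cod.PB_add frag_extend_add ..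
 qed
 moreover have "\<sigma>B n \<in> extensional (elts dom.PB n)" for n by (simp add: base_change_map_def)
 moreover have "\<sigma>B (n - 1) (dif dom.PB n Y) = dif cod.PB n (\<sigma>B n Y)" if Y: "Y \<in> elts dom.PB n" for n Y
 proof -
  from Y obtain x where x: "x \<in> dom.el n" "Y = dom.cl n x" by (auto simp: dom.PB_elts)
  have e: "dom.ext (dif B n) x \<in> dom.el (n - 1)" by (rule dom.ext_closed[OF x(1)]) simp
  show ?thesis unfolding x(2) dom.PB_dif \<sigma>B_cl[OF x(1)] \<sigma>B_cl[OF e] cod.PB_dif ext_\<sigma>_commute ..
 qed
 moreover have "\<sigma>B (i + j) (act dom.PB i j Y b) = act cod.PB i j (\<sigma>B i Y) b"
  if Y: "Y \<in> elts dom.PB i" and b: "b \<in> elts B j" for i j Y b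
 proof -
  from Y obtain x where x: "x \<in> dom.el i" "Y = dom.cl i x" by (auto simp: dom.PB_elts)
  have e: "dom.ext (%a. mul B i j a b) x \<in> dom.el (i + j)" by (rule dom.ext_closed[OF x(1)]) (simp add: b)
  show ?thesis unfolding x(2) dom.PB_act[OF b] \<sigma>B_cl[OF x(1)] \<sigma>B_cl[OF e] cod.PB_act[OF b] ext_\<sigma>_commute ..
 qed
 ultimately show ?thesis by (simp add: dgm_homs_def chain_maps_def)
qed

lemma homology_bij_solvable:
 "bij_betw (homology_map cod.PB \<sigma>B n) (homology dom.PB n) (homology cod.PB n) \<longleftrightarrow>
  homology_solvable B dom.lft E E' mat n" (is "?L \<longleftrightarrow> _")
proof -
 have cm: "\<sigma>B \<in> chain_maps dom.PB cod.PB" using \<sigma>B_hom by (simp add: dgm_homs_def)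
 have el: "b \<in> E -> elts B n" if "b \<in> E -> cycles B n" for b n using that by (auto simp: cycles_def)
 have el': "b \<in> E' -> elts B n" if "b \<in> E' -> cycles B n" for b n using that by (auto simp: cycles_def)
 have sys: "sys n b \<in> E' -> elts B n" if "b \<in> E -> cycles B n" for b using sys_closed[OF el[OF that]] by auto
 have c1: "cycles dom.PB n = (%b. dom.cl n (tsum E b)) ` (E -> cycles B n)"
 proof (intro Set.set_eqI iffI)
  fix Y assume Y: "Y \<in> cycles dom.PB n"
  then have "Y \<in> elts dom.PB n" by (simp add: cycles_def)
  then obtain b where b: "b \<in> E -> elts B n" "Y = dom.cl n (tsum E b)" unfolding dom.PB_tsum_elts by (rule imageE)
  then have "b \<in> E -> cycles B n" using Y by (simp add: dom.PB_cycle_iff Pi_iff)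
  then show "Y \<in> (%b. dom.cl n (tsum E b)) ` (E -> cycles B n)" unfolding b(2) by (rule imageI)
 next
  fix Y assume "Y \<in> (%b. dom.cl n (tsum E b)) ` (E -> cycles B n)"
  then obtain b where b: "b \<in> E -> cycles B n" "Y = dom.cl n (tsum E b)" by (rule imageE)
  then show "Y \<in> cycles dom.PB n" using dom.PB_cycle_iff[OF el[OF b(1)]] by auto
 qed
 have c2: "cycles cod.PB n = (%b. cod.cl n (tsum E' b)) ` (E' -> cycles B n)"
 proof (intro Set.set_eqI iffI)
  fix Y assume Y: "Y \<in> cycles cod.PB n"
  then have "Y \<in> elts cod.PB n" by (simp add: cycles_def)
  then obtain b where b: "b \<in> E' -> elts B n" "Y = cod.cl n (tsum E' b)" unfolding cod.PB_tsum_elts by (rule imageE)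
  then have "b \<in> E' -> cycles B n" using Y by (simp add: cod.PB_cycle_iff Pi_iff)
  then show "Y \<in> (%b. cod.cl n (tsum E' b)) ` (E' -> cycles B n)" unfolding b(2) by (rule imageI)
 next
  fix Y assume "Y \<in> (%b. cod.cl n (tsum E' b)) ` (E' -> cycles B n)"
  then obtain b where b: "b \<in> E' -> cycles B n" "Y = cod.cl n (tsum E' b)" by (rule imageE)
  then show "Y \<in> cycles cod.PB n" using cod.PB_cycle_iff[OF el'[OF b(1)]] by auto
 qed
 have 1: "(\<forall>x\<in>cycles dom.PB n. \<sigma>B n x \<in> boundaries cod.PB n --> x \<in> boundaries dom.PB n) \<longleftrightarrow>
  (\<forall>b\<in>E -> cycles B n. (\<forall>f\<in>E'. sys n b f \<in> boundaries B n) --> (\<forall>e\<in>E. b e \<in> boundaries B n))"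
  unfolding c1 by (simp add: \<sigma>B_tsum el dom.PB_boundary_iff cod.PB_boundary_iff sys cong: ball_cong)
 have 2: "(\<forall>y\<in>cycles cod.PB n. \<exists>x\<in>cycles dom.PB n. \<sigma>B n x \<ominus>[gr cod.PB n] y \<in> boundaries cod.PB n) \<longleftrightarrow>
  (\<forall>c\<in>E' -> cycles B n. \<exists>b\<in>E -> cycles B n. \<forall>f\<in>E'. sys n b f \<ominus>[gr B n] c f \<in> boundaries B n)"
 proof -
  interpret M: abelian_group "gr B n" by simp
  have "\<sigma>B n (dom.cl n (tsum E b)) \<ominus>[gr cod.PB n] cod.cl n (tsum E' c) \<in> boundaries cod.PB n \<longleftrightarrow>
   (\<forall>f\<in>E'. sys n b f \<ominus>[gr B n] c f \<in> boundaries B n)"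
   if "b \<in> E -> cycles B n" "c \<in> E' -> cycles B n" for b c
  proof -
   have "(%f. sys n b f \<ominus>[gr B n] c f) \<in> E' -> elts B n" using sys[OF that(1)] el'[OF that(2)] by auto
   then show ?thesis
    by (simp add: \<sigma>B_tsum el[OF that(1)] cod.PB_minus[OF sys[OF that(1)] el'[OF that(2)]] cod.PB_boundary_iff)
  qed
  then show ?thesis unfolding c1 c2 by (simp cong: ball_cong bex_cong)
 qed
 show ?thesis
  unfolding homology_bij_iff[OF dom.PB_cplx cod.PB_cplx cm] 1 2 homology_solvable_def ..
qed

end

subsection \<open>The derived category of a dg algebra\<close>

lemma dgm_homs_chain: "f \<in> dgm_homs B M N ==> f \<in> chain_maps M N"
 by (simp add: dgm_homs_def)

lemma dg_right_module_cplx: "dg_right_module B M ==> chain_complex M"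
 by (simp add: dg_right_module_def)

lemma dgm_id:
 assumes "dg_right_module B M" shows "(%n. restrict id (elts M n)) \<in> dgm_homs B M M"
proof -
 interpret dg_right_module B M by fact
 show ?thesis using chain_maps_id[OF chain_complex_axioms] lin_closed[OF act_linear_left]
  by (auto simp: dgm_homs_def)
qed

lemma dgm_comp:
 assumes "dg_right_module B L" "f \<in> dgm_homs B L M" "g \<in> dgm_homs B M N"
 shows "(%n. compose (elts L n) (g n) (f n)) \<in> dgm_homs B L N"
proof -
 interpret dg_right_module B L by fact
 have "f i x \<in> elts M i" if "x \<in> elts L i" for i x using chain_maps_closed[OF dgm_homs_chain[OF assms(2)]] that .
 then show ?thesis using chain_maps_comp[OF chain_complex_axioms dgm_homs_chain[OF assms(2)] dgm_homs_chain[OF assms(3)]]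
  lin_closed[OF act_linear_left] assms(2,3)
  by (auto simp: dgm_homs_def compose_def)
qed

lemma dgm_cat_functor:
 "wcat_functor (dgm_cat B :: (('k::field, 'u, 'v) dgm, int => 'v => 'v) wcat) (%M. homology M n) (%M N f. homology_map N f n)"
proof
 fix M N f x assume "M \<in> Ob (dgm_cat B)" "N \<in> Ob (dgm_cat B)" "f \<in> Hom (dgm_cat B) M N" "x \<in> homology M n"
 then show "homology_map N f n x \<in> homology N n"
  by (auto simp: dgm_cat_def intro!: homology_map_closed[of M] dg_right_module_cplx dgm_homs_chain)
next
 fix M :: "('k, 'u, 'v) dgm" and x assume "M \<in> Ob (dgm_cat B)" "x \<in> homology M n"
 then show "homology_map M (Idn (dgm_cat B) M) n x = x"
  by (auto simp: dgm_cat_def intro!: homology_map_id dg_right_module_cplx)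
next
 fix L M N :: "('k, 'u, 'v) dgm" and f g x
 assume "L \<in> Ob (dgm_cat B)" "M \<in> Ob (dgm_cat B)" "N \<in> Ob (dgm_cat B)" "f \<in> Hom (dgm_cat B) L M" "g \<in> Hom (dgm_cat B) M N"
  and x: "x \<in> homology L n"
 then have ob: "dg_right_module B L" "dg_right_module B M" "dg_right_module B N" and h: "f \<in> dgm_homs B L M" "g \<in> dgm_homs B M N"
  by (simp_all add: dgm_cat_def)
 show "homology_map N (Cmp (dgm_cat B) L g f) n x = homology_map N g n (homology_map M f n x)"
  using homology_map_comp[OF dg_right_module_cplx[OF ob(1)] dg_right_module_cplx[OF ob(2)] dg_right_module_cplx[OF ob(3)]
   dgm_homs_chain[OF h(1)] dgm_homs_chain[OF h(2)] x dgm_homs_chain[OF dgm_comp[OF ob(1) h]]] by (simp add: dgm_cat_def)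
next
 fix M :: "('k, 'u, 'v) dgm" assume "M \<in> Ob (dgm_cat B)"
 then show "Idn (dgm_cat B) M \<in> Hom (dgm_cat B) M M" by (auto simp: dgm_cat_def intro!: dgm_id)
next
 fix L M N :: "('k, 'u, 'v) dgm" and f g
 assume "L \<in> Ob (dgm_cat B)" "M \<in> Ob (dgm_cat B)" "N \<in> Ob (dgm_cat B)" "f \<in> Hom (dgm_cat B) L M" "g \<in> Hom (dgm_cat B) M N"
 then show "Cmp (dgm_cat B) L g f \<in> Hom (dgm_cat B) L N" by (auto simp: dgm_cat_def intro!: dgm_comp)
qed (auto simp: dgm_cat_def quasi_iso_def)

lemma weq_loc_iso:
 assumes "a \<in> Ob C" "b \<in> Ob C" "w \<in> Weq C a b" shows "loc_iso C a b w"
 unfolding loc_iso_def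
 by (rule exI[of _ "[Bwd w a]"]) (use assms in \<open>auto intro: zigzag_eq.inv_right zigzag_eq.inv_left\<close>)

lemma (in based_arrow) loc_iso_iff_solvable:
 "loc_iso (dgm_cat B) dom.PB cod.PB \<sigma>B \<longleftrightarrow> (\<forall>n. homology_solvable B dom.lft E E' mat n)"
proof
 assume l: "loc_iso (dgm_cat B) dom.PB cod.PB \<sigma>B"
 show "\<forall>n. homology_solvable B dom.lft E E' mat n"
 proof
  fix n
  interpret F: wcat_functor "dgm_cat B" "%M. homology M n" "%M N f. homology_map N f n" by (rule dgm_cat_functor)
  have "\<sigma>B \<in> Hom (dgm_cat B) dom.PB cod.PB" using \<sigma>B_hom by (simp add: dgm_cat_def)
  from F.loc_iso_bij[OF l this] show "homology_solvable B dom.lft E E' mat n" by (simp add: homology_bij_solvable)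
 qed
next
 assume "\<forall>n. homology_solvable B dom.lft E E' mat n"
 then have "\<sigma>B \<in> Weq (dgm_cat B) dom.PB cod.PB"
  using \<sigma>B_hom by (simp add: dgm_cat_def quasi_iso_def homology_bij_solvable)
 then show "loc_iso (dgm_cat B) dom.PB cod.PB \<sigma>B"
  by (rule weq_loc_iso[rotated 2]) (simp_all add: dgm_cat_def dom.PB_dgm cod.PB_dgm)
qed

lemma arrow_matrix_closed:
 assumes "\<Sigma> \<subseteq> fg_free_arrows R" "(P, Q, \<sigma>) \<in> \<Sigma>" and E: "free_right_module R P E" "free_right_module R Q E'" and e: "e \<in> E" "f \<in> E'"
 shows "hom_matrix R Q E' \<sigma> f e \<in> carrier R"
proof -
 interpret P: free_right_module R P E by (rule E(1))
 interpret Q: free_right_module R Q E' by (rule E(2))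
 have "\<sigma> \<in> right_module_hom R P Q" using assms by (auto simp: fg_free_arrows_def)
 then show ?thesis using e P.E_sub by (auto simp: hom_matrix_def right_module_hom_def intro!: Q.coef_closed)
qed

definition homology_inverts ::
  "('k::field, 'r) module => ('r, 'p) arrow set => ('k, 'v, 'm) cplx_scheme => (int => 'r => 'v => 'v) => int => bool" where
 "homology_inverts R \<Sigma> N l n \<longleftrightarrow> (\<forall>(P, Q, \<sigma>)\<in>\<Sigma>. \<forall>E E'.
  free_right_module R P E --> free_right_module R Q E' -->
  homology_solvable N l E E' (hom_matrix R Q E' \<sigma>) n)"

text \<open>Homology is defined on the derived category, so an isomorphism there is bijective on homology, which in
 coordinates is solvability; conversely quasi-isomorphisms are isomorphisms in the derived category.\<close>

lemma derived_inverts_iff: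
 assumes "dga_under B R \<eta>" and \<Sigma>: "\<Sigma> \<subseteq> fg_free_arrows R"
 shows "derived_inverts R \<Sigma> (B, \<eta>) \<longleftrightarrow> (\<forall>n. homology_inverts R \<Sigma> B (left_act (B, \<eta>)) n)"
proof -
 interpret dga_under B R \<eta> by fact
 have arrow: "based_arrow B R \<eta> P E Q E' \<sigma>"
  if "(P, Q, \<sigma>) \<in> \<Sigma>" "free_right_module R P E" "free_right_module R Q E'" for P Q \<sigma> E E'
  using that \<Sigma> assms(1) by (auto simp: based_arrow_def based_arrow_axioms_def based_change_def fg_free_arrows_def)
 show ?thesis
 proof
  assume d: "derived_inverts R \<Sigma> (B, \<eta>)"
  show "\<forall>n. homology_inverts R \<Sigma> B (left_act (B, \<eta>)) n"
   unfolding homology_inverts_def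
  proof clarify
   fix n P Q \<sigma> E E' assume *: "(P, Q, \<sigma>) \<in> \<Sigma>" "free_right_module R P E" "free_right_module R Q E'"
   interpret based_arrow B R \<eta> P E Q E' \<sigma> by (rule arrow[OF *])
   have "loc_iso (dgm_cat B) dom.PB cod.PB \<sigma>B" using d *(1) by (auto simp: derived_inverts_def)
   then show "homology_solvable B (left_act (B, \<eta>)) E E' (hom_matrix R Q E' \<sigma>) n"
    unfolding loc_iso_iff_solvable by blast
  qed
 next
  assume h: "\<forall>n. homology_inverts R \<Sigma> B (left_act (B, \<eta>)) n"
  show "derived_inverts R \<Sigma> (B, \<eta>)"
   unfolding derived_inverts_def
  proof clarify
   fix P Q \<sigma> assume *: "(P, Q, \<sigma>) \<in> \<Sigma>"
   then obtain E E' where E: "free_right_module R P E" "free_right_module R Q E'"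
    using \<Sigma> by (auto simp: fg_free_arrows_def fg_free_basis)
   interpret based_arrow B R \<eta> P E Q E' \<sigma> by (rule arrow[OF * E])
   have "\<forall>n. homology_solvable B (left_act (B, \<eta>)) E E' mat n"
    using h * E unfolding homology_inverts_def by blast
   then show "loc_iso (dgm_cat (fst (B, \<eta>))) (base_change R (B, \<eta>) P) (base_change R (B, \<eta>) Q) (base_change_map R (B, \<eta>) (P, Q, \<sigma>))"
    using loc_iso_iff_solvable by simp
  qed
 qed
qed

text \<open>Being inverting passes from \<open>B\<close> to any \<open>B'\<close> for which solvability of systems can be transferred; the bases of the
 modules in \<open>\<Sigma>\<close> then need no further mention.\<close>

lemma derived_inverts_transfer:
 assumes \<Sigma>: "\<Sigma> \<subseteq> fg_free_arrows R" and U: "dga_under B R \<eta>" and V: "dga_under B' R \<eta>'" and inv: "derived_inverts R \<Sigma> (B, \<eta>)"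
  and step: "\<And>(E :: 'p set) (E' :: 'p set) a n. finite E ==> finite E' ==> (\<And>e f. e \<in> E ==> f \<in> E' ==> a f e \<in> carrier R) ==>
   (\<And>n. homology_solvable B (left_act (B, \<eta>)) E E' a n) ==> homology_solvable B' (left_act (B', \<eta>')) E E' a n"
 shows "derived_inverts R (\<Sigma> :: ('r, 'p) arrow set) (B', \<eta>')"
proof -
 have hi: "homology_inverts R \<Sigma> B (left_act (B, \<eta>)) n" for n using inv unfolding derived_inverts_iff[OF U \<Sigma>] by blast
 have "homology_solvable B' (left_act (B', \<eta>')) E E' (hom_matrix R Q E' \<sigma>) n"
  if *: "(P, Q, \<sigma>) \<in> \<Sigma>" "free_right_module R P E" "free_right_module R Q E'" for P Q \<sigma> E E' n
 proof (rule step)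
  show "finite E" "finite E'" by (rule free_right_module.fin[OF *(2)], rule free_right_module.fin[OF *(3)])
  show "hom_matrix R Q E' \<sigma> f e \<in> carrier R" if "e \<in> E" "f \<in> E'" for e f by (rule arrow_matrix_closed[OF \<Sigma> * that])
  show "homology_solvable B (left_act (B, \<eta>)) E E' (hom_matrix R Q E' \<sigma>) n" for n
   using hi * unfolding homology_inverts_def by blast
 qed
 then show ?thesis unfolding derived_inverts_iff[OF V \<Sigma>] homology_inverts_def by blast
qed

definition ring_solvable :: "('s, 'l) ring_scheme => ('r => 's) => 'e set => 'f set => ('f => 'e => 'r) => bool" where
 "ring_solvable S \<phi> E E' a \<longleftrightarrow> (let l = (%r b. \<phi> r \<otimes>[S] b) in
  (\<forall>b\<in>E -> carrier S. (\<forall>f\<in>E'. linear_system S l E a b f = \<zero>[S]) --> (\<forall>e\<in>E. b e = \<zero>[S])) \<and>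
  (\<forall>c\<in>E' -> carrier S. \<exists>b\<in>E -> carrier S. \<forall>f\<in>E'. linear_system S l E a b f = c f))"

lemma ring_left_action:
 assumes "ring R" "ring S" "\<phi> \<in> ring_hom R S" shows "left_action R S (%r b. \<phi> r \<otimes>[S] b)"
proof -
 interpret R: ring R by fact
 interpret S: ring S by fact
 have c: "\<phi> r \<in> carrier S" if "r \<in> carrier R" for r using assms(3) that by (auto simp: ring_hom_def)
 show ?thesis
  by unfold_locales (use assms(3) in \<open>auto simp: c S.r_distr S.l_distr S.m_assoc ring_hom_add ring_hom_mult ring_hom_one\<close>)
qed

lemma inverts_iff:
 assumes "ring R" "ring S" "\<phi> \<in> ring_hom R S" and \<Sigma>: "\<Sigma> \<subseteq> fg_free_arrows R"
 shows "inverts R \<Sigma> S \<phi> \<longleftrightarrow> (\<forall>(P, Q, \<sigma>)\<in>\<Sigma>. \<forall>E E'. free_right_module R P E --> free_right_module R Q E' -->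
  ring_solvable S \<phi> E E' (hom_matrix R Q E' \<sigma>))"
proof -
 let ?l = "%r b. \<phi> r \<otimes>[S] b"
 have la: "left_action R S ?l" by (rule ring_left_action[OF assms(1-3)])
 have key: "bij_betw (tensor_map R Q S ?l (map_prod \<sigma> id)) (tensor_carrier R P S ?l) (tensor_carrier R Q S ?l) \<longleftrightarrow>
  ring_solvable S \<phi> E E' (hom_matrix R Q E' \<sigma>)"
  if "(P, Q, \<sigma>) \<in> \<Sigma>" "free_right_module R P E" "free_right_module R Q E'" for P Q \<sigma> E E'
 proof -
  have "\<sigma> \<in> right_module_hom R P Q" using that \<Sigma> by (auto simp: fg_free_arrows_def)
  from tensor_map_bij_iff[OF tensor.intro[OF that(2) la] tensor.intro[OF that(3) la] this]
  show ?thesis unfolding ring_solvable_def Let_def .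
 qed
 have ex: "\<exists>E E'. free_right_module R P E \<and> free_right_module R Q E'" if "(P, Q, \<sigma>) \<in> \<Sigma>" for P Q \<sigma>
  using that \<Sigma> by (auto simp: fg_free_arrows_def fg_free_basis)
 show ?thesis
 proof
  assume i: "inverts R \<Sigma> S \<phi>"
  show "\<forall>(P, Q, \<sigma>)\<in>\<Sigma>. \<forall>E E'. free_right_module R P E --> free_right_module R Q E' -->
   ring_solvable S \<phi> E E' (hom_matrix R Q E' \<sigma>)"
  proof clarify
   fix P Q \<sigma> E E' assume *: "(P, Q, \<sigma>) \<in> \<Sigma>" "free_right_module R P E" "free_right_module R Q E'"
   from i *(1) have "bij_betw (tensor_map R Q S ?l (map_prod \<sigma> id)) (tensor_carrier R P S ?l) (tensor_carrier R Q S ?l)"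
    unfolding inverts_def Let_def by blast
   then show "ring_solvable S \<phi> E E' (hom_matrix R Q E' \<sigma>)" unfolding key[OF *] .
  qed
 next
  assume h: "\<forall>(P, Q, \<sigma>)\<in>\<Sigma>. \<forall>E E'. free_right_module R P E --> free_right_module R Q E' -->
   ring_solvable S \<phi> E E' (hom_matrix R Q E' \<sigma>)"
  show "inverts R \<Sigma> S \<phi>" unfolding inverts_def Let_def
  proof clarify
   fix P Q \<sigma> assume *: "(P, Q, \<sigma>) \<in> \<Sigma>"
   from ex[OF *] obtain E E' where E: "free_right_module R P E" "free_right_module R Q E'" by blast
   from h * E have "ring_solvable S \<phi> E E' (hom_matrix R Q E' \<sigma>)" by blast
   then show "bij_betw (tensor_map R Q S ?l (map_prod \<sigma> id)) (tensor_carrier R P S ?l) (tensor_carrier R Q S ?l)"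
    unfolding key[OF * E] .
  qed
 qed
qed

section \<open>The category of dg algebras under \<open>R\<close>\<close>

lemma dga_homs_id:
 assumes "dg_algebra A" shows "(%n. restrict id (elts A n)) \<in> dga_homs A A"
proof -
 interpret dg_algebra A by fact
 show ?thesis using chain_maps_id[OF chain_complex_axioms] by (auto simp: dga_homs_def unit_closed)
qed

lemma dga_homs_comp:
 assumes "dg_algebra A" "f \<in> dga_homs A B" "g \<in> dga_homs B C"
 shows "(%n. compose (elts A n) (g n) (f n)) \<in> dga_homs A C"
proof -
 interpret dg_algebra A by fact
 note f = dga_homsD[OF assms(2)] and g = dga_homsD[OF assms(3)]
 show ?thesis using chain_maps_comp[OF chain_complex_axioms f(1) g(1)]
  by (auto simp: dga_homs_def unit_closed compose_def f g)
qed

definition under_homs :: "('k::field, 'r) module => ('k, 'r, 'u) dga_under => ('k, 'r, 'v) dga_under => (int => 'u => 'v) set" where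
 "under_homs R U V = {f \<in> dga_homs (fst U) (fst V). \<forall>r\<in>carrier R. f 0 (snd U 0 r) = snd V 0 r}"

lemma dga_under_other_degree:
 assumes "ring R" "dg_algebra B" "\<eta> \<in> dga_homs (concentrated R) B" "n \<noteq> 0"
 shows "\<eta> n \<zero>[R] = \<zero>[gr B n]"
proof -
 interpret R: ring R by fact
 interpret dg_algebra B by fact
 interpret M: abelian_group "gr B n" by simp
 have "\<eta> n \<zero>[R] \<oplus>[gr B n] \<eta> n \<zero>[R] = \<eta> n \<zero>[R]" "\<eta> n \<zero>[R] \<in> elts B n"
  using lin_add[OF dga_homsD(4)[OF assms(3), of n], of "\<zero>[R]" "\<zero>[R]"] dga_homsD(5)[OF assms(3), of "\<zero>[R]" n] assms(4)
  by (simp_all add: concentrated_def)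
 then show ?thesis using M.add.l_cancel_one by metis
qed

lemma under_cat_Ob: "ring R ==> (B, \<eta>) \<in> Ob (under_cat R) \<longleftrightarrow> dga_under B R \<eta>"
 by (auto simp: under_cat_def Let_def dga_under_def dga_under_axioms_def)

lemma under_cat_Hom:
 assumes R: "ring R" and "U \<in> Ob (under_cat R)" "V \<in> Ob (under_cat R)"
 shows "f \<in> Hom (under_cat R) U V \<longleftrightarrow> f \<in> under_homs R U V"
proof -
 obtain A \<eta> B \<theta> where U: "U = (A, \<eta>)" "V = (B, \<theta>)" by (metis prod.exhaust)
 have ob: "dg_algebra A" "\<eta> \<in> dga_homs (concentrated R) A" "dg_algebra B" "\<theta> \<in> dga_homs (concentrated R) B"
  using assms(2,3) by (auto simp: under_cat_def Let_def U)
 interpret A: dg_algebra A by (rule ob(1))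
 interpret B: dg_algebra B by (rule ob(3))
 have "f n (\<eta> n r) = \<theta> n r" if "f \<in> under_homs R U V" "r \<in> elts (concentrated R) n" for n r
 proof (cases "n = 0")
  case True then show ?thesis using that by (simp add: under_homs_def U concentrated_def)
 next
  case False
  then have "r = \<zero>[R]" using that by (simp add: concentrated_def)
  moreover have "f \<in> dga_homs A B" using that by (simp add: under_homs_def U)
  ultimately show ?thesis
   using dga_under_other_degree[OF R ob(1,2) False] dga_under_other_degree[OF R ob(3,4) False]
    lin_zero[OF A.vs B.vs dga_homsD(4)] by simp
 qed
 moreover have "elts (concentrated R) 0 = carrier R" by (simp add: concentrated_def)
 ultimately show ?thesis by (auto simp: under_cat_def Let_def U under_homs_def)
qed

lemma under_cat_Weq:
 assumes R: "ring R" and "U \<in> Ob (under_cat R)" "V \<in> Ob (under_cat R)"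
 shows "f \<in> Weq (under_cat R) U V \<longleftrightarrow> f \<in> under_homs R U V \<and> quasi_iso (fst U) (fst V) f"
 using under_cat_Hom[OF assms, of f] by (auto simp: under_cat_def Let_def)

lemma under_cat_Ob_dga: "U \<in> Ob (under_cat R) ==> dg_algebra (fst U)"
 by (auto simp: under_cat_def Let_def)

lemma under_cat_Ob_cplx: "U \<in> Ob (under_cat R) ==> chain_complex (fst U)"
 by (auto dest!: under_cat_Ob_dga simp: dg_algebra_def)

lemma under_homs_chain: "f \<in> under_homs R U V ==> f \<in> chain_maps (fst U) (fst V)"
 by (auto simp: under_homs_def dga_homs_def)

lemma under_cat_functor:
 assumes R: "ring R"
 shows "wcat_functor (under_cat R :: (('k::field, 'r, 'u) dga_under, int => 'u => 'u) wcat)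
  (%U. homology (fst U) n) (%U V f. homology_map (fst V) f n)"
proof (rule wcat_functor.intro)
 fix U V :: "('k, 'r, 'u) dga_under" and f x
 assume *: "U \<in> Ob (under_cat R)" "V \<in> Ob (under_cat R)" "f \<in> Hom (under_cat R) U V" "x \<in> homology (fst U) n"
 then show "homology_map (fst V) f n x \<in> homology (fst V) n"
  by (intro homology_map_closed[of "fst U"] under_cat_Ob_cplx[of _ R] under_homs_chain[of _ R]) (simp_all add: under_cat_Hom R)
next
 fix U :: "('k, 'r, 'u) dga_under" and x assume *: "U \<in> Ob (under_cat R)" "x \<in> homology (fst U) n"
 have "Idn (under_cat R) U = (%n. restrict id (elts (fst U) n))" by (simp add: under_cat_def Let_def)
 then show "homology_map (fst U) (Idn (under_cat R) U) n x = x"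
  using homology_map_id[OF under_cat_Ob_cplx[OF *(1)] *(2)] by simp
next
 fix U V W :: "('k, 'r, 'u) dga_under" and f g x
 assume *: "U \<in> Ob (under_cat R)" "V \<in> Ob (under_cat R)" "W \<in> Ob (under_cat R)" "f \<in> Hom (under_cat R) U V" "g \<in> Hom (under_cat R) V W"
  "x \<in> homology (fst U) n"
 have h: "f \<in> under_homs R U V" "g \<in> under_homs R V W" using * under_cat_Hom[OF R] by blast+
 have "Cmp (under_cat R) U g f = (%n. compose (elts (fst U) n) (g n) (f n))" by (simp add: under_cat_def Let_def)
 moreover note chain_maps_comp[OF under_cat_Ob_cplx[OF *(1)] under_homs_chain[OF h(1)] under_homs_chain[OF h(2)]]
 ultimately show "homology_map (fst W) (Cmp (under_cat R) U g f) n x = homology_map (fst W) g n (homology_map (fst V) f n x)"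
  using homology_map_comp[OF under_cat_Ob_cplx[OF *(1)] under_cat_Ob_cplx[OF *(2)] under_cat_Ob_cplx[OF *(3)]
   under_homs_chain[OF h(1)] under_homs_chain[OF h(2)] *(6)] by simp
next
 fix U :: "('k, 'r, 'u) dga_under" assume U: "U \<in> Ob (under_cat R)"
 obtain B \<eta> where B: "U = (B, \<eta>)" by fastforce
 interpret dga_under B R \<eta> using U under_cat_Ob[OF R] B by blast
 show "Idn (under_cat R) U \<in> Hom (under_cat R) U U"
  unfolding under_cat_Hom[OF R U U]
  using dga_homs_id[OF under_cat_Ob_dga[OF U]] by (auto simp: under_cat_def Let_def under_homs_def B eta_closed)
next
 fix U V W :: "('k, 'r, 'u) dga_under" and f g
 assume *: "U \<in> Ob (under_cat R)" "V \<in> Ob (under_cat R)" "W \<in> Ob (under_cat R)" "f \<in> Hom (under_cat R) U V" "g \<in> Hom (under_cat R) V W"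
 have h: "f \<in> under_homs R U V" "g \<in> under_homs R V W" using * under_cat_Hom[OF R] by blast+
 obtain B \<eta> where B: "U = (B, \<eta>)" by fastforce
 interpret dga_under B R \<eta> using * under_cat_Ob[OF R] B by blast
 have "(%n. compose (elts (fst U) n) (g n) (f n)) \<in> under_homs R U W"
  using dga_homs_comp[OF under_cat_Ob_dga[OF *(1)], of f "fst V" g "fst W"] h by (auto simp: under_homs_def B eta_closed compose_def)
 then show "Cmp (under_cat R) U g f \<in> Hom (under_cat R) U W"
  unfolding under_cat_Hom[OF R *(1,3)] by (simp add: under_cat_def Let_def)
next
 fix U V :: "('k, 'r, 'u) dga_under" and w
 show "w \<in> Weq (under_cat R) U V ==> w \<in> Hom (under_cat R) U V" 
  by (auto simp: under_cat_def Let_def)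
 show "w \<in> Weq (under_cat R) U V ==> bij_betw (homology_map (fst V) w n) (homology (fst U) n) (homology (fst V) n)"
  by (auto simp: under_cat_def Let_def quasi_iso_def)
qed

lemma homology_zigzag_zz:
 assumes R: "ring (R :: ('k::field, 'r) module)"
 shows "homology_zigzag n (U :: ('k::field, 'r, 'u) dga_under) p =
  wcat_functor.zz (%U. homology (fst U) n) (%U V f. homology_map (fst V) f n) U p"
proof -
 interpret F: wcat_functor "under_cat R :: (('k, 'r, 'u) dga_under, int => 'u => 'u) wcat"
  "%U. homology (fst U) n" "%U V f. homology_map (fst V) f n" by (rule under_cat_functor[OF R])
 show ?thesis
 proof (induction p arbitrary: U)
  case (Cons s p) then show ?case by (cases s) auto
 qed simp
qed

section \<open>Rings under \<open>R\<close> as dg algebras\<close>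

locale assoc_algebra = ring R for R :: "('k::field, 'r) module" (structure) +
 assumes vspace: "vspace R"
  and smult_mult_left: "x \<in> carrier R ==> y \<in> carrier R ==> (c \<odot>[R] x) \<otimes>[R] y = c \<odot>[R] (x \<otimes>[R] y)"
  and smult_mult_right: "x \<in> carrier R ==> y \<in> carrier R ==> x \<otimes>[R] (c \<odot>[R] y) = c \<odot>[R] (x \<otimes>[R] y)"

text \<open>A ring under \<open>R\<close> is an algebra over the ground field only if the scalars have central image.\<close>

locale central_ring_under = R: assoc_algebra R + S: ring S
 for R :: "('k::field, 'r) module" and S :: "'u ring" and \<phi> :: "'r => 'u" +
 assumes phi: "\<phi> \<in> ring_hom R S"
  and central: "x \<in> carrier S ==> \<phi> (c \<odot>[R] \<one>[R]) \<otimes>[S] x = x \<otimes>[S] \<phi> (c \<odot>[R] \<one>[R])"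
begin

abbreviation "SA \<equiv> fst (ring_under R S \<phi>)"
abbreviation "S\<eta> \<equiv> snd (ring_under R S \<phi>)"

lemma phi_closed: "r \<in> carrier R ==> \<phi> r \<in> carrier S" using phi by (auto simp: ring_hom_def)
lemma scalar_closed: "c \<odot>[R] \<one>[R] \<in> carrier R" using R.vspace by (simp add: vs_smult_closed)

lemma SA_simps [simp]:
 "elts SA n = (if n = 0 then carrier S else {\<zero>[S]})"
 "x \<oplus>[gr SA n] y = x \<oplus>[S] y" "\<zero>[gr SA n] = \<zero>[S]" "c \<odot>[gr SA n] x = \<phi> (c \<odot>[R] \<one>[R]) \<otimes>[S] x"
 "dif SA n x = \<zero>[S]" "mul SA i j x y = (if i = 0 \<and> j = 0 then x \<otimes>[S] y else \<zero>[S])" "unit SA = \<one>[S]"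
 by (simp_all add: ring_under_def Let_def concentrated_def)

lemma SA_vspace: "vspace (gr SA n)"
proof (rule vspaceI)
 show "abelian_group (gr SA n)"
 proof (rule abelian_groupI)
  fix x assume x: "x \<in> elts SA n"
  then show "\<exists>y\<in>elts SA n. y \<oplus>[gr SA n] x = \<zero>[gr SA n]"
   by (intro bexI[of _ "\<ominus>[S] x"]) (auto simp: S.l_neg split: if_splits)
 qed (auto simp: S.a_ac split: if_splits)
 fix x assume x: "x \<in> elts SA n"
 then have xS: "x \<in> carrier S" by (auto split: if_splits)
 show "c \<odot>[gr SA n] x \<in> elts SA n" for c using x by (auto simp: phi_closed scalar_closed split: if_splits)
 show "(c + d) \<odot>[gr SA n] x = c \<odot>[gr SA n] x \<oplus>[gr SA n] d \<odot>[gr SA n] x" for c d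
  using xS by (simp add: vs_distl[OF R.vspace] ring_hom_add[OF phi] scalar_closed S.l_distr phi_closed)
 have "(c * d) \<odot>[R] \<one>[R] = (c \<odot>[R] \<one>[R]) \<otimes>[R] (d \<odot>[R] \<one>[R])" for c d
  by (simp add: R.smult_mult_left scalar_closed vs_assoc[OF R.vspace])
 then show "(c * d) \<odot>[gr SA n] x = c \<odot>[gr SA n] (d \<odot>[gr SA n] x)" for c d
  using xS by (simp add: ring_hom_mult[OF phi] scalar_closed phi_closed S.m_assoc)
 show "1 \<odot>[gr SA n] x = x" using xS by (simp add: vs_one[OF R.vspace] ring_hom_one[OF phi])
 show "c \<odot>[gr SA n] (x \<oplus>[gr SA n] y) = c \<odot>[gr SA n] x \<oplus>[gr SA n] c \<odot>[gr SA n] y" if "y \<in> elts SA n" for c y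
  using that xS by (auto simp: S.r_distr scalar_closed phi_closed split: if_splits)
qed

lemma SA_dga: "dg_algebra SA"
proof -
 have cl: "\<phi> (c \<odot>[R] \<one>[R]) \<in> carrier S" for c by (simp add: phi_closed scalar_closed)
 have sc: "x \<otimes>[S] (\<phi> (c \<odot>[R] \<one>[R]) \<otimes>[S] y) = \<phi> (c \<odot>[R] \<one>[R]) \<otimes>[S] (x \<otimes>[S] y)"
  if "x \<in> carrier S" "y \<in> carrier S" for c x y
  using S.m_assoc[OF that(1) cl that(2), of c] S.m_assoc[OF cl that, of c] central[OF that(1), of c] by simp
 show ?thesis
 proof (intro dg_algebra.intro dg_algebra_axioms.intro chain_complex.intro SA_vspace)
  show "dif SA n \<in> linear_maps (gr SA n) (gr SA (n - 1))" for n
   by (rule linear_mapsI) (auto simp: cl)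
  show "(%x. mul SA i j x y) \<in> linear_maps (gr SA i) (gr SA (i + j))" if "y \<in> elts SA j" for y i j
   using that by (intro linear_mapsI) (auto simp: cl S.l_distr S.m_assoc split: if_splits)
  show "mul SA i j x \<in> linear_maps (gr SA j) (gr SA (i + j))" if "x \<in> elts SA i" for x i j
   using that by (intro linear_mapsI) (auto simp: cl S.r_distr sc split: if_splits)
 qed (auto simp: S.m_assoc cl split: if_splits)
qed

lemma SA_under: "dga_under SA R S\<eta>"
proof (intro dga_under.intro dga_under_axioms.intro SA_dga R.ring_axioms)
 have z: "\<phi> \<zero>[R] = \<zero>[S]" by (rule ring_hom_zero[OF phi R.ring_axioms S.ring_axioms])
 have e: "S\<eta> n = (if n = 0 then restrict \<phi> (carrier R) else restrict (%_. \<zero>[S]) {\<zero>[R]})" for n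
  by (rule ext) (simp add: ring_under_def Let_def concentrated_map_def)
 have sm: "\<phi> (c \<odot>[R] r) = \<phi> (c \<odot>[R] \<one>[R]) \<otimes>[S] \<phi> r" if "r \<in> carrier R" for c r
 proof -
  have "c \<odot>[R] r = (c \<odot>[R] \<one>[R]) \<otimes>[R] r" using that by (simp add: R.smult_mult_left)
  then show ?thesis using that by (simp add: ring_hom_mult[OF phi] scalar_closed)
 qed
 have c0: "c \<odot>[R] \<zero>[R] = \<zero>[R]" for c by (simp add: vs_smult_zero R.vspace)
 have rsm: "c \<odot>[R] r \<in> carrier R" if "r \<in> carrier R" for c r using that by (simp add: vs_smult_closed R.vspace)
 show "S\<eta> \<in> dga_homs (concentrated R) SA"
  using ring_hom_one[OF phi]
  by (auto simp: dga_homs_def chain_maps_def linear_maps_def e concentrated_def phi_closed scalar_closed rsm z c0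
   ring_hom_add[OF phi] ring_hom_mult[OF phi] sm[symmetric])
qed

lemma S\<eta>_0: "r \<in> carrier R ==> S\<eta> 0 r = \<phi> r" by (simp add: ring_under_def Let_def concentrated_map_def)

lemma cycles_SA: "cycles SA n = (if n = 0 then carrier S else {\<zero>[S]})" by (auto simp: cycles_def)
lemma boundaries_SA: "boundaries SA n = {\<zero>[S]}" by (auto simp: boundaries_def)

lemma SA_minus: "x \<in> carrier S ==> y \<in> carrier S ==> x \<ominus>[gr SA 0] y = x \<ominus>[S] y"
proof -
 assume x: "x \<in> carrier S" "y \<in> carrier S"
 interpret A: abelian_group "gr SA 0" by (rule vs_group[OF SA_vspace])
 show ?thesis using A.diff_eq_iff[of x y "x \<ominus>[S] y"] S.diff_eq_iff[of x y "x \<ominus>[S] y"] x by simp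
qed

lemma linear_system_SA:
 assumes "\<And>e. e \<in> E ==> a f e \<in> carrier R" "b \<in> E -> carrier S" "finite E"
 shows "linear_system (gr SA 0) (left_act (SA, S\<eta>) 0) E a b f = linear_system S (%r b. \<phi> r \<otimes>[S] b) E a b f"
proof -
 interpret U: dga_under SA R S\<eta> by (rule SA_under)
 show ?thesis using system_natural[OF U.left_action_B ring_left_action[OF R.ring_axioms S.ring_axioms phi],
  of 0 id E a f b] assms by (simp add: U.lft S\<eta>_0 del: prod.collapse)
qed

lemma solvable_SA_iff:
 assumes E: "finite E" and mat: "\<And>e f. e \<in> E ==> f \<in> E' ==> a f e \<in> carrier R"
 shows "homology_solvable SA (left_act (SA, S\<eta>)) E E' a 0 \<longleftrightarrow> ring_solvable S \<phi> E E' a"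
proof -
 have sys: "linear_system (gr SA 0) (left_act (SA, S\<eta>) 0) E a b f = linear_system S (%r b. \<phi> r \<otimes>[S] b) E a b f"
  if "b \<in> E -> carrier S" "f \<in> E'" for b f
  by (rule linear_system_SA) (use that mat E in auto)
 have cl: "linear_system S (%r b. \<phi> r \<otimes>[S] b) E a b f \<in> carrier S"
  if "b \<in> E -> carrier S" "f \<in> E'" for b f
  by (rule left_action.system_closed[OF ring_left_action[OF R.ring_axioms S.ring_axioms phi]]) (use that mat in auto)
 have "linear_system S (%r b. \<phi> r \<otimes>[S] b) E a b f \<ominus>[gr SA 0] c f = \<zero>[S] \<longleftrightarrow>
  linear_system S (%r b. \<phi> r \<otimes>[S] b) E a b f = c f"
  if "b \<in> E -> carrier S" "f \<in> E'" "c \<in> E' -> carrier S" for b f c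
  using cl[OF that(1,2)] funcset_mem[OF that(3,2)] by (simp add: SA_minus S.diff_eq_iff)
 then show ?thesis unfolding homology_solvable_def cycles_SA boundaries_SA ring_solvable_def Let_def
  by (simp add: sys cong: ball_cong bex_cong del: prod.collapse)
qed

lemma derived_inverts_SA:
 assumes \<Sigma>: "\<Sigma> \<subseteq> fg_free_arrows R" and inv: "inverts R \<Sigma> S \<phi>"
 shows "derived_inverts R \<Sigma> (ring_under R S \<phi>)"
proof -
 interpret U: dga_under SA R S\<eta> by (rule SA_under)
 have "homology_solvable SA (left_act (SA, S\<eta>)) E E' (hom_matrix R Q E' \<sigma>) n"
  if *: "(P, Q, \<sigma>) \<in> \<Sigma>" "free_right_module R P E" "free_right_module R Q E'" for P Q \<sigma> E E' n
 proof (cases "n = 0")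
  case False
  note mat = arrow_matrix_closed[OF \<Sigma> *]
  have z: "x \<ominus>[gr SA n] y = \<zero>[S]" if "x \<in> elts SA n" "y \<in> elts SA n" for x y
   using abelian_group.minus_closed[OF U.ag that] False by simp
  have "linear_system (gr SA n) (left_act (SA, S\<eta>) n) E (hom_matrix R Q E' \<sigma>) (%_. \<zero>[S]) f \<in> elts SA n" if "f \<in> E'" for f
   using that by (intro left_action.system_closed[OF U.left_action_B] mat) auto
  then show ?thesis using False unfolding homology_solvable_def cycles_SA boundaries_SA
   by (auto simp: z Pi_iff simp del: SA_simps(6) intro!: bexI[of _ "%_. \<zero>[S]"])
 next
  case True
  have "ring_solvable S \<phi> E E' (hom_matrix R Q E' \<sigma>)"
   using inv inverts_iff[OF R.ring_axioms S.ring_axioms phi \<Sigma>] * by blast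
  then show ?thesis using True solvable_SA_iff[OF free_right_module.fin[OF *(2)], of E' "hom_matrix R Q E' \<sigma>"]
   arrow_matrix_closed[OF \<Sigma> *] by blast
 qed
 then have "\<forall>n. homology_inverts R \<Sigma> SA (left_act (SA, S\<eta>)) n" unfolding homology_inverts_def by blast
 then have "derived_inverts R \<Sigma> (SA, S\<eta>)" using derived_inverts_iff[OF SA_under \<Sigma>] by blast
 then show ?thesis by simp
qed

end

section \<open>Connective covers\<close>

lemma vspace_sub:
 fixes V :: "('k::field, 'v) module"
 assumes V: "vspace V" and W: "W \<subseteq> carrier V" "\<zero>[V] \<in> W" "\<And>x y. x \<in> W ==> y \<in> W ==> x \<oplus>[V] y \<in> W"
  "\<And>c x. x \<in> W ==> c \<odot>[V] x \<in> W"
 shows "vspace (V\<lparr>carrier := W\<rparr>)"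
proof -
 interpret V: abelian_group V by (rule vs_group[OF V])
 have s: "x \<in> W ==> x \<in> carrier V" for x using W by blast
 show ?thesis
 proof (rule vspaceI)
  show "abelian_group (V\<lparr>carrier := W\<rparr>)"
  proof (rule abelian_groupI)
   fix x assume "x \<in> carrier (V\<lparr>carrier := W\<rparr>)"
   then have x: "x \<in> W" by simp
   have "(-1) \<odot>[V] x \<oplus>[V] x = \<zero>[V]" using V.l_neg[OF s[OF x]] by (simp add: vs_minus[OF V s[OF x]])
   then show "\<exists>y\<in>carrier (V\<lparr>carrier := W\<rparr>). y \<oplus>[V\<lparr>carrier := W\<rparr>] x = \<zero>[V\<lparr>carrier := W\<rparr>]"
    using W(4)[OF x, of "-1"] by auto
  qed (auto simp: W s V.a_ac)
 qed (auto simp: s W vs_distl[OF V] vs_distr[OF V] vs_assoc[OF V] vs_one[OF V])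
qed

text \<open>The good truncation, with cycles in degree \<open>0\<close>.\<close>

definition connective_cover :: "('k, 'u) dga => ('k, 'u) dga" where
 "connective_cover B = B\<lparr>gr := %n. (gr B n)\<lparr>carrier :=
  if n < 0 then {\<zero>[gr B n]} else if n = 0 then cycles B 0 else elts B n\<rparr>\<rparr>"

context dg_algebra begin

lemma mul_cycles:
 assumes "x \<in> cycles A i" "y \<in> cycles A j" shows "mul A i j x y \<in> cycles A (i + j)"
proof -
 interpret M: abelian_group "gr A (i + j - 1)" by simp
 have i: "i - 1 + j = i + j - 1" "i + (j - 1) = i + j - 1" by auto
 have x: "x \<in> elts A i" "dif A i x = \<zero>[gr A (i - 1)]" and y: "y \<in> elts A j" "dif A j y = \<zero>[gr A (j - 1)]"
  using assms by (auto simp: cycles_def)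
 have "mul A (i - 1) j (dif A i x) y = \<zero>[gr A (i + j - 1)]" using mul_zero_left[OF y(1), of "i - 1"] x(2) i by simp
 moreover have "mul A i (j - 1) x (dif A j y) = \<zero>[gr A (i + j - 1)]" using mul_zero_right[OF x(1), of "j - 1"] y(2) i by simp
 ultimately show ?thesis using leibniz[OF x(1) y(1)] x y by (simp add: cycles_def vs_smult_zero)
qed

lemma dif_unit: "dif A 0 (unit A) = \<zero>[gr A (- 1)]"
proof -
 interpret M: abelian_group "gr A (-1)" by simp
 have "dif A 0 (unit A) \<in> elts A (-1)" using d_closed[OF unit_closed] by simp
 then have "dif A 0 (unit A) = dif A 0 (unit A) \<oplus>[gr A (- 1)] dif A 0 (unit A)" and c: "dif A 0 (unit A) \<in> elts A (-1)"
  using leibniz[OF unit_closed unit_closed] by (simp_all add: unit_closed unit_left unit_right vs_one)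
 then show ?thesis using M.add.l_cancel_one by metis
qed

end

text \<open>The record type is fixed here, since the connective cover is formed by updating a record of this type.\<close>

locale closed_dga = dg_algebra A for A :: "('k::field, 'u) dga"
begin

abbreviation "cc \<equiv> connective_cover A"

lemma cc_simps [simp]:
 "elts cc n = (if n < 0 then {\<zero>[gr A n]} else if n = 0 then cycles A 0 else elts A n)"
 "x \<oplus>[gr cc n] y = x \<oplus>[gr A n] y" "\<zero>[gr cc n] = \<zero>[gr A n]" "c \<odot>[gr cc n] x = c \<odot>[gr A n] x"
 "dif cc n = dif A n" "mul cc i j = mul A i j" "unit cc = unit A"
 by (simp_all add: connective_cover_def)

lemma cc_sub: "x \<in> elts cc n ==> x \<in> elts A n"
 by (auto simp: cycles_elts abelian_groupE(2)[OF ag] split: if_splits)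

lemma cc_vs: "vspace (gr cc n)"
proof -
 interpret M: abelian_group "gr A n" by simp
 show ?thesis
  unfolding connective_cover_def using cc_sub[of _ n]
  by (auto intro!: vspace_sub[OF vs] simp: cycles_ops vs_smult_closed vs_smult_zero split: if_splits)
qed

lemma cc_dif: "x \<in> elts cc n ==> dif A n x \<in> elts cc (n - 1)"
 using boundaries_sub_cycles[of 0] by (auto simp: cycles_def boundaries_def dif_dif d_d' split: if_splits)

lemma cc_mul: assumes "x \<in> elts cc i" "y \<in> elts cc j" shows "mul A i j x y \<in> elts cc (i + j)"
proof (cases "i < 0 \<or> j < 0")
 case True
 then have "x = \<zero>[gr A i] \<or> y = \<zero>[gr A j]" using assms by auto
 then have "mul A i j x y = \<zero>[gr A (i + j)]"
  using mul_zero_left[OF cc_sub[OF assms(2)]] mul_zero_right[OF cc_sub[OF assms(1)]] by blast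
 then show ?thesis using abelian_groupE(2)[OF ag] by (auto simp: cycles_ops)
next
 case False
 then show ?thesis using assms mul_cycles[of x 0 y 0] mul_closed[OF cc_sub[OF assms(1)] cc_sub[OF assms(2)]]
  by (auto split: if_splits)
qed

lemma cc_dga: "dg_algebra cc"
proof (intro dg_algebra.intro dg_algebra_axioms.intro chain_complex.intro cc_vs)
 show "dif cc n \<in> linear_maps (gr cc n) (gr cc (n - 1))" for n
 proof (rule linear_mapsI)
  fix x assume x: "x \<in> elts cc n"
  then show "dif cc n x \<in> elts cc (n - 1)" using cc_dif by simp
  show "dif cc n (c \<odot>[gr cc n] x) = c \<odot>[gr cc (n - 1)] dif cc n x" for c
   using cc_sub[OF x] by (simp add: d_smult)
  show "dif cc n (x \<oplus>[gr cc n] y) = dif cc n x \<oplus>[gr cc (n - 1)] dif cc n y" if "y \<in> elts cc n" for y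
   using cc_sub[OF x] cc_sub[OF that] by (simp add: d_add)
 qed
 fix i j
 show "(%x. mul cc i j x y) \<in> linear_maps (gr cc i) (gr cc (i + j))" if y: "y \<in> elts cc j" for y
 proof (rule linear_mapsI)
  fix x assume x: "x \<in> elts cc i"
  show "mul cc i j x y \<in> elts cc (i + j)" using cc_mul[OF x y] by simp
  show "mul cc i j (c \<odot>[gr cc i] x) y = c \<odot>[gr cc (i + j)] mul cc i j x y" for c
   using mul_smult_left[OF cc_sub[OF x] cc_sub[OF y]] by simp
  show "mul cc i j (x \<oplus>[gr cc i] x') y = mul cc i j x y \<oplus>[gr cc (i + j)] mul cc i j x' y" if "x' \<in> elts cc i" for x'
   using mul_add_left[OF cc_sub[OF x] cc_sub[OF that] cc_sub[OF y]] by simp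
 qed
 show "mul cc i j x \<in> linear_maps (gr cc j) (gr cc (i + j))" if x: "x \<in> elts cc i" for x
 proof (rule linear_mapsI)
  fix y assume y: "y \<in> elts cc j"
  show "mul cc i j x y \<in> elts cc (i + j)" using cc_mul[OF x y] by simp
  show "mul cc i j x (c \<odot>[gr cc j] y) = c \<odot>[gr cc (i + j)] mul cc i j x y" for c
   using mul_smult_right[OF cc_sub[OF x] cc_sub[OF y]] by simp
  show "mul cc i j x (y \<oplus>[gr cc j] y') = mul cc i j x y \<oplus>[gr cc (i + j)] mul cc i j x y'" if "y' \<in> elts cc j" for y'
   using mul_add_right[OF cc_sub[OF x] cc_sub[OF y] cc_sub[OF that]] by simp
 qed
 fix x y assume x: "x \<in> elts cc i" and y: "y \<in> elts cc j"
 show "mul cc (i + j) l (mul cc i j x y) z = mul cc i (j + l) x (mul cc j l y z)" if "z \<in> elts cc l" for l z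
  using mul_assoc[OF cc_sub[OF x] cc_sub[OF y] cc_sub[OF that]] by simp
 show "dif cc (i + j) (mul cc i j x y) = mul cc (i - 1) j (dif cc i x) y
  \<oplus>[gr cc (i + j - 1)] ((- 1) powi i) \<odot>[gr cc (i + j - 1)] mul cc i (j - 1) x (dif cc j y)"
  using leibniz[OF cc_sub[OF x] cc_sub[OF y]] by simp
next
 show "unit cc \<in> elts cc 0" using dif_unit unit_closed by (simp add: cycles_def)
next
 fix x i assume "x \<in> elts cc i"
 from cc_sub[OF this] show "mul cc 0 i (unit cc) x = x" "mul cc i 0 x (unit cc) = x"
  "dif cc (i - 1) (dif cc i x) = \<zero>[gr cc (i - 2)]" by (simp_all add: unit_left unit_right dif_dif)
qed

lemma cc_cycles: "cycles cc n = (if n < 0 then {\<zero>[gr A n]} else cycles A n)"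
 by (auto simp: cycles_def)

lemma cc_boundaries: "boundaries cc n = (if n < 0 then {\<zero>[gr A n]} else boundaries A n)"
proof -
 consider "n < -1" | "n = -1" | "n \<ge> 0" by linarith
 then show ?thesis
 proof cases
  case 1 then show ?thesis using d_zero[of "n + 1"] by (simp add: boundaries_def)
 next
  case 2 then show ?thesis using cycles_ops(1)[of 0] by (auto simp: boundaries_def cycles_def intro!: rev_image_eqI[OF cycles_ops(1)])
 qed (auto simp: boundaries_def)
qed

lemma cc_minus: "x \<in> elts cc n ==> y \<in> elts cc n ==> x \<ominus>[gr cc n] y = x \<ominus>[gr A n] y"
proof -
 assume x: "x \<in> elts cc n" "y \<in> elts cc n"
 interpret M: abelian_group "gr A n" by simp
 interpret C: abelian_group "gr cc n" by (rule vs_group[OF cc_vs])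
 have m: "x \<ominus>[gr cc n] y \<in> elts cc n" using C.minus_closed[OF x] .
 have "x = y \<oplus>[gr A n] (x \<ominus>[gr cc n] y)" using C.diff_eq_iff[OF x m] by simp
 then show ?thesis using M.diff_eq_iff[OF cc_sub[OF x(1)] cc_sub[OF x(2)] cc_sub[OF m]] by simp
qed

lemma cc_incl: "(%n. restrict id (elts cc n)) \<in> dga_homs cc A"
proof -
 interpret C: dg_algebra cc by (rule cc_dga)
 have "restrict id (elts cc n) \<in> linear_maps (gr cc n) (gr A n)" for n
  using cc_sub C.add_closed[of _ n] vs_smult_closed[OF C.vs, of _ n] by (intro linear_mapsI) (auto simp del: cc_simps(1))
 then show ?thesis using cc_dif cc_mul C.unit_closed
  by (simp add: dga_homs_def chain_maps_def del: cc_simps(1))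
qed

end

sublocale dga_under \<subseteq> closed_dga B ..

context dga_under begin

lemma cc_eta: "\<eta> \<in> dga_homs (concentrated R) (connective_cover B)"
proof -
 have cl: "\<eta> n r \<in> elts (connective_cover B) n" if "r \<in> elts (concentrated R) n" for n r
 proof (cases "n = 0")
  case True then show ?thesis using that eta_closed eta_cycle by (auto simp: cycles_def concentrated_def)
 next
  case False then show ?thesis using that dga_under_other_degree[OF R.ring_axioms dg_algebra_axioms eta False] abelian_groupE(2)[OF ag]
   by (auto simp: concentrated_def)
 qed
 show ?thesis using eta cl by (auto simp: dga_homs_def chain_maps_def linear_maps_def Pi_iff simp del: cc_simps(1))
qed

lemma cc_under: "dga_under (connective_cover B) R \<eta>"
 by (intro dga_under.intro dga_under_axioms.intro cc_dga cc_eta R.ring_axioms)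

text \<open>In degrees \<open>n \<ge> 0\<close> the homology is unchanged, and in negative degrees it vanishes.\<close>

lemma cc_solvable:
 assumes h: "\<And>n. n \<ge> 0 ==> homology_solvable B lft E E' a n" and E: "finite E"
  and a: "\<And>e f. e \<in> E ==> f \<in> E' ==> a f e \<in> carrier R"
 shows "homology_solvable cc (left_act (cc, \<eta>)) E E' a n"
proof -
 interpret C: dga_under cc R \<eta> by (rule cc_under)
 have sys: "linear_system (gr cc n) (left_act (cc, \<eta>) n) E a b f = linear_system (gr B n) (lft n) E a b f"
  if "b \<in> E -> elts cc n" "f \<in> E'" for b f
  using system_natural[OF C.left_action_B left_action_B, of n id n E a f b] that E a cc_sub by (simp add: C.lft lft del: cc_simps(1))
 have cl: "linear_system (gr cc n) (left_act (cc, \<eta>) n) E a b f \<in> elts cc n"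
  if "b \<in> E -> elts cc n" "f \<in> E'" for b f
  using that by (intro left_action.system_closed[OF C.left_action_B] a)
 have cyc: "b \<in> A -> elts cc n" if "b \<in> A -> cycles cc n" for b and A :: "'x set" using that by (auto simp: cycles_def)
 show ?thesis
 proof (cases "n < 0")
  case True
  have z: "x \<ominus>[gr cc n] y = \<zero>[gr B n]" if "x \<in> elts cc n" "y \<in> elts cc n" for x y
   using abelian_group.minus_closed[OF C.ag that] True by simp
  have zf: "(%_. \<zero>[gr B n]) \<in> E -> elts cc n" using True by simp
  show ?thesis unfolding homology_solvable_def cc_cycles cc_boundaries
   using True z[OF cl[OF zf]] by (auto simp: Pi_iff intro!: bexI[of _ "%_. \<zero>[gr B n]"])
 next
  case False
  then have *: "homology_solvable B lft E E' a n" using h by simp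
  have c: "cycles cc n = cycles B n" "boundaries cc n = boundaries B n" using False by (simp_all add: cc_cycles cc_boundaries)
  have "linear_system (gr cc n) (left_act (cc, \<eta>) n) E a b f \<ominus>[gr cc n] c f = linear_system (gr B n) (lft n) E a b f \<ominus>[gr B n] c f"
   if "b \<in> E -> cycles cc n" "c \<in> E' -> cycles cc n" "f \<in> E'" for b c f
   using cc_minus[OF cl[OF cyc[OF that(1)] that(3)] funcset_mem[OF cyc[OF that(2)] that(3)]] sys[OF cyc[OF that(1)] that(3)] by simp
  then show ?thesis using * unfolding homology_solvable_def c[symmetric]
   by (simp add: sys cyc cong: ball_cong bex_cong del: cc_simps)
 qed
qed

end

section \<open>Linear extension and bases modulo a subspace\<close>

definition lin_ext :: "('k::field, 'v, 'm) module_scheme => ('w => 'v) => ('w \<Rightarrow>\<^sub>0 'k) => 'v" where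
 "lin_ext V f p = (\<Oplus>\<^bsub>V\<^esub>w\<in>keys p. lookup p w \<odot>[V] f w)"

abbreviation scl :: "'k::field => ('w \<Rightarrow>\<^sub>0 'k) => ('w \<Rightarrow>\<^sub>0 'k)" where "scl c \<equiv> Poly_Mapping.map ((*) c)"

lemma lookup_scl: "lookup (scl c p) w = c * lookup p w"
 by (simp add: map.rep_eq when_def)

lemma keys_scl: "keys (scl c p) \<subseteq> keys p"
 by (auto simp: in_keys_iff lookup_scl)

lemma scl_single: "scl c (single w d) = single w (c * d)"
 by (rule poly_mapping_eqI) (simp add: lookup_scl lookup_single when_def)

lemma vector_space_scl: "vector_space (scl :: 'k::field => ('w \<Rightarrow>\<^sub>0 'k) => _)"
 by unfold_locales (auto intro!: poly_mapping_eqI simp: lookup_scl lookup_add algebra_simps)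

context
 fixes V :: "('k::field, 'v, 'm) module_scheme" and f :: "'w => 'v" and A :: "'w set"
 assumes V: "vspace V" and f: "\<And>w. w \<in> A ==> f w \<in> carrier V"
begin

interpretation V: abelian_group V by (rule vs_group[OF V])

lemma lin_ext_superset:
 assumes "keys p \<subseteq> B" "B \<subseteq> A" "finite B"
 shows "lin_ext V f p = (\<Oplus>\<^bsub>V\<^esub>w\<in>B. lookup p w \<odot>[V] f w)"
 unfolding lin_ext_def
 by (rule V.add.finprod_mono_neutral_cong_left)
  (use assms f in \<open>auto simp: in_keys_iff vs_zero_scalar[OF V] vs_smult_closed[OF V] subset_iff\<close>)

lemma terms_lin_ext: "B \<subseteq> A ==> (%w. lookup p w \<odot>[V] f w) \<in> B -> carrier V"
 using f by (auto simp: vs_smult_closed[OF V])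

lemma lin_ext_closed: "keys p \<subseteq> A ==> lin_ext V f p \<in> carrier V"
 unfolding lin_ext_def by (rule V.finsum_closed[OF terms_lin_ext])

lemma lin_ext_add:
 assumes "keys p \<subseteq> A" "keys q \<subseteq> A"
 shows "lin_ext V f (p + q) = lin_ext V f p \<oplus>[V] lin_ext V f q"
proof -
 let ?B = "keys p \<union> keys q"
 have B: "?B \<subseteq> A" "finite ?B" using assms by auto
 have "lin_ext V f (p + q) = (\<Oplus>\<^bsub>V\<^esub>w\<in>?B. lookup (p + q) w \<odot>[V] f w)"
  by (rule lin_ext_superset[OF Poly_Mapping.keys_add B])
 also have "\<dots> = (\<Oplus>\<^bsub>V\<^esub>w\<in>?B. lookup p w \<odot>[V] f w \<oplus>[V] lookup q w \<odot>[V] f w)"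
  by (rule V.finsum_cong') (use B f in \<open>auto simp: lookup_add vs_distl[OF V] vs_smult_closed[OF V] subset_iff\<close>)
 also have "\<dots> = (\<Oplus>\<^bsub>V\<^esub>w\<in>?B. lookup p w \<odot>[V] f w) \<oplus>[V] (\<Oplus>\<^bsub>V\<^esub>w\<in>?B. lookup q w \<odot>[V] f w)"
  by (rule V.finsum_addf[OF terms_lin_ext[OF B(1)] terms_lin_ext[OF B(1)]])
 also have "\<dots> = lin_ext V f p \<oplus>[V] lin_ext V f q"
  using B by (simp add: lin_ext_superset[of p ?B] lin_ext_superset[of q ?B])
 finally show ?thesis .
qed

lemma lin_ext_single: "w \<in> A ==> lin_ext V f (single w c) = c \<odot>[V] f w"
proof -
 assume w: "w \<in> A"
 have "lin_ext V f (single w c) = (\<Oplus>\<^bsub>V\<^esub>w'\<in>{w}. lookup (single w c) w' \<odot>[V] f w')"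
  by (rule lin_ext_superset) (use w in auto)
 also have "\<dots> = c \<odot>[V] f w" using f[OF w] by (simp add: vs_smult_closed[OF V])
 finally show ?thesis .
qed

lemma lin_ext_scl:
 assumes "keys p \<subseteq> A" shows "lin_ext V f (scl c p) = c \<odot>[V] lin_ext V f p"
proof -
 have lin: "(%x. c \<odot>[V] x) \<in> linear_maps V V"
  by (rule linear_mapsI) (auto simp: vs_smult_closed[OF V] vs_distr[OF V] vs_assoc[OF V] mult.commute)
 have "lin_ext V f (scl c p) = (\<Oplus>\<^bsub>V\<^esub>w\<in>keys p. lookup (scl c p) w \<odot>[V] f w)"
  by (rule lin_ext_superset[OF keys_scl assms]) simp
 also have "\<dots> = (\<Oplus>\<^bsub>V\<^esub>w\<in>keys p. c \<odot>[V] (lookup p w \<odot>[V] f w))"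
  by (rule V.finsum_cong') (use assms f in \<open>auto simp: lookup_scl vs_assoc[OF V] vs_smult_closed[OF V] subset_iff\<close>)
 also have "\<dots> = c \<odot>[V] lin_ext V f p"
  unfolding lin_ext_def by (rule lin_finsum[OF V V lin terms_lin_ext[OF assms], symmetric])
 finally show ?thesis .
qed

end

lemma single_1_eq: "single a (1::'k::field) = single b 1 \<longleftrightarrow> a = b"
proof
 assume "single a (1::'k) = single b 1"
 then have "lookup (single a (1::'k)) a = lookup (single b 1) a" by simp
 then show "a = b" by (simp add: lookup_single when_def split: if_splits)
qed simp

definition linear_functional :: "('k::field, 'v, 'm) module_scheme => ('v => 'k) => bool" where
 "linear_functional V h \<longleftrightarrow>
  (\<forall>x\<in>carrier V. \<forall>y\<in>carrier V. h (x \<oplus>[V] y) = h x + h y) \<and> (\<forall>c. \<forall>x\<in>carrier V. h (c \<odot>[V] x) = c * h x)"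

text \<open>A basis of \<open>V/W\<close>, represented by elements of \<open>V\<close>, and its coordinates.  The free vector
 space on \<open>V\<close> provides a type on which the existence of bases is known.\<close>

lemma basis_modulo_subspace:
 fixes V :: "('k::field, 'v, 'm) module_scheme"
 assumes V: "vspace V" and W: "W \<subseteq> carrier V" "\<zero>[V] \<in> W" "\<And>x y. x \<in> W ==> y \<in> W ==> x \<oplus>[V] y \<in> W"
  "\<And>c x. x \<in> W ==> c \<odot>[V] x \<in> W"
 obtains J and \<kappa> :: "'v => 'v => 'k" where "J \<subseteq> carrier V"
  "\<And>j. j \<in> J ==> linear_functional V (\<kappa> j)" "\<And>j w. j \<in> J ==> w \<in> W ==> \<kappa> j w = 0"
  "\<And>i j. i \<in> J ==> j \<in> J ==> \<kappa> i j = (if i = j then 1 else 0)"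
  "\<And>v. v \<in> carrier V ==> finite {j\<in>J. \<kappa> j v \<noteq> 0} \<and> v \<ominus>[V] (\<Oplus>\<^bsub>V\<^esub>j\<in>{j\<in>J. \<kappa> j v \<noteq> 0}. \<kappa> j v \<odot>[V] j) \<in> W"
proof -
 interpret V: abelian_group V by (rule vs_group[OF V])
 interpret P: vector_space "scl :: 'k => ('v \<Rightarrow>\<^sub>0 'k) => _" by (rule vector_space_scl)
 let ?s = "%v. single v (1::'k)"
 let ?G = "{p :: 'v \<Rightarrow>\<^sub>0 'k. keys p \<subseteq> carrier V}"
 let ?F = "lin_ext V (%v. v)"
 define K where "K = {p \<in> ?G. ?F p \<in> W}"
 note F = lin_ext_closed[OF V, of "carrier V" "%v. v", simplified] lin_ext_add[OF V, of "carrier V" "%v. v", simplified]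
  lin_ext_single[OF V, of "carrier V" "%v. v", simplified] lin_ext_scl[OF V, of "carrier V" "%v. v", simplified]
 have G: "p + q \<in> ?G" if "p \<in> ?G" "q \<in> ?G" for p q
  using that Poly_Mapping.keys_add[of p q] by auto
 have G': "scl c p \<in> ?G" if "p \<in> ?G" for p c
  using that keys_scl[of c p] by auto
 have F0: "?F 0 = \<zero>[V]" by (simp add: lin_ext_def)
 have K0: "P.subspace K"
  unfolding P.subspace_def K_def
 proof (intro conjI ballI allI)
  show "0 \<in> {p \<in> ?G. ?F p \<in> W}" using W(2) by (simp add: F0)
  show "p + q \<in> {p \<in> ?G. ?F p \<in> W}" if "p \<in> {p \<in> ?G. ?F p \<in> W}" "q \<in> {p \<in> ?G. ?F p \<in> W}" for p q
   using that G[of p q] W(3) by (simp add: F)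
  show "scl c p \<in> {p \<in> ?G. ?F p \<in> W}" if "p \<in> {p \<in> ?G. ?F p \<in> W}" for c p
   using that G'[of p c] W(4) by (simp add: F)
 qed
 obtain BK where BK: "BK \<subseteq> K" "P.independent BK" "K \<subseteq> P.span BK"
  using P.maximal_independent_subset by blast
 have spanK: "P.span BK = K" using BK K0 by (simp add: P.span_subspace)
 obtain B where B: "BK \<subseteq> B" "B \<subseteq> BK \<union> ?s ` carrier V" "P.independent B" "BK \<union> ?s ` carrier V \<subseteq> P.span B"
  using P.maximal_independent_subset_extend[of BK "BK \<union> ?s ` carrier V"] BK(2) by blast
 define J where "J = {v \<in> carrier V. ?s v \<in> B - BK}"
 define \<kappa> where "\<kappa> = (%j v. P.representation B (?s v) (?s j))"
 have sp: "?s v \<in> P.span B" if "v \<in> carrier V" for v using B(4) that by blast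
 have repK: "P.representation B p (?s j) = 0" if "p \<in> K" "j \<in> J" for p j
 proof -
  have "P.representation B p = P.representation BK p"
   by (rule P.representation_extend[OF B(3) _ B(1)]) (use spanK that in simp)
  then show ?thesis using P.representation_ne_zero[of BK p "?s j"] that by (auto simp: J_def)
 qed
 have repdiff: "P.representation B p (?s j) = P.representation B q (?s j)"
  if "p - q \<in> K" "p \<in> P.span B" "q \<in> P.span B" "j \<in> J" for p q j
  using repK[OF that(1,4)] fun_cong[OF P.representation_diff[OF B(3) that(3,2)], of "?s j"] by simp
 have neg: "- p = scl (-1) p" for p :: "'v \<Rightarrow>\<^sub>0 'k" by (rule poly_mapping_eqI) (simp add: lookup_scl)
 have Fneg: "?F (- p) = \<ominus>[V] ?F p" if "p \<in> ?G" for p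
  using F(4)[of p "-1"] that vs_minus[OF V F(1)[of p]] unfolding neg by simp
 have Fdiff: "?F (p - q) = ?F p \<ominus>[V] ?F q" if "p \<in> ?G" "q \<in> ?G" for p q
  using F(2)[of p "- q"] Fneg[OF that(2)] that unfolding a_minus_def by simp
 have Gdiff: "p - q \<in> ?G" if "p \<in> ?G" "q \<in> ?G" for p q :: "'v \<Rightarrow>\<^sub>0 'k"
  using that Poly_Mapping.keys_diff[of p q] by auto
 have KI: "p - q \<in> K" if "p \<in> ?G" "q \<in> ?G" "?F p = ?F q" for p q
 proof -
  have "?F (p - q) = \<zero>[V]"
   unfolding Fdiff[OF that(1,2)] that(3) a_minus_def using F(1)[of q] that(2) by (simp add: V.r_neg)
  then show ?thesis using Gdiff[OF that(1,2)] W(2) unfolding K_def by simp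
 qed
 have sG: "?s v \<in> ?G" if "v \<in> carrier V" for v using that by simp
 have Fs: "?F (?s v) = v" if "v \<in> carrier V" for v using F(3)[OF that, of 1] vs_one[OF V that] by simp
 have lin: "linear_functional V (\<kappa> j)" if j: "j \<in> J" for j
  unfolding linear_functional_def
 proof (intro conjI ballI allI)
  fix v v' assume v: "v \<in> carrier V" "v' \<in> carrier V"
  then have vv: "v \<oplus>[V] v' \<in> carrier V" by simp
  have "?F (?s (v \<oplus>[V] v')) = ?F (?s v + ?s v')"
   using F(2)[of "?s v" "?s v'"] sG[OF v(1)] sG[OF v(2)] Fs[OF vv] Fs[OF v(1)] Fs[OF v(2)] by simp
  then have "?s (v \<oplus>[V] v') - (?s v + ?s v') \<in> K" by (rule KI[OF sG[OF vv] G[OF sG[OF v(1)] sG[OF v(2)]]])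
  from repdiff[OF this sp[OF vv] P.span_add[OF sp[OF v(1)] sp[OF v(2)]] j]
  show "\<kappa> j (v \<oplus>[V] v') = \<kappa> j v + \<kappa> j v'"
   unfolding \<kappa>_def P.representation_add[OF B(3) sp[OF v(2)] sp[OF v(1)]] .
 next
  fix c v assume v: "v \<in> carrier V"
  then have cv: "c \<odot>[V] v \<in> carrier V" by (rule vs_smult_closed[OF V])
  have "?F (?s (c \<odot>[V] v)) = ?F (scl c (?s v))"
   using F(4)[of "?s v" c] sG[OF v] Fs[OF cv] Fs[OF v] by simp
  then have "?s (c \<odot>[V] v) - scl c (?s v) \<in> K" by (rule KI[OF sG[OF cv] G'[OF sG[OF v]]])
  from repdiff[OF this sp[OF cv] P.span_scale[OF sp[OF v]] j]
  show "\<kappa> j (c \<odot>[V] v) = c * \<kappa> j v"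
   unfolding \<kappa>_def P.representation_scale[OF B(3) sp[OF v]] .
 qed
 have van: "\<kappa> j w = 0" if "j \<in> J" "w \<in> W" for j w
 proof -
  have "w \<in> carrier V" using that W(1) by blast
  then have "?s w \<in> K" using sG[of w] Fs[of w] that(2) unfolding K_def by simp
  then show ?thesis unfolding \<kappa>_def using that(1) by (rule repK)
 qed
 have delta: "\<kappa> i j = (if i = j then 1 else 0)" if "i \<in> J" "j \<in> J" for i j
 proof -
  have "?s j \<in> B" using that by (simp add: J_def)
  from P.representation_basis[OF B(3) this] show ?thesis
   by (simp add: \<kappa>_def single_1_eq)
 qed
 have expand: "finite {j\<in>J. \<kappa> j v \<noteq> 0} \<and> v \<ominus>[V] (\<Oplus>\<^bsub>V\<^esub>j\<in>{j\<in>J. \<kappa> j v \<noteq> 0}. \<kappa> j v \<odot>[V] j) \<in> W"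
  if v: "v \<in> carrier V" for v
 proof -
  let ?r = "P.representation B (?s v)"
  let ?S = "{j\<in>J. \<kappa> j v \<noteq> 0}"
  have fin: "finite {b. ?r b \<noteq> 0}" by (rule P.finite_representation)
  have inj: "inj_on ?s ?S" by (rule inj_onI) (simp add: single_1_eq)
  have sub: "?s ` ?S \<subseteq> {b. ?r b \<noteq> 0}" by (auto simp: \<kappa>_def)
  have finS: "finite ?S" using finite_imageD[OF finite_subset[OF sub fin] inj] .
  let ?q = "\<Sum>j\<in>?S. single j (\<kappa> j v)"
  have "?s v = (\<Sum>b | ?r b \<noteq> 0. scl (?r b) b)"
   by (rule P.sum_nonzero_representation_eq[OF B(3) sp[OF v], symmetric])
  also have "\<dots> = (\<Sum>b\<in>{b. ?r b \<noteq> 0} - ?s ` ?S. scl (?r b) b) + (\<Sum>b\<in>?s ` ?S. scl (?r b) b)"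
   by (rule sum.subset_diff[OF sub fin])
  also have "(\<Sum>b\<in>?s ` ?S. scl (?r b) b) = ?q"
   by (subst sum.reindex[OF inj]) (simp add: \<kappa>_def scl_single)
  finally have eq: "?s v - ?q = (\<Sum>b\<in>{b. ?r b \<noteq> 0} - ?s ` ?S. scl (?r b) b)" by (simp only: diff_eq_eq)
  have "b \<in> BK" if b: "b \<in> {b. ?r b \<noteq> 0} - ?s ` ?S" for b
  proof (rule ccontr)
   assume nb: "b \<notin> BK"
   have "b \<in> B" using b P.representation_ne_zero[of B "?s v" b] by auto
   then obtain j where "j \<in> carrier V" "b = ?s j" using B(2) nb by auto
   then have "j \<in> ?S" using nb b \<open>b \<in> B\<close> by (auto simp: J_def \<kappa>_def)
   then show False using b \<open>b = ?s j\<close> by auto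
  qed
  then have "?s v - ?q \<in> K" unfolding eq using BK(1) K0 by (intro P.subspace_sum P.subspace_scale) auto
  moreover have Sj: "j \<in> carrier V" if "j \<in> ?S" for j using that by (simp add: J_def)
  have q: "?F (\<Sum>j\<in>A. single j (\<kappa> j v)) = (\<Oplus>\<^bsub>V\<^esub>j\<in>A. \<kappa> j v \<odot>[V] j) \<and> (\<Sum>j\<in>A. single j (\<kappa> j v)) \<in> ?G"
   if "A \<subseteq> ?S" for A
   using finite_subset[OF that finS] that
  proof (induction A)
   case empty show ?case by (simp add: lin_ext_def)
  next
   case (insert a A)
   then have a: "a \<in> carrier V" "A \<subseteq> ?S" using Sj by auto
   have g: "single a (\<kappa> a v) \<in> ?G" using a by simp
   have cl: "(%j. \<kappa> j v \<odot>[V] j) \<in> A -> carrier V" using a Sj by (auto simp: vs_smult_closed[OF V])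
   show ?case using insert a g cl G[OF g conjunct2[OF insert.IH[OF a(2)]]]
    by (simp add: F V.finsum_insert vs_smult_closed[OF V])
  qed
  then have "?F (?s v - ?q) = v \<ominus>[V] (\<Oplus>\<^bsub>V\<^esub>j\<in>?S. \<kappa> j v \<odot>[V] j)"
   using Fdiff[OF sG[OF v], of ?q] Fs[OF v] by simp
  ultimately show ?thesis using finS by (simp add: K_def)
 qed
 show thesis by (rule that[of J \<kappa>]) (use lin van delta expand in \<open>auto simp: J_def\<close>)
qed

section \<open>Square-zero extensions\<close>

locale dg_bimodule = closed_dga A + Y: chain_complex Y
 for A :: "('k::field, 'u) dga" and Y :: "('k, 'v) cplx" +
 fixes la :: "int => int => 'u => 'v => 'v" and ra :: "int => int => 'v => 'u => 'v"
 assumes la_lin1: "y \<in> elts Y j ==> (%x. la i j x y) \<in> linear_maps (gr A i) (gr Y (i + j))"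
  and la_lin2: "x \<in> elts A i ==> la i j x \<in> linear_maps (gr Y j) (gr Y (i + j))"
  and ra_lin1: "x \<in> elts A j ==> (%y. ra i j y x) \<in> linear_maps (gr Y i) (gr Y (i + j))"
  and ra_lin2: "y \<in> elts Y i ==> ra i j y \<in> linear_maps (gr A j) (gr Y (i + j))"
  and la_assoc: "x \<in> elts A i ==> x' \<in> elts A j ==> y \<in> elts Y l ==>
   la (i + j) l (mul A i j x x') y = la i (j + l) x (la j l x' y)"
  and lra_assoc: "x \<in> elts A i ==> y \<in> elts Y j ==> x' \<in> elts A l ==>
   ra (i + j) l (la i j x y) x' = la i (j + l) x (ra j l y x')"
  and ra_assoc: "y \<in> elts Y i ==> x \<in> elts A j ==> x' \<in> elts A l ==>
   ra (i + j) l (ra i j y x) x' = ra i (j + l) y (mul A j l x x')"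
  and la_unit: "y \<in> elts Y j ==> la 0 j (unit A) y = y"
  and ra_unit: "y \<in> elts Y j ==> ra j 0 y (unit A) = y"
  and la_leibniz: "x \<in> elts A i ==> y \<in> elts Y j ==> dif Y (i + j) (la i j x y) =
    la (i - 1) j (dif A i x) y \<oplus>[gr Y (i + j - 1)] ((- 1) powi i) \<odot>[gr Y (i + j - 1)] la i (j - 1) x (dif Y j y)"
  and ra_leibniz: "y \<in> elts Y i ==> x \<in> elts A j ==> dif Y (i + j) (ra i j y x) =
    ra (i - 1) j (dif Y i y) x \<oplus>[gr Y (i + j - 1)] ((- 1) powi i) \<odot>[gr Y (i + j - 1)] ra i (j - 1) y (dif A j x)"
begin

definition sqz :: "('k, 'u \<times> 'v) dga" where
 "sqz = \<lparr>gr = (%n. \<lparr>carrier = elts A n \<times> elts Y n, monoid.mult = undefined, one = undefined,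
    ring.zero = (\<zero>[gr A n], \<zero>[gr Y n]),
    ring.add = (%p q. (fst p \<oplus>[gr A n] fst q, snd p \<oplus>[gr Y n] snd q)),
    module.smult = (%c p. (c \<odot>[gr A n] fst p, c \<odot>[gr Y n] snd p))\<rparr>),
   dif = (%n p. (dif A n (fst p), dif Y n (snd p))),
   mul = (%i j p q. (mul A i j (fst p) (fst q),
    la i j (fst p) (snd q) \<oplus>[gr Y (i + j)] ra i j (snd p) (fst q))),
   unit = (unit A, \<zero>[gr Y 0])\<rparr>"

lemma sqz_simps [simp]:
 "elts sqz n = elts A n \<times> elts Y n" "\<zero>[gr sqz n] = (\<zero>[gr A n], \<zero>[gr Y n])"
 "p \<oplus>[gr sqz n] q = (fst p \<oplus>[gr A n] fst q, snd p \<oplus>[gr Y n] snd q)"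
 "c \<odot>[gr sqz n] p = (c \<odot>[gr A n] fst p, c \<odot>[gr Y n] snd p)"
 "dif sqz n p = (dif A n (fst p), dif Y n (snd p))"
 "mul sqz i j p q = (mul A i j (fst p) (fst q), la i j (fst p) (snd q) \<oplus>[gr Y (i + j)] ra i j (snd p) (fst q))"
 "unit sqz = (unit A, \<zero>[gr Y 0])"
 by (simp_all add: sqz_def)

lemma la_closed: "x \<in> elts A i ==> y \<in> elts Y j ==> la i j x y \<in> elts Y (i + j)" by (rule lin_closed[OF la_lin2])
lemma ra_closed: "y \<in> elts Y i ==> x \<in> elts A j ==> ra i j y x \<in> elts Y (i + j)" by (rule lin_closed[OF ra_lin2])
lemma la_zero2: "x \<in> elts A i ==> la i j x \<zero>[gr Y j] = \<zero>[gr Y (i + j)]" by (rule lin_zero[OF Y.vs Y.vs la_lin2])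
lemma ra_zero1: "x \<in> elts A j ==> ra i j \<zero>[gr Y i] x = \<zero>[gr Y (i + j)]" by (rule lin_zero[OF Y.vs Y.vs ra_lin1])
lemma ra_zero2: "y \<in> elts Y i ==> ra i j y \<zero>[gr A j] = \<zero>[gr Y (i + j)]" by (rule lin_zero[OF vs Y.vs ra_lin2])

lemma Yadd_closed: "x \<in> elts Y i ==> y \<in> elts Y i ==> x \<oplus>[gr Y i] y \<in> elts Y i" using abelian_groupE(1)[OF Y.ag] by blast

lemma Yinterchange:
 assumes "a \<in> elts Y i" "b \<in> elts Y i" "c \<in> elts Y i" "d \<in> elts Y i"
 shows "(a \<oplus>[gr Y i] b) \<oplus>[gr Y i] (c \<oplus>[gr Y i] d) = (a \<oplus>[gr Y i] c) \<oplus>[gr Y i] (b \<oplus>[gr Y i] d)"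
proof -
 interpret abelian_group "gr Y i" by simp
 show ?thesis using assms by (simp add: a_ac)
qed

lemma sqz_vs: "vspace (gr sqz n)"
proof -
 interpret A: abelian_group "gr A n" by simp
 interpret Y': abelian_group "gr Y n" by simp
 show ?thesis
 proof (rule vspaceI)
  show "abelian_group (gr sqz n)"
  proof (rule abelian_groupI)
   fix p assume p: "p \<in> elts sqz n"
   then show "\<exists>q\<in>elts sqz n. q \<oplus>[gr sqz n] p = \<zero>[gr sqz n]"
    by (intro bexI[of _ "(\<ominus>[gr A n] fst p, \<ominus>[gr Y n] snd p)"]) (auto simp: A.l_neg Y'.l_neg)
  qed (auto simp: A.a_ac Y'.a_ac)
 qed (auto simp: vs_smult_closed vs_distl vs_distr vs_assoc vs_one)
qed

lemma sqz_dga: "dg_algebra sqz"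
proof (intro dg_algebra.intro dg_algebra_axioms.intro chain_complex.intro sqz_vs)
 show "dif sqz n \<in> linear_maps (gr sqz n) (gr sqz (n - 1))" for n
  by (rule linear_mapsI) (auto simp: d_add Y.d_add d_smult Y.d_smult)
 fix i j
 show "(%p. mul sqz i j p q) \<in> linear_maps (gr sqz i) (gr sqz (i + j))" if q: "q \<in> elts sqz j" for q
 proof (rule linear_mapsI)
  fix p assume p: "p \<in> elts sqz i"
  then have c: "mul A i j (fst p) (fst q) \<in> elts A (i + j)" "la i j (fst p) (snd q) \<in> elts Y (i + j)"
   "ra i j (snd p) (fst q) \<in> elts Y (i + j)" using q by (auto intro: la_closed ra_closed)
  then show "mul sqz i j p q \<in> elts sqz (i + j)" by (simp add: Yadd_closed)
  show "mul sqz i j (c \<odot>[gr sqz i] p) q = c \<odot>[gr sqz (i + j)] mul sqz i j p q" for c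
   using p q c by (auto simp: mul_smult_left lin_smult[OF la_lin1] lin_smult[OF ra_lin1] vs_distr)
  fix p' assume p': "p' \<in> elts sqz i"
  then have c': "la i j (fst p') (snd q) \<in> elts Y (i + j)" "ra i j (snd p') (fst q) \<in> elts Y (i + j)"
   using q by (auto intro: la_closed ra_closed)
  show "mul sqz i j (p \<oplus>[gr sqz i] p') q = mul sqz i j p q \<oplus>[gr sqz (i + j)] mul sqz i j p' q"
   using p p' q Yinterchange[OF c(2) c'(1) c(3) c'(2)]
   by (auto simp: mul_add_left lin_add[OF la_lin1] lin_add[OF ra_lin1])
 qed
 show "mul sqz i j p \<in> linear_maps (gr sqz j) (gr sqz (i + j))" if p: "p \<in> elts sqz i" for p
 proof (rule linear_mapsI)
  fix q assume q: "q \<in> elts sqz j"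
  then have c: "mul A i j (fst p) (fst q) \<in> elts A (i + j)" "la i j (fst p) (snd q) \<in> elts Y (i + j)"
   "ra i j (snd p) (fst q) \<in> elts Y (i + j)" using p by (auto intro: la_closed ra_closed)
  then show "mul sqz i j p q \<in> elts sqz (i + j)" by (simp add: Yadd_closed)
  show "mul sqz i j p (c \<odot>[gr sqz j] q) = c \<odot>[gr sqz (i + j)] mul sqz i j p q" for c
   using p q c by (auto simp: mul_smult_right lin_smult[OF la_lin2] lin_smult[OF ra_lin2] vs_distr)
  fix q' assume q': "q' \<in> elts sqz j"
  then have c': "la i j (fst p) (snd q') \<in> elts Y (i + j)" "ra i j (snd p) (fst q') \<in> elts Y (i + j)"
   using p by (auto intro: la_closed ra_closed)
  show "mul sqz i j p (q \<oplus>[gr sqz j] q') = mul sqz i j p q \<oplus>[gr sqz (i + j)] mul sqz i j p q'"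
   using p q q' Yinterchange[OF c(2) c'(1) c(3) c'(2)]
   by (auto simp: mul_add_right lin_add[OF la_lin2] lin_add[OF ra_lin2])
 qed
next
 fix p q r i j l assume "p \<in> elts sqz i" "q \<in> elts sqz j" "r \<in> elts sqz l"
 then have p: "fst p \<in> elts A i" "snd p \<in> elts Y i" "fst q \<in> elts A j" "snd q \<in> elts Y j" "fst r \<in> elts A l" "snd r \<in> elts Y l"
  by auto
 interpret S: abelian_group "gr Y (i + (j + l))" by simp
 have c: "la i (j + l) (fst p) (la j l (fst q) (snd r)) \<in> elts Y (i + (j + l))"
  "la i (j + l) (fst p) (ra j l (snd q) (fst r)) \<in> elts Y (i + (j + l))"
  "ra i (j + l) (snd p) (mul A j l (fst q) (fst r)) \<in> elts Y (i + (j + l))"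
  using p by (auto intro!: la_closed ra_closed)
 have "ra (i + j) l (la i j (fst p) (snd q) \<oplus>[gr Y (i + j)] ra i j (snd p) (fst q)) (fst r) =
   ra (i + j) l (la i j (fst p) (snd q)) (fst r) \<oplus>[gr Y (i + j + l)] ra (i + j) l (ra i j (snd p) (fst q)) (fst r)"
  using p by (intro lin_add[OF ra_lin1]) (auto intro: la_closed ra_closed)
 moreover have "la i (j + l) (fst p) (la j l (fst q) (snd r) \<oplus>[gr Y (j + l)] ra j l (snd q) (fst r)) =
   la i (j + l) (fst p) (la j l (fst q) (snd r)) \<oplus>[gr Y (i + (j + l))] la i (j + l) (fst p) (ra j l (snd q) (fst r))"
  using p by (intro lin_add[OF la_lin2]) (auto intro: la_closed ra_closed)
 ultimately show "mul sqz (i + j) l (mul sqz i j p q) r = mul sqz i (j + l) p (mul sqz j l q r)"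
  using p c by (simp add: mul_assoc la_assoc lra_assoc ra_assoc S.a_assoc) (simp add: add.assoc S.a_assoc)
next
 show "unit sqz \<in> elts sqz 0" using abelian_groupE(2)[OF Y.ag] by (simp add: unit_closed)
next
 fix p i assume "p \<in> elts sqz i"
 then have p: "fst p \<in> elts A i" "snd p \<in> elts Y i" by auto
 interpret S: abelian_group "gr Y i" by simp
 show "mul sqz 0 i (unit sqz) p = p"
  using p ra_zero1[OF p(1), of 0] by (simp add: unit_left la_unit)
 show "mul sqz i 0 p (unit sqz) = p"
  using p la_zero2[OF p(1), of 0] by (simp add: unit_right ra_unit)
 show "dif sqz (i - 1) (dif sqz i p) = \<zero>[gr sqz (i - 2)]" using p by (simp add: dif_dif Y.dif_dif)
next
 fix p q i j assume "p \<in> elts sqz i" "q \<in> elts sqz j"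
 then have p: "fst p \<in> elts A i" "snd p \<in> elts Y i" "fst q \<in> elts A j" "snd q \<in> elts Y j" by auto
 have ij: "i - 1 + j = i + j - 1" "i + (j - 1) = i + j - 1" by auto
 have c: "la (i - 1) j (dif A i (fst p)) (snd q) \<in> elts Y (i + j - 1)" "ra (i - 1) j (dif Y i (snd p)) (fst q) \<in> elts Y (i + j - 1)"
  "la i (j - 1) (fst p) (dif Y j (snd q)) \<in> elts Y (i + j - 1)" "ra i (j - 1) (snd p) (dif A j (fst q)) \<in> elts Y (i + j - 1)"
  using la_closed[OF d_closed[OF p(1)] p(4)] ra_closed[OF Y.d_closed[OF p(2)] p(3)]
   la_closed[OF p(1) Y.d_closed[OF p(4)]] ra_closed[OF p(2) d_closed[OF p(3)]] by (simp_all add: ij)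
 let ?s = "%y. ((- 1) powi i) \<odot>[gr Y (i + j - 1)] y"
 have "dif Y (i + j) (la i j (fst p) (snd q) \<oplus>[gr Y (i + j)] ra i j (snd p) (fst q)) =
  (la (i - 1) j (dif A i (fst p)) (snd q) \<oplus>[gr Y (i + j - 1)] ?s (la i (j - 1) (fst p) (dif Y j (snd q)))) \<oplus>[gr Y (i + j - 1)]
  (ra (i - 1) j (dif Y i (snd p)) (fst q) \<oplus>[gr Y (i + j - 1)] ?s (ra i (j - 1) (snd p) (dif A j (fst q))))"
  using p by (subst Y.d_add) (auto intro: la_closed ra_closed simp: la_leibniz ra_leibniz)
 also have "\<dots> = (la (i - 1) j (dif A i (fst p)) (snd q) \<oplus>[gr Y (i + j - 1)] ra (i - 1) j (dif Y i (snd p)) (fst q)) \<oplus>[gr Y (i + j - 1)]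
  ?s (la i (j - 1) (fst p) (dif Y j (snd q)) \<oplus>[gr Y (i + j - 1)] ra i (j - 1) (snd p) (dif A j (fst q)))"
  using c by (subst Yinterchange) (auto simp: vs_smult_closed vs_distr)
 finally show "dif sqz (i + j) (mul sqz i j p q) = mul sqz (i - 1) j (dif sqz i p) q
  \<oplus>[gr sqz (i + j - 1)] ((- 1) powi i) \<odot>[gr sqz (i + j - 1)] mul sqz i (j - 1) p (dif sqz j q)"
  using p by (simp add: leibniz ij)
qed

lemma sqz_cycles: "cycles sqz n = cycles A n \<times> cycles Y n" by (auto simp: cycles_def)
lemma sqz_boundaries: "boundaries sqz n = boundaries A n \<times> boundaries Y n" by (auto simp: boundaries_def image_iff)

end

text \<open>As a complex of left modules, a square-zero extension is an extension of \<open>A\<close> by \<open>Y\<close>, so a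
 linear system that is solvable in the homology of both is solvable in its homology.\<close>

locale square_zero_under = dg_bimodule A Y la ra + base: dga_under A R \<eta> + ext: dga_under "dg_bimodule.sqz A Y la ra" R \<theta>
 for A :: "('k::field, 'u) dga" and Y :: "('k, 'v) cplx" and la ra
  and R :: "('k, 'r) module" and \<eta> and \<theta> +
 assumes fst_\<theta>: "r \<in> carrier R ==> fst (\<theta> 0 r) = \<eta> 0 r"
begin

abbreviation "lY n r y \<equiv> la 0 n (\<eta> 0 r) y"

lemma left_action_Y: "left_action R (gr Y n) (lY n)"
proof -
 interpret S: abelian_group "gr Y n" by simp
 show ?thesis
 proof
  fix r b assume r: "r \<in> carrier R" and b: "b \<in> elts Y n"
  show "lY n r b \<in> elts Y n" using la_closed[OF base.eta_closed[OF r] b] by simp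
  show "lY n r (b \<oplus>[gr Y n] c) = lY n r b \<oplus>[gr Y n] lY n r c" if "c \<in> elts Y n" for c
   using lin_add[OF la_lin2[OF base.eta_closed[OF r]] b that] by simp
  show "lY n (r \<oplus>[R] s) b = lY n r b \<oplus>[gr Y n] lY n s b" if "s \<in> carrier R" for s
   using lin_add[OF la_lin1[OF b, of 0] base.eta_closed[OF r] base.eta_closed[OF that]] by (simp add: base.eta_add r that)
  show "lY n (r \<otimes>[R] s) b = lY n r (lY n s b)" if "s \<in> carrier R" for s
   using la_assoc[OF base.eta_closed[OF r] base.eta_closed[OF that] b] by (simp add: base.eta_mult r that)
 next
  fix b assume "b \<in> elts Y n"
  then show "lY n \<one>[R] b = b" by (simp add: base.eta_one la_unit)
 qed
qed

lemma solvable: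
 assumes hA: "homology_solvable A (left_act (A, \<eta>)) E E' a n" and hY: "homology_solvable Y lY E E' a n"
  and E: "finite E" and a: "\<And>e f. e \<in> E ==> f \<in> E' ==> a f e \<in> carrier R"
 shows "homology_solvable sqz (left_act (sqz, \<theta>)) E E' a n"
proof -
 interpret A': abelian_group "gr A n" by simp
 interpret Y': abelian_group "gr Y n" by simp
 interpret S': abelian_group "gr sqz n" using vs_group[OF sqz_vs] .
 interpret LA: left_action R "gr A n" "left_act (A, \<eta>) n" by (rule base.left_action_B)
 interpret LY: left_action R "gr Y n" "lY n" by (rule left_action_Y)
 interpret LS: left_action R "gr sqz n" "left_act (sqz, \<theta>) n" by (rule ext.left_action_B)
 let ?FA = "linear_system (gr A n) (left_act (A, \<eta>) n) E a"
 let ?FY = "linear_system (gr Y n) (lY n) E a"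
 let ?FS = "linear_system (gr sqz n) (left_act (sqz, \<theta>) n) E a"
 have \<theta>: "fst (\<theta> 0 r) = \<eta> 0 r" "snd (\<theta> 0 r) \<in> elts Y 0" if "r \<in> carrier R" for r
  using ext.eta_closed[OF that] fst_\<theta>[OF that] by auto
 have nat1: "fst (?FS b f) = ?FA (%e. fst (b e)) f" if "b \<in> E -> elts sqz n" "f \<in> E'" for b f
  using that E a by (intro system_natural[OF ext.left_action_B base.left_action_B])
   (auto simp: ext.lft base.lft \<theta>)
 have inj: "?FS (%e. (\<zero>[gr A n], y e)) f = (\<zero>[gr A n], ?FY y f)" if "y \<in> E -> elts Y n" "f \<in> E'" for y f
 proof -
  have "(\<zero>[gr A n], lY n r x) = left_act (sqz, \<theta>) n r (\<zero>[gr A n], x)" if "r \<in> carrier R" "x \<in> elts Y n" for r x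
   using that \<theta> la_closed[OF base.eta_closed[OF that(1)] that(2)] mul_zero_right[OF base.eta_closed[OF that(1)], of n]
    ra_zero2[OF \<theta>(2)[OF that(1)], of n]
   by (simp add: ext.lft)
  then show ?thesis
   using that E a by (intro system_natural[OF left_action_Y ext.left_action_B, symmetric, where \<phi> = "%y. (\<zero>[gr A n], y)"]) auto
 qed
 have natd: "dif sqz (n + 1) (linear_system (gr sqz (n + 1)) (left_act (sqz, \<theta>) (n + 1)) E a b f) = ?FS (%e. dif sqz (n + 1) (b e)) f"
  if "b \<in> E -> elts sqz (n + 1)" "f \<in> E'" for b f
  using that E a ext.d_closed'[of _ n] ext.lft_dif[of _ _ "n + 1"] ext.d_add[of _ "n + 1"]
  by (intro system_natural[OF ext.left_action_B ext.left_action_B]) (simp_all del: sqz_simps)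
 have sub: "p \<ominus>[gr sqz n] q = (fst p \<ominus>[gr A n] fst q, snd p \<ominus>[gr Y n] snd q)" if "p \<in> elts sqz n" "q \<in> elts sqz n" for p q
 proof -
  have "p = q \<oplus>[gr sqz n] (fst p \<ominus>[gr A n] fst q, snd p \<ominus>[gr Y n] snd q)"
   using that A'.diff_eq_iff[of "fst p" "fst q" "fst p \<ominus>[gr A n] fst q"] Y'.diff_eq_iff[of "snd p" "snd q" "snd p \<ominus>[gr Y n] snd q"]
   by (auto simp: prod_eq_iff)
  then show ?thesis using that S'.diff_eq_iff[of p q "(fst p \<ominus>[gr A n] fst q, snd p \<ominus>[gr Y n] snd q)"] by auto
 qed
 have cyc: "b \<in> I -> elts sqz n" if "b \<in> I -> cycles sqz n" for b and I :: "'x set"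
  using that by (auto simp: Pi_iff cycles_def)
 have FS: "?FS b f \<in> elts sqz n" if "b \<in> E -> elts sqz n" "f \<in> E'" for b f using that a by (intro LS.system_closed) auto
 have FA: "?FA b f \<in> elts A n" if "b \<in> E -> elts A n" "f \<in> E'" for b f using that a by (intro LA.system_closed) auto
 have FY: "?FY b f \<in> elts Y n" if "b \<in> E -> elts Y n" "f \<in> E'" for b f using that a by (intro LY.system_closed) auto
 show ?thesis unfolding homology_solvable_def
 proof (intro conjI ballI impI)
  fix b e assume b: "b \<in> E -> cycles sqz n" and bd: "\<forall>f\<in>E'. ?FS b f \<in> boundaries sqz n" and e: "e \<in> E"
  have "(%e. fst (b e)) \<in> E -> cycles A n" using b by (auto simp: sqz_cycles Pi_iff mem_Times_iff)
  moreover have "\<forall>f\<in>E'. ?FA (%e. fst (b e)) f \<in> boundaries A n"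
   using bd nat1[OF cyc[OF b]] by (auto simp: sqz_boundaries mem_Times_iff)
  ultimately have "\<forall>e\<in>E. fst (b e) \<in> boundaries A n" using hA unfolding homology_solvable_def by blast
  then have "\<forall>e\<in>E. \<exists>u. u \<in> elts A (n + 1) \<and> fst (b e) = dif A (n + 1) u" by (auto simp: boundaries_def)
  then obtain u where u: "\<And>e. e \<in> E ==> u e \<in> elts A (n + 1) \<and> fst (b e) = dif A (n + 1) (u e)" by metis
  define v where "v = (%e. (u e, \<zero>[gr Y (n + 1)]))"
  have v: "v \<in> E -> elts sqz (n + 1)" using u abelian_groupE(2)[OF Y.ag, of "n + 1"] by (auto simp: v_def)
  have dv: "dif sqz (n + 1) (v e) = (fst (b e), \<zero>[gr Y n])" if "e \<in> E" for e
   using u[OF that] Y.d_zero[of "n + 1"] by (simp add: v_def)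
  define y where "y = (%e. snd (b e))"
  have y: "y \<in> E -> elts Y n" "y \<in> E -> cycles Y n" using b by (auto simp: y_def sqz_cycles Pi_iff mem_Times_iff cycles_def)
  have "(\<zero>[gr A n], ?FY y f) \<in> boundaries sqz n" if f: "f \<in> E'" for f
  proof -
   have dvc: "(%e. dif sqz (n + 1) (v e)) \<in> E -> elts sqz n" using v ext.d_closed'[of _ n] by (simp add: Pi_iff del: sqz_simps)
   have z: "(%e. (\<zero>[gr A n], y e)) \<in> E -> elts sqz n" using y by auto
   have "?FS b f = ?FS (%e. dif sqz (n + 1) (v e) \<oplus>[gr sqz n] (\<zero>[gr A n], y e)) f"
    using a f cyc[OF b] dv y cyc[OF b]
    by (intro LS.system_cong[symmetric]) (auto simp: Pi_iff y_def mem_Times_iff prod_eq_iff)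
   also have "\<dots> = ?FS (%e. dif sqz (n + 1) (v e)) f \<oplus>[gr sqz n] ?FS (%e. (\<zero>[gr A n], y e)) f"
    using a f by (intro LS.system_add dvc z) auto
   finally have eq: "?FS b f \<ominus>[gr sqz n] ?FS (%e. dif sqz (n + 1) (v e)) f = ?FS (%e. (\<zero>[gr A n], y e)) f"
    using FS[OF cyc[OF b] f] FS[OF dvc f] FS[OF z f] by (subst S'.diff_eq_iff) auto
   have "?FS (%e. dif sqz (n + 1) (v e)) f \<in> boundaries sqz n"
    unfolding natd[OF v f, symmetric] boundaries_def using v a f
    by (intro imageI left_action.system_closed[OF ext.left_action_B]) auto
   then show ?thesis using ext.boundaries_ops(5)[OF bspec[OF bd f]] eq inj[OF y(1) f] by metis
  qed
  then have "\<forall>f\<in>E'. ?FY y f \<in> boundaries Y n" by (auto simp: sqz_boundaries)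
  then have "y e \<in> boundaries Y n" using hY y(2) e unfolding homology_solvable_def by blast
  then show "b e \<in> boundaries sqz n" using \<open>\<forall>e\<in>E. fst (b e) \<in> boundaries A n\<close> e
   by (simp add: sqz_boundaries mem_Times_iff y_def)
 next
  fix c assume c: "c \<in> E' -> cycles sqz n"
  have "(%f. fst (c f)) \<in> E' -> cycles A n" using c by (auto simp: sqz_cycles Pi_iff mem_Times_iff)
  then obtain u where u: "u \<in> E -> cycles A n" "\<forall>f\<in>E'. ?FA u f \<ominus>[gr A n] fst (c f) \<in> boundaries A n"
   using bspec[OF conjunct2[OF hA[unfolded homology_solvable_def]]] by blast
  define v where "v = (%e. (u e, \<zero>[gr Y n]))"
  have v: "v \<in> E -> cycles sqz n" using u(1) Y.cycles_ops(1) by (auto simp: v_def sqz_cycles)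
  have Fv: "?FS v f \<in> cycles sqz n" if f: "f \<in> E'" for f
  proof -
   have "dif sqz n (?FS v f) = linear_system (gr sqz (n - 1)) (left_act (sqz, \<theta>) (n - 1)) E a (%e. dif sqz n (v e)) f"
    using cyc[OF v] E a f ext.d_closed[of _ n] ext.lft_dif[of _ _ n] ext.d_add[of _ n]
    by (intro system_natural[OF ext.left_action_B ext.left_action_B]) (simp_all del: sqz_simps)
   also have "\<dots> = linear_system (gr sqz (n - 1)) (left_act (sqz, \<theta>) (n - 1)) E a (%e. \<zero>[gr sqz (n - 1)]) f"
    using v a f abelian_groupE(2)[OF ext.ag, of "n - 1"]
    by (intro left_action.system_cong[OF ext.left_action_B]) (auto simp: cycles_def Pi_iff simp del: sqz_simps)
   also have "\<dots> = \<zero>[gr sqz (n - 1)]" using a f by (intro left_action.system_zero[OF ext.left_action_B]) auto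
   finally show ?thesis using FS[OF cyc[OF v] f] by (simp add: cycles_def del: sqz_simps)
  qed
  define z where "z = (%f. c f \<ominus>[gr sqz n] ?FS v f)"
  have z: "z f \<in> cycles sqz n" if "f \<in> E'" for f
   unfolding z_def using c that Fv[OF that] by (intro ext.cycles_ops(4)) auto
  then have "(%f. snd (z f)) \<in> E' -> cycles Y n" by (auto simp: sqz_cycles mem_Times_iff)
  then obtain y where y: "y \<in> E -> cycles Y n" "\<forall>f\<in>E'. ?FY y f \<ominus>[gr Y n] snd (z f) \<in> boundaries Y n"
   using bspec[OF conjunct2[OF hY[unfolded homology_solvable_def]]] by blast
  have y': "y \<in> E -> elts Y n" using y(1) by (auto simp: cycles_def)
  have u': "u \<in> E -> elts A n" using u(1) by (auto simp: cycles_def)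
  show "\<exists>b\<in>E -> cycles sqz n. \<forall>f\<in>E'. ?FS b f \<ominus>[gr sqz n] c f \<in> boundaries sqz n"
  proof (intro bexI ballI)
   show b: "(%e. (u e, y e)) \<in> E -> cycles sqz n" using u(1) y(1) by (auto simp: sqz_cycles)
   fix f assume f: "f \<in> E'"
   have zy: "(%e. (\<zero>[gr A n], y e)) \<in> E -> elts sqz n" using y' by auto
   have "?FS (%e. (u e, y e)) f = ?FS (%e. v e \<oplus>[gr sqz n] (\<zero>[gr A n], y e)) f"
    using a f cyc[OF b] u' y' by (intro LS.system_cong[symmetric]) (auto simp: v_def Pi_iff)
   also have "\<dots> = ?FS v f \<oplus>[gr sqz n] (\<zero>[gr A n], ?FY y f)"
    unfolding inj[OF y' f, symmetric] using a f cyc[OF v] zy by (intro LS.system_add) auto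
   finally have eq: "?FS (%e. (u e, y e)) f = (fst (?FS v f), snd (?FS v f) \<oplus>[gr Y n] ?FY y f)"
    using FS[OF cyc[OF v] f] by auto
   have cf: "c f \<in> elts sqz n" using cyc[OF c] f by auto
   have Fvf: "?FS v f \<in> elts sqz n" by (rule FS[OF cyc[OF v] f])
   have zf: "snd (z f) = snd (c f) \<ominus>[gr Y n] snd (?FS v f)" unfolding z_def sub[OF cf Fvf] by simp
   have 1: "fst (?FS v f) \<ominus>[gr A n] fst (c f) \<in> boundaries A n"
    using u(2) f nat1[OF cyc[OF v] f] by (simp add: v_def)
   have m: "fst (?FS v f) \<in> elts A n" "snd (?FS v f) \<in> elts Y n" "fst (c f) \<in> elts A n" "snd (c f) \<in> elts Y n"
    using Fvf cf by auto
   have "(snd (?FS v f) \<oplus>[gr Y n] ?FY y f) \<ominus>[gr Y n] snd (c f) = ?FY y f \<ominus>[gr Y n] snd (z f)"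
    unfolding zf using m FY[OF y' f] by (simp add: a_minus_def Y'.minus_add Y'.a_ac)
   then have 2: "(snd (?FS v f) \<oplus>[gr Y n] ?FY y f) \<ominus>[gr Y n] snd (c f) \<in> boundaries Y n" using y(2) f by simp
   have "?FS (%e. (u e, y e)) f \<in> elts sqz n" by (rule FS[OF cyc[OF b] f])
   from sub[OF this cf] show "?FS (%e. (u e, y e)) f \<ominus>[gr sqz n] c f \<in> boundaries sqz n"
    using 1 2 by (simp add: eq sqz_boundaries)
  qed
 qed
qed

end

section \<open>The bimodule \<open>C \<otimes> k\<^sup>J \<otimes> H\<^sub>0(C)\<close>\<close>

context dg_algebra begin

lemma sign_square: "((- 1) powi i) * ((- 1) powi i) = (1 :: 'k)"
 by (simp add: power_int_mult_distrib[symmetric])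

lemma boundary_mul_left:
 assumes "b \<in> boundaries A i" "x \<in> cycles A j" shows "mul A i j b x \<in> boundaries A (i + j)"
proof -
 interpret M: abelian_group "gr A (i + j)" by simp
 obtain u where u: "u \<in> elts A (i + 1)" "b = dif A (i + 1) u" using assms(1) by (auto simp: boundaries_def)
 have x: "x \<in> elts A j" "dif A j x = \<zero>[gr A (j - 1)]" using assms(2) by (auto simp: cycles_def)
 have ij: "i + 1 + j = i + j + 1" "i + 1 + (j - 1) = i + j" by auto
 have m: "mul A (i + 1) (j - 1) u \<zero>[gr A (j - 1)] = \<zero>[gr A (i + j)]" using mul_zero_right[OF u(1), of "j - 1"] by (simp add: ij)
 have b: "b \<in> elts A i" using boundaries_elts[OF assms(1)] .
 have "dif A (i + j + 1) (mul A (i + 1) j u x) = mul A i j b x"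
  using leibniz[OF u(1) x(1)] x u(2) mul_closed[OF b x(1)] by (simp add: ij m vs_smult_zero)
 moreover have "mul A (i + 1) j u x \<in> elts A (i + j + 1)" using mul_closed[OF u(1) x(1)] by (simp add: ij)
 ultimately show ?thesis unfolding boundaries_def by (metis imageI)
qed

lemma boundary_mul_right:
 assumes "x \<in> cycles A i" "b \<in> boundaries A j" shows "mul A i j x b \<in> boundaries A (i + j)"
proof -
 interpret M: abelian_group "gr A (i + j)" by simp
 obtain u where u: "u \<in> elts A (j + 1)" "b = dif A (j + 1) u" using assms(2) by (auto simp: boundaries_def)
 have x: "x \<in> elts A i" "dif A i x = \<zero>[gr A (i - 1)]" using assms(1) by (auto simp: cycles_def)
 have ij: "i + (j + 1) = i + j + 1" "i - 1 + (j + 1) = i + j" by auto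
 have m: "mul A (i - 1) (j + 1) \<zero>[gr A (i - 1)] u = \<zero>[gr A (i + j)]" using mul_zero_left[OF u(1), of "i - 1"] by (simp add: ij)
 have b: "b \<in> elts A j" using boundaries_elts[OF assms(2)] .
 have "dif A (i + j + 1) (mul A i (j + 1) x u) = ((- 1) powi i) \<odot>[gr A (i + j)] mul A i j x b"
  using leibniz[OF x(1) u(1)] x u(2) mul_closed[OF x(1) b] vs_smult_closed[OF vs mul_closed[OF x(1) b]]
  by (simp add: ij m add.assoc[symmetric])
 moreover have "mul A i (j + 1) x u \<in> elts A (i + j + 1)" using mul_closed[OF x(1) u(1)] by (simp add: ij)
 ultimately have "((- 1) powi i) \<odot>[gr A (i + j)] mul A i j x b \<in> boundaries A (i + j)"
  unfolding boundaries_def by (metis imageI)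
 from boundaries_ops(3)[OF this, of "(- 1) powi i"] show ?thesis
  using mul_closed[OF x(1) b] by (simp add: vs_assoc sign_square vs_one)
qed

end

locale connective_under = dga_under C R \<eta> for C :: "('k::field, 'u) dga" and R :: "('k, 'r) module" and \<eta> +
 assumes negative: "n < 0 ==> elts C n = {\<zero>[gr C n]}"
begin

lemma dif_0: "x \<in> elts C 0 ==> dif C 0 x = \<zero>[gr C (- 1)]"
 using d_closed[of x 0] negative[of "-1"] by simp

lemma cycles_0: "cycles C 0 = elts C 0"
 using dif_0 by (auto simp: cycles_def)

text \<open>The dual of \<open>H\<^sub>0(C)\<close>, as functionals on \<open>C\<^sub>0\<close>; extending them by zero makes their equality
 that of functions.\<close>

definition dual :: "('u => 'k) set" where
 "dual = {h. linear_functional (gr C 0) h \<and> (\<forall>b\<in>boundaries C 0. h b = 0) \<and> (\<forall>t. t \<notin> elts C 0 --> h t = 0)}"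

text \<open>The two actions of \<open>C\<^sub>0\<close> on the dual of \<open>H\<^sub>0(C)\<close>, which are transposes of multiplication.\<close>

definition dual_right :: "('u => 'k) => 'u => 'u => 'k" where
 "dual_right h c t = (if t \<in> elts C 0 then h (mul C 0 0 t c) else 0)"

definition dual_left :: "'u => ('u => 'k) => 'u => 'k" where
 "dual_left c h t = (if t \<in> elts C 0 then h (mul C 0 0 c t) else 0)"

lemma mul0: "s \<in> elts C 0 ==> t \<in> elts C 0 ==> mul C 0 0 s t \<in> elts C 0" using mul_closed[of s 0 t 0] by simp

lemma dualD:
 assumes "h \<in> dual"
 shows "s \<in> elts C 0 ==> t \<in> elts C 0 ==> h (s \<oplus>[gr C 0] t) = h s + h t"
  "t \<in> elts C 0 ==> h (a \<odot>[gr C 0] t) = a * h t" "b \<in> boundaries C 0 ==> h b = 0" "t \<notin> elts C 0 ==> h t = 0"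
 using assms by (auto simp: dual_def linear_functional_def)

lemma dual_right_closed: assumes h: "h \<in> dual" and c: "c \<in> elts C 0" shows "dual_right h c \<in> dual"
 unfolding dual_def linear_functional_def
proof (intro CollectI conjI ballI allI impI)
 fix s t assume "s \<in> elts C 0" "t \<in> elts C 0"
 then show "dual_right h c (s \<oplus>[gr C 0] t) = dual_right h c s + dual_right h c t"
  using mul_add_left[of s 0 t c 0] c by (simp add: dual_right_def add_closed dualD[OF h] mul0)
next
 fix a t assume "t \<in> elts C 0"
 then show "dual_right h c (a \<odot>[gr C 0] t) = a * dual_right h c t"
  using mul_smult_left[of t 0 c 0 a] c by (simp add: dual_right_def vs_smult_closed dualD[OF h] mul0)
next
 fix b assume b: "b \<in> boundaries C 0"
 then show "dual_right h c b = 0"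
  using boundary_mul_left[OF b, of c 0] c boundaries_elts[OF b] by (simp add: dual_right_def cycles_0 dualD[OF h])
qed (simp add: dual_right_def)

lemma dual_left_closed: assumes h: "h \<in> dual" and c: "c \<in> elts C 0" shows "dual_left c h \<in> dual"
 unfolding dual_def linear_functional_def
proof (intro CollectI conjI ballI allI impI)
 fix s t assume "s \<in> elts C 0" "t \<in> elts C 0"
 then show "dual_left c h (s \<oplus>[gr C 0] t) = dual_left c h s + dual_left c h t"
  using mul_add_right[of c 0 s 0 t] c by (simp add: dual_left_def add_closed dualD[OF h] mul0)
next
 fix a t assume "t \<in> elts C 0"
 then show "dual_left c h (a \<odot>[gr C 0] t) = a * dual_left c h t"
  using mul_smult_right[of c 0 t 0 a] c by (simp add: dual_left_def vs_smult_closed dualD[OF h] mul0)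
next
 fix b assume b: "b \<in> boundaries C 0"
 then show "dual_left c h b = 0"
  using boundary_mul_right[of c 0 b 0] c boundaries_elts[OF b] by (simp add: dual_left_def cycles_0 dualD[OF h])
qed (simp add: dual_left_def)

lemma dual_right_right:
 "c \<in> elts C 0 ==> c' \<in> elts C 0 ==> dual_right (dual_right h c') c = dual_right h (mul C 0 0 c c')"
 using mul_assoc[of _ 0 c 0 c' 0] by (intro ext) (simp add: dual_right_def mul0)

lemma dual_right_left:
 "c \<in> elts C 0 ==> c' \<in> elts C 0 ==> dual_right (dual_left c h) c' = dual_left c (dual_right h c')"
 using mul_assoc[of c 0 _ 0 c' 0] by (intro ext) (simp add: dual_right_def dual_left_def mul0)

lemma dual_right_unit: "h \<in> dual ==> dual_right h (unit C) = h"
 by (intro ext) (simp add: dual_right_def unit_right dualD)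

lemma dual_right_add: "h \<in> dual ==> c \<in> elts C 0 ==> c' \<in> elts C 0 ==>
  dual_right h (c \<oplus>[gr C 0] c') = (%t. dual_right h c t + dual_right h c' t)"
 using mul_add_right[of _ 0 c 0 c'] by (intro ext) (simp add: dual_right_def dualD mul0)

lemma dual_right_smult: "h \<in> dual ==> c \<in> elts C 0 ==> dual_right h (a \<odot>[gr C 0] c) = (%t. a * dual_right h c t)"
 using mul_smult_right[of _ 0 c 0 a] by (intro ext) (simp add: dual_right_def dualD mul0)

lemma dual_right_boundary: "h \<in> dual ==> c \<in> boundaries C 0 ==> dual_right h c = (%_. 0)"
 using boundary_mul_right[of _ 0 c 0] by (intro ext) (simp add: dual_right_def dualD cycles_0)

subsection \<open>Functions of finite rank\<close>

text \<open>The tensor \<open>c \<otimes> v\<^sub>i \<otimes> t\<close> is represented by the function that sends \<open>(i, h)\<close> to \<open>h(t) c\<close> and the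
 other pairs to zero.  On functions, both actions and the differential are given pointwise.\<close>

definition rank_one :: "int => nat => 'u => 'u => nat \<times> ('u => 'k) => 'u" where
 "rank_one n i t c p = (if fst p = i \<and> snd p \<in> dual then snd p t \<odot>[gr C n] c else \<zero>[gr C n])"

inductive_set finite_rank :: "nat set => int => 'u set => (nat \<times> ('u => 'k) => 'u) set" for J n W where
 finite_rank_zero: "(%p. \<zero>[gr C n]) \<in> finite_rank J n W"
| finite_rank_step: "y \<in> finite_rank J n W ==> i \<in> J ==> t \<in> elts C 0 ==> c \<in> W ==>
  (%p. y p \<oplus>[gr C n] rank_one n i t c p) \<in> finite_rank J n W"

abbreviation "fr J n \<equiv> finite_rank J n (elts C n)"

lemma zero_closed: "\<zero>[gr C n] \<in> elts C n" using abelian_groupE(2)[OF ag] .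
lemma l_zero: "x \<in> elts C n ==> \<zero>[gr C n] \<oplus>[gr C n] x = x" using abelian_groupE(5)[OF ag] .
lemma r_zero: "x \<in> elts C n ==> x \<oplus>[gr C n] \<zero>[gr C n] = x"
 using abelian_monoid.r_zero[OF abelian_group.axioms(1)[OF ag]] .
lemma a_assoc: "x \<in> elts C n ==> y \<in> elts C n ==> z \<in> elts C n ==>
  (x \<oplus>[gr C n] y) \<oplus>[gr C n] z = x \<oplus>[gr C n] (y \<oplus>[gr C n] z)"
 using abelian_groupE(3)[OF ag] .
lemma interchange:
 assumes "a \<in> elts C n" "b \<in> elts C n" "c \<in> elts C n" "d \<in> elts C n"
 shows "(a \<oplus>[gr C n] b) \<oplus>[gr C n] (c \<oplus>[gr C n] d) = (a \<oplus>[gr C n] c) \<oplus>[gr C n] (b \<oplus>[gr C n] d)"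
proof -
 interpret abelian_group "gr C n" by simp
 show ?thesis using assms by (simp add: a_ac)
qed

lemma rank_one_closed: "c \<in> elts C n ==> rank_one n i t c p \<in> elts C n"
 by (simp add: rank_one_def vs_smult_closed zero_closed)

lemma rank_one_in: "i \<in> J ==> t \<in> elts C 0 ==> c \<in> W ==> W \<subseteq> elts C n ==> rank_one n i t c \<in> finite_rank J n W"
 using finite_rank_step[OF finite_rank_zero, of i J t c W n] by (simp add: l_zero rank_one_closed subset_iff)

lemma fr_value: "y \<in> finite_rank J n W ==> W \<subseteq> elts C n ==> y p \<in> elts C n"
proof (induction arbitrary: p rule: finite_rank.induct)
 case (finite_rank_step y i t c)
 then have "y p \<in> elts C n" "c \<in> elts C n" by blast+
 then show ?case by (intro add_closed rank_one_closed)
qed (simp add: zero_closed)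

lemma fr_mono: "y \<in> finite_rank J n W ==> W \<subseteq> W' ==> y \<in> finite_rank J n W'"
 by (induction rule: finite_rank.induct) (auto intro: finite_rank.intros)

lemma fr_off: "y \<in> fr J n ==> snd p \<notin> dual ==> y p = \<zero>[gr C n]"
 by (induction rule: finite_rank.induct) (auto simp: rank_one_def l_zero zero_closed)

lemma dual_add: "h \<in> dual ==> h' \<in> dual ==> (%t. h t + h' t) \<in> dual"
 by (auto simp: dual_def linear_functional_def algebra_simps)
lemma dual_smult: "h \<in> dual ==> (%t. a * h t) \<in> dual"
 by (auto simp: dual_def linear_functional_def algebra_simps)

lemma fr_dual_add:
 "y \<in> fr J n ==> h \<in> dual ==> h' \<in> dual ==> y (i, %t. h t + h' t) = y (i, h) \<oplus>[gr C n] y (i, h')"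
proof (induction rule: finite_rank.induct)
 case (finite_rank_step y i' t c)
 have "rank_one n i' t c (i, %t. h t + h' t) = rank_one n i' t c (i, h) \<oplus>[gr C n] rank_one n i' t c (i, h')"
  using finite_rank_step by (simp add: rank_one_def dual_add vs_distl l_zero zero_closed)
 then show ?case using finite_rank_step
  by (simp add: interchange fr_value rank_one_closed)
qed (simp add: l_zero zero_closed)

lemma fr_dual_smult: "y \<in> fr J n ==> h \<in> dual ==> y (i, %t. a * h t) = a \<odot>[gr C n] y (i, h)"
proof (induction rule: finite_rank.induct)
 case (finite_rank_step y i' t c)
 have "rank_one n i' t c (i, %t. a * h t) = a \<odot>[gr C n] rank_one n i' t c (i, h)"
  using finite_rank_step by (simp add: rank_one_def dual_smult vs_assoc vs_smult_zero)
 then show ?case using finite_rank_step by (simp add: vs_distr fr_value rank_one_closed)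
qed (simp add: vs_smult_zero)

lemma zero_dual: "(%_. 0) \<in> dual" by (simp add: dual_def linear_functional_def)

lemma fr_dual_zero: assumes "y \<in> fr J n" shows "y (i, %_. 0) = \<zero>[gr C n]"
 using fr_dual_smult[OF assms zero_dual, of i 0] fr_value[OF assms] by (simp add: vs_zero_scalar)

lemma fr_add:
 assumes "y' \<in> finite_rank J n W" "y \<in> finite_rank J n W" and W: "W \<subseteq> elts C n"
 shows "(%p. y p \<oplus>[gr C n] y' p) \<in> finite_rank J n W"
 using assms(1)
proof (induction rule: finite_rank.induct)
 case finite_rank_zero then show ?case using assms(2) by (simp add: r_zero fr_value[OF assms(2) W])
next
 case (finite_rank_step y' i t c)
 have "(%p. y p \<oplus>[gr C n] (y' p \<oplus>[gr C n] rank_one n i t c p)) = (%p. (y p \<oplus>[gr C n] y' p) \<oplus>[gr C n] rank_one n i t c p)"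
  using finite_rank_step W assms(2) by (intro ext) (auto simp: a_assoc fr_value rank_one_closed subset_iff)
 then show ?case using finite_rank.finite_rank_step[OF finite_rank_step.IH] finite_rank_step by simp
qed

lemma fr_map:
 assumes "y \<in> finite_rank J n W" and W: "W \<subseteq> elts C n" and \<phi>: "\<phi> \<in> linear_maps (gr C n) (gr C k)" "\<And>x. x \<in> W ==> \<phi> x \<in> W'"
 shows "(%p. \<phi> (y p)) \<in> finite_rank J k W'"
 using assms(1)
proof (induction rule: finite_rank.induct)
 case finite_rank_zero show ?case using lin_zero[OF vs vs \<phi>(1)] by (simp add: finite_rank.finite_rank_zero)
next
 case (finite_rank_step y i t c)
 then have c: "c \<in> elts C n" using W by blast
 have "\<phi> (y p \<oplus>[gr C n] rank_one n i t c p) = \<phi> (y p) \<oplus>[gr C k] rank_one k i t (\<phi> c) p" for p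
  using lin_add[OF \<phi>(1) fr_value[OF finite_rank_step(1) W] rank_one_closed[OF c]] lin_smult[OF \<phi>(1) c] lin_zero[OF vs vs \<phi>(1)]
  by (simp add: rank_one_def)
 then show ?case using finite_rank.finite_rank_step[OF finite_rank_step.IH _ _ \<phi>(2)] finite_rank_step by simp
qed

lemma fr_smult: "y \<in> fr J n ==> (%p. a \<odot>[gr C n] y p) \<in> fr J n"
 by (rule fr_map[of y J n "elts C n"])
  (auto intro!: linear_mapsI simp: vs_smult_closed vs_distr vs_assoc mult.commute)

lemma fr_right:
 assumes "y \<in> fr J n" and s: "s \<in> elts C 0"
 shows "(%p. if snd p \<in> dual then y (fst p, dual_right (snd p) s) else \<zero>[gr C n]) \<in> fr J n"
 using assms(1)
proof (induction rule: finite_rank.induct)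
 case finite_rank_zero show ?case using finite_rank.finite_rank_zero by simp
next
 case (finite_rank_step y i t c)
 have "(%p. if snd p \<in> dual then y (fst p, dual_right (snd p) s) \<oplus>[gr C n] rank_one n i t c (fst p, dual_right (snd p) s) else \<zero>[gr C n]) =
  (%p. (if snd p \<in> dual then y (fst p, dual_right (snd p) s) else \<zero>[gr C n]) \<oplus>[gr C n] rank_one n i (mul C 0 0 t s) c p)"
  using finite_rank_step s dual_right_closed[OF _ s]
  by (intro ext) (auto simp: rank_one_def dual_right_def l_zero zero_closed)
 then show ?case using finite_rank.finite_rank_step[OF finite_rank_step.IH, of i "mul C 0 0 t s" c] finite_rank_step s by (simp add: mul0)
qed

subsection \<open>The dg bimodule\<close>

definition fr_cplx :: "nat set => ('k, nat \<times> ('u => 'k) => 'u) cplx" where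
 "fr_cplx J = \<lparr>gr = (%n. \<lparr>carrier = fr J n, monoid.mult = undefined, one = undefined,
   ring.zero = (%p. \<zero>[gr C n]), ring.add = (%y y' p. y p \<oplus>[gr C n] y' p),
   module.smult = (%a y p. a \<odot>[gr C n] y p)\<rparr>),
  dif = (%n y p. dif C n (y p))\<rparr>"

lemma fr_cplx_simps [simp]:
 "elts (fr_cplx J) n = fr J n" "\<zero>[gr (fr_cplx J) n] = (%p. \<zero>[gr C n])"
 "y \<oplus>[gr (fr_cplx J) n] y' = (%p. y p \<oplus>[gr C n] y' p)" "a \<odot>[gr (fr_cplx J) n] y = (%p. a \<odot>[gr C n] y p)"
 "dif (fr_cplx J) n y = (%p. dif C n (y p))"
 by (simp_all add: fr_cplx_def)

definition fr_left :: "int => int => 'u => (nat \<times> ('u => 'k) => 'u) => nat \<times> ('u => 'k) => 'u" where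
 "fr_left i j x y p = mul C i j x (y p)"

text \<open>The right action factors through \<open>C \<rightarrow> H\<^sub>0(C)\<close>, so that it is zero in degrees other than \<open>0\<close>.  The tensor factor
 \<open>t \<in> H\<^sub>0(C)\<close> appears as the evaluation \<open>h \<mapsto> h(t)\<close>, and is multiplied by transposing \<open>h\<close>.\<close>

definition fr_right :: "int => int => (nat \<times> ('u => 'k) => 'u) => 'u => nat \<times> ('u => 'k) => 'u" where
 "fr_right i j y x p = (if j = 0 \<and> snd p \<in> dual then y (fst p, dual_right (snd p) x) else \<zero>[gr C (i + j)])"

lemma value_closed: "y \<in> fr J n ==> y p \<in> elts C n" by (rule fr_value) auto

lemma fr_left_closed: "x \<in> elts C i ==> y \<in> fr J j ==> fr_left i j x y \<in> fr J (i + j)"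
 using fr_map[of y J j "elts C j" "mul C i j x" "i + j" "elts C (i + j)", OF _ subset_refl mul_linear_right]
 by (simp add: fr_left_def[abs_def])

lemma fr_right_closed: "y \<in> fr J i ==> x \<in> elts C j ==> fr_right i j y x \<in> fr J (i + j)"
 using fr_right[of y J i x] finite_rank_zero[of "i + j" J "elts C (i + j)"]
 by (cases "j = 0") (simp_all add: fr_right_def[abs_def] cong: if_cong)

lemma fr_cplx: "chain_complex (fr_cplx J)"
proof (rule chain_complex.intro)
 show "vspace (gr (fr_cplx J) n)" for n
 proof (rule vspaceI)
  interpret A: abelian_group "gr C n" by simp
  show "abelian_group (gr (fr_cplx J) n)"
  proof (rule abelian_groupI)
   fix y assume "y \<in> elts (fr_cplx J) n"
   then have y: "y \<in> fr J n" by simp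
   have "(-1) \<odot>[gr C n] y p \<oplus>[gr C n] y p = \<zero>[gr C n]" for p
    using A.l_neg[OF value_closed[OF y, of p]] vs_minus[OF vs value_closed[OF y, of p]] by simp
   then show "\<exists>z\<in>elts (fr_cplx J) n. z \<oplus>[gr (fr_cplx J) n] y = \<zero>[gr (fr_cplx J) n]"
    by (intro bexI[of _ "%p. (-1) \<odot>[gr C n] y p"]) (simp_all add: fr_smult[OF y])
  qed (auto intro: fr_add finite_rank_zero simp: value_closed A.a_ac)
 qed (auto intro: fr_smult simp: value_closed vs_distl vs_distr vs_assoc vs_one)
 show "dif (fr_cplx J) n \<in> linear_maps (gr (fr_cplx J) n) (gr (fr_cplx J) (n - 1))" for n
  by (rule linear_mapsI)
   (auto intro!: fr_map[of _ J n "elts C n" "dif C n" "n - 1" "elts C (n - 1)", OF _ subset_refl d_lin]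
    simp: d_add d_smult value_closed)
 show "dif (fr_cplx J) (n - 1) (dif (fr_cplx J) n y) = \<zero>[gr (fr_cplx J) (n - 2)]" if "y \<in> elts (fr_cplx J) n" for n y
  using that by (auto simp: value_closed dif_dif)
qed

lemma product_degree_zero:
 assumes "x \<in> elts C j" "x' \<in> elts C l" "j + l = 0" "j \<noteq> 0" shows "mul C j l x x' = \<zero>[gr C 0]"
proof (cases "j < 0")
 case True
 then have "x = \<zero>[gr C j]" using assms(1) negative by auto
 then show ?thesis using mul_zero_left[OF assms(2), of j] assms(3) by simp
next
 case False
 then have "x' = \<zero>[gr C l]" using assms negative[of l] by auto
 then show ?thesis using mul_zero_right[OF assms(1), of l] assms(3) by simp
qed

lemma fr_bimodule: "dg_bimodule C (fr_cplx J) fr_left fr_right"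
proof (intro dg_bimodule.intro dg_bimodule_axioms.intro fr_cplx closed_dga_axioms)
 fix i j
 show "(%x. fr_left i j x y) \<in> linear_maps (gr C i) (gr (fr_cplx J) (i + j))" if "y \<in> elts (fr_cplx J) j" for y
  using that by (intro linear_mapsI) (auto simp: fr_left_closed fr_left_def mul_add_left mul_smult_left value_closed)
 show "fr_left i j x \<in> linear_maps (gr (fr_cplx J) j) (gr (fr_cplx J) (i + j))" if "x \<in> elts C i" for x
  using that by (intro linear_mapsI) (auto simp: fr_left_closed fr_left_def mul_add_right mul_smult_right value_closed)
 show "(%y. fr_right i j y x) \<in> linear_maps (gr (fr_cplx J) i) (gr (fr_cplx J) (i + j))" if "x \<in> elts C j" for x
  using that by (intro linear_mapsI) (auto simp: fr_right_closed fr_right_def l_zero zero_closed vs_smult_zero)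
 show "fr_right i j y \<in> linear_maps (gr C j) (gr (fr_cplx J) (i + j))" if "y \<in> elts (fr_cplx J) i" for y
 proof (rule linear_mapsI)
  have y: "y \<in> fr J i" using that by simp
  fix x assume x: "x \<in> elts C j"
  show "fr_right i j y x \<in> elts (fr_cplx J) (i + j)" using fr_right_closed[OF y x] by simp
  show "fr_right i j y (a \<odot>[gr C j] x) = a \<odot>[gr (fr_cplx J) (i + j)] fr_right i j y x" for a
   using x by (intro ext) (auto simp: fr_right_def dual_right_smult fr_dual_smult[OF y] dual_right_closed vs_smult_zero)
  show "fr_right i j y (x \<oplus>[gr C j] x') = fr_right i j y x \<oplus>[gr (fr_cplx J) (i + j)] fr_right i j y x'" if "x' \<in> elts C j" for x'
   using x that by (intro ext) (auto simp: fr_right_def dual_right_add fr_dual_add[OF y] dual_right_closed l_zero zero_closed)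
 qed
 fix l x y x'
 show "fr_left (i + j) l (mul C i j x x') y = fr_left i (j + l) x (fr_left j l x' y)"
  if "x \<in> elts C i" "x' \<in> elts C j" "y \<in> elts (fr_cplx J) l"
  using that by (intro ext) (auto simp: fr_left_def mul_assoc value_closed)
 show "fr_right (i + j) l (fr_left i j x y) x' = fr_left i (j + l) x (fr_right j l y x')"
  if "x \<in> elts C i" "y \<in> elts (fr_cplx J) j" "x' \<in> elts C l"
  using that mul_zero_right[of x i "j + l"] by (intro ext) (auto simp: fr_left_def fr_right_def add.assoc)
 show "fr_right (i + j) l (fr_right i j y x) x' = fr_right i (j + l) y (mul C j l x x')"
  if "y \<in> elts (fr_cplx J) i" "x \<in> elts C j" "x' \<in> elts C l"
 proof (rule ext)
  fix p
  show "fr_right (i + j) l (fr_right i j y x) x' p = fr_right i (j + l) y (mul C j l x x') p"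
  proof (cases "j = 0 \<and> l = 0")
   case True then show ?thesis using that by (auto simp: fr_right_def dual_right_right dual_right_closed)
  next
   case False
   have "fr_right i (j + l) y (mul C j l x x') p = \<zero>[gr C (i + (j + l))]"
   proof (cases "j + l = 0")
    case True
    then have "mul C j l x x' = \<zero>[gr C 0]" using False that by (intro product_degree_zero) auto
    then show ?thesis using True that(1) boundaries_ops(1)[of 0]
     by (auto simp: fr_right_def dual_right_boundary fr_dual_zero)
   qed (simp add: fr_right_def)
   then show ?thesis using False by (auto simp: fr_right_def add.assoc)
  qed
 qed
next
 fix y j assume "y \<in> elts (fr_cplx J) j"
 then have y: "y \<in> fr J j" by simp
 show "fr_left 0 j (unit C) y = y" by (rule ext) (simp add: fr_left_def unit_left value_closed[OF y])
 show "fr_right j 0 y (unit C) = y" by (rule ext) (simp add: fr_right_def dual_right_unit fr_off[OF y])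
next
 fix x i y j assume x: "x \<in> elts C i" and "y \<in> elts (fr_cplx J) j"
 then have y: "y \<in> fr J j" by simp
 show "dif (fr_cplx J) (i + j) (fr_left i j x y) = fr_left (i - 1) j (dif C i x) y
  \<oplus>[gr (fr_cplx J) (i + j - 1)] ((- 1) powi i) \<odot>[gr (fr_cplx J) (i + j - 1)] fr_left i (j - 1) x (dif (fr_cplx J) j y)"
  using x value_closed[OF y] by (intro ext) (auto simp: fr_left_def leibniz)
next
 fix y i x j assume "y \<in> elts (fr_cplx J) i" and x: "x \<in> elts C j"
 then have y: "y \<in> fr J i" by simp
 have ij: "i - 1 + j = i + j - 1" "i + (j - 1) = i + j - 1" by auto
 show "dif (fr_cplx J) (i + j) (fr_right i j y x) = fr_right (i - 1) j (dif (fr_cplx J) i y) x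
  \<oplus>[gr (fr_cplx J) (i + j - 1)] ((- 1) powi i) \<odot>[gr (fr_cplx J) (i + j - 1)] fr_right i (j - 1) y (dif C j x)"
 proof (rule ext)
  fix p
  consider "j = 0" | "j = 1" | "j \<noteq> 0" "j \<noteq> 1" by blast
  then show "dif (fr_cplx J) (i + j) (fr_right i j y x) p = (fr_right (i - 1) j (dif (fr_cplx J) i y) x
   \<oplus>[gr (fr_cplx J) (i + j - 1)] ((- 1) powi i) \<odot>[gr (fr_cplx J) (i + j - 1)] fr_right i (j - 1) y (dif C j x)) p"
  proof cases
   case 1 then show ?thesis
    using d_closed[OF value_closed[OF y]] by (auto simp: fr_right_def vs_smult_zero r_zero zero_closed)
  next
   case 2
   then have "dif C 1 x \<in> boundaries C 0" using x by (auto simp: boundaries_def)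
   then show ?thesis using 2 d_zero[of "i + 1"]
    by (simp add: fr_right_def dual_right_boundary fr_dual_zero[OF y] vs_smult_zero l_zero zero_closed)
  next
   case 3 then show ?thesis by (simp add: fr_right_def vs_smult_zero l_zero zero_closed ij)
  qed
 qed
qed

end

subsection \<open>Solvable right-hand sides\<close>

lemma (in abelian_group) add_diff_add:
 assumes "a \<in> carrier G" "b \<in> carrier G" "c \<in> carrier G" "d \<in> carrier G"
 shows "(a \<oplus> b) \<ominus> (c \<oplus> d) = (a \<ominus> c) \<oplus> (b \<ominus> d)"
proof -
 have "(a \<oplus> b) \<ominus> (c \<oplus> d) = (a \<oplus> b) \<oplus> (\<ominus> c \<oplus> \<ominus> d)" using assms by (simp add: a_minus_def minus_add)
 also have "\<dots> = a \<oplus> ((b \<oplus> \<ominus> c) \<oplus> \<ominus> d)" using assms by (simp add: a_assoc)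
 also have "\<dots> = a \<oplus> ((\<ominus> c \<oplus> b) \<oplus> \<ominus> d)" using assms by (simp add: a_comm)
 finally show ?thesis using assms by (simp add: a_minus_def a_assoc)
qed

lemma (in abelian_group) diff_diff_diff:
 assumes "y \<in> carrier G" "a \<in> carrier G" "b \<in> carrier G"
 shows "(y \<ominus> b) \<ominus> (y \<ominus> a) = a \<ominus> b"
proof -
 have "(y \<ominus> b) \<ominus> (y \<ominus> a) = (\<ominus> b \<oplus> y) \<oplus> (\<ominus> y \<oplus> a)" using assms by (simp add: a_minus_def minus_add a_comm)
 also have "\<dots> = \<ominus> b \<oplus> a" using assms by (simp add: a_assoc r_neg2)
 finally show ?thesis using assms by (simp add: a_minus_def a_comm)
qed

lemma (in abelian_group) diff_add_diff:
 assumes "a \<in> carrier G" "b \<in> carrier G" "c \<in> carrier G"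
 shows "(a \<ominus> b) \<oplus> (b \<ominus> c) = a \<ominus> c"
 using assms by (simp add: a_minus_def a_assoc r_neg1)

definition solvable_vector ::
  "('k, 'v, 'm) cplx_scheme => (int => 'r => 'v => 'v) => 'e set => 'f set => ('f => 'e => 'r) => int => ('f => 'v) => bool" where
 "solvable_vector N l E E' a n c \<longleftrightarrow> (\<exists>b\<in>E -> cycles N n.
  \<forall>f\<in>E'. linear_system (gr N n) (l n) E a b f \<ominus>[gr N n] c f \<in> boundaries N n)"

context
 fixes N :: "('k::field, 'v, 'm) cplx_scheme" and R :: "('r, 'n) ring_scheme" and l and E :: "'e set" and E' :: "'f set" and a n
 assumes N: "chain_complex N" and l: "left_action R (gr N n) (l n)"
  and a: "\<And>e f. e \<in> E ==> f \<in> E' ==> a f e \<in> carrier R"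
begin

interpretation N: chain_complex N by (rule N)
interpretation A: abelian_group "gr N n" by simp
interpretation L: left_action R "gr N n" "l n" by (rule l)

abbreviation (input) "sol \<equiv> solvable_vector N l E E' a n"

lemma solvable_vector_zero: "sol (%f. \<zero>[gr N n])"
 unfolding solvable_vector_def
proof (intro bexI ballI)
 show "(%e. \<zero>[gr N n]) \<in> E -> cycles N n" using N.cycles_ops(1) by simp
 fix f assume "f \<in> E'"
 then have "linear_system (gr N n) (l n) E a (%e. \<zero>[gr N n]) f = \<zero>[gr N n]" using a by (intro L.system_zero) auto
 then show "linear_system (gr N n) (l n) E a (%e. \<zero>[gr N n]) f \<ominus>[gr N n] \<zero>[gr N n] \<in> boundaries N n"
  using N.boundaries_ops(5)[OF N.boundaries_ops(1) N.boundaries_ops(1), of n] by simp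
qed

lemma solvable_vector_add:
 assumes s: "sol c" "sol c'" and c: "\<And>f. f \<in> E' ==> c f \<in> elts N n" "\<And>f. f \<in> E' ==> c' f \<in> elts N n"
 shows "sol (%f. c f \<oplus>[gr N n] c' f)"
proof -
 let ?F = "linear_system (gr N n) (l n) E a"
 obtain b where b: "b \<in> E -> cycles N n" "\<forall>f\<in>E'. ?F b f \<ominus>[gr N n] c f \<in> boundaries N n"
  using s(1) unfolding solvable_vector_def by (rule bexE)
 obtain b' where b': "b' \<in> E -> cycles N n" "\<forall>f\<in>E'. ?F b' f \<ominus>[gr N n] c' f \<in> boundaries N n"
  using s(2) unfolding solvable_vector_def by (rule bexE)
 have el: "b \<in> E -> elts N n" "b' \<in> E -> elts N n" using b(1) b'(1) by (auto simp: cycles_def)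
 show ?thesis unfolding solvable_vector_def
 proof (intro bexI ballI)
  show "(%e. b e \<oplus>[gr N n] b' e) \<in> E -> cycles N n"
   using b(1) b'(1) N.cycles_ops(2) by (auto simp: Pi_iff)
  fix f assume f: "f \<in> E'"
  have cl: "?F b f \<in> elts N n" "?F b' f \<in> elts N n"
   using L.system_closed[of E a f b] L.system_closed[of E a f b'] el a f by auto
  have "?F (%e. b e \<oplus>[gr N n] b' e) f = ?F b f \<oplus>[gr N n] ?F b' f"
   using a f el by (intro L.system_add) auto
  moreover have "(?F b f \<oplus>[gr N n] ?F b' f) \<ominus>[gr N n] (c f \<oplus>[gr N n] c' f) =
   (?F b f \<ominus>[gr N n] c f) \<oplus>[gr N n] (?F b' f \<ominus>[gr N n] c' f)"
   by (rule A.add_diff_add[OF cl c[OF f]])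
  ultimately show "?F (%e. b e \<oplus>[gr N n] b' e) f \<ominus>[gr N n] (c f \<oplus>[gr N n] c' f) \<in> boundaries N n"
   using N.boundaries_ops(2)[OF bspec[OF b(2) f] bspec[OF b'(2) f]] by simp
 qed
qed

lemma solvable_vector_cong: "(\<And>f. f \<in> E' ==> c f = c' f) ==> sol c \<longleftrightarrow> sol c'"
 by (simp add: solvable_vector_def)

lemma solvable_vector_units:
 assumes E': "finite E'" and c: "\<And>f. f \<in> E' ==> c f \<in> elts N n"
  and s: "\<And>f0. f0 \<in> E' ==> sol (%f. if f = f0 then c f0 else \<zero>[gr N n])"
 shows "sol c"
proof -
 have "sol (%f. if f \<in> I then c f else \<zero>[gr N n])" if "I \<subseteq> E'" for I
  using finite_subset[OF that E'] that
 proof (induction I)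
  case empty then show ?case using solvable_vector_zero by simp
 next
  case (insert f0 I)
  then have s2: "sol (%f. (if f \<in> I then c f else \<zero>[gr N n]) \<oplus>[gr N n] (if f = f0 then c f0 else \<zero>[gr N n]))"
   using c by (intro solvable_vector_add s) auto
  have eq: "(if f \<in> I then c f else \<zero>[gr N n]) \<oplus>[gr N n] (if f = f0 then c f0 else \<zero>[gr N n]) =
   (if f \<in> insert f0 I then c f else \<zero>[gr N n])" if "f \<in> E'" for f
   using insert(2) c[OF that] by auto
  show ?case by (rule iffD1[OF solvable_vector_cong[OF eq] s2])
 qed
 from this[of E'] show ?thesis by (simp add: solvable_vector_def)
qed

end

subsection \<open>Bases of \<open>H\<^sub>0(C)\<close>\<close>

locale based_connective = connective_under C R \<eta>
 for C :: "('k::field, 'u) dga" and R :: "('k, 'r) module" and \<eta> +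
 fixes B :: "'u set" and \<kappa> :: "'u => 'u => 'k"
 assumes B_sub: "B \<subseteq> elts C 0"
  and \<kappa>_dual: "j \<in> B ==> \<kappa> j \<in> dual"
  and \<kappa>_delta: "i \<in> B ==> j \<in> B ==> \<kappa> i j = (if i = j then 1 else 0)"
  and \<kappa>_finite: "t \<in> elts C 0 ==> finite {j\<in>B. \<kappa> j t \<noteq> 0}"
  and \<kappa>_expand: "t \<in> elts C 0 ==>
   t \<ominus>[gr C 0] (\<Oplus>\<^bsub>gr C 0\<^esub>j\<in>{j\<in>B. \<kappa> j t \<noteq> 0}. \<kappa> j t \<odot>[gr C 0] j) \<in> boundaries C 0"

text \<open>A basis of \<open>H\<^sub>0(C)\<close> over the ground field, lifted to \<open>C\<^sub>0\<close>, with the dual basis.\<close>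

lemma (in connective_under) ex_based: obtains B \<kappa> where "based_connective C R \<eta> B \<kappa>"
proof -
 obtain B :: "'u set" and \<kappa> :: "'u => 'u => 'k" where b: "B \<subseteq> elts C 0"
  "\<And>j. j \<in> B ==> linear_functional (gr C 0) (\<kappa> j)" "\<And>j w. j \<in> B ==> w \<in> boundaries C 0 ==> \<kappa> j w = 0"
  "\<And>i j. i \<in> B ==> j \<in> B ==> \<kappa> i j = (if i = j then 1 else 0)"
  "\<And>v. v \<in> elts C 0 ==> finite {j\<in>B. \<kappa> j v \<noteq> 0} \<and>
   v \<ominus>[gr C 0] (\<Oplus>\<^bsub>gr C 0\<^esub>j\<in>{j\<in>B. \<kappa> j v \<noteq> 0}. \<kappa> j v \<odot>[gr C 0] j) \<in> boundaries C 0"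
  by (rule basis_modulo_subspace[OF vs, where W = "boundaries C 0"])
   (use boundaries_elts boundaries_ops(1,2,3) in auto)
 define \<kappa>' where "\<kappa>' = (%j t. if t \<in> elts C 0 then \<kappa> j t else 0)"
 have e: "\<kappa>' j t = \<kappa> j t" if "t \<in> elts C 0" for j t using that by (simp add: \<kappa>'_def)
 have "based_connective C R \<eta> B \<kappa>'"
 proof (intro based_connective.intro based_connective_axioms.intro connective_under_axioms)
  show "\<kappa>' j \<in> dual" if "j \<in> B" for j
   using b(2,3)[OF that] by (auto simp: dual_def linear_functional_def e add_closed vs_smult_closed boundaries_elts)
    (simp add: \<kappa>'_def)
  show "\<kappa>' i j = (if i = j then 1 else 0)" if "i \<in> B" "j \<in> B" for i j
   using b(4)[OF that] b(1) that(2) by (subst e) auto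
  fix t assume t: "t \<in> elts C 0"
  show "finite {j\<in>B. \<kappa>' j t \<noteq> 0}" "t \<ominus>[gr C 0] (\<Oplus>\<^bsub>gr C 0\<^esub>j\<in>{j\<in>B. \<kappa>' j t \<noteq> 0}. \<kappa>' j t \<odot>[gr C 0] j) \<in> boundaries C 0"
   using b(5)[OF t] unfolding e[OF t] by auto
 qed (rule b(1))
 then show thesis by (rule that)
qed

context based_connective begin

abbreviation "supp t \<equiv> {j\<in>B. \<kappa> j t \<noteq> 0}"

lemma \<kappa>_scaled_closed: "S \<subseteq> B ==> (%j. \<kappa> j t \<odot>[gr C 0] j) \<in> S -> elts C 0"
 using B_sub by (auto simp: vs_smult_closed)

lemma expand_superset:
 assumes t: "t \<in> elts C 0" and S: "finite S" "S \<subseteq> B" "supp t \<subseteq> S"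
 shows "t \<ominus>[gr C 0] (\<Oplus>\<^bsub>gr C 0\<^esub>j\<in>S. \<kappa> j t \<odot>[gr C 0] j) \<in> boundaries C 0"
proof -
 interpret A: abelian_group "gr C 0" by simp
 have "(\<Oplus>\<^bsub>gr C 0\<^esub>j\<in>supp t. \<kappa> j t \<odot>[gr C 0] j) = (\<Oplus>\<^bsub>gr C 0\<^esub>j\<in>S. \<kappa> j t \<odot>[gr C 0] j)"
  by (rule A.add.finprod_mono_neutral_cong_left)
   (use S B_sub \<kappa>_scaled_closed[OF S(2)] in \<open>auto simp: vs_zero_scalar subset_iff\<close>)
 then show ?thesis using \<kappa>_expand[OF t] by simp
qed

lemma dual_finsum:
 assumes h: "h \<in> dual" and "finite S" "f \<in> S -> elts C 0"
 shows "h (\<Oplus>\<^bsub>gr C 0\<^esub>j\<in>S. f j) = (\<Sum>j\<in>S. h (f j))"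
proof -
 interpret A: abelian_group "gr C 0" by simp
 show ?thesis using assms(2,3)
 proof (induction S)
  case empty show ?case using dualD(3)[OF h boundaries_ops(1)] by simp
 next
  case (insert j S)
  then have "f j \<in> elts C 0" "f \<in> S -> elts C 0" by auto
  then show ?case using insert by (simp add: A.finsum_insert dualD(1)[OF h] A.finsum_closed)
 qed
qed

lemma dual_expand:
 assumes h: "h \<in> dual" and t: "t \<in> elts C 0" and S: "finite S" "S \<subseteq> B" "supp t \<subseteq> S"
 shows "h t = (\<Sum>j\<in>S. \<kappa> j t * h j)"
proof -
 interpret A: abelian_group "gr C 0" by simp
 let ?s = "\<Oplus>\<^bsub>gr C 0\<^esub>j\<in>S. \<kappa> j t \<odot>[gr C 0] j"
 have s: "?s \<in> elts C 0" by (rule A.finsum_closed[OF \<kappa>_scaled_closed[OF S(2)]])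
 have b: "t \<ominus>[gr C 0] ?s \<in> boundaries C 0" by (rule expand_superset[OF t S])
 have "t = ?s \<oplus>[gr C 0] (t \<ominus>[gr C 0] ?s)" using A.diff_eq_iff[OF t s boundaries_elts[OF b]] by simp
 then have "h t = h ?s" using dualD(1)[OF h s boundaries_elts[OF b]] dualD(3)[OF h b] by simp
 also have "\<dots> = (\<Sum>j\<in>S. h (\<kappa> j t \<odot>[gr C 0] j))" by (rule dual_finsum[OF h S(1) \<kappa>_scaled_closed[OF S(2)]])
 also have "\<dots> = (\<Sum>j\<in>S. \<kappa> j t * h j)" using S(2) B_sub by (intro sum.cong) (auto simp: dualD(2)[OF h])
 finally show ?thesis .
qed

lemma sum_smult:
 assumes "c \<in> elts C n" "finite S"
 shows "(\<Sum>j\<in>S. f j) \<odot>[gr C n] c = (\<Oplus>\<^bsub>gr C n\<^esub>j\<in>S. f j \<odot>[gr C n] c)"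
proof -
 interpret A: abelian_group "gr C n" by simp
 show ?thesis using assms(2)
  by induction (simp_all add: vs_zero_scalar assms(1) A.finsum_insert vs_distl vs_smult_closed Pi_def)
qed

lemma rank_one_expand:
 assumes c: "c \<in> elts C n" and t: "t \<in> elts C 0" and S: "finite S" "S \<subseteq> B" "supp t \<subseteq> S"
 shows "rank_one n i t c p = (\<Oplus>\<^bsub>gr C n\<^esub>j\<in>S. rank_one n i j (\<kappa> j t \<odot>[gr C n] c) p)"
proof -
 interpret A: abelian_group "gr C n" by simp
 show ?thesis
 proof (cases "fst p = i \<and> snd p \<in> dual")
  case True
  then have "rank_one n i t c p = (\<Sum>j\<in>S. \<kappa> j t * snd p j) \<odot>[gr C n] c"
   using dual_expand[OF _ t S, of "snd p"] by (simp add: rank_one_def)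
  also have "\<dots> = (\<Oplus>\<^bsub>gr C n\<^esub>j\<in>S. (\<kappa> j t * snd p j) \<odot>[gr C n] c)" by (rule sum_smult[OF c S(1)])
  also have "\<dots> = (\<Oplus>\<^bsub>gr C n\<^esub>j\<in>S. rank_one n i j (\<kappa> j t \<odot>[gr C n] c) p)"
   using True c by (intro A.finsum_cong') (auto simp: rank_one_def vs_smult_closed vs_assoc mult.commute)
  finally show ?thesis .
 next
  case False
  then have z: "rank_one n i j x p = \<zero>[gr C n]" for j x by (auto simp: rank_one_def)
  show ?thesis unfolding z by simp
 qed
qed

lemma rank_one_add: "c \<in> elts C n ==> c' \<in> elts C n ==>
  rank_one n i t (c \<oplus>[gr C n] c') p = rank_one n i t c p \<oplus>[gr C n] rank_one n i t c' p"
 by (simp add: rank_one_def vs_distr l_zero zero_closed)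

lemma rank_one_zero: "rank_one n i t \<zero>[gr C n] p = \<zero>[gr C n]"
 by (simp add: rank_one_def vs_smult_zero)

lemma fr_expand:
 assumes "y \<in> fr J n"
 shows "\<exists>S0. finite S0 \<and> S0 \<subseteq> J \<times> B \<and> (\<forall>S p. finite S --> S0 \<subseteq> S --> S \<subseteq> J \<times> B -->
  y p = (\<Oplus>\<^bsub>gr C n\<^esub>q\<in>S. rank_one n (fst q) (snd q) (y (fst q, \<kappa> (snd q))) p))"
proof -
 interpret A: abelian_group "gr C n" by simp
 show ?thesis using assms
 proof (induction rule: finite_rank.induct)
  case finite_rank_zero
  show ?case by (rule exI[of _ "{}"]) (simp add: rank_one_zero)
 next
  case (finite_rank_step y i t c)
  then obtain S0 where S0: "finite S0" "S0 \<subseteq> J \<times> B" and ex: "\<And>S p. finite S ==> S0 \<subseteq> S ==> S \<subseteq> J \<times> B ==>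
   y p = (\<Oplus>\<^bsub>gr C n\<^esub>q\<in>S. rank_one n (fst q) (snd q) (y (fst q, \<kappa> (snd q))) p)" by blast
  have y: "y p \<in> elts C n" for p by (rule value_closed[OF finite_rank_step(1)])
  let ?r = "rank_one n i t c"
  have r: "?r p \<in> elts C n" for p by (rule rank_one_closed[OF finite_rank_step(4)])
  show ?case
  proof (intro exI[of _ "S0 \<union> {i} \<times> supp t"] conjI allI impI)
   show "finite (S0 \<union> {i} \<times> supp t)" using S0 \<kappa>_finite[OF finite_rank_step(3)] by simp
   show "S0 \<union> {i} \<times> supp t \<subseteq> J \<times> B" using S0 finite_rank_step(2) by auto
   fix S p assume S: "finite S" "S0 \<union> {i} \<times> supp t \<subseteq> S" "S \<subseteq> J \<times> B"
   define Si where "Si = {j. (i, j) \<in> S}"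
   have iSi: "inj_on (Pair i) Si" "Pair i ` Si \<subseteq> S" by (auto simp: Si_def inj_on_def)
   have Si: "finite Si" "Si \<subseteq> B" "supp t \<subseteq> Si" using S finite_imageD[OF finite_subset[OF iSi(2) S(1)] iSi(1)] by (auto simp: Si_def)
   let ?g = "%q. rank_one n (fst q) (snd q) (?r (fst q, \<kappa> (snd q))) p"
   have g: "?g q \<in> elts C n" for q by (intro rank_one_closed r)
   have g0: "?g q = \<zero>[gr C n]" if "q \<in> S - Pair i ` Si" for q
   proof -
    have "fst q \<noteq> i" using that by (cases q) (auto simp: Si_def)
    then have "?r (fst q, \<kappa> (snd q)) = \<zero>[gr C n]" by (simp add: rank_one_def)
    then show ?thesis by (simp add: rank_one_zero)
   qed
   have "(\<Oplus>\<^bsub>gr C n\<^esub>q\<in>S. ?g q) = (\<Oplus>\<^bsub>gr C n\<^esub>q\<in>Pair i ` Si. ?g q)"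
    by (rule A.add.finprod_mono_neutral_cong_right[OF S(1) iSi(2)]) (use g g0 in blast)+
   also have "\<dots> = (\<Oplus>\<^bsub>gr C n\<^esub>j\<in>Si. ?g (i, j))"
    by (rule A.finsum_reindex[OF _ iSi(1)]) (use g in blast)
   also have "\<dots> = (\<Oplus>\<^bsub>gr C n\<^esub>j\<in>Si. rank_one n i j (\<kappa> j t \<odot>[gr C n] c) p)"
   proof (rule A.finsum_cong'[OF HOL.refl])
    show "(%j. rank_one n i j (\<kappa> j t \<odot>[gr C n] c) p) \<in> Si -> elts C n"
     using rank_one_closed[OF vs_smult_closed[OF vs finite_rank_step(4)]] by blast
    fix j assume "j \<in> Si"
    then have "?r (i, \<kappa> j) = \<kappa> j t \<odot>[gr C n] c" using Si(2) \<kappa>_dual[of j] by (auto simp: rank_one_def)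
    then show "?g (i, j) = rank_one n i j (\<kappa> j t \<odot>[gr C n] c) p" by simp
   qed
   also have "\<dots> = ?r p" by (rule rank_one_expand[OF finite_rank_step(4,3) Si, symmetric])
   finally have 2: "(\<Oplus>\<^bsub>gr C n\<^esub>q\<in>S. ?g q) = ?r p" .
   have "y p \<oplus>[gr C n] ?r p =
    (\<Oplus>\<^bsub>gr C n\<^esub>q\<in>S. rank_one n (fst q) (snd q) (y (fst q, \<kappa> (snd q))) p) \<oplus>[gr C n] (\<Oplus>\<^bsub>gr C n\<^esub>q\<in>S. ?g q)"
    using ex[of S p] S 2 by force
   also have "\<dots> = (\<Oplus>\<^bsub>gr C n\<^esub>q\<in>S. rank_one n (fst q) (snd q) (y (fst q, \<kappa> (snd q))) p \<oplus>[gr C n] ?g q)"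
    by (rule A.finsum_addf[symmetric]) (use g rank_one_closed[OF y] in blast)+
   also have "\<dots> = (\<Oplus>\<^bsub>gr C n\<^esub>q\<in>S. rank_one n (fst q) (snd q) (y (fst q, \<kappa> (snd q)) \<oplus>[gr C n] ?r (fst q, \<kappa> (snd q))) p)"
   proof (rule A.finsum_cong'[OF HOL.refl])
    show "(%q. rank_one n (fst q) (snd q) (y (fst q, \<kappa> (snd q)) \<oplus>[gr C n] ?r (fst q, \<kappa> (snd q))) p) \<in> S -> elts C n"
     using rank_one_closed[OF add_closed[OF y r]] by blast
   qed (rule rank_one_add[OF y r, symmetric])
   finally show "y p \<oplus>[gr C n] ?r p = (\<Oplus>\<^bsub>gr C n\<^esub>q\<in>S. rank_one n (fst q) (snd q)
    (y (fst q, \<kappa> (snd q)) \<oplus>[gr C n] ?r (fst q, \<kappa> (snd q))) p)" .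
  qed
 qed
qed

text \<open>A function of finite rank with values in \<open>W\<close> is a sum of functions of rank one with values
 in \<open>W\<close>: this is the exactness of \<open>- \<otimes> H\<^sub>0(C)\<close>, and it is used for cycles and boundaries.\<close>

lemma fr_values:
 assumes y: "y \<in> fr J n" and W: "W \<subseteq> elts C n" and val: "\<And>p. y p \<in> W"
 shows "y \<in> finite_rank J n W"
proof -
 interpret A: abelian_group "gr C n" by simp
 obtain S where S: "finite S" "S \<subseteq> J \<times> B" and ex: "\<forall>S' p. finite S' --> S \<subseteq> S' --> S' \<subseteq> J \<times> B -->
   y p = (\<Oplus>\<^bsub>gr C n\<^esub>q\<in>S'. rank_one n (fst q) (snd q) (y (fst q, \<kappa> (snd q))) p)"
  using fr_expand[OF y] by (elim exE conjE)
 have eq: "y p = (\<Oplus>\<^bsub>gr C n\<^esub>q\<in>S. rank_one n (fst q) (snd q) (y (fst q, \<kappa> (snd q))) p)" for p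
  by (rule ex[rule_format, OF S(1) subset_refl S(2)])
 have "(%p. \<Oplus>\<^bsub>gr C n\<^esub>q\<in>S. rank_one n (fst q) (snd q) (y (fst q, \<kappa> (snd q))) p) \<in> finite_rank J n W"
  using S
 proof (induction S)
  case empty then show ?case by (simp add: finite_rank_zero)
 next
  case (insert q S)
  have q: "fst q \<in> J" "snd q \<in> elts C 0" using insert.prems B_sub by auto
  have r: "rank_one n (fst q) (snd q) (y (fst q, \<kappa> (snd q))) \<in> finite_rank J n W"
   by (rule rank_one_in[OF q val W])
  have IH: "(%p. \<Oplus>\<^bsub>gr C n\<^esub>q\<in>S. rank_one n (fst q) (snd q) (y (fst q, \<kappa> (snd q))) p) \<in> finite_rank J n W"
   using insert by blast
  have "(%q. rank_one n (fst q) (snd q) (y (fst q, \<kappa> (snd q))) p) \<in> S -> elts C n" for p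
   using rank_one_closed[OF value_closed[OF y]] by blast
  then have "(\<Oplus>\<^bsub>gr C n\<^esub>q\<in>insert q S. rank_one n (fst q) (snd q) (y (fst q, \<kappa> (snd q))) p) =
   rank_one n (fst q) (snd q) (y (fst q, \<kappa> (snd q))) p \<oplus>[gr C n]
   (\<Oplus>\<^bsub>gr C n\<^esub>q\<in>S. rank_one n (fst q) (snd q) (y (fst q, \<kappa> (snd q))) p)" for p
   by (rule A.finsum_insert[OF insert(1,2) _ rank_one_closed[OF value_closed[OF y]]])
  then show ?case using fr_add[OF IH r W] by simp
 qed
 moreover have "(%p. \<Oplus>\<^bsub>gr C n\<^esub>q\<in>S. rank_one n (fst q) (snd q) (y (fst q, \<kappa> (snd q))) p) = y"
  by (rule ext) (rule eq[symmetric])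
 ultimately show ?thesis by (rule back_subst)
qed

lemma rank_one_lin: "t \<in> elts C 0 ==> (%x. rank_one n i t x p) \<in> linear_maps (gr C n) (gr C n)"
 by (rule linear_mapsI) (auto simp: rank_one_closed rank_one_add, auto simp: rank_one_def vs_assoc mult.commute vs_smult_zero)

lemma rank_one_dif: "c \<in> elts C n ==> dif C n (rank_one n i t c p) = rank_one (n - 1) i t (dif C n c) p"
 by (simp add: rank_one_def d_smult)

lemma cycles_fr: "y \<in> cycles (fr_cplx J) n \<longleftrightarrow> y \<in> fr J n \<and> (\<forall>p. y p \<in> cycles C n)"
 using value_closed[of y J n] by (auto simp: cycles_def fun_eq_iff)

lemma boundaries_fr: "y \<in> boundaries (fr_cplx J) n \<longleftrightarrow> y \<in> fr J n \<and> (\<forall>p. y p \<in> boundaries C n)"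
proof
 interpret Y: chain_complex "fr_cplx J" by (rule fr_cplx)
 assume y: "y \<in> boundaries (fr_cplx J) n"
 then show "y \<in> fr J n \<and> (\<forall>p. y p \<in> boundaries C n)"
  using Y.boundaries_elts[OF y] by (auto simp: boundaries_def value_closed)
next
 interpret Y: chain_complex "fr_cplx J" by (rule fr_cplx)
 assume y: "y \<in> fr J n \<and> (\<forall>p. y p \<in> boundaries C n)"
 then have "y \<in> finite_rank J n (boundaries C n)" using fr_values boundaries_elts by blast
 then show "y \<in> boundaries (fr_cplx J) n"
 proof (induction rule: finite_rank.induct)
  case finite_rank_zero show ?case using Y.boundaries_ops(1) by simp
 next
  case (finite_rank_step y i t c)
  then obtain u where u: "u \<in> elts C (n + 1)" "c = dif C (n + 1) u" by (auto simp: boundaries_def)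
  have "rank_one n i t c = dif (fr_cplx J) (n + 1) (rank_one (n + 1) i t u)"
   using rank_one_dif[OF u(1)] u(2) by (intro ext) simp
  moreover have "rank_one (n + 1) i t u \<in> elts (fr_cplx J) (n + 1)" using finite_rank_step u by (simp add: rank_one_in)
  ultimately have "rank_one n i t c \<in> boundaries (fr_cplx J) n" unfolding boundaries_def by (metis imageI)
  then show ?case using Y.boundaries_ops(2)[OF finite_rank_step.IH] by simp
 qed
qed

abbreviation "fr_act n r y \<equiv> fr_left 0 n (\<eta> 0 r) y"

lemma fr_left_action: "left_action R (gr (fr_cplx J) n) (fr_act n)"
proof -
 interpret Y: dg_bimodule C "fr_cplx J" fr_left fr_right by (rule fr_bimodule)
 interpret A: abelian_group "gr (fr_cplx J) n" using Y.Y.ag by blast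
 interpret L: left_action R "gr C n" "lft n" by (rule left_action_B)
 have e: "fr_act n r y = (%p. lft n r (y p))" for r y by (intro ext) (simp add: fr_left_def lft)
 show ?thesis
  using fr_left_closed[of _ 0 _ J n] 
  by unfold_locales (auto simp: eta_closed, auto simp: e value_closed L.l_add_left L.l_add_right L.l_mult L.l_one)
qed

lemma fr_minus: assumes "y \<in> fr J n" "z \<in> fr J n" shows "y \<ominus>[gr (fr_cplx J) n] z = (%p. y p \<ominus>[gr C n] z p)"
proof
 fix p
 interpret Y: chain_complex "fr_cplx J" by (rule fr_cplx)
 interpret A: abelian_group "gr C n" by simp
 interpret YA: abelian_group "gr (fr_cplx J) n" by simp
 have d: "y \<ominus>[gr (fr_cplx J) n] z \<in> fr J n" using YA.minus_closed[of y z] assms by simp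
 have "y = (%p. z p \<oplus>[gr C n] (y \<ominus>[gr (fr_cplx J) n] z) p)" using YA.diff_eq_iff[of y z "y \<ominus>[gr (fr_cplx J) n] z"] assms d by simp
 then have "y p = z p \<oplus>[gr C n] (y \<ominus>[gr (fr_cplx J) n] z) p" by (rule fun_cong)
 from A.diff_eq_iff[THEN iffD2, OF value_closed[OF assms(1)] value_closed[OF assms(2)] value_closed[OF d] this]
 show "(y \<ominus>[gr (fr_cplx J) n] z) p = y p \<ominus>[gr C n] z p" by (rule HOL.sym)
qed

text \<open>Over a field, \<open>C \<otimes> k\<^sup>J \<otimes> H\<^sub>0(C)\<close> is a direct sum of copies of \<open>C\<close> as a left module, so that a system can be solved one
 rank-one summand of the right-hand side at a time.\<close>

lemma fr_solvable:
 assumes h: "homology_solvable C lft E E' a n" and E: "finite E" "finite E'"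
  and a: "\<And>e f. e \<in> E ==> f \<in> E' ==> a f e \<in> carrier R"
 shows "homology_solvable (fr_cplx J) fr_act E E' a n"
proof -
 interpret Y: chain_complex "fr_cplx J" by (rule fr_cplx)
 interpret A: abelian_group "gr C n" by simp
 interpret YA: abelian_group "gr (fr_cplx J) n" by simp
 interpret LY: left_action R "gr (fr_cplx J) n" "fr_act n" by (rule fr_left_action)
 interpret L: left_action R "gr C n" "lft n" by (rule left_action_B)
 let ?F = "linear_system (gr C n) (lft n) E a" and ?FY = "linear_system (gr (fr_cplx J) n) (fr_act n) E a"
 have el: "b \<in> I -> fr J n" if "b \<in> I -> cycles (fr_cplx J) n" for b and I :: "'z set"
  using that by (auto simp: Pi_iff cycles_fr)
 have FY: "?FY b f \<in> fr J n" if "b \<in> E -> fr J n" "f \<in> E'" for b f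
  using LY.system_closed[of E a f b] that a by simp
 have eval: "?FY b f p = ?F (%e. b e p) f" if "b \<in> E -> fr J n" "f \<in> E'" for b f p
  using system_natural[OF fr_left_action left_action_B, where \<phi> = "%y. y p", of J n n E a f b] that E a
  by (simp add: value_closed fr_left_def lft)
 have subY: "(y \<ominus>[gr (fr_cplx J) n] z) p = y p \<ominus>[gr C n] z p" if "y \<in> fr J n" "z \<in> fr J n" for y z p
  unfolding fr_minus[OF that] by (rule HOL.refl)
 let ?sol = "solvable_vector (fr_cplx J) fr_act E E' a n"
 have sol_rank: "?sol (%f. if f = f0 then rank_one n i t c else \<zero>[gr (fr_cplx J) n])"
  if "i \<in> J" and t: "t \<in> elts C 0" and c: "c \<in> cycles C n" for f0 i t c
 proof -
  have "(%f. if f = f0 then c else \<zero>[gr C n]) \<in> E' -> cycles C n" using c cycles_ops(1) by auto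
  from bspec[OF conjunct2[OF h[unfolded homology_solvable_def]] this] obtain g where
   g: "g \<in> E -> cycles C n" "\<forall>f\<in>E'. ?F g f \<ominus>[gr C n] (if f = f0 then c else \<zero>[gr C n]) \<in> boundaries C n" by (rule bexE)
  have g': "g \<in> E -> elts C n" using g(1) by (auto simp: cycles_def)
  have rk: "rank_one n i t x \<in> fr J n" if "x \<in> elts C n" for x using that \<open>i \<in> J\<close> t by (intro rank_one_in) auto
  have rkc: "rank_one n i t x p \<in> cycles C n" if "x \<in> cycles C n" for x p
   using that by (auto simp: rank_one_def cycles_ops)
  show ?thesis unfolding solvable_vector_def
  proof (intro bexI ballI)
   show b: "(%e. rank_one n i t (g e)) \<in> E -> cycles (fr_cplx J) n"
    using g(1) rkc rk cycles_elts by (auto simp: cycles_fr Pi_iff)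
   fix f assume f: "f \<in> E'"
   let ?x = "?F g f \<ominus>[gr C n] (if f = f0 then c else \<zero>[gr C n])"
   have Fg: "?F g f \<in> elts C n" using L.system_closed[of E a f g] a f g' by simp
   have x: "?x \<in> boundaries C n" using g(2) f by blast
   have "(?FY (%e. rank_one n i t (g e)) f \<ominus>[gr (fr_cplx J) n] (if f = f0 then rank_one n i t c else \<zero>[gr (fr_cplx J) n])) p =
    rank_one n i t ?x p" for p
   proof -
    have zin: "(if f = f0 then rank_one n i t c else \<zero>[gr (fr_cplx J) n]) \<in> fr J n" using rk cycles_elts[OF c] finite_rank_zero by simp
    have "?FY (%e. rank_one n i t (g e)) f p = ?F (%e. rank_one n i t (g e) p) f" by (rule eval[OF el[OF b] f])
    also have "\<dots> = rank_one n i t (?F g f) p"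
     using g' E a f rank_one_lin[OF t, of n i p]
     by (intro system_natural[OF left_action_B left_action_B, symmetric, where \<phi> = "%x. rank_one n i t x p"])
      (auto simp: lin_closed lin_add rank_one_def lft_smult L.l_zero_right)
    finally have "(?FY (%e. rank_one n i t (g e)) f \<ominus>[gr (fr_cplx J) n] (if f = f0 then rank_one n i t c else \<zero>[gr (fr_cplx J) n])) p =
     rank_one n i t (?F g f) p \<ominus>[gr C n] rank_one n i t (if f = f0 then c else \<zero>[gr C n]) p"
     using subY[OF FY[OF el[OF b] f] zin] by (simp add: rank_one_zero)
    also have "\<dots> = rank_one n i t ?x p"
     using lin_diff[OF vs vs rank_one_lin[OF t] Fg, of "if f = f0 then c else \<zero>[gr C n]" i p] cycles_elts[OF c] by simp
    finally show ?thesis .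
   qed
   then have "?FY (%e. rank_one n i t (g e)) f \<ominus>[gr (fr_cplx J) n] (if f = f0 then rank_one n i t c else \<zero>[gr (fr_cplx J) n]) = rank_one n i t ?x"
    by (rule ext)
   moreover have "rank_one n i t ?x p \<in> boundaries C n" for p using x by (simp add: rank_one_def boundaries_ops)
   ultimately show "?FY (%e. rank_one n i t (g e)) f \<ominus>[gr (fr_cplx J) n] (if f = f0 then rank_one n i t c else \<zero>[gr (fr_cplx J) n]) \<in> boundaries (fr_cplx J) n"
    using rk[OF boundaries_elts[OF x]] by (simp add: boundaries_fr)
  qed
 qed
 have sol_single: "?sol (%f. if f = f0 then y else \<zero>[gr (fr_cplx J) n])" if y: "y \<in> finite_rank J n (cycles C n)" for f0 y
  using y
 proof (induction rule: finite_rank.induct)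
  case finite_rank_zero
  have 1: "(%f. if f = f0 then %p. \<zero>[gr C n] else \<zero>[gr (fr_cplx J) n]) = (%f. \<zero>[gr (fr_cplx J) n])" by (rule ext) simp
  have 2: "?sol (%f. \<zero>[gr (fr_cplx J) n])"
   by (rule solvable_vector_zero, rule fr_cplx, rule fr_left_action, rule a)
  show ?case by (rule back_subst[of ?sol, OF 2 1[symmetric]])
 next
  case (finite_rank_step y i t c)
  have y: "y \<in> fr J n" using fr_mono[OF finite_rank_step(1)] cycles_elts by blast
  have r: "rank_one n i t c \<in> fr J n" using finite_rank_step cycles_elts by (intro rank_one_in) auto
  have 2: "?sol (%f. (if f = f0 then y else \<zero>[gr (fr_cplx J) n]) \<oplus>[gr (fr_cplx J) n] (if f = f0 then rank_one n i t c else \<zero>[gr (fr_cplx J) n]))"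
   by (rule solvable_vector_add, rule fr_cplx, rule fr_left_action, rule a, assumption, assumption,
     rule finite_rank_step.IH, rule sol_rank[OF finite_rank_step(2-4)])
    (use y r finite_rank_zero in auto)
  have 1: "(%f. (if f = f0 then y else \<zero>[gr (fr_cplx J) n]) \<oplus>[gr (fr_cplx J) n] (if f = f0 then rank_one n i t c else \<zero>[gr (fr_cplx J) n])) =
   (%f. if f = f0 then (%p. y p \<oplus>[gr C n] rank_one n i t c p) else \<zero>[gr (fr_cplx J) n])"
   by (rule ext) (simp add: l_zero zero_closed)
  show ?case by (rule back_subst[of ?sol, OF 2 1])
 qed
 show ?thesis unfolding homology_solvable_def
 proof (intro conjI ballI impI)
  fix b e assume b: "b \<in> E -> cycles (fr_cplx J) n" and bd: "\<forall>f\<in>E'. ?FY b f \<in> boundaries (fr_cplx J) n" and e: "e \<in> E"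
  have "b e p \<in> boundaries C n" for p
  proof -
   have 1: "(%e. b e p) \<in> E -> cycles C n"
   proof
    fix e assume "e \<in> E"
    from funcset_mem[OF b this] show "b e p \<in> cycles C n" unfolding cycles_fr by blast
   qed
   have 2: "\<forall>f\<in>E'. ?F (%e. b e p) f \<in> boundaries C n"
   proof
    fix f assume f: "f \<in> E'"
    from bspec[OF bd f] have "?FY b f p \<in> boundaries C n" unfolding boundaries_fr by blast
    then show "?F (%e. b e p) f \<in> boundaries C n" unfolding eval[OF el[OF b] f] .
   qed
   show ?thesis using mp[OF bspec[OF conjunct1[OF h[unfolded homology_solvable_def]] 1] 2] e by (rule bspec)
  qed
  moreover have "b e \<in> fr J n" using el[OF b] e by (rule funcset_mem)
  ultimately show "b e \<in> boundaries (fr_cplx J) n" unfolding boundaries_fr by blast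
 next
  fix c assume c: "c \<in> E' -> cycles (fr_cplx J) n"
  have "?sol c"
  proof (rule solvable_vector_units, rule fr_cplx, rule fr_left_action, rule a, assumption, assumption, rule E(2))
   fix f0 assume f0: "f0 \<in> E'"
   then have "c f0 \<in> cycles (fr_cplx J) n" using c by (rule_tac funcset_mem)
   then have cf: "c f0 \<in> fr J n" "\<And>p. c f0 p \<in> cycles C n" unfolding cycles_fr by blast+
   then show "c f0 \<in> elts (fr_cplx J) n" by simp
   have "c f0 \<in> finite_rank J n (cycles C n)" by (rule fr_values[OF cf(1) _ cf(2)]) (use cycles_elts in blast)
   then show "?sol (%f. if f = f0 then c f0 else \<zero>[gr (fr_cplx J) n])" by (rule sol_single)
  qed
  then show "\<exists>b\<in>E -> cycles (fr_cplx J) n. \<forall>f\<in>E'. ?FY b f \<ominus>[gr (fr_cplx J) n] c f \<in> boundaries (fr_cplx J) n"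
   unfolding solvable_vector_def .
 qed
qed

end

section \<open>Derivations as algebra maps into square-zero extensions\<close>

context dg_bimodule begin

definition inner_map :: "'v => int => 'u => 'u \<times> 'v" where
 "inner_map e n = restrict (%x. (x, la n 0 x e \<ominus>[gr Y n] ra 0 n e x)) (elts A n)"

text \<open>The inner derivation \<open>x \<mapsto> x e - e x\<close> commutes with the differentials because \<open>e\<close> is a cycle; the graph of a
 derivation is an algebra map.\<close>

lemma inner_map_hom:
 assumes e: "e \<in> cycles Y 0" shows "inner_map e \<in> dga_homs A sqz"
proof -
 have e0: "e \<in> elts Y 0" and de: "dif Y 0 e = \<zero>[gr Y (- 1)]" using e by (auto simp: cycles_def)
 let ?D = "%n x. la n 0 x e \<ominus>[gr Y n] ra 0 n e x"
 have cl: "la n 0 x e \<in> elts Y n" "ra 0 n e x \<in> elts Y n" if "x \<in> elts A n" for n x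
  using la_closed[OF that e0] ra_closed[OF e0 that] by simp_all
 have D: "?D n x \<in> elts Y n" if "x \<in> elts A n" for n x
  using abelian_group.minus_closed[OF Y.ag cl[OF that]] .
 have sq: "inner_map e n x = (x, ?D n x)" if "x \<in> elts A n" for n x using that by (simp add: inner_map_def)
 have la_e: "la n 0 (x \<oplus>[gr A n] y) e = la n 0 x e \<oplus>[gr Y n] la n 0 y e" "la n 0 (c \<odot>[gr A n] x) e = c \<odot>[gr Y n] la n 0 x e"
  "ra 0 n e (x \<oplus>[gr A n] y) = ra 0 n e x \<oplus>[gr Y n] ra 0 n e y" "ra 0 n e (c \<odot>[gr A n] x) = c \<odot>[gr Y n] ra 0 n e x"
  if "x \<in> elts A n" "y \<in> elts A n" for n x y c
  using lin_add[OF la_lin1[OF e0, of n] that] lin_smult[OF la_lin1[OF e0, of n] that(1)]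
   lin_add[OF ra_lin2[OF e0, of n] that] lin_smult[OF ra_lin2[OF e0, of n] that(1)] by simp_all
 have lin: "inner_map e n \<in> linear_maps (gr A n) (gr sqz n)" for n
 proof (rule linear_mapsI)
  interpret Yn: abelian_group "gr Y n" by simp
  fix x assume x: "x \<in> elts A n"
  show "inner_map e n x \<in> elts sqz n" using x D by (simp add: sq)
  show "inner_map e n (c \<odot>[gr A n] x) = c \<odot>[gr sqz n] inner_map e n x" for c
  proof -
   have "c \<odot>[gr Y n] ?D n x = c \<odot>[gr Y n] la n 0 x e \<ominus>[gr Y n] c \<odot>[gr Y n] ra 0 n e x"
    using cl[OF x] unfolding a_minus_def
    by (simp add: vs_distr vs_minus[OF Y.vs] vs_smult_closed vs_assoc)
   then show ?thesis using x by (simp add: sq vs_smult_closed la_e[OF x x])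
  qed
  show "inner_map e n (x \<oplus>[gr A n] y) = inner_map e n x \<oplus>[gr sqz n] inner_map e n y" if y: "y \<in> elts A n" for y
   using x y by (simp add: sq add_closed la_e[OF x y] Yn.add_diff_add[OF cl(1)[OF x] cl(1)[OF y] cl(2)[OF x] cl(2)[OF y]])
 qed
 have dif: "inner_map e (n - 1) (dif A n x) = dif sqz n (inner_map e n x)" if x: "x \<in> elts A n" for n x
 proof -
  interpret Yn: abelian_group "gr Y (n - 1)" by simp
  have "dif Y n (la n 0 x e) = la (n - 1) 0 (dif A n x) e"
   using la_leibniz[OF x e0] la_zero2[OF x, of "-1"] de cl(1)[OF d_closed[OF x]] by (simp add: vs_smult_zero)
  moreover have "dif Y n (ra 0 n e x) = ra 0 (n - 1) e (dif A n x)"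
   using ra_leibniz[OF e0 x] ra_zero1[OF x, of "-1"] de cl(2)[OF d_closed[OF x]] by (simp add: vs_one)
  ultimately show ?thesis using x cl[OF x] by (simp add: sq Y.d_diff)
 qed
 have mult: "inner_map e (i + j) (mul A i j x y) = mul sqz i j (inner_map e i x) (inner_map e j y)"
  if x: "x \<in> elts A i" and y: "y \<in> elts A j" for i j x y
 proof -
  interpret Yn: abelian_group "gr Y (i + j)" by simp
  have xy: "mul A i j x y \<in> elts A (i + j)" using x y by simp
  have 1: "la i j x (?D j y) = la (i + j) 0 (mul A i j x y) e \<ominus>[gr Y (i + j)] la i j x (ra 0 j e y)"
   using lin_diff[OF Y.vs Y.vs la_lin2[OF x, of j] cl[OF y]] la_assoc[OF x y e0] by simp
  have 2: "ra i j (?D i x) y = la i j x (ra 0 j e y) \<ominus>[gr Y (i + j)] ra 0 (i + j) e (mul A i j x y)"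
   using lin_diff[OF Y.vs Y.vs ra_lin1[OF y, of i] cl[OF x]] lra_assoc[OF x e0 y] ra_assoc[OF e0 x y] by simp
  have c: "la (i + j) 0 (mul A i j x y) e \<in> elts Y (i + j)" "la i j x (ra 0 j e y) \<in> elts Y (i + j)"
   "ra 0 (i + j) e (mul A i j x y) \<in> elts Y (i + j)" using cl[OF xy] la_closed[OF x cl(2)[OF y]] by simp_all
  have "la i j x (?D j y) \<oplus>[gr Y (i + j)] ra i j (?D i x) y = ?D (i + j) (mul A i j x y)"
   unfolding 1 2 using c by (rule Yn.diff_add_diff)
  then show ?thesis using x y xy by (simp add: sq)
 qed
 have unit: "inner_map e 0 (unit A) = unit sqz"
 proof -
  interpret Yn: abelian_group "gr Y 0" by simp
  show ?thesis using la_unit[OF e0] ra_unit[OF e0] e0 by (simp add: sq unit_closed a_minus_def Yn.r_neg)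
 qed
 have ext: "inner_map e n \<in> extensional (elts A n)" for n by (simp add: inner_map_def)
 show ?thesis unfolding dga_homs_def chain_maps_def using lin ext dif mult unit by blast
qed

end

lemma bimodule_map_hom:
 assumes "dg_bimodule A Y la ra" "dg_bimodule A Z lb rb"
  and g: "\<And>n. g n \<in> linear_maps (gr Y n) (gr Z n)" "\<And>n y. y \<in> elts Y n ==> g (n - 1) (dif Y n y) = dif Z n (g n y)"
   "\<And>i j x y. x \<in> elts A i ==> y \<in> elts Y j ==> g (i + j) (la i j x y) = lb i j x (g j y)"
   "\<And>i j x y. y \<in> elts Y i ==> x \<in> elts A j ==> g (i + j) (ra i j y x) = rb i j (g i y) x"
 shows "(%n. restrict (%q. (fst q, g n (snd q))) (elts A n \<times> elts Y n)) \<in>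
  dga_homs (dg_bimodule.sqz A Y la ra) (dg_bimodule.sqz A Z lb rb)"
proof -
 interpret Y: dg_bimodule A Y la ra by fact
 interpret Z: dg_bimodule A Z lb rb by fact
 have u: "\<zero>[gr Y 0] \<in> elts Y 0" using abelian_groupE(2)[OF Y.Y.ag] .
 have sm: "c \<odot>[gr A n] x \<in> elts A n" "c \<odot>[gr Y n] y \<in> elts Y n" if "x \<in> elts A n" "y \<in> elts Y n" for c x y n
  using that by (simp_all add: vs_smult_closed)
 show ?thesis
  unfolding dga_homs_def chain_maps_def linear_maps_def
  by (auto simp: g(2-4) lin_closed[OF g(1)] lin_add[OF g(1)] lin_smult[OF g(1)] lin_zero[OF Y.Y.vs Z.Y.vs g(1)]
    Y.add_closed Y.Yadd_closed sm Y.la_closed Y.ra_closed Y.unit_closed u)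
qed

section \<open>The higher homology of a localization vanishes\<close>

locale based_generated = based_connective C R \<eta> B \<kappa>
 for C :: "('k::field, 'u) dga" and R :: "('k, 'r) module" and \<eta> B \<kappa> +
 fixes m :: nat and \<zeta> :: "nat => 'u"
 assumes \<zeta>: "i < m ==> \<zeta> i \<in> elts C 0"
begin

definition commutator_term :: "int => (nat \<times> ('u => 'k) => 'u) => nat => ('u => 'k) => 'u" where
 "commutator_term n w i h = mul C n 0 (w (i, h)) (\<zeta> i) \<ominus>[gr C n] w (i, dual_left (\<zeta> i) h)"

text \<open>In tensor notation, the bimodule map \<open>c \<otimes> v\<^sub>i \<otimes> t \<mapsto> c \<zeta>\<^sub>i \<otimes> t - c \<otimes> \<zeta>\<^sub>i t\<close>.\<close>

definition commutator :: "int => (nat \<times> ('u => 'k) => 'u) => nat \<times> ('u => 'k) => 'u" where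
 "commutator n w p = (if fst p = 0 \<and> snd p \<in> dual then \<Oplus>\<^bsub>gr C n\<^esub>i\<in>{..<m}. commutator_term n w i (snd p) else \<zero>[gr C n])"

lemma mul_0: "x \<in> elts C n ==> t \<in> elts C 0 ==> mul C n 0 x t \<in> elts C n" using mul_closed[of x n t 0] by simp

lemma minus_closed': "x \<in> elts C n ==> y \<in> elts C n ==> x \<ominus>[gr C n] y \<in> elts C n"
 using abelian_group.minus_closed[OF ag] .

lemma commutator_term_closed: "(\<And>p. w p \<in> elts C n) ==> i < m ==> commutator_term n w i h \<in> elts C n"
 unfolding commutator_term_def by (intro minus_closed' mul_0 \<zeta>)

lemma commutator_terms_closed: "(\<And>p. w p \<in> elts C n) ==> (%i. commutator_term n w i h) \<in> {..<m} -> elts C n"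
 using commutator_term_closed by blast

lemma finsum_C_closed: "f \<in> I -> elts C n ==> finsum (gr C n) f I \<in> elts C n"
 by (rule abelian_monoid.finsum_closed[OF abelian_group.axioms(1)[OF ag]])

lemma commutator_value: "(\<And>p. w p \<in> elts C n) ==> commutator n w p \<in> elts C n"
 unfolding commutator_def by (auto intro!: finsum_C_closed commutator_term_closed zero_closed)

lemma finsum_C_cong: "g \<in> I -> elts C n ==> (\<And>i. i \<in> I ==> f i = g i) ==> finsum (gr C n) f I = finsum (gr C n) g I"
 by (rule abelian_monoid.finsum_cong'[OF abelian_group.axioms(1)[OF ag] HOL.refl])

lemma commutator_add:
 assumes w: "\<And>p. w p \<in> elts C n" "\<And>p. w' p \<in> elts C n"
 shows "commutator n (%p. w p \<oplus>[gr C n] w' p) p = commutator n w p \<oplus>[gr C n] commutator n w' p"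
proof -
 interpret A: abelian_group "gr C n" by simp
 have t: "commutator_term n (%p. w p \<oplus>[gr C n] w' p) i h = commutator_term n w i h \<oplus>[gr C n] commutator_term n w' i h"
  if "i < m" for i h
  using mul_add_left[OF w(1) w(2) \<zeta>[OF that], of "(i, h)" "(i, h)"]
  by (simp add: commutator_term_def A.add_diff_add[OF mul_0[OF w(1) \<zeta>[OF that]] mul_0[OF w(2) \<zeta>[OF that]] w])
 have 1: "(\<Oplus>\<^bsub>gr C n\<^esub>i\<in>{..<m}. commutator_term n (%p. w p \<oplus>[gr C n] w' p) i h) =
  (\<Oplus>\<^bsub>gr C n\<^esub>i\<in>{..<m}. commutator_term n w i h \<oplus>[gr C n] commutator_term n w' i h)" for h
  using commutator_term_closed[of w n, OF w(1)] commutator_term_closed[of w' n, OF w(2)]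
  by (intro finsum_C_cong) (auto simp: t)
 have 2: "(\<Oplus>\<^bsub>gr C n\<^esub>i\<in>{..<m}. commutator_term n w i h \<oplus>[gr C n] commutator_term n w' i h) =
  (\<Oplus>\<^bsub>gr C n\<^esub>i\<in>{..<m}. commutator_term n w i h) \<oplus>[gr C n] (\<Oplus>\<^bsub>gr C n\<^esub>i\<in>{..<m}. commutator_term n w' i h)" for h
  by (rule A.finsum_addf[OF commutator_terms_closed commutator_terms_closed]) (use w in auto)
 show ?thesis by (simp add: commutator_def 1 2 l_zero zero_closed)
qed

lemma commutator_map:
 assumes \<phi>: "\<phi> \<in> linear_maps (gr C n) (gr C k)" and w: "\<And>p. w p \<in> elts C n"
  and r: "\<And>x i. x \<in> elts C n ==> i < m ==> \<phi> (mul C n 0 x (\<zeta> i)) = mul C k 0 (\<phi> x) (\<zeta> i)"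
 shows "commutator k (%p. \<phi> (w p)) p = \<phi> (commutator n w p)"
proof -
 have "commutator_term k (%p. \<phi> (w p)) i h = \<phi> (commutator_term n w i h)" if "i < m" for i h
  unfolding commutator_term_def using lin_diff[OF vs vs \<phi> mul_0[OF w \<zeta>[OF that]] w] r[OF w that] by simp
 then have 1: "(\<Oplus>\<^bsub>gr C k\<^esub>i\<in>{..<m}. commutator_term k (%p. \<phi> (w p)) i h) = (\<Oplus>\<^bsub>gr C k\<^esub>i\<in>{..<m}. \<phi> (commutator_term n w i h))" for h
  using commutator_term_closed[of w n, OF w] lin_closed[OF \<phi>] by (intro finsum_C_cong) auto
 have 2: "(\<Oplus>\<^bsub>gr C k\<^esub>i\<in>{..<m}. \<phi> (commutator_term n w i h)) = \<phi> (\<Oplus>\<^bsub>gr C n\<^esub>i\<in>{..<m}. commutator_term n w i h)" for h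
  by (rule lin_finsum[OF vs vs \<phi> commutator_terms_closed, symmetric]) (rule w)
 show ?thesis using lin_zero[OF vs vs \<phi>] by (simp add: commutator_def 1 2)
qed

lemma commutator_rank_one:
 assumes i: "i < m" and t: "t \<in> elts C 0" and c: "c \<in> elts C n"
 shows "commutator n (rank_one n i t c) p =
  rank_one n 0 t (mul C n 0 c (\<zeta> i)) p \<ominus>[gr C n] rank_one n 0 (mul C 0 0 (\<zeta> i) t) c p"
proof (cases "fst p = 0 \<and> snd p \<in> dual")
 case True
 interpret A: abelian_group "gr C n" by simp
 let ?h = "snd p"
 have h: "?h \<in> dual" using True by simp
 let ?x = "rank_one n 0 t (mul C n 0 c (\<zeta> i)) p \<ominus>[gr C n] rank_one n 0 (mul C 0 0 (\<zeta> i) t) c p"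
 have x: "?x \<in> elts C n" by (intro minus_closed' rank_one_closed mul_0 c \<zeta> i)
 have "commutator_term n (rank_one n i t c) i' ?h = (if i = i' then ?x else \<zero>[gr C n])" if "i' < m" for i'
 proof (cases "i = i'")
  case eq: True
  then show ?thesis using True dual_left_closed[OF h \<zeta>[OF i]] mul_smult_left[OF c \<zeta>[OF i], of "?h t"] t
   by (simp add: commutator_term_def rank_one_def dual_left_def)
 next
  case False
  then show ?thesis using mul_zero_left[OF \<zeta>[OF that], of n]
   by (simp add: commutator_term_def rank_one_def a_minus_def A.r_neg)
 qed
 then have "(\<Oplus>\<^bsub>gr C n\<^esub>i'\<in>{..<m}. commutator_term n (rank_one n i t c) i' ?h) = (\<Oplus>\<^bsub>gr C n\<^esub>i'\<in>{..<m}. if i = i' then ?x else \<zero>[gr C n])"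
  using x zero_closed by (intro finsum_C_cong) auto
 also have "\<dots> = ?x" using A.finsum_singleton[of i "{..<m}" "%_. ?x"] i x by simp
 finally show ?thesis using True by (simp add: commutator_def)
next
 case False
 interpret A: abelian_group "gr C n" by simp
 show ?thesis using False by (auto simp: commutator_def rank_one_def a_minus_def A.r_neg)
qed

lemma minus_fr:
 assumes "y \<in> fr J n" "y' \<in> fr J n" shows "(%p. y p \<ominus>[gr C n] y' p) \<in> fr J n"
proof -
 have "(%p. y p \<oplus>[gr C n] (-1) \<odot>[gr C n] y' p) \<in> fr J n" by (rule fr_add[OF fr_smult[OF assms(2)] assms(1)]) simp
 moreover have "y p \<ominus>[gr C n] y' p = y p \<oplus>[gr C n] (-1) \<odot>[gr C n] y' p" for p
  by (simp add: a_minus_def vs_minus[OF vs value_closed[OF assms(2)]])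
 ultimately show ?thesis by simp
qed

lemma commutator_zero: "commutator n (%p. \<zero>[gr C n]) p = \<zero>[gr C n]"
proof -
 have "(%x. \<zero>[gr C n]) \<in> linear_maps (gr C n) (gr C n)"
  by (rule linear_mapsI) (simp_all add: zero_closed l_zero vs_smult_zero)
 from commutator_map[OF this, of "%p. \<zero>[gr C n]" p] show ?thesis
  using mul_zero_left[OF \<zeta>, of _ n] by (simp add: zero_closed)
qed

lemma commutator_closed: "w \<in> fr {..<m} n ==> commutator n w \<in> fr {0} n"
proof (induction rule: finite_rank.induct)
 case finite_rank_zero
 show ?case using finite_rank.finite_rank_zero by (simp add: commutator_zero[abs_def])
next
 case (finite_rank_step w i t c)
 then have i: "i < m" by simp
 have "commutator n (%p. w p \<oplus>[gr C n] rank_one n i t c p) = (%p. commutator n w p \<oplus>[gr C n]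
   (rank_one n 0 t (mul C n 0 c (\<zeta> i)) p \<ominus>[gr C n] rank_one n 0 (mul C 0 0 (\<zeta> i) t) c p))"
  using finite_rank_step
  by (intro ext) (simp add: commutator_add[OF value_closed[OF finite_rank_step(1)] rank_one_closed] commutator_rank_one[OF i])
 also have "\<dots> \<in> fr {0} n"
  using finite_rank_step \<zeta>[OF i] by (intro fr_add[OF minus_fr finite_rank_step.IH] rank_one_in) (auto simp: mul_0 mul0)
 finally show ?case .
qed

abbreviation "XV \<equiv> dg_bimodule.sqz C (fr_cplx {..<m}) fr_left fr_right"
abbreviation "X0 \<equiv> dg_bimodule.sqz C (fr_cplx {0}) fr_left fr_right"

definition commutator_hom :: "int => 'u \<times> (nat \<times> ('u => 'k) => 'u) => 'u \<times> (nat \<times> ('u => 'k) => 'u)" where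
 "commutator_hom n = restrict (%q. (fst q, commutator n (snd q))) (elts C n \<times> fr {..<m} n)"

lemma commutator_hom: "commutator_hom \<in> dga_homs XV X0"
proof -
 have lin: "commutator n \<in> linear_maps (gr (fr_cplx {..<m}) n) (gr (fr_cplx {0}) n)" for n
 proof (rule linear_mapsI)
  fix w assume "w \<in> elts (fr_cplx {..<m}) n"
  then have w: "w \<in> fr {..<m} n" by simp
  show "commutator n w \<in> elts (fr_cplx {0}) n" using commutator_closed[OF w] by simp
  have sl: "(%x. c \<odot>[gr C n] x) \<in> linear_maps (gr C n) (gr C n)" for c
   by (rule linear_mapsI) (auto simp: vs_smult_closed vs_distr vs_assoc mult.commute)
  show "commutator n (c \<odot>[gr (fr_cplx {..<m}) n] w) = c \<odot>[gr (fr_cplx {0}) n] commutator n w" for c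
   using mul_smult_left[OF _ \<zeta>, of _ n] by (intro ext) (simp add: commutator_map[OF sl value_closed[OF w]])
  show "commutator n (w \<oplus>[gr (fr_cplx {..<m}) n] w') = commutator n w \<oplus>[gr (fr_cplx {0}) n] commutator n w'"
   if "w' \<in> elts (fr_cplx {..<m}) n" for w'
  proof (rule ext)
   fix p
   have "w' \<in> fr {..<m} n" using that by simp
   from commutator_add[OF value_closed[OF w] value_closed[OF this]]
   show "commutator n (w \<oplus>[gr (fr_cplx {..<m}) n] w') p = (commutator n w \<oplus>[gr (fr_cplx {0}) n] commutator n w') p" by simp
  qed
 qed
 have dif: "commutator (n - 1) (dif (fr_cplx {..<m}) n w) = dif (fr_cplx {0}) n (commutator n w)"
  if "w \<in> elts (fr_cplx {..<m}) n" for n w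
 proof -
  have w: "w \<in> fr {..<m} n" using that by simp
  have "dif C n (mul C n 0 x (\<zeta> i)) = mul C (n - 1) 0 (dif C n x) (\<zeta> i)" if "x \<in> elts C n" "i < m" for x i
   using leibniz[OF that(1) \<zeta>[OF that(2)]] dif_0[OF \<zeta>[OF that(2)]] mul_zero_right[OF that(1), of "-1"] mul_0[OF d_closed[OF that(1)] \<zeta>[OF that(2)]]
   by (simp add: vs_smult_zero r_zero)
  then show ?thesis by (intro ext) (simp add: commutator_map[OF d_lin value_closed[OF w]])
 qed
 have left: "commutator (i + j) (fr_left i j x w) = fr_left i j x (commutator j w)"
  if x: "x \<in> elts C i" and "w \<in> elts (fr_cplx {..<m}) j" for i j x w
 proof -
  have w: "w \<in> fr {..<m} j" using that by simp
  have "mul C i j x (mul C j 0 y (\<zeta> a)) = mul C (i + j) 0 (mul C i j x y) (\<zeta> a)" if "y \<in> elts C j" "a < m" for y a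
   using mul_assoc[OF x that(1) \<zeta>[OF that(2)]] by simp
  then show ?thesis
   by (intro ext) (simp add: fr_left_def[abs_def] commutator_map[OF mul_linear_right[OF x] value_closed[OF w]])
 qed
 have right: "commutator (i + j) (fr_right i j w x) = fr_right i j (commutator i w) x"
  if "w \<in> elts (fr_cplx {..<m}) i" and x: "x \<in> elts C j" for i j x w
 proof (cases "j = 0")
  case False
  then show ?thesis by (intro ext) (simp add: fr_right_def[abs_def] commutator_zero)
 next
  case True
  have w: "w \<in> fr {..<m} i" using that by simp
  have x0: "x \<in> elts C 0" using x True by simp
  have "commutator_term i (fr_right i 0 w x) a h = commutator_term i w a (dual_right h x)" if "h \<in> dual" "a < m" for a h
   using that \<zeta>[OF that(2)] x0 by (simp add: commutator_term_def fr_right_def dual_left_closed dual_right_left)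
  then have "(\<Oplus>\<^bsub>gr C i\<^esub>a\<in>{..<m}. commutator_term i (fr_right i 0 w x) a h) = (\<Oplus>\<^bsub>gr C i\<^esub>a\<in>{..<m}. commutator_term i w a (dual_right h x))"
   if "h \<in> dual" for h
   using commutator_terms_closed[of w i, OF value_closed[OF w]] that by (intro finsum_C_cong) auto
  then show ?thesis using x0 True
   by (intro ext) (auto simp: commutator_def fr_right_def[of i 0 "commutator i w"] dual_right_closed)
 qed
 show ?thesis
  using bimodule_map_hom[where g = commutator, OF fr_bimodule fr_bimodule lin dif left right]
  unfolding commutator_hom_def[abs_def] fr_cplx_simps .
qed

text \<open>The action map \<open>C \<otimes> H\<^sub>0(C) \<rightarrow> C\<close>, in coordinates with respect to finitely many basis
 elements.  It is well defined only up to boundaries, and on cycles only.\<close>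

definition action_sum :: "int => 'u set => (nat \<times> ('u => 'k) => 'u) => 'u" where
 "action_sum n S y = (\<Oplus>\<^bsub>gr C n\<^esub>j\<in>S. mul C n 0 (y (0, \<kappa> j)) j)"

lemma action_terms: "S \<subseteq> B ==> (\<And>p. y p \<in> elts C n) ==> (%j. mul C n 0 (y (0, \<kappa> j)) j) \<in> S -> elts C n"
 using B_sub by (auto intro!: mul_0)

lemma action_sum_closed: "S \<subseteq> B ==> (\<And>p. y p \<in> elts C n) ==> action_sum n S y \<in> elts C n"
 unfolding action_sum_def by (rule finsum_C_closed[OF action_terms])

lemma action_sum_add:
 assumes S: "S \<subseteq> B" and y: "\<And>p. y p \<in> elts C n" "\<And>p. y' p \<in> elts C n"
 shows "action_sum n S (%p. y p \<oplus>[gr C n] y' p) = action_sum n S y \<oplus>[gr C n] action_sum n S y'"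
proof -
 interpret A: abelian_group "gr C n" by simp
 have "action_sum n S (%p. y p \<oplus>[gr C n] y' p) = (\<Oplus>\<^bsub>gr C n\<^esub>j\<in>S. mul C n 0 (y (0, \<kappa> j)) j \<oplus>[gr C n] mul C n 0 (y' (0, \<kappa> j)) j)"
  unfolding action_sum_def
 proof (rule finsum_C_cong)
  show "(%j. mul C n 0 (y (0, \<kappa> j)) j \<oplus>[gr C n] mul C n 0 (y' (0, \<kappa> j)) j) \<in> S -> elts C n"
   using S B_sub y by (auto intro!: mul_0 add_closed)
  fix j assume "j \<in> S"
  then have "j \<in> elts C 0" using S B_sub by auto
  from mul_add_left[OF y(1) y(2) this] show "mul C n 0 (y (0, \<kappa> j) \<oplus>[gr C n] y' (0, \<kappa> j)) j =
   mul C n 0 (y (0, \<kappa> j)) j \<oplus>[gr C n] mul C n 0 (y' (0, \<kappa> j)) j" by simp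
 qed
 also have "\<dots> = action_sum n S y \<oplus>[gr C n] action_sum n S y'"
  unfolding action_sum_def by (rule A.finsum_addf[OF action_terms[OF S y(1)] action_terms[OF S y(2)]])
 finally show ?thesis .
qed

lemma action_sum_boundary:
 assumes S: "finite S" "S \<subseteq> B" and y: "\<And>p. y p \<in> boundaries C n"
 shows "action_sum n S y \<in> boundaries C n"
proof -
 interpret A: abelian_group "gr C n" by simp
 have t: "mul C n 0 (y p) j \<in> boundaries C n" if "j \<in> B" for j p
 proof -
  have "j \<in> cycles C 0" using that B_sub by (auto simp: cycles_0)
  from boundary_mul_left[OF y[of p] this] show ?thesis by simp
 qed
 show ?thesis unfolding action_sum_def using S
 proof (induction S)
  case (insert j S)
  then have "(%j. mul C n 0 (y (0, \<kappa> j)) j) \<in> S -> elts C n" using boundaries_elts[OF y] by (intro action_terms) auto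
  then show ?case using insert t[of j] boundaries_elts[OF t[of j]] by (auto simp: A.finsum_insert intro!: boundaries_ops(2))
 qed (simp add: boundaries_ops)
qed

lemma action_sum_rank_one:
 assumes S: "finite S" "S \<subseteq> B" "supp t \<subseteq> S" and t: "t \<in> elts C 0" and c: "c \<in> cycles C n"
 shows "mul C n 0 c t \<ominus>[gr C n] action_sum n S (rank_one n 0 t c) \<in> boundaries C n"
proof -
 interpret A0: abelian_group "gr C 0" by simp
 have c': "c \<in> elts C n" by (rule cycles_elts[OF c])
 let ?s = "\<Oplus>\<^bsub>gr C 0\<^esub>j\<in>S. \<kappa> j t \<odot>[gr C 0] j"
 have s: "?s \<in> elts C 0" by (rule A0.finsum_closed[OF \<kappa>_scaled_closed[OF S(2)]])
 have l: "mul C n 0 c \<in> linear_maps (gr C 0) (gr C n)" using mul_linear_right[OF c', of 0] by simp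
 have "mul C n 0 c ?s = (\<Oplus>\<^bsub>gr C n\<^esub>j\<in>S. mul C n 0 c (\<kappa> j t \<odot>[gr C 0] j))"
  by (rule lin_finsum[OF vs vs l \<kappa>_scaled_closed[OF S(2)]])
 also have "\<dots> = action_sum n S (rank_one n 0 t c)"
  unfolding action_sum_def
 proof (rule finsum_C_cong)
  show "(%j. mul C n 0 (rank_one n 0 t c (0, \<kappa> j)) j) \<in> S -> elts C n"
   by (rule action_terms[OF S(2)]) (rule rank_one_closed[OF c'])
  fix j assume "j \<in> S"
  then have j: "j \<in> B" "j \<in> elts C 0" using S(2) B_sub by auto
  show "mul C n 0 c (\<kappa> j t \<odot>[gr C 0] j) = mul C n 0 (rank_one n 0 t c (0, \<kappa> j)) j"
   using mul_smult_right[OF c' j(2), of "\<kappa> j t"] mul_smult_left[OF c' j(2), of "\<kappa> j t"] \<kappa>_dual[OF j(1)] by (simp add: rank_one_def)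
 qed
 finally have "mul C n 0 c t \<ominus>[gr C n] action_sum n S (rank_one n 0 t c) = mul C n 0 c (t \<ominus>[gr C 0] ?s)"
  using lin_diff[OF vs vs l t s] by simp
 then show ?thesis using boundary_mul_right[OF c expand_superset[OF t S]] by simp
qed

text \<open>The two terms of \<open>c \<zeta>\<^sub>i \<otimes> t - c \<otimes> \<zeta>\<^sub>i t\<close> have the same image \<open>c \<zeta>\<^sub>i t\<close>.  As the sum runs over finitely many basis elements,
 it has to contain the supports of all tensor factors that occur in \<open>w\<close>.\<close>

lemma action_sum_commutator:
 assumes "w \<in> finite_rank {..<m} n (cycles C n)"
 shows "\<exists>S0. finite S0 \<and> S0 \<subseteq> B \<and> (\<forall>S. finite S --> S0 \<subseteq> S --> S \<subseteq> B --> action_sum n S (commutator n w) \<in> boundaries C n)"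
 using assms
proof (induction rule: finite_rank.induct)
 case finite_rank_zero
 have "action_sum n S (commutator n (%p. \<zero>[gr C n])) \<in> boundaries C n" if "finite S" "S \<subseteq> B" for S
  using that by (intro action_sum_boundary) (auto simp: commutator_zero boundaries_ops)
 then show ?case by blast
next
 case (finite_rank_step w i t c)
 interpret A: abelian_group "gr C n" by simp
 from finite_rank_step have i: "i < m" by simp
 have c: "c \<in> elts C n" by (rule cycles_elts[OF finite_rank_step(4)])
 let ?r = "rank_one n 0 t (mul C n 0 c (\<zeta> i))" and ?r' = "rank_one n 0 (mul C 0 0 (\<zeta> i) t) c"
 have cz: "mul C n 0 c (\<zeta> i) \<in> cycles C n" using mul_cycles[OF finite_rank_step(4), of "\<zeta> i" 0] \<zeta>[OF i] by (simp add: cycles_0)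
 have zt: "mul C 0 0 (\<zeta> i) t \<in> elts C 0" using \<zeta>[OF i] finite_rank_step(3) by (rule mul0)
 have w: "w p \<in> elts C n" for p by (rule fr_value[OF finite_rank_step(1)]) (auto simp: cycles_elts)
 have r: "?r p \<in> elts C n" "?r' p \<in> elts C n" for p by (intro rank_one_closed cycles_elts[OF cz] c)+
 have cw: "commutator n w p \<in> elts C n" for p by (rule commutator_value) (rule w)
 obtain S0 where S0: "finite S0" "S0 \<subseteq> B"
  "\<And>S. finite S ==> S0 \<subseteq> S ==> S \<subseteq> B ==> action_sum n S (commutator n w) \<in> boundaries C n"
  using finite_rank_step.IH by blast
 show ?case
 proof (intro exI[of _ "S0 \<union> supp t \<union> supp (mul C 0 0 (\<zeta> i) t)"] conjI allI impI)
  show "finite (S0 \<union> supp t \<union> supp (mul C 0 0 (\<zeta> i) t))" using S0 \<kappa>_finite[OF finite_rank_step(3)] \<kappa>_finite[OF zt] by simp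
  show "S0 \<union> supp t \<union> supp (mul C 0 0 (\<zeta> i) t) \<subseteq> B" using S0 by auto
  fix S assume S: "finite S" "S0 \<union> supp t \<union> supp (mul C 0 0 (\<zeta> i) t) \<subseteq> S" "S \<subseteq> B"
  let ?a = "action_sum n S"
  have d: "?r p \<ominus>[gr C n] ?r' p \<in> elts C n" for p using r by (intro minus_closed')
  have "commutator n (%p. w p \<oplus>[gr C n] rank_one n i t c p) = (%p. commutator n w p \<oplus>[gr C n] (?r p \<ominus>[gr C n] ?r' p))"
   using finite_rank_step c by (intro ext) (simp add: commutator_add[OF w rank_one_closed] commutator_rank_one[OF i])
  then have 1: "?a (commutator n (%p. w p \<oplus>[gr C n] rank_one n i t c p)) = ?a (commutator n w) \<oplus>[gr C n] ?a (%p. ?r p \<ominus>[gr C n] ?r' p)"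
   using action_sum_add[OF S(3), of "commutator n w" n "%p. ?r p \<ominus>[gr C n] ?r' p", OF cw d] by simp
  have "?r = (%p. ?r' p \<oplus>[gr C n] (?r p \<ominus>[gr C n] ?r' p))"
  proof (rule ext)
   fix p show "?r p = ?r' p \<oplus>[gr C n] (?r p \<ominus>[gr C n] ?r' p)" using A.diff_eq_iff[OF r(1)[of p] r(2)[of p] d[of p]] by simp
  qed
  then have "?a ?r = ?a ?r' \<oplus>[gr C n] ?a (%p. ?r p \<ominus>[gr C n] ?r' p)"
   using action_sum_add[OF S(3), of ?r' n "%p. ?r p \<ominus>[gr C n] ?r' p", OF r(2) d] by (rule HOL.trans[OF arg_cong[where f = ?a]])
  then have 2: "?a (%p. ?r p \<ominus>[gr C n] ?r' p) = ?a ?r \<ominus>[gr C n] ?a ?r'"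
   using A.diff_eq_iff[of "?a ?r" "?a ?r'" "?a (%p. ?r p \<ominus>[gr C n] ?r' p)"] action_sum_closed[OF S(3)] r d by simp
  have ctz: "mul C n 0 (mul C n 0 c (\<zeta> i)) t = mul C n 0 c (mul C 0 0 (\<zeta> i) t)"
   using mul_assoc[OF c \<zeta>[OF i] finite_rank_step(3)] by simp
  let ?y = "mul C n 0 c (mul C 0 0 (\<zeta> i) t)"
  have y: "?y \<in> elts C n" using c zt by (rule mul_0)
  have b1: "?y \<ominus>[gr C n] ?a ?r \<in> boundaries C n"
   using action_sum_rank_one[OF S(1,3) _ finite_rank_step(3) cz] S(2) by (simp add: ctz)
  have b2: "?y \<ominus>[gr C n] ?a ?r' \<in> boundaries C n"
   using action_sum_rank_one[OF S(1,3) _ zt finite_rank_step(4)] S(2) by simp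
  have "(?y \<ominus>[gr C n] ?a ?r') \<ominus>[gr C n] (?y \<ominus>[gr C n] ?a ?r) = ?a ?r \<ominus>[gr C n] ?a ?r'"
   using y action_sum_closed[OF S(3) r(1)] action_sum_closed[OF S(3) r(2)] by (rule A.diff_diff_diff)
  then have "?a ?r \<ominus>[gr C n] ?a ?r' \<in> boundaries C n" using boundaries_ops(5)[OF b2 b1] by simp
  moreover have "?a (commutator n w) \<in> boundaries C n" using S0(3)[of S] S by blast
  ultimately show "?a (commutator n (%p. w p \<oplus>[gr C n] rank_one n i t c p)) \<in> boundaries C n"
   unfolding 1 2 by (intro boundaries_ops(2))
 qed
qed

definition one_tensor_one :: "nat \<times> ('u => 'k) => 'u" where "one_tensor_one = rank_one 0 0 (unit C) (unit C)"

lemma one_tensor_one_cycle: "one_tensor_one \<in> cycles (fr_cplx {0}) 0"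
 using rank_one_in[of 0 "{0}" "unit C" "unit C" "elts C 0" 0] rank_one_closed[OF unit_closed, of 0]
 by (simp add: cycles_fr cycles_0 one_tensor_one_def unit_closed)

lemma left_one_tensor_one: "x \<in> elts C n ==> fr_left n 0 x one_tensor_one = rank_one n 0 (unit C) x"
 using mul_smult_right[OF _ unit_closed, of x n] mul_zero_right[of x n 0] unit_right[of x n]
 by (intro ext) (simp add: fr_left_def one_tensor_one_def rank_one_def)

text \<open>Apply the action map \<open>C \<otimes> H\<^sub>0(C) \<rightarrow> H\<^sub>n(C)\<close>: it sends \<open>x \<otimes> 1\<close> to the class of \<open>x\<close>, and the commutator to zero.\<close>

lemma boundary_if_commutator:
 assumes x: "x \<in> cycles C n" and w: "w \<in> cycles (fr_cplx {..<m}) n"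
  and b: "(%p. rank_one n 0 (unit C) x p \<ominus>[gr C n] commutator n w p) \<in> boundaries (fr_cplx {0}) n"
 shows "x \<in> boundaries C n"
proof -
 interpret A: abelian_group "gr C n" by simp
 let ?r = "rank_one n 0 (unit C) x" and ?z = "%p. rank_one n 0 (unit C) x p \<ominus>[gr C n] commutator n w p"
 have x': "x \<in> elts C n" by (rule cycles_elts[OF x])
 have w': "w \<in> fr {..<m} n" "\<And>p. w p \<in> cycles C n" using w unfolding cycles_fr by blast+
 have "w \<in> finite_rank {..<m} n (cycles C n)" by (rule fr_values[OF w'(1) _ w'(2)]) (use cycles_elts in blast)
 from action_sum_commutator[OF this] obtain S0 where S0: "finite S0" "S0 \<subseteq> B"
  "\<And>S. finite S ==> S0 \<subseteq> S ==> S \<subseteq> B ==> action_sum n S (commutator n w) \<in> boundaries C n" by blast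
 \<comment> \<open>large enough both for \<open>w\<close> and for \<open>x \<otimes> 1\<close>\<close>
 define S where "S = S0 \<union> supp (unit C)"
 have S: "finite S" "S \<subseteq> B" "S0 \<subseteq> S" "supp (unit C) \<subseteq> S" using S0 \<kappa>_finite[OF unit_closed] by (auto simp: S_def)
 let ?a = "action_sum n S"
 have z: "?z p \<in> boundaries C n" for p using b unfolding boundaries_fr by blast
 have cw: "commutator n w p \<in> elts C n" for p by (rule commutator_value) (rule value_closed[OF w'(1)])
 have z': "?z p \<in> elts C n" for p by (rule boundaries_elts[OF z])
 have "?r = (%p. commutator n w p \<oplus>[gr C n] ?z p)"
 proof (rule ext)
  fix p show "?r p = commutator n w p \<oplus>[gr C n] ?z p"
   by (rule iffD1[OF A.diff_eq_iff[OF rank_one_closed[OF x'] cw z'] HOL.refl])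
 qed
 then have "?a ?r = ?a (commutator n w) \<oplus>[gr C n] ?a ?z"
  using action_sum_add[OF S(2), of "commutator n w" n ?z, OF cw z'] by (rule HOL.trans[OF arg_cong[where f = ?a]])
 then have ar: "?a ?r \<in> boundaries C n"
  using boundaries_ops(2)[OF S0(3)[OF S(1,3,2)] action_sum_boundary[OF S(1,2), of ?z n, OF z]] by (simp only:)
 have "x \<ominus>[gr C n] ?a ?r \<in> boundaries C n"
  using action_sum_rank_one[OF S(1,2,4) unit_closed x] unit_right[OF x'] by simp
 from boundaries_ops(2)[OF this ar] show ?thesis
  using x' boundaries_elts[OF ar] by (simp add: a_minus_def A.a_assoc A.l_neg)
qed

end

section \<open>Free algebras\<close>

lemma free_algebra_simps [simp]:
 "carrier (free_algebra m) = {p. keys p \<subseteq> lists {..<m}}" "\<zero>[free_algebra m] = 0"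
 "p \<oplus>[free_algebra m] q = p + q" "c \<odot>[free_algebra m] p = scl c p" "\<one>[free_algebra m] = single [] 1"
 by (simp_all add: free_algebra_def)

lemma poly_mapping_induct_single:
 fixes p :: "'w \<Rightarrow>\<^sub>0 'k::field"
 assumes p: "keys p \<subseteq> A" and z: "P 0" and s: "\<And>w c. w \<in> A ==> P (single w c)"
  and a: "\<And>p q. keys p \<subseteq> A ==> keys q \<subseteq> A ==> P p ==> P q ==> P (p + q)"
 shows "P p"
proof -
 let ?s = "%F. \<Sum>w\<in>F. single w (lookup p w)"
 have "keys (?s F) \<subseteq> A \<and> P (?s F)" if "finite F" "F \<subseteq> A" for F
  using that
 proof (induction F rule: finite_induct)
  case empty then show ?case using z by simp
 next
  case (insert w F)
  have 1: "keys (single w (lookup p w)) \<subseteq> A" using insert.prems by auto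
  have 2: "keys (?s F) \<subseteq> A" "P (?s F)" using insert by auto
  have 3: "?s (insert w F) = single w (lookup p w) + ?s F" using insert.hyps by simp
  have "P (?s (insert w F))" unfolding 3 by (rule a[OF 1 2(1) s 2(2)]) (use insert.prems in simp)
  moreover have "keys (?s (insert w F)) \<subseteq> A" unfolding 3 using Poly_Mapping.keys_add[of "single w (lookup p w)" "?s F"] 1 2(1) by blast
  ultimately show ?case by blast
 qed
 from this[of "keys p"] have "P (?s (keys p))" using p by simp
 moreover have "?s (keys p) = p"
  by (rule poly_mapping_eqI) (simp add: lookup_sum lookup_single when_def in_keys_iff)
 ultimately show ?thesis by simp
qed

lemma free_mult:
 assumes "finite U" "keys p \<subseteq> U" "finite V" "keys q \<subseteq> V"
 shows "p \<otimes>[free_algebra m] q =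
  (\<Sum>u\<in>U. \<Sum>v\<in>V. single (u @ v) (lookup p u * lookup q v))"
proof -
 have "(\<Sum>v\<in>keys q. single (u @ v) (lookup p u * lookup q v)) =
  (\<Sum>v\<in>V. single (u @ v) (lookup p u * lookup q v))" for u
  using assms by (intro sum.mono_neutral_left) (auto simp: in_keys_iff)
 moreover have "(\<Sum>u\<in>keys p. \<Sum>v\<in>V. single (u @ v) (lookup p u * lookup q v)) =
  (\<Sum>u\<in>U. \<Sum>v\<in>V. single (u @ v) (lookup p u * lookup q v))"
  using assms by (intro sum.mono_neutral_left) (auto simp: in_keys_iff)
 ultimately show ?thesis by (simp add: free_algebra_def)
qed

lemma free_mult_add_left: "(p + p') \<otimes>[free_algebra m] q = p \<otimes>[free_algebra m] q + p' \<otimes>[free_algebra m] q"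
proof -
 let ?U = "keys p \<union> keys p'"
 have "keys (p + p') \<subseteq> ?U" by (rule Poly_Mapping.keys_add)
 then show ?thesis
  by (simp add: free_mult[of ?U _ "keys q"] lookup_add algebra_simps single_add sum.distrib)
qed

lemma free_mult_add_right: "q \<otimes>[free_algebra m] (p + p') = q \<otimes>[free_algebra m] p + q \<otimes>[free_algebra m] p'"
proof -
 let ?U = "keys p \<union> keys p'"
 have "keys (p + p') \<subseteq> ?U" by (rule Poly_Mapping.keys_add)
 then show ?thesis
  by (simp add: free_mult[of "keys q" _ ?U] lookup_add algebra_simps single_add sum.distrib)
qed

lemma free_mult_zero [simp]: "0 \<otimes>[free_algebra m] q = 0" "q \<otimes>[free_algebra m] 0 = 0"
 by (simp_all add: free_algebra_def)

lemma free_mult_single [simp]: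
 "single u c \<otimes>[free_algebra m] single v d = single (u @ v) (c * d)"
 by (simp add: free_mult[of "{u}" _ "{v}"] split: if_splits)

lemma scl_add: "scl c (p + q) = scl c p + scl c q"
 by (rule poly_mapping_eqI) (simp add: lookup_scl lookup_add algebra_simps)

lemma scl_zero: "scl c 0 = 0"
 by (rule poly_mapping_eqI) (simp add: lookup_scl)

lemma free_mult_scl:
 "scl c p \<otimes>[free_algebra m] q = scl c (p \<otimes>[free_algebra m] q)" "p \<otimes>[free_algebra m] scl c q = scl c (p \<otimes>[free_algebra m] q)"
proof -
 have *: "scl c (single u a) \<otimes>[free_algebra m] q = scl c (single u a \<otimes>[free_algebra m] q)
  \<and> q \<otimes>[free_algebra m] scl c (single u a) = scl c (q \<otimes>[free_algebra m] single u a)" for u a q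
  by (rule poly_mapping_induct_single[of q UNIV])
   (simp_all add: scl_single scl_zero scl_add free_mult_add_right free_mult_add_left mult.assoc mult.left_commute)
 show "scl c p \<otimes>[free_algebra m] q = scl c (p \<otimes>[free_algebra m] q)"
  by (rule poly_mapping_induct_single[of p UNIV]) (simp_all add: *[unfolded scl_single] scl_single scl_zero scl_add free_mult_add_left)
 show "p \<otimes>[free_algebra m] scl c q = scl c (p \<otimes>[free_algebra m] q)"
  by (rule poly_mapping_induct_single[of q UNIV]) (simp_all add: *[unfolded scl_single] scl_single scl_zero scl_add free_mult_add_right)
qed

lemma free_mult_assoc:
 "(p \<otimes>[free_algebra m] q) \<otimes>[free_algebra m] r = p \<otimes>[free_algebra m] (q \<otimes>[free_algebra m] r)"
proof (rule poly_mapping_induct_single[of p UNIV])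
 fix u a
 show "(single u a \<otimes>[free_algebra m] q) \<otimes>[free_algebra m] r =
  single u a \<otimes>[free_algebra m] (q \<otimes>[free_algebra m] r)"
 proof (rule poly_mapping_induct_single[of q UNIV])
  fix v b
  show "(single u a \<otimes>[free_algebra m] single v b) \<otimes>[free_algebra m] r =
   single u a \<otimes>[free_algebra m] (single v b \<otimes>[free_algebra m] r)"
   by (rule poly_mapping_induct_single[of r UNIV]) (simp_all add: free_mult_add_right mult.assoc)
 qed (simp_all add: free_mult_add_left free_mult_add_right)
qed (simp_all add: free_mult_add_left)

lemma free_mult_one:
 "single [] 1 \<otimes>[free_algebra m] p = p" "p \<otimes>[free_algebra m] single [] 1 = p"
proof -
 show "single [] 1 \<otimes>[free_algebra m] p = p"
  by (rule poly_mapping_induct_single[of p UNIV]) (simp_all add: free_mult_add_right)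
 show "p \<otimes>[free_algebra m] single [] 1 = p"
  by (rule poly_mapping_induct_single[of p UNIV]) (simp_all add: free_mult_add_left)
qed

lemma free_mult_closed:
 assumes "keys p \<subseteq> lists {..<m}" "keys q \<subseteq> lists {..<m}"
 shows "keys (p \<otimes>[free_algebra m] q) \<subseteq> lists {..<m}"
proof (rule poly_mapping_induct_single[OF assms(1)])
 fix u :: "nat list" and a assume u: "u \<in> lists {..<m}"
 show "keys (single u a \<otimes>[free_algebra m] q) \<subseteq> lists {..<m}"
 proof (rule poly_mapping_induct_single[OF assms(2)])
  fix p q assume "keys (single u a \<otimes>[free_algebra m] p) \<subseteq> lists {..<m}"
   "keys (single u a \<otimes>[free_algebra m] q) \<subseteq> lists {..<m}"
  then show "keys (single u a \<otimes>[free_algebra m] (p + q)) \<subseteq> lists {..<m}"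
   using Poly_Mapping.keys_add[of "single u a \<otimes>[free_algebra m] p" "single u a \<otimes>[free_algebra m] q"]
   by (simp only: free_mult_add_right) blast
 qed (use u in \<open>auto split: if_splits\<close>)
next
 fix p p' assume "keys (p \<otimes>[free_algebra m] q) \<subseteq> lists {..<m}"
  "keys (p' \<otimes>[free_algebra m] q) \<subseteq> lists {..<m}"
 then show "keys ((p + p') \<otimes>[free_algebra m] q) \<subseteq> lists {..<m}"
  using Poly_Mapping.keys_add[of "p \<otimes>[free_algebra m] q" "p' \<otimes>[free_algebra m] q"]
  by (simp only: free_mult_add_left) blast
qed simp

lemma keys_add_subset: "keys p \<subseteq> A ==> keys q \<subseteq> A ==> keys (p + q) \<subseteq> A"
 using Poly_Mapping.keys_add[of p q] by blast

lemma free_algebra_abelian_group: "abelian_group (free_algebra m :: ('k::field, _) module)"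
proof (rule abelian_groupI)
 fix p :: "nat list \<Rightarrow>\<^sub>0 'k" assume "p \<in> carrier (free_algebra m)"
 then show "\<exists>y\<in>carrier (free_algebra m). y \<oplus>[free_algebra m] p = \<zero>[free_algebra m :: ('k, _) module]"
  by (intro bexI[of _ "- p"]) auto
qed (simp_all add: add_ac keys_add_subset)

lemma free_algebra_assoc_algebra: "assoc_algebra (free_algebra m :: ('k::field, _) module)"
proof -
 have r: "ring (free_algebra m :: ('k, _) module)"
  by (rule ringI[OF free_algebra_abelian_group monoidI])
   (simp_all add: free_mult_closed free_mult_assoc free_mult_one free_mult_add_left free_mult_add_right)
 have v: "vspace (free_algebra m :: ('k, _) module)"
 proof (rule vspaceI[OF free_algebra_abelian_group])
  fix c d :: 'k and p :: "nat list \<Rightarrow>\<^sub>0 'k"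
  show "(c + d) \<odot>[free_algebra m] p = c \<odot>[free_algebra m] p \<oplus>[free_algebra m] d \<odot>[free_algebra m] p"
   "(c * d) \<odot>[free_algebra m] p = c \<odot>[free_algebra m] (d \<odot>[free_algebra m] p)" "1 \<odot>[free_algebra m] p = p"
   by (auto intro!: poly_mapping_eqI simp: lookup_scl lookup_add algebra_simps)
 qed (auto simp: scl_add dest: keys_scl[THEN subsetD])
 show ?thesis
  by (intro assoc_algebra.intro assoc_algebra_axioms.intro r v) (simp_all add: free_mult_scl)
qed

abbreviation generator :: "nat => (nat list \<Rightarrow>\<^sub>0 'k::field)" where "generator i \<equiv> single [i] 1"

lemma concentrated_simps:
 "elts (concentrated S) n = (if n = 0 then carrier S else {\<zero>[S]})"
 "x \<oplus>[gr (concentrated S) n] y = x \<oplus>[S] y" "\<zero>[gr (concentrated S) n] = \<zero>[S]" "c \<odot>[gr (concentrated S) n] x = c \<odot>[S] x"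
 "dif (concentrated S) n x = \<zero>[S]" "mul (concentrated S) i j x y = (if i = 0 \<and> j = 0 then x \<otimes>[S] y else \<zero>[S])"
 "unit (concentrated S) = \<one>[S]"
 by (simp_all add: concentrated_def)

lemma concentrated_homI:
 assumes S: "assoc_algebra S" and A: "dg_algebra A"
  and f: "\<And>x. x \<in> carrier S ==> f x \<in> cycles A 0"
   "\<And>x y. x \<in> carrier S ==> y \<in> carrier S ==> f (x \<oplus>[S] y) = f x \<oplus>[gr A 0] f y"
   "\<And>c x. x \<in> carrier S ==> f (c \<odot>[S] x) = c \<odot>[gr A 0] f x"
   "\<And>x y. x \<in> carrier S ==> y \<in> carrier S ==> f (x \<otimes>[S] y) = mul A 0 0 (f x) (f y)"
   "f \<one>[S] = unit A"
 shows "(%n. if n = 0 then restrict f (carrier S) else restrict (%_. \<zero>[gr A n]) {\<zero>[S]}) \<in> dga_homs (concentrated S) A"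
  (is "?g \<in> _")
proof -
 interpret S: assoc_algebra S by fact
 interpret A: dg_algebra A by fact
 have z: "\<zero>[gr A n] \<in> elts A n" for n using abelian_groupE(2)[OF A.ag] .
 have zz: "\<zero>[gr A n] \<oplus>[gr A n] \<zero>[gr A n] = \<zero>[gr A n]" for n using abelian_groupE(5)[OF A.ag z] .
 have f': "x \<in> carrier S ==> f x \<in> elts A 0" for x using f(1) A.cycles_elts by blast
 have f0: "f \<zero>[S] = \<zero>[gr A 0]"
 proof -
  interpret M: abelian_group "gr A 0" by simp
  have "f \<zero>[S] \<oplus>[gr A 0] f \<zero>[S] = f \<zero>[S]" using f(2)[of "\<zero>[S]" "\<zero>[S]"] by simp
  then show ?thesis using M.add.l_cancel_one[of "f \<zero>[S]" "f \<zero>[S]"] f'[of "\<zero>[S]"] by simp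
 qed
 have lin: "?g n \<in> linear_maps (gr (concentrated S) n) (gr A n)" for n
  by (cases "n = 0"; rule linear_mapsI)
   (simp_all add: concentrated_simps f f' z zz vs_smult_closed[OF S.vspace] vs_smult_zero[OF S.vspace] vs_smult_zero[OF A.vs])
 have dif: "?g (n - 1) (dif (concentrated S) n x) = dif A n (?g n x)" if "x \<in> elts (concentrated S) n" for n x
  using that f0 f(1)[of x] A.d_zero[of n] by (auto simp: concentrated_simps cycles_def split: if_splits)
 have mult: "?g (i + j) (mul (concentrated S) i j x y) = mul A i j (?g i x) (?g j y)"
  if x: "x \<in> elts (concentrated S) i" and y: "y \<in> elts (concentrated S) j" for i j x y
 proof (cases "i = 0 \<and> j = 0")
  case True then show ?thesis using x y by (simp add: concentrated_simps f)
 next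
  case False
  have gz: "?g n \<zero>[S] = \<zero>[gr A n]" for n by (simp add: f0)
  have "?g i x = \<zero>[gr A i] \<or> ?g j y = \<zero>[gr A j]" using False x y by (auto simp: concentrated_simps)
  then have "mul A i j (?g i x) (?g j y) = \<zero>[gr A (i + j)]"
   using A.mul_zero_left[OF lin_closed[OF lin y]] A.mul_zero_right[OF lin_closed[OF lin x]] by (elim disjE) (simp_all only:)
  moreover have "mul (concentrated S) i j x y = \<zero>[S]" using False by (auto simp: concentrated_simps)
  ultimately show ?thesis using gz[of "i + j"] by (simp only:)
 qed
 have ext: "?g n \<in> extensional (elts (concentrated S) n)" for n by (simp add: concentrated_simps)
 have u: "?g 0 (unit (concentrated S)) = unit A" by (simp add: concentrated_simps f)
 show ?thesis unfolding dga_homs_def chain_maps_def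
  using lin ext dif mult u by blast
qed

lemma free_algebra_hom_exists:
 fixes A :: "('k::field, 'v) dga" and a :: "nat => 'v"
 assumes A: "dg_algebra A" and a: "\<And>i. i < m ==> a i \<in> cycles A 0"
 obtains \<theta> where "\<theta> \<in> dga_homs (concentrated (free_algebra m)) A" "\<And>i. i < m ==> \<theta> 0 (generator i) = a i"
proof -
 interpret A: dg_algebra A by fact
 let ?F = "free_algebra m :: ('k, _) module"
 define w where "w = (%u. foldr (%i x. mul A 0 0 (a i) x) u (unit A))"
 have wc: "w u \<in> cycles A 0" if "u \<in> lists {..<m}" for u
  using that
 proof (induction u)
  case Nil then show ?case using A.unit_closed A.dif_unit by (simp add: w_def cycles_def)
 next
  case (Cons i u)
  then have "mul A 0 0 (a i) (w u) \<in> cycles A (0 + 0)" by (intro A.mul_cycles a) auto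
  then show ?case by (simp add: w_def)
 qed
 have we: "w u \<in> elts A 0" if "u \<in> lists {..<m}" for u using wc[OF that] by (rule A.cycles_elts)
 have wa: "w (u @ v) = mul A 0 0 (w u) (w v)" if "u \<in> lists {..<m}" "v \<in> lists {..<m}" for u v
  using that(1)
 proof (induction u)
  case Nil then show ?case using we[OF that(2)] A.unit_left[of "w v" 0] by (simp add: w_def)
 next
  case (Cons i u)
  then have i: "i < m" "u \<in> lists {..<m}" by auto
  have "w ((i # u) @ v) = mul A 0 0 (a i) (mul A 0 0 (w u) (w v))" using Cons.IH i by (simp add: w_def)
  also have "\<dots> = mul A 0 0 (mul A 0 0 (a i) (w u)) (w v)"
   using A.mul_assoc[OF A.cycles_elts[OF a[OF i(1)]] we[OF i(2)] we[OF that(2)]] by simp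
  finally show ?case by (simp add: w_def)
 qed
 let ?f = "lin_ext (gr A 0) w"
 have ext: "?f p \<in> elts A 0" "?f (p + q) = ?f p \<oplus>[gr A 0] ?f q" "?f (scl c p) = c \<odot>[gr A 0] ?f p"
  if p: "keys p \<subseteq> lists {..<m}" and q: "keys q \<subseteq> lists {..<m}" for p q c
  by (rule lin_ext_closed[OF A.vs, of "lists {..<m}"], erule we, rule p)
   (rule lin_ext_add[OF A.vs, of "lists {..<m}"], erule we, rule p, rule q,
   rule lin_ext_scl[OF A.vs, of "lists {..<m}"], erule we, rule p)
 have ext_single: "?f (single u c) = c \<odot>[gr A 0] w u" if "u \<in> lists {..<m}" for u c
  by (rule lin_ext_single[OF A.vs, of "lists {..<m}"], erule we, rule that)
 have fz: "?f 0 = \<zero>[gr A 0]"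
  using abelian_monoid.finsum_empty[OF abelian_group.axioms(1)[OF A.ag[of 0]]] by (simp add: lin_ext_def)
 have cz: "\<zero>[gr A 0] \<in> elts A 0" using abelian_groupE(2)[OF A.ag] .
 have mult1: "?f (single u c \<otimes>[?F] q) = mul A 0 0 (?f (single u c)) (?f q)"
  if u: "u \<in> lists {..<m}" and q: "keys q \<subseteq> lists {..<m}" for u c q
 proof (rule poly_mapping_induct_single[OF q])
  have su: "keys (single u c) \<subseteq> lists {..<m}" using u by (auto split: if_splits)
  show "?f (single u c \<otimes>[?F] 0) = mul A 0 0 (?f (single u c)) (?f 0)"
   using A.mul_zero_right[OF ext(1)[OF su su], of 0] by (simp add: fz)
  show "?f (single u c \<otimes>[?F] single v d) = mul A 0 0 (?f (single u c)) (?f (single v d))"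
   if v: "v \<in> lists {..<m}" for v d
  proof -
   have "mul A 0 0 (c \<odot>[gr A 0] w u) (d \<odot>[gr A 0] w v) = c \<odot>[gr A 0] (d \<odot>[gr A 0] mul A 0 0 (w u) (w v))"
    using A.mul_smult_left[OF we[OF u] vs_smult_closed[OF A.vs we[OF v]]] A.mul_smult_right[OF we[OF u] we[OF v]] by simp
   then show ?thesis using u v A.mul00(1)[OF we[OF u] we[OF v]]
    by (simp add: ext_single wa vs_assoc[OF A.vs])
  qed
  fix p q assume pq: "keys p \<subseteq> lists {..<m}" "keys q \<subseteq> lists {..<m}"
   "?f (single u c \<otimes>[?F] p) = mul A 0 0 (?f (single u c)) (?f p)"
   "?f (single u c \<otimes>[?F] q) = mul A 0 0 (?f (single u c)) (?f q)"
  have "?f (single u c \<otimes>[?F] (p + q)) = ?f (single u c \<otimes>[?F] p) \<oplus>[gr A 0] ?f (single u c \<otimes>[?F] q)"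
   unfolding free_mult_add_right by (rule ext(2)[OF free_mult_closed[OF su pq(1)] free_mult_closed[OF su pq(2)]])
  also have "\<dots> = mul A 0 0 (?f (single u c)) (?f p \<oplus>[gr A 0] ?f q)"
   using A.mul_add_right[OF ext(1)[OF su su] ext(1)[OF pq(1) pq(1)] ext(1)[OF pq(2) pq(2)]] pq(3,4) by simp
  also have "?f p \<oplus>[gr A 0] ?f q = ?f (p + q)" by (rule ext(2)[OF pq(1,2), symmetric])
  finally show "?f (single u c \<otimes>[?F] (p + q)) = mul A 0 0 (?f (single u c)) (?f (p + q))" .
 qed
 have mult: "?f (p \<otimes>[?F] q) = mul A 0 0 (?f p) (?f q)"
  if p: "keys p \<subseteq> lists {..<m}" and q: "keys q \<subseteq> lists {..<m}" for p q
 proof (rule poly_mapping_induct_single[OF p])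
  show "?f (0 \<otimes>[?F] q) = mul A 0 0 (?f 0) (?f q)"
   using A.mul_zero_left[OF ext(1)[OF q q], of 0] by (simp add: fz)
  fix p p' assume pq: "keys p \<subseteq> lists {..<m}" "keys p' \<subseteq> lists {..<m}"
   "?f (p \<otimes>[?F] q) = mul A 0 0 (?f p) (?f q)" "?f (p' \<otimes>[?F] q) = mul A 0 0 (?f p') (?f q)"
  have "?f ((p + p') \<otimes>[?F] q) = ?f (p \<otimes>[?F] q) \<oplus>[gr A 0] ?f (p' \<otimes>[?F] q)"
   unfolding free_mult_add_left by (rule ext(2)[OF free_mult_closed[OF pq(1) q] free_mult_closed[OF pq(2) q]])
  also have "\<dots> = mul A 0 0 (?f p \<oplus>[gr A 0] ?f p') (?f q)"
   using A.mul_add_left[OF ext(1)[OF pq(1) pq(1)] ext(1)[OF pq(2) pq(2)] ext(1)[OF q q]] pq(3,4) by simp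
  also have "?f p \<oplus>[gr A 0] ?f p' = ?f (p + p')" by (rule ext(2)[OF pq(1,2), symmetric])
  finally show "?f ((p + p') \<otimes>[?F] q) = mul A 0 0 (?f (p + p')) (?f q)" .
 qed (rule mult1[OF _ q])
 have cyc: "?f p \<in> cycles A 0" if "keys p \<subseteq> lists {..<m}" for p
 proof (rule poly_mapping_induct_single[OF that])
  show "?f 0 \<in> cycles A 0" using A.cycles_ops(1)[of 0] by (simp add: fz)
  show "?f (single u c) \<in> cycles A 0" if "u \<in> lists {..<m}" for u c
   using A.cycles_ops(3)[OF wc[OF that]] by (simp add: ext_single[OF that])
  fix p q assume pq: "keys p \<subseteq> lists {..<m}" "keys q \<subseteq> lists {..<m}" "?f p \<in> cycles A 0" "?f q \<in> cycles A 0"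
  show "?f (p + q) \<in> cycles A 0" unfolding ext(2)[OF pq(1,2)] by (rule A.cycles_ops(2)[OF pq(3,4)])
 qed
 have e: "w [] = unit A" "\<And>i. i < m ==> w [i] = a i"
  using A.unit_right[of _ 0] A.cycles_elts[OF a] by (simp_all add: w_def)
 let ?g = "%n. if n = 0 then restrict ?f (carrier ?F) else restrict (%_. \<zero>[gr A n]) {\<zero>[?F]}"
 have "?g \<in> dga_homs (concentrated ?F) A"
 proof (rule concentrated_homI[OF free_algebra_assoc_algebra A])
  show "?f \<one>[?F] = unit A" using ext_single[of "[]" 1] vs_one[OF A.vs A.unit_closed] by (simp add: e)
 qed (simp_all add: cyc mult ext(2) ext(3))
 moreover have "?g 0 (generator i) = a i" if "i < m" for i
  using that ext_single[of "[i]" 1] vs_one[OF A.vs A.cycles_elts[OF a[OF that]]] by (simp add: e)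
 ultimately show ?thesis by (rule that)
qed

text \<open>Algebra maps are determined by the generators, since these generate all words and words span.\<close>

lemma free_algebra_hom_unique:
 fixes A :: "('k::field, 'v) dga"
 assumes A: "dg_algebra A" and h: "\<theta> \<in> dga_homs (concentrated (free_algebra m)) A" "\<theta>' \<in> dga_homs (concentrated (free_algebra m)) A"
  and eq: "\<And>i. i < m ==> \<theta> 0 (generator i) = \<theta>' 0 (generator i)"
  and p: "p \<in> carrier (free_algebra m :: ('k::field, _) module)"
 shows "\<theta> 0 p = \<theta>' 0 p"
proof -
 let ?F = "free_algebra m :: ('k, _) module"
 interpret F: assoc_algebra ?F by (rule free_algebra_assoc_algebra)
 interpret U: dga_under A ?F \<theta> using A h(1) F.ring_axioms by (simp add: dga_under_def dga_under_axioms_def)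
 interpret V: dga_under A ?F \<theta>' using A h(2) F.ring_axioms by (simp add: dga_under_def dga_under_axioms_def)
 have c: "single u d \<in> carrier ?F" if "u \<in> lists {..<m}" for u d using that by auto
 have w: "\<theta> 0 (single u 1) = \<theta>' 0 (single u 1)" if "u \<in> lists {..<m}" for u
  using that
 proof (induction u)
  case Nil then show ?case using U.eta_one V.eta_one by simp
 next
  case (Cons i u)
  then have i: "i < m" "u \<in> lists {..<m}" by auto
  have gi: "[i] \<in> lists {..<m}" using i by simp
  have "\<theta> 0 (generator i \<otimes>[?F] single u 1) = \<theta>' 0 (generator i \<otimes>[?F] single u 1)"
   unfolding U.eta_mult[OF c[OF gi, of 1] c[OF i(2), of 1]] V.eta_mult[OF c[OF gi, of 1] c[OF i(2), of 1]]
   by (simp only: Cons.IH eq[OF i(1)])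
  then show ?case by simp
 qed
 have "keys p \<subseteq> lists {..<m}" using p by simp
 then show ?thesis
 proof (rule poly_mapping_induct_single)
  have "\<theta> 0 \<zero>[?F] = \<zero>[gr A 0]" "\<theta>' 0 \<zero>[?F] = \<zero>[gr A 0]"
   using U.eta_smult[of "\<zero>[?F]" 0] V.eta_smult[of "\<zero>[?F]" 0] U.eta_closed[of "\<zero>[?F]"] V.eta_closed[of "\<zero>[?F]"]
   by (simp_all add: scl_zero vs_zero_scalar[OF U.vs])
  then show "\<theta> 0 0 = \<theta>' 0 0" by simp
  fix u d assume u: "u \<in> lists {..<m}"
  have "\<theta> 0 (d \<odot>[?F] single u 1) = \<theta>' 0 (d \<odot>[?F] single u 1)"
   unfolding U.eta_smult[OF c[OF u, of 1]] V.eta_smult[OF c[OF u, of 1]] by (simp only: w[OF u])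
  then show "\<theta> 0 (single u d) = \<theta>' 0 (single u d)" by (simp add: scl_single)
 next
  fix p q assume "keys p \<subseteq> lists {..<m}" "keys q \<subseteq> lists {..<m}" "\<theta> 0 p = \<theta>' 0 p" "\<theta> 0 q = \<theta>' 0 q"
  then show "\<theta> 0 (p + q) = \<theta>' 0 (p + q)" using U.eta_add[of p q] V.eta_add[of p q] by simp
 qed
qed

section \<open>Invariance under quasi-isomorphisms and transport of structure\<close>

lemma (in dga_under) system_boundaries:
 assumes b: "b \<in> E -> boundaries B n" and E: "finite E" and a: "\<And>e. e \<in> E ==> a f e \<in> carrier R"
 shows "linear_system (gr B n) (lft n) E a b f \<in> boundaries B n"
proof -
 have "\<forall>e\<in>E. \<exists>u. u \<in> elts B (n + 1) \<and> b e = dif B (n + 1) u" using b unfolding boundaries_def by (auto dest!: funcset_mem)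
 then obtain u where u: "\<And>e. e \<in> E ==> u e \<in> elts B (n + 1) \<and> b e = dif B (n + 1) (u e)" by metis
 then have uc: "u \<in> E -> elts B (n + 1)" by blast
 have "dif B (n + 1) (linear_system (gr B (n + 1)) (lft (n + 1)) E a u f) = linear_system (gr B n) (lft n) E a (%e. dif B (n + 1) (u e)) f"
  using lft_dif[of _ _ "n + 1"] d_add[of _ "n + 1"]
  by (intro system_natural[OF left_action_B left_action_B] E a uc) simp_all
 also have "\<dots> = linear_system (gr B n) (lft n) E a b f"
  using u b boundaries_elts by (intro left_action.system_cong[OF left_action_B] a) (auto dest!: funcset_mem)
 finally have *: "linear_system (gr B n) (lft n) E a b f = dif B (n + 1) (linear_system (gr B (n + 1)) (lft (n + 1)) E a u f)" by simp
 show ?thesis unfolding * boundaries_def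
  by (intro imageI left_action.system_closed[OF left_action_B] a uc)
qed

lemma (in dga_under) system_cycles:
 assumes b: "b \<in> E -> cycles B n" and E: "finite E" and a: "\<And>e. e \<in> E ==> a f e \<in> carrier R"
 shows "linear_system (gr B n) (lft n) E a b f \<in> cycles B n"
proof -
 have be: "b \<in> E -> elts B n" using b cycles_elts by (auto dest!: funcset_mem)
 have z: "\<zero>[gr B (n - 1)] \<in> elts B (n - 1)" using abelian_groupE(2)[OF ag] .
 have "dif B n (linear_system (gr B n) (lft n) E a b f) = linear_system (gr B (n - 1)) (lft (n - 1)) E a (%e. dif B n (b e)) f"
  using lft_dif[of _ _ n] d_add[of _ n]
  by (intro system_natural[OF left_action_B left_action_B] E a be) simp_all
 also have "\<dots> = linear_system (gr B (n - 1)) (lft (n - 1)) E a (%e. \<zero>[gr B (n - 1)]) f"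
  using b z by (intro left_action.system_cong[OF left_action_B] a) (auto dest!: funcset_mem simp: cycles_def)
 also have "\<dots> = \<zero>[gr B (n - 1)]" by (intro left_action.system_zero[OF left_action_B] a)
 finally have "dif B n (linear_system (gr B n) (lft n) E a b f) = \<zero>[gr B (n - 1)]" .
 moreover have "linear_system (gr B n) (lft n) E a b f \<in> elts B n" by (intro left_action.system_closed[OF left_action_B] a be)
 ultimately show ?thesis by (simp add: cycles_def)
qed

text \<open>Solvability in homology is a statement about homology as a module over \<open>R\<close>, and a map under \<open>R\<close> is linear.\<close>

lemma solvable_transfer:
 assumes U: "dga_under A R \<eta>" and V: "dga_under B R \<theta>" and f: "f \<in> under_homs R (A, \<eta>) (B, \<theta>)"
  and bij: "bij_betw (homology_map B f n) (homology A n) (homology B n)"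
  and h: "homology_solvable A (left_act (A, \<eta>)) E E' a n"
  and E: "finite E" and a: "\<And>e f. e \<in> E ==> f \<in> E' ==> a f e \<in> carrier R"
 shows "homology_solvable B (left_act (B, \<theta>)) E E' a n"
proof -
 interpret U: dga_under A R \<eta> by fact
 interpret V: dga_under B R \<theta> by fact
 interpret M: abelian_group "gr B n" by simp
 interpret N: abelian_group "gr A n" by simp
 interpret L: left_action R "gr B n" "left_act (B, \<theta>) n" by (rule V.left_action_B)
 let ?FA = "linear_system (gr A n) (left_act (A, \<eta>) n) E a"
 let ?FB = "linear_system (gr B n) (left_act (B, \<theta>) n) E a"
 have fh: "f \<in> dga_homs A B" and fe: "\<And>r. r \<in> carrier R ==> f 0 (\<eta> 0 r) = \<theta> 0 r"
  using f by (auto simp: under_homs_def)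
 note fD = dga_homsD[OF fh]
 have cA: "chain_complex A" and cB: "chain_complex B" by unfold_locales
 note ch = chain_maps_cycles[OF cA cB fD(1)] chain_maps_boundaries[OF cA cB fD(1)]
 have inj: "\<And>x. x \<in> cycles A n ==> f n x \<in> boundaries B n ==> x \<in> boundaries A n"
  and surj: "\<And>y. y \<in> cycles B n ==> \<exists>x. x \<in> cycles A n \<and> f n x \<ominus>[gr B n] y \<in> boundaries B n"
  using bij unfolding homology_bij_iff[OF cA cB fD(1)] by blast+
 have nat: "f n (?FA b i) = ?FB (%e. f n (b e)) i" if b: "b \<in> E -> elts A n" and i: "i \<in> E'" for b i
 proof (rule system_natural[OF U.left_action_B[of n] V.left_action_B[of n]])
  show "finite E" "b \<in> E -> elts A n" "\<And>e. e \<in> E ==> a i e \<in> carrier R" using E b a i by simp_all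
  show "f n (left_act (A, \<eta>) n r x) = left_act (B, \<theta>) n r (f n x)" if "r \<in> carrier R" "x \<in> elts A n" for r x
   using fD(3)[OF U.eta_closed[OF that(1)] that(2)] fe[OF that(1)] by (simp add: U.lft V.lft)
 qed (simp_all add: fD(5) lin_add[OF fD(4)])
 have lift: "\<exists>b'. b' \<in> I -> cycles A n \<and> (\<forall>e\<in>I. f n (b' e) \<ominus>[gr B n] b e \<in> boundaries B n)"
  if "b \<in> I -> cycles B n" for b and I :: "'x set"
 proof -
  have "\<forall>e\<in>I. \<exists>x. x \<in> cycles A n \<and> f n x \<ominus>[gr B n] b e \<in> boundaries B n" using surj funcset_mem[OF that] by blast
  then obtain b' where "\<And>e. e \<in> I ==> b' e \<in> cycles A n \<and> f n (b' e) \<ominus>[gr B n] b e \<in> boundaries B n" by metis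
  then show ?thesis by blast
 qed
 have toe: "b \<in> I -> elts A n" if "b \<in> I -> cycles A n" for b and I :: "'x set" using that by (auto simp: Pi_iff cycles_def)
 have toeB: "b \<in> I -> elts B n" if "b \<in> I -> cycles B n" for b and I :: "'x set" using that by (auto simp: Pi_iff cycles_def)
 have fP: "(%e. f n (b e)) \<in> I -> cycles B n" if "b \<in> I -> cycles A n" for b and I :: "'x set"
  using funcset_mem[OF that] ch(1) by blast
 have FAc: "?FA b i \<in> cycles A n" if "b \<in> E -> cycles A n" "i \<in> E'" for b i
  by (rule U.system_cycles) (use that E a in simp_all)
 have FBc: "?FB b i \<in> cycles B n" if "b \<in> E -> cycles B n" "i \<in> E'" for b i
  by (rule V.system_cycles) (use that E a in simp_all)
 have FBb: "?FB b i \<in> boundaries B n" if "b \<in> E -> boundaries B n" "i \<in> E'" for b i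
  by (rule V.system_boundaries) (use that E a in simp_all)
 have FBd: "?FB (%e. b e \<ominus>[gr B n] c e) i = ?FB b i \<ominus>[gr B n] ?FB c i"
  if "b \<in> E -> elts B n" "c \<in> E -> elts B n" "i \<in> E'" for b c i
  by (rule L.system_diff) (use that a in simp_all)
 show ?thesis unfolding homology_solvable_def
 proof (intro conjI ballI impI)
  fix b e assume b: "b \<in> E -> cycles B n" and bd: "\<forall>i\<in>E'. ?FB b i \<in> boundaries B n" and e: "e \<in> E"
  from lift[OF b] obtain b' where b': "b' \<in> E -> cycles A n" "\<forall>e\<in>E. f n (b' e) \<ominus>[gr B n] b e \<in> boundaries B n" by (elim exE conjE)
  have "?FA b' i \<in> boundaries A n" if i: "i \<in> E'" for i
  proof -
   have "?FB (%e. f n (b' e) \<ominus>[gr B n] b e) i \<in> boundaries B n"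
    by (rule FBb[OF _ i]) (use b'(2) in blast)
   then have "f n (?FA b' i) \<ominus>[gr B n] ?FB b i \<in> boundaries B n"
    unfolding nat[OF toe[OF b'(1)] i] using FBd[OF toeB[OF fP[OF b'(1)]] toeB[OF b] i] by simp
   from V.boundaries_ops(2)[OF this bspec[OF bd i]]
   have "f n (?FA b' i) \<in> boundaries B n"
    using M.minus_eq fD(5)[OF U.cycles_elts[OF FAc[OF b'(1) i]]] V.cycles_elts[OF FBc[OF b i]]
    by (simp add: M.a_assoc M.l_neg)
   then show ?thesis by (rule inj[OF FAc[OF b'(1) i]])
  qed
  then have "b' e \<in> boundaries A n" using h b'(1) e unfolding homology_solvable_def by (elim conjE) (drule (1) bspec, blast)
  from ch(2)[OF this] have 1: "f n (b' e) \<in> boundaries B n" .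
  have 2: "f n (b' e) \<ominus>[gr B n] (f n (b' e) \<ominus>[gr B n] b e) \<in> boundaries B n"
   by (rule V.boundaries_ops(5)[OF 1 bspec[OF b'(2) e]])
  have ce: "f n (b' e) \<in> elts B n" "b e \<in> elts B n" using V.boundaries_elts[OF 1] funcset_mem[OF toeB[OF b] e] .
  have "f n (b' e) \<ominus>[gr B n] (f n (b' e) \<ominus>[gr B n] b e) = b e"
   using ce by (subst M.diff_eq_iff) (simp_all add: M.minus_eq M.a_assoc M.l_neg)
  then show "b e \<in> boundaries B n" using 2 by simp
 next
  fix c assume c: "c \<in> E' -> cycles B n"
  from lift[OF c] obtain c' where c': "c' \<in> E' -> cycles A n" "\<forall>i\<in>E'. f n (c' i) \<ominus>[gr B n] c i \<in> boundaries B n" by (elim exE conjE)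
  from h c'(1) obtain b' where b': "b' \<in> E -> cycles A n" "\<forall>i\<in>E'. ?FA b' i \<ominus>[gr A n] c' i \<in> boundaries A n"
   unfolding homology_solvable_def by (elim conjE) (drule (1) bspec, elim bexE, rule that)
  have "?FB (%e. f n (b' e)) i \<ominus>[gr B n] c i \<in> boundaries B n" if i: "i \<in> E'" for i
  proof -
   have cA': "?FA b' i \<in> elts A n" "c' i \<in> elts A n"
    using U.cycles_elts[OF FAc[OF b'(1) i]] funcset_mem[OF toe[OF c'(1)] i] .
   have "f n (?FA b' i \<ominus>[gr A n] c' i) \<oplus>[gr B n] (f n (c' i) \<ominus>[gr B n] c i) \<in> boundaries B n"
    by (rule V.boundaries_ops(2)[OF ch(2)[OF bspec[OF b'(2) i]] bspec[OF c'(2) i]])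
   moreover have "f n (?FA b' i \<ominus>[gr A n] c' i) = f n (?FA b' i) \<ominus>[gr B n] f n (c' i)"
    by (rule lin_diff[OF U.vs V.vs fD(4) cA'])
   moreover have "(f n (?FA b' i) \<ominus>[gr B n] f n (c' i)) \<oplus>[gr B n] (f n (c' i) \<ominus>[gr B n] c i) = f n (?FA b' i) \<ominus>[gr B n] c i"
    using fD(5)[OF cA'(1)] fD(5)[OF cA'(2)] funcset_mem[OF toeB[OF c] i]
    by (simp add: M.minus_eq M.a_assoc M.r_neg2 M.r_neg1 M.l_neg)
   ultimately show ?thesis using nat[OF toe[OF b'(1)] i] by simp
  qed
  then show "\<exists>b\<in>E -> cycles B n. \<forall>i\<in>E'. ?FB b i \<ominus>[gr B n] c i \<in> boundaries B n"
   using fP[OF b'(1)] by (intro bexI[of _ "%e. f n (b' e)"]) simp_all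
 qed
qed

lemma iso_homology_bij:
 assumes C: "chain_complex C" "chain_complex D" and f: "f \<in> chain_maps C D" "g \<in> chain_maps D C"
  and gf: "\<And>x. x \<in> elts C n ==> g n (f n x) = x" and fg: "\<And>y. y \<in> elts D n ==> f n (g n y) = y"
 shows "bij_betw (homology_map D f n) (homology C n) (homology D n)"
proof -
 interpret C: chain_complex C by fact
 interpret D: chain_complex D by fact
 interpret M: abelian_group "gr D n" by simp
 show ?thesis unfolding homology_bij_iff[OF C f(1)]
 proof (intro conjI ballI impI)
  fix x assume "x \<in> cycles C n" "f n x \<in> boundaries D n"
  then show "x \<in> boundaries C n" using chain_maps_boundaries[OF C(2,1) f(2), of "f n x" n] gf C.cycles_elts[of x n] by simp
 next
  fix y assume y: "y \<in> cycles D n"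
  have "f n (g n y) \<ominus>[gr D n] y = \<zero>[gr D n]" using fg D.cycles_elts[OF y] by (simp add: M.r_neg M.minus_eq)
  then show "\<exists>x\<in>cycles C n. f n x \<ominus>[gr D n] y \<in> boundaries D n"
   using D.boundaries_ops(1)[of n] by (intro bexI[OF _ chain_maps_cycles[OF C(2,1) f(2) y]]) simp
 qed
qed

text \<open>The square-zero extensions consist of functions and have to be moved into the universe, along injections in
 each degree.\<close>

locale transported = dg_algebra A for A :: "('k::field, 'v) dga" +
 fixes g :: "int => 'v => 'u"
 assumes inj: "inj_on (g n) (elts A n)"
begin

definition untr :: "int => 'u => 'v" where "untr n = inv_into (elts A n) (g n)"

lemma untr [simp]: "x \<in> elts A n ==> untr n (g n x) = x"
 using inj by (simp add: untr_def)

definition transport :: "('k, 'u) dga" where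
 "transport = \<lparr>gr = (%n. \<lparr>carrier = g n ` elts A n, monoid.mult = undefined, one = undefined,
    ring.zero = g n \<zero>[gr A n],
    ring.add = (%p q. g n (untr n p \<oplus>[gr A n] untr n q)),
    module.smult = (%c p. g n (c \<odot>[gr A n] untr n p))\<rparr>),
   dif = (%n p. g (n - 1) (dif A n (untr n p))),
   mul = (%i j p q. g (i + j) (mul A i j (untr i p) (untr j q))),
   unit = g 0 (unit A)\<rparr>"

lemma transport_simps [simp]:
 "elts transport n = g n ` elts A n" "\<zero>[gr transport n] = g n \<zero>[gr A n]"
 "p \<oplus>[gr transport n] q = g n (untr n p \<oplus>[gr A n] untr n q)"
 "c \<odot>[gr transport n] p = g n (c \<odot>[gr A n] untr n p)"
 "dif transport n p = g (n - 1) (dif A n (untr n p))"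
 "mul transport i j p q = g (i + j) (mul A i j (untr i p) (untr j q))"
 "unit transport = g 0 (unit A)"
 by (simp_all add: transport_def)

lemma transport_vs: "vspace (gr transport n)"
proof -
 interpret M: abelian_group "gr A n" by simp
 note s = vs_smult_closed[OF vs]
 show ?thesis
 proof (rule vspaceI)
  show "abelian_group (gr transport n)"
  proof (rule abelian_groupI)
   fix x assume "x \<in> elts transport n"
   then obtain y where "y \<in> elts A n" "x = g n y" by auto
   then show "\<exists>y\<in>elts transport n. y \<oplus>[gr transport n] x = \<zero>[gr transport n]"
    by (intro bexI[of _ "g n (\<ominus>[gr A n] y)"]) (auto simp: M.l_neg)
  qed (auto simp: M.a_ac)
 qed (auto simp: s vs_distl[OF vs] vs_distr[OF vs] vs_assoc[OF vs] vs_one[OF vs])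
qed

lemma transport_dga: "dg_algebra transport"
proof (intro dg_algebra.intro dg_algebra_axioms.intro chain_complex.intro transport_vs)
 note s = vs_smult_closed[OF vs] and a = add_closed
 show "dif transport n \<in> linear_maps (gr transport n) (gr transport (n - 1))" for n
  by (rule linear_mapsI) (auto simp: s a d_add d_smult)
 show "(%x. mul transport i j x y) \<in> linear_maps (gr transport i) (gr transport (i + j))" if "y \<in> elts transport j" for y i j
  using that by (intro linear_mapsI) (auto simp: s a mul_add_left mul_smult_left)
 show "mul transport i j x \<in> linear_maps (gr transport j) (gr transport (i + j))" if "x \<in> elts transport i" for x i j
  using that by (intro linear_mapsI) (auto simp: s a mul_add_right mul_smult_right)
 show "dif transport (n - 1) (dif transport n x) = \<zero>[gr transport (n - 2)]" if "x \<in> elts transport n" for x n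
  using that by (auto simp: dif_dif)
 fix x y z i j l
 show "mul transport (i + j) l (mul transport i j x y) z = mul transport i (j + l) x (mul transport j l y z)"
  if "x \<in> elts transport i" "y \<in> elts transport j" "z \<in> elts transport l"
  using that by (auto simp: mul_assoc add.assoc)
 show "dif transport (i + j) (mul transport i j x y) = mul transport (i - 1) j (dif transport i x) y
  \<oplus>[gr transport (i + j - 1)] ((- 1) powi i) \<odot>[gr transport (i + j - 1)] mul transport i (j - 1) x (dif transport j y)"
  if xy: "x \<in> elts transport i" "y \<in> elts transport j"
 proof -
  obtain u v where u: "u \<in> elts A i" "x = g i u" and v: "v \<in> elts A j" "y = g j v" using xy by (auto simp del: untr)
  have e: "i - 1 + j = i + j - 1" "i + (j - 1) = i + j - 1" by auto
  have c: "mul A (i - 1) j (dif A i u) v \<in> elts A (i + j - 1)" "mul A i (j - 1) u (dif A j v) \<in> elts A (i + j - 1)"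
   using mul_closed[OF d_closed[OF u(1)] v(1)] mul_closed[OF u(1) d_closed[OF v(1)]] e by simp_all
  have b1: "untr (i + j - 1) (g (i - 1 + j) w) = w" if "w \<in> elts A (i + j - 1)" for w unfolding e using that by simp
  have b2: "untr (i + j - 1) (g (i + (j - 1)) w) = w" if "w \<in> elts A (i + j - 1)" for w unfolding e using that by simp
  show ?thesis using u v c by (simp add: b1 b2 s leibniz)
 qed
qed (auto simp: unit_closed unit_left unit_right)

lemma transport_hom: "(%n. restrict (g n) (elts A n)) \<in> dga_homs A transport"
proof -
 have "restrict (g n) (elts A n) \<in> linear_maps (gr A n) (gr transport n)" for n
  by (rule linear_mapsI) (auto simp: add_closed vs_smult_closed[OF vs])
 then show ?thesis by (auto simp: dga_homs_def chain_maps_def unit_closed)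
qed

lemma transport_hom_inv: "(%n. restrict (untr n) (elts transport n)) \<in> dga_homs transport A"
proof -
 have "restrict (untr n) (elts transport n) \<in> linear_maps (gr transport n) (gr A n)" for n
 proof (rule linear_mapsI)
  show "restrict (untr n) (elts transport n) (x \<oplus>[gr transport n] y) =
   restrict (untr n) (elts transport n) x \<oplus>[gr A n] restrict (untr n) (elts transport n) y"
   if "x \<in> elts transport n" "y \<in> elts transport n" for x y
  proof -
   obtain u v where uv: "u \<in> elts A n" "x = g n u" "v \<in> elts A n" "y = g n v" using \<open>x \<in> _\<close> \<open>y \<in> _\<close> unfolding transport_simps by (elim imageE)
   then show ?thesis using add_closed[OF uv(1,3)] by simp
  qed
  show "restrict (untr n) (elts transport n) (c \<odot>[gr transport n] x) = c \<odot>[gr A n] restrict (untr n) (elts transport n) x"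
   if "x \<in> elts transport n" for c x
  proof -
   obtain u where uv: "u \<in> elts A n" "x = g n u" using \<open>x \<in> _\<close> unfolding transport_simps by (elim imageE)
   then show ?thesis using vs_smult_closed[OF vs uv(1), of c] by simp
  qed
 qed auto
 then show ?thesis by (auto simp: dga_homs_def chain_maps_def unit_closed)
qed

lemma transport_bij: "bij_betw (homology_map transport (%n. restrict (g n) (elts A n)) n) (homology A n) (homology transport n)"
 by (rule iso_homology_bij[OF chain_complex_axioms dg_algebra.axioms(1)[OF transport_dga]
  dga_homsD(1)[OF transport_hom] dga_homsD(1)[OF transport_hom_inv]]) auto

end

lemma concentrated_dga: assumes "assoc_algebra S" shows "dg_algebra (concentrated S)"
proof -
 interpret S: assoc_algebra S by fact
 note s = vs_smult_closed[OF S.vspace] vs_smult_zero[OF S.vspace]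
 have v: "vspace (gr (concentrated S) n)" for n
 proof -
  have "vspace (S\<lparr>carrier := {\<zero>[S]}\<rparr>)" by (rule vspace_sub[OF S.vspace]) (auto simp: s)
  then show ?thesis using S.vspace by (simp add: concentrated_def)
 qed
 show ?thesis
 proof (intro dg_algebra.intro dg_algebra_axioms.intro chain_complex.intro v)
  show "dif (concentrated S) n \<in> linear_maps (gr (concentrated S) n) (gr (concentrated S) (n - 1))" for n
   by (rule linear_mapsI) (auto simp: concentrated_simps s)
  show "(%x. mul (concentrated S) i j x y) \<in> linear_maps (gr (concentrated S) i) (gr (concentrated S) (i + j))"
   if "y \<in> elts (concentrated S) j" for y i j
   using that by (intro linear_mapsI) (auto simp: concentrated_simps s S.l_distr S.smult_mult_left split: if_splits)
  show "mul (concentrated S) i j x \<in> linear_maps (gr (concentrated S) j) (gr (concentrated S) (i + j))"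
   if "x \<in> elts (concentrated S) i" for x i j
   using that by (intro linear_mapsI) (auto simp: concentrated_simps s S.r_distr S.smult_mult_right split: if_splits)
 qed (auto simp: concentrated_simps s S.m_assoc split: if_splits)
qed

lemma concentrated_comp:
 assumes S: "assoc_algebra S" and \<eta>: "\<eta> \<in> dga_homs (concentrated S) A" and f: "f \<in> dga_homs A B"
 shows "(%n. compose (elts (concentrated S) n) (f n) (\<eta> n)) \<in> dga_homs (concentrated S) B"
 by (rule dga_homs_comp[OF concentrated_dga[OF S] \<eta> f])

section \<open>The size of the square-zero extensions\<close>

context connective_under begin

text \<open>A function of finite rank is determined by finitely many natural numbers and elements of the universe:
 \<open>G k\<close> contains the sums of \<open>k\<close> functions of rank one.\<close>

lemma fr_card:
 assumes inf: "infinite (UNIV :: 'u set)"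
 obtains h :: "'u \<times> (nat \<times> ('u => 'k) => 'u) => 'u" where "inj_on h (elts C n \<times> fr J n)"
proof -
 let ?U = "UNIV :: 'u set"
 let ?s = "%q. %p. fst q p \<oplus>[gr C n] rank_one n (fst (snd q)) (fst (snd (snd q))) (snd (snd (snd q))) p"
 define G where "G = rec_nat {%p. \<zero>[gr C n]} (%_ F. ?s ` (F \<times> (UNIV :: nat set) \<times> ?U \<times> ?U))"
 have nat: "|UNIV :: nat set| \<le>o |?U|" using inf infinite_iff_card_of_nat by blast
 have UU: "|?U| \<le>o |?U|" by (rule card_of_mono1) simp
 have P: "|A \<times> B| \<le>o |?U|" if "|A| \<le>o |?U|" "|B| \<le>o |?U|" for A :: "'a set" and B :: "'b set"
 proof -
  have "|A \<times> B| \<le>o |?U \<times> B|" by (rule card_of_Times_mono1[OF that(1)])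
  also have "|?U \<times> B| \<le>o |?U \<times> ?U|" by (rule card_of_Times_mono2[OF that(2)])
  also have "|?U \<times> ?U| =o |?U|" by (rule card_of_Times_same_infinite[OF inf])
  finally show ?thesis .
 qed
 have G: "|G k| \<le>o |?U|" for k
 proof (induction k)
  case 0
  have "|{%p :: nat \<times> ('u => 'k). \<zero>[gr C n]}| \<le>o |?U|" by (rule card_of_singl_ordLeq) simp
  then show ?case by (simp add: G_def)
 next
  case (Suc k)
  have "|?s ` (G k \<times> (UNIV :: nat set) \<times> ?U \<times> ?U)| \<le>o |G k \<times> (UNIV :: nat set) \<times> ?U \<times> ?U|" by (rule card_of_image)
  also have "|G k \<times> (UNIV :: nat set) \<times> ?U \<times> ?U| \<le>o |?U|" by (rule P[OF Suc P[OF nat P[OF UU UU]]])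
  finally show ?case by (simp add: G_def)
 qed
 have "y \<in> (\<Union>k. G k)" if "y \<in> fr J n" for y
  using that
 proof (induction rule: finite_rank.induct)
  case finite_rank_zero then show ?case by (auto simp: G_def intro!: exI[of _ 0])
 next
  case (finite_rank_step y i t c)
  then obtain k where "y \<in> G k" by auto
  then have "(%p. y p \<oplus>[gr C n] rank_one n i t c p) \<in> G (Suc k)"
   by (auto simp: G_def intro!: rev_image_eqI[of "(y, i, t, c)"])
  then show ?case by blast
 qed
 then have "|fr J n| \<le>o |\<Union>k. G k|" by (intro card_of_mono1) blast
 also have "|\<Union>k. G k| \<le>o |?U|" using card_of_UNION_ordLeq_infinite[OF inf nat] G by blast
 finally have "|fr J n| \<le>o |?U|" .
 moreover have "|elts C n| \<le>o |?U|" by (rule card_of_mono1) simp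
 ultimately have "|elts C n \<times> fr J n| \<le>o |?U|" by (intro P)
 then show ?thesis using that unfolding card_of_ordLeq[symmetric] by blast
qed

end

section \<open>The ring \<open>H\<^sub>0\<close>\<close>

locale connective_over_algebra = connective_under C R \<eta> + RA: assoc_algebra R
 for C :: "('k::field, 'u) dga" and R :: "('k, 'r) module" and \<eta>
begin

definition C0 :: "'u ring" where
 "C0 = \<lparr>carrier = elts C 0, monoid.mult = mul C 0 0, one = unit C, ring.zero = \<zero>[gr C 0], ring.add = ring.add (gr C 0)\<rparr>"

lemma C0_simps [simp]: "carrier C0 = elts C 0" "x \<otimes>[C0] y = mul C 0 0 x y" "\<one>[C0] = unit C"
 "\<zero>[C0] = \<zero>[gr C 0]" "x \<oplus>[C0] y = x \<oplus>[gr C 0] y"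
 by (simp_all add: C0_def)

lemma C0_ring: "ring C0"
proof -
 interpret M: abelian_group "gr C 0" by simp
 have ag: "abelian_group C0"
 proof (rule abelian_groupI)
  fix x assume "x \<in> carrier C0"
  then show "\<exists>y\<in>carrier C0. y \<oplus>[C0] x = \<zero>[C0]" by (intro bexI[of _ "\<ominus>[gr C 0] x"]) (simp_all add: M.l_neg)
 qed (simp_all add: M.a_ac)
 have mon: "monoid C0"
  using mul_assoc[of _ 0 _ 0 _ 0] unit_left[of _ 0] unit_right[of _ 0]
  by (intro monoidI) (simp_all add: mul0 unit_closed)
 show ?thesis
  using mul_add_left[of _ 0 _ _ 0] mul_add_right[of _ 0 _ 0] by (intro ringI[OF ag mon]) simp_all
qed

lemma C0_minus: assumes x: "x \<in> elts C 0" "y \<in> elts C 0" shows "x \<ominus>[C0] y = x \<ominus>[gr C 0] y"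
proof -
 interpret M: abelian_group "gr C 0" by simp
 interpret C0: ring C0 by (rule C0_ring)
 have c: "x \<ominus>[gr C 0] y \<in> elts C 0" using M.minus_closed[OF x] .
 then show ?thesis using M.diff_eq_iff[OF x c] C0.diff_eq_iff[of x y "x \<ominus>[gr C 0] y"] x by simp
qed

lemma boundaries_ideal: "ideal (boundaries C 0) C0"
proof -
 interpret C0: ring C0 by (rule C0_ring)
 have neg: "\<ominus>[C0] x \<in> boundaries C 0" if "x \<in> boundaries C 0" for x
 proof -
  have "\<ominus>[C0] x = \<zero>[C0] \<ominus>[C0] x" using C0.minus_eq[of "\<zero>[C0]" x] C0.l_zero[OF C0.a_inv_closed[of x]] boundaries_elts[OF that] by (simp del: C0_simps(4,5))
  also have "\<dots> = \<zero>[gr C 0] \<ominus>[gr C 0] x" using C0_minus[OF zero_closed boundaries_elts[OF that]] by simp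
  finally show ?thesis using boundaries_ops(5)[OF boundaries_ops(1) that] by simp
 qed
 have sg: "subgroup (boundaries C 0) (add_monoid C0)"
 proof (rule subgroup.intro)
  show "inv\<^bsub>add_monoid C0\<^esub> x \<in> boundaries C 0" if "x \<in> boundaries C 0" for x
   using neg[OF that] by (simp add: a_inv_def)
 qed (use boundaries_elts boundaries_ops in auto)
 show ?thesis
 proof (rule idealI[OF C0_ring sg])
  fix a x assume "a \<in> boundaries C 0" "x \<in> carrier C0"
  then show "x \<otimes>[C0] a \<in> boundaries C 0" "a \<otimes>[C0] x \<in> boundaries C 0"
   using boundary_mul_left[of a 0 x 0] boundary_mul_right[of x 0 a 0] by (simp_all add: cycles_0)
 qed
qed

text \<open>The universe need not contain cosets, so the elements of \<open>H\<^sub>0\<close> are represented by chosen cycles.\<close>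

definition nf :: "'u => 'u" where "nf x = (SOME y. y \<in> hcls 0 x)"

lemma nf: assumes "x \<in> elts C 0" shows "nf x \<in> hcls 0 x"
 unfolding nf_def by (rule someI) (rule hcls_self[OF assms])

lemma nf_eq_iff: assumes x: "x \<in> elts C 0" "y \<in> elts C 0" shows "nf x = nf y \<longleftrightarrow> x \<ominus>[gr C 0] y \<in> boundaries C 0"
proof -
 interpret M: abelian_group "gr C 0" by simp
 have "x \<ominus>[gr C 0] y \<in> boundaries C 0" if eq: "nf x = nf y"
 proof -
  obtain b b' where b: "b \<in> boundaries C 0" "nf x = b \<oplus>[gr C 0] x" "b' \<in> boundaries C 0" "nf y = b' \<oplus>[gr C 0] y"
   using nf[OF x(1)] nf[OF x(2)] by (auto simp: hcls_iff)
  have e: "b' \<oplus>[gr C 0] y = b \<oplus>[gr C 0] x" using b eq by simp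
  note c = boundaries_elts[OF b(1)] boundaries_elts[OF b(3)] x
  have "x \<ominus>[gr C 0] y = b' \<ominus>[gr C 0] b"
  proof (subst M.diff_eq_iff)
   have "y \<oplus>[gr C 0] (b' \<ominus>[gr C 0] b) = (b' \<oplus>[gr C 0] y) \<ominus>[gr C 0] b" using c by (simp add: M.minus_eq M.a_ac)
   also have "\<dots> = x" unfolding e using c by (subst M.diff_eq_iff) (simp_all add: M.a_ac)
   finally show "x = y \<oplus>[gr C 0] (b' \<ominus>[gr C 0] b)" by simp
  qed (use c in auto)
  then show ?thesis using boundaries_ops(5)[OF b(3,1)] by simp
 qed
 moreover have "nf x = nf y" if "x \<ominus>[gr C 0] y \<in> boundaries C 0"
  using that hcls_eq_iff[OF x] unfolding nf_def by simp
 ultimately show ?thesis by blast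
qed

definition H0 :: "'u ring" where "H0 = image_ring nf C0"

lemma weak: "weak_ring_morphism nf (boundaries C 0) C0"
 by (rule weak_ring_morphismI[OF boundaries_ideal]) (simp add: nf_eq_iff C0_minus)

lemma H0_ring: "ring H0"
 unfolding H0_def by (rule ring.image_ring_is_ring[OF C0_ring weak])

lemma nf_hom: "nf \<in> ring_hom C0 H0"
 unfolding H0_def by (rule ring.weak_ring_morphism_is_hom[OF C0_ring weak])

lemma H0_carrier: "carrier H0 = nf ` elts C 0" by (simp add: H0_def image_ring_carrier)
lemma H0_zero: "\<zero>[H0] = nf \<zero>[gr C 0]" by (simp add: H0_def image_ring_zero)
lemma H0_one: "\<one>[H0] = nf (unit C)" by (simp add: H0_def image_ring_one)
lemma nf_closed: "x \<in> elts C 0 ==> nf x \<in> carrier H0" by (simp add: H0_carrier)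
lemma nf_add: "x \<in> elts C 0 ==> y \<in> elts C 0 ==> nf (x \<oplus>[gr C 0] y) = nf x \<oplus>[H0] nf y"
 using ring_hom_add[OF nf_hom, of x y] by simp
lemma nf_mult: "x \<in> elts C 0 ==> y \<in> elts C 0 ==> nf (mul C 0 0 x y) = nf x \<otimes>[H0] nf y"
 using ring_hom_mult[OF nf_hom, of x y] by simp

lemma nf_zero_iff: assumes x: "x \<in> elts C 0" shows "nf x = \<zero>[H0] \<longleftrightarrow> x \<in> boundaries C 0"
proof -
 interpret M: abelian_group "gr C 0" by simp
 show ?thesis unfolding H0_zero using nf_eq_iff[OF x zero_closed] M.diff_eq_iff[of x "\<zero>[gr C 0]" x] x by simp
qed

definition \<phi> :: "'r => 'u" where "\<phi> r = nf (\<eta> 0 r)"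

lemma phi_hom: "\<phi> \<in> ring_hom R H0"
 by (rule ring_hom_memI) (simp_all add: \<phi>_def eta_closed eta_add eta_mult eta_one nf_closed nf_add nf_mult H0_one)

lemma phi_scalar: assumes x: "x \<in> elts C 0"
 shows "\<phi> (c \<odot>[R] \<one>[R]) \<otimes>[H0] nf x = nf (c \<odot>[gr C 0] x)" "nf x \<otimes>[H0] \<phi> (c \<odot>[R] \<one>[R]) = nf (c \<odot>[gr C 0] x)"
proof -
 have u: "c \<odot>[gr C 0] unit C \<in> elts C 0" by (rule vs_smult_closed[OF vs unit_closed])
 have p: "\<phi> (c \<odot>[R] \<one>[R]) = nf (c \<odot>[gr C 0] unit C)" by (simp add: \<phi>_def eta_smult eta_one)
 show "\<phi> (c \<odot>[R] \<one>[R]) \<otimes>[H0] nf x = nf (c \<odot>[gr C 0] x)" "nf x \<otimes>[H0] \<phi> (c \<odot>[R] \<one>[R]) = nf (c \<odot>[gr C 0] x)"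
  using mul_smult_left[OF unit_closed x, of c] mul_smult_right[OF x unit_closed, of c] unit_left[OF x] unit_right[OF x]
  unfolding p by (simp_all add: nf_mult[OF u x, symmetric] nf_mult[OF x u, symmetric])
qed

sublocale H: central_ring_under R H0 \<phi>
proof (intro central_ring_under.intro central_ring_under_axioms.intro RA.assoc_algebra_axioms H0_ring phi_hom)
 fix x c assume "x \<in> carrier H0"
 then obtain y where "y \<in> elts C 0" "x = nf y" by (auto simp: H0_carrier)
 then show "\<phi> (c \<odot>[R] \<one>[R]) \<otimes>[H0] x = x \<otimes>[H0] \<phi> (c \<odot>[R] \<one>[R])" by (simp add: phi_scalar)
qed

definition \<pi> :: "int => 'u => 'u" where
 "\<pi> n = restrict (%x. if n = 0 then nf x else \<zero>[H0]) (elts C n)"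

lemma pi_0: "x \<in> elts C 0 ==> \<pi> 0 x = nf x" by (simp add: \<pi>_def)
lemma pi_other: "x \<in> elts C n ==> n \<noteq> 0 ==> \<pi> n x = \<zero>[H0]" by (simp add: \<pi>_def)

text \<open>The projection \<open>\<pi>\<close> of a connective dg algebra onto its \<open>H\<^sub>0\<close> is multiplicative: a product of degree \<open>0\<close> with factors
 in other degrees has a factor of negative degree, which is zero.\<close>

lemma pi_hom: "\<pi> \<in> under_homs R (C, \<eta>) (ring_under R H0 \<phi>)"
proof -
 have lin: "\<pi> n \<in> linear_maps (gr C n) (gr H.SA n)" for n
  using phi_scalar(1)
  by (cases "n = 0"; intro linear_mapsI)
   (simp_all add: pi_0 pi_other add_closed vs_smult_closed[OF vs] nf_closed nf_add H.phi_closed H.scalar_closed)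
 have dif: "\<pi> (n - 1) (dif C n x) = dif H.SA n (\<pi> n x)" if x: "x \<in> elts C n" for n x
 proof (cases "n = 1")
  case True
  then have "dif C n x \<in> boundaries C 0" using x by (auto simp: boundaries_def)
  then show ?thesis using True nf_zero_iff[OF boundaries_elts] boundaries_elts by (simp add: pi_0)
 next
  case False then show ?thesis using d_closed[OF x] by (simp add: pi_other)
 qed
 have mult: "\<pi> (i + j) (mul C i j x y) = mul H.SA i j (\<pi> i x) (\<pi> j y)" if x: "x \<in> elts C i" and y: "y \<in> elts C j" for i j x y
 proof (cases "i = 0 \<and> j = 0")
  case True then show ?thesis using x y by (simp add: pi_0 mul0 nf_mult)
 next
  case False
  show ?thesis
  proof (cases "i + j = 0")
   case True
   then have "mul C i j x y = \<zero>[gr C 0]" using product_degree_zero[OF x y True] False by auto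
   then show ?thesis using False True pi_0[OF zero_closed] by (auto simp: H0_zero)
  next
   case F2: False then show ?thesis using False mul_closed[OF x y] by (auto simp: pi_other)
  qed
 qed
 have ext: "\<pi> n \<in> extensional (elts C n)" for n by (simp add: \<pi>_def)
 have u: "\<pi> 0 (unit C) = unit H.SA" using unit_closed by (simp add: pi_0 H0_one)
 have "\<pi> \<in> dga_homs C H.SA" unfolding dga_homs_def chain_maps_def using lin dif mult ext u by blast
 then show ?thesis unfolding under_homs_def using H.S\<eta>_0 by (simp add: pi_0 eta_closed \<phi>_def)
qed

lemma pi_bij:
 assumes "n = 0 \<or> cycles C n \<subseteq> boundaries C n"
 shows "bij_betw (homology_map H.SA \<pi> n) (homology C n) (homology H.SA n)"
proof -
 interpret M: abelian_group "gr H.SA n" by (rule vs_group[OF H.SA_vspace])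
 have cS: "chain_complex H.SA" by (rule dg_algebra.axioms(1)[OF H.SA_dga])
 have ch: "\<pi> \<in> chain_maps C H.SA" using pi_hom by (simp add: under_homs_def dga_homs_def)
 have z: "\<zero>[H0] \<ominus>[gr H.SA n] \<zero>[H0] = \<zero>[H0]" using M.r_neg[of "\<zero>[gr H.SA n]"] M.minus_eq[of "\<zero>[gr H.SA n]"] by simp
 show ?thesis unfolding homology_bij_iff[OF chain_complex_axioms cS ch] H.cycles_SA H.boundaries_SA
 proof (cases "n = 0")
  case True
  have "nf x \<ominus>[gr H.SA 0] nf x = \<zero>[H0]" if "x \<in> elts C 0" for x
   using H.SA_minus[OF nf_closed[OF that] nf_closed[OF that]] H.S.diff_eq_iff[of "nf x" "nf x" "\<zero>[H0]"] nf_closed[OF that] by simp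
  then show "(\<forall>x\<in>cycles C n. \<pi> n x \<in> {\<zero>[H0]} --> x \<in> boundaries C n) \<and>
   (\<forall>y\<in>if n = 0 then carrier H0 else {\<zero>[H0]}. \<exists>x\<in>cycles C n. \<pi> n x \<ominus>[gr H.SA n] y \<in> {\<zero>[H0]})"
   using True by (auto simp: cycles_0 pi_0 nf_zero_iff H0_carrier)
 next
  case False
  have "\<pi> n \<zero>[gr C n] = \<zero>[H0]" using pi_other[OF zero_closed False] .
  then show "(\<forall>x\<in>cycles C n. \<pi> n x \<in> {\<zero>[H0]} --> x \<in> boundaries C n) \<and>
   (\<forall>y\<in>if n = 0 then carrier H0 else {\<zero>[H0]}. \<exists>x\<in>cycles C n. \<pi> n x \<ominus>[gr H.SA n] y \<in> {\<zero>[H0]})"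
   using False assms z cycles_ops(1)[of n] by (auto intro!: bexI[of _ "\<zero>[gr C n]"])
 qed
qed

lemma H0_inverts:
 assumes \<Sigma>: "\<Sigma> \<subseteq> fg_free_arrows R" and inv: "derived_inverts R \<Sigma> (C, \<eta>)"
 shows "inverts R \<Sigma> H0 \<phi>"
proof -
 have hi: "homology_inverts R \<Sigma> C lft 0"
  using inv unfolding derived_inverts_iff[OF dga_under_axioms \<Sigma>] by blast
 have "ring_solvable H0 \<phi> E E' (hom_matrix R Q E' \<sigma>)"
  if *: "(P, Q, \<sigma>) \<in> \<Sigma>" "free_right_module R P E" "free_right_module R Q E'" for P Q \<sigma> E E'
 proof -
  note fin = free_right_module.fin[OF *(2)] and mat = arrow_matrix_closed[OF \<Sigma> *]
  have s: "homology_solvable C lft E E' (hom_matrix R Q E' \<sigma>) 0" using hi * unfolding homology_inverts_def by blast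
  have ph: "\<pi> \<in> under_homs R (C, \<eta>) (H.SA, H.S\<eta>)" using pi_hom by simp
  have "homology_solvable H.SA (left_act (H.SA, H.S\<eta>)) E E' (hom_matrix R Q E' \<sigma>) 0"
   by (rule solvable_transfer[OF dga_under_axioms H.SA_under ph pi_bij s fin mat]) simp_all
  then show ?thesis using H.solvable_SA_iff[where a = "hom_matrix R Q E' \<sigma>", OF fin mat] by blast
 qed
 then show ?thesis unfolding inverts_iff[OF R.ring_axioms H0_ring phi_hom \<Sigma>] by blast
qed

end

section \<open>Two maps into a square-zero extension\<close>

lemma (in dg_bimodule) fst_hom: "(%n. restrict fst (elts sqz n)) \<in> dga_homs sqz A"
proof -
 have z: "elts sqz n = elts A n \<times> elts Y n" for n by simp
 interpret S: dg_algebra sqz by (rule sqz_dga)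
 have lin: "restrict fst (elts sqz n) \<in> linear_maps (gr sqz n) (gr A n)" for n
 proof (rule linear_mapsI)
  fix x assume x: "x \<in> elts sqz n"
  then show "restrict fst (elts sqz n) x \<in> elts A n" by (simp add: mem_Times_iff)
  show "restrict fst (elts sqz n) (c \<odot>[gr sqz n] x) = c \<odot>[gr A n] restrict fst (elts sqz n) x" for c
   using x vs_smult_closed[OF S.vs x, of c] unfolding restrict_def by (simp del: sqz_simps(1) add: sqz_simps(4))
  fix y assume y: "y \<in> elts sqz n"
  show "restrict fst (elts sqz n) (x \<oplus>[gr sqz n] y) = restrict fst (elts sqz n) x \<oplus>[gr A n] restrict fst (elts sqz n) y"
   using x y S.add_closed[OF x y] unfolding restrict_def by (simp del: sqz_simps(1))
 qed
 have dif: "restrict fst (elts sqz (n - 1)) (dif sqz n x) = dif A n (restrict fst (elts sqz n) x)" if "x \<in> elts sqz n" for n x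
  using that S.d_closed[OF that] unfolding restrict_def by (simp del: sqz_simps(1))
 have mult: "restrict fst (elts sqz (i + j)) (mul sqz i j x y) = mul A i j (restrict fst (elts sqz i) x) (restrict fst (elts sqz j) y)"
  if "x \<in> elts sqz i" "y \<in> elts sqz j" for i j x y
  using that S.mul_closed[OF that] unfolding restrict_def by (simp del: sqz_simps(1))
 have u: "restrict fst (elts sqz 0) (unit sqz) = unit A"
  using S.unit_closed unfolding restrict_def by (simp del: sqz_simps(1))
 have ext: "restrict fst (elts sqz n) \<in> extensional (elts sqz n)" for n by simp
 show ?thesis unfolding dga_homs_def chain_maps_def using lin ext dif mult u by blast
qed

locale free_connective = based_generated C "free_algebra m" \<eta> B \<kappa> m "%i. \<eta> 0 (generator i)"
 for C :: "('k::field, 'u) dga" and m \<eta> B \<kappa>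
begin

abbreviation "F \<equiv> free_algebra m :: ('k, nat list \<Rightarrow>\<^sub>0 'k) module"
abbreviation "\<zeta>' i \<equiv> \<eta> 0 (generator i)"

lemma generator_closed: "i < m ==> generator i \<in> carrier F" by simp

sublocale YV: dg_bimodule C "fr_cplx {..<m}" fr_left fr_right by (rule fr_bimodule)
sublocale Y0: dg_bimodule C "fr_cplx {0}" fr_left fr_right by (rule fr_bimodule)

abbreviation "inner \<equiv> Y0.inner_map one_tensor_one"

lemma inner_hom: "inner \<in> dga_homs C X0" by (rule Y0.inner_map_hom[OF one_tensor_one_cycle])

lemma right_one_tensor_one: "z \<in> elts C 0 ==> fr_right 0 0 one_tensor_one z = rank_one 0 0 z (unit C)"
proof (rule ext)
 fix p assume z: "z \<in> elts C 0"
 show "fr_right 0 0 one_tensor_one z p = rank_one 0 0 z (unit C) p"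
  using dual_right_closed[OF _ z, of "snd p"] unit_left[OF z] unit_closed
  by (simp add: fr_right_def one_tensor_one_def rank_one_def dual_right_def)
qed

lemma inner_0: "z \<in> elts C 0 ==> inner 0 z = (z, %p. rank_one 0 0 (unit C) z p \<ominus>[gr C 0] rank_one 0 0 z (unit C) p)"
proof -
 assume z: "z \<in> elts C 0"
 have "rank_one 0 0 (unit C) z \<in> fr {0} 0" "rank_one 0 0 z (unit C) \<in> fr {0} 0"
  by (rule rank_one_in; simp add: z unit_closed)+
 from fr_minus[OF this] show ?thesis using z left_one_tensor_one[OF z] right_one_tensor_one[OF z]
  by (simp add: Y0.inner_map_def)
qed

lemma inner_pos: assumes x: "x \<in> elts C n" and n: "n \<noteq> 0" shows "inner n x = (x, rank_one n 0 (unit C) x)"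
proof -
 interpret A: abelian_group "gr C n" by simp
 have r: "rank_one n 0 (unit C) x \<in> fr {0} n" by (rule rank_one_in) (simp_all add: x unit_closed)
 have z: "fr_right 0 n one_tensor_one x = (%p. \<zero>[gr C n])" using n by (intro ext) (simp add: fr_right_def)
 have "rank_one n 0 (unit C) x p \<ominus>[gr C n] \<zero>[gr C n] = rank_one n 0 (unit C) x p" for p
  using A.diff_eq_iff[OF rank_one_closed[OF x] zero_closed rank_one_closed[OF x]] A.l_zero[OF rank_one_closed[OF x]] by simp
 then show ?thesis using fr_minus[OF r finite_rank.finite_rank_zero] x left_one_tensor_one[OF x]
  by (simp add: Y0.inner_map_def z)
qed

text \<open>On the generators, the composite \<open>R \<rightarrow> X\<^sub>V \<rightarrow> X\<^sub>0\<close> is \<open>s\<close>; as \<open>R\<close> is free this makes both maps into \<open>X\<^sub>0\<close> maps under \<open>R\<close>.\<close>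

lemma commutator_hom_generator:
 assumes i: "i < m" shows "commutator_hom 0 (\<zeta>' i, rank_one 0 i (unit C) (unit C)) = inner 0 (\<zeta>' i)"
proof -
 have z: "\<zeta>' i \<in> elts C 0" by (rule eta_closed[OF generator_closed[OF i]])
 have r: "rank_one 0 i (unit C) (unit C) \<in> fr {..<m} 0" by (rule rank_one_in) (simp_all add: i unit_closed)
 have "commutator 0 (rank_one 0 i (unit C) (unit C)) p = rank_one 0 0 (unit C) (\<zeta>' i) p \<ominus>[gr C 0] rank_one 0 0 (\<zeta>' i) (unit C) p" for p
  using commutator_rank_one[OF i unit_closed unit_closed, of p] unit_left[OF z] unit_right[OF z] by simp
 then show ?thesis unfolding inner_0[OF z] commutator_hom_def using z r by (simp add: fun_eq_iff)
qed

text \<open>\<open>R\<close> is free, so \<open>z\<^sub>i \<mapsto> (z\<^sub>i, v\<^sub>i)\<close> extends to an algebra map.  That it lifts the given map to \<open>C\<close>, and becomes \<open>s\<close> under \<open>\<alpha>\<close>, is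
 checked on generators.\<close>

lemma generator_map_exists:
 obtains \<theta> where "\<theta> \<in> dga_homs (concentrated F) XV" "\<And>r. r \<in> carrier F ==> fst (\<theta> 0 r) = \<eta> 0 r"
  "\<And>r. r \<in> carrier F ==> commutator_hom 0 (\<theta> 0 r) = inner 0 (\<eta> 0 r)"
proof -
 have cyc: "(\<zeta>' i, rank_one 0 i (unit C) (unit C)) \<in> cycles XV 0" if i: "i < m" for i
 proof -
  have "rank_one 0 i (unit C) (unit C) \<in> fr {..<m} 0" by (rule rank_one_in) (simp_all add: i unit_closed)
  then have "rank_one 0 i (unit C) (unit C) \<in> cycles (fr_cplx {..<m}) 0"
   unfolding cycles_fr cycles_0 using rank_one_closed[OF unit_closed] by blast
  then show ?thesis using eta_closed[OF generator_closed[OF i]] by (simp add: YV.sqz_cycles cycles_0)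
 qed
 obtain \<theta> where \<theta>: "\<theta> \<in> dga_homs (concentrated F) XV" "\<And>i. i < m ==> \<theta> 0 (generator i) = (\<zeta>' i, rank_one 0 i (unit C) (unit C))"
  by (rule free_algebra_hom_exists[OF YV.sqz_dga, of m "%i. (\<zeta>' i, rank_one 0 i (unit C) (unit C))"]) (use cyc in blast)+
 have S: "assoc_algebra F" by (rule free_algebra_assoc_algebra)
 have ec: "elts (concentrated F) 0 = carrier F" by (simp add: concentrated_def)
 have \<theta>e: "\<theta> 0 r \<in> elts XV 0" if "r \<in> carrier F" for r using dga_homsD(5)[OF \<theta>(1), of r 0] that ec by blast
 note c1 = concentrated_comp[OF S \<theta>(1) YV.fst_hom] and c2 = concentrated_comp[OF S \<theta>(1) commutator_hom] and c3 = concentrated_comp[OF S eta inner_hom]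
 have "fst (\<theta> 0 r) = \<eta> 0 r" if r: "r \<in> carrier F" for r
 proof -
  have v: "compose (elts (concentrated F) 0) (restrict fst (elts XV 0)) (\<theta> 0) r = fst (\<theta> 0 r)" if "r \<in> carrier F" for r
   using \<theta>e[OF that] that unfolding ec compose_def by (simp only: restrict_apply' if_True)
  have "compose (elts (concentrated F) 0) (restrict fst (elts XV 0)) (\<theta> 0) r = \<eta> 0 r"
  proof (rule free_algebra_hom_unique[OF dg_algebra_axioms c1 eta _ r])
   fix i assume i: "i < m"
   show "compose (elts (concentrated F) 0) (restrict fst (elts XV 0)) (\<theta> 0) (generator i) = \<zeta>' i"
    unfolding v[OF generator_closed[OF i]] \<theta>(2)[OF i] by simp
  qed
  then show ?thesis using v[OF r] by simp
 qed
 moreover have "commutator_hom 0 (\<theta> 0 r) = inner 0 (\<eta> 0 r)" if r: "r \<in> carrier F" for r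
 proof -
  have v: "compose (elts (concentrated F) 0) (commutator_hom 0) (\<theta> 0) r = commutator_hom 0 (\<theta> 0 r)"
   "compose (elts (concentrated F) 0) (inner 0) (\<eta> 0) r = inner 0 (\<eta> 0 r)" if "r \<in> carrier F" for r
   using that unfolding ec compose_def by (simp_all only: restrict_apply')
  have "compose (elts (concentrated F) 0) (commutator_hom 0) (\<theta> 0) r = compose (elts (concentrated F) 0) (inner 0) (\<eta> 0) r"
  proof (rule free_algebra_hom_unique[OF Y0.sqz_dga c2 c3 _ r])
   fix i assume i: "i < m"
   show "compose (elts (concentrated F) 0) (commutator_hom 0) (\<theta> 0) (generator i) = compose (elts (concentrated F) 0) (inner 0) (\<eta> 0) (generator i)"
    unfolding v[OF generator_closed[OF i]] \<theta>(2)[OF i] by (rule commutator_hom_generator[OF i])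
  qed
  then show ?thesis using v[OF r] by simp
 qed
 ultimately show ?thesis by (rule that[OF \<theta>(1)])
qed

text \<open>In degrees other than \<open>0\<close> the inner derivation is \<open>x \<mapsto> x e\<close>, as the right action vanishes there.\<close>

lemma boundary_if_agree:
 assumes x: "x \<in> cycles C n" and n: "n \<noteq> 0" and q: "q \<in> cycles XV n"
  and b: "commutator_hom n q \<ominus>[gr X0 n] inner n x \<in> boundaries X0 n"
 shows "x \<in> boundaries C n"
proof -
 interpret A: abelian_group "gr C n" by simp
 interpret X0': abelian_group "gr X0 n" by (rule vs_group[OF Y0.sqz_vs])
 define z where "z = commutator_hom n q \<ominus>[gr X0 n] inner n x"
 have qc: "fst q \<in> elts C n" "snd q \<in> cycles (fr_cplx {..<m}) n"
  using q cycles_elts unfolding YV.sqz_cycles by (auto simp: mem_Times_iff)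
 have w: "snd q \<in> fr {..<m} n" using qc(2) unfolding cycles_fr by blast
 have q': "q \<in> elts C n \<times> fr {..<m} n" using qc(1) w by (simp add: mem_Times_iff)
 have x': "x \<in> elts C n" by (rule cycles_elts[OF x])
 have z: "snd z \<in> boundaries (fr_cplx {0}) n" using b unfolding z_def[symmetric] Y0.sqz_boundaries by (simp add: mem_Times_iff)
 have zf: "snd z \<in> fr {0} n" "\<And>p. snd z p \<in> boundaries C n" using z unfolding boundaries_fr by blast+
 have ze: "\<And>p. snd z p \<in> elts C n" by (rule boundaries_elts[OF zf(2)])
 have e1: "commutator_hom n q = (fst q, commutator n (snd q))" using q' by (simp add: commutator_hom_def)
 note e2 = inner_pos[OF x' n]
 have c: "commutator_hom n q \<in> elts X0 n" "inner n x \<in> elts X0 n"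
  using dga_homsD(5)[OF commutator_hom, of q n] dga_homsD(5)[OF inner_hom x'] q' by (simp_all)
 have "commutator_hom n q = inner n x \<oplus>[gr X0 n] z"
  using X0'.diff_eq_iff[OF c X0'.minus_closed[OF c]] unfolding z_def by blast
 then have "snd (commutator_hom n q) = snd (inner n x \<oplus>[gr X0 n] z)" by (rule arg_cong)
 then have "commutator n (snd q) = (%p. rank_one n 0 (unit C) x p \<oplus>[gr C n] snd z p)"
  unfolding e1 e2 by simp
 then have cv: "commutator n (snd q) p = rank_one n 0 (unit C) x p \<oplus>[gr C n] snd z p" for p by (rule fun_cong)
 have neg: "rank_one n 0 (unit C) x p \<ominus>[gr C n] commutator n (snd q) p = \<ominus>[gr C n] snd z p" for p
  unfolding cv using A.diff_eq_iff[of "rank_one n 0 (unit C) x p" "rank_one n 0 (unit C) x p \<oplus>[gr C n] snd z p" "\<ominus>[gr C n] snd z p"]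
   rank_one_closed[OF x'] ze by (simp add: A.a_assoc A.r_neg)
 have r: "rank_one n 0 (unit C) x \<in> fr {0} n" by (rule rank_one_in) (simp_all add: x' unit_closed)
 have "(%p. rank_one n 0 (unit C) x p \<ominus>[gr C n] commutator n (snd q) p) \<in> boundaries (fr_cplx {0}) n"
  unfolding boundaries_fr using minus_fr[OF r commutator_closed[OF w]] neg boundaries_ops(4)[OF zf(2)] by simp
 then show ?thesis by (rule boundary_if_commutator[OF x qc(2)])
qed

text \<open>The data that initiality is applied to, with both extensions moved into the universe.  Whenever \<open>\<alpha>\<close> and \<open>s\<close> agree
 in homology, \<open>boundary_if_commutator\<close> applies.\<close>

lemma commutator_test:
 assumes inf: "infinite (UNIV :: 'u set)"
 obtains TV \<theta>V T0 \<theta>0 \<alpha> s :: "_" where "dga_under (TV :: ('k, 'u) dga) F \<theta>V" "dga_under (T0 :: ('k, 'u) dga) F \<theta>0"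
  "\<alpha> \<in> under_homs F (TV, \<theta>V) (T0, \<theta>0)" "s \<in> under_homs F (C, \<eta>) (T0, \<theta>0)"
  "\<And>(E :: 'p set) (E' :: 'p set) a n. finite E ==> finite E' ==> (\<And>e f. e \<in> E ==> f \<in> E' ==> a f e \<in> carrier F) ==>
   homology_solvable C lft E E' a n ==>
   homology_solvable TV (left_act (TV, \<theta>V)) E E' a n \<and> homology_solvable T0 (left_act (T0, \<theta>0)) E E' a n"
  "\<And>n x y. n \<noteq> 0 ==> x \<in> cycles C n ==> y \<in> cycles TV n ==> \<alpha> n y \<ominus>[gr T0 n] s n x \<in> boundaries T0 n ==> x \<in> boundaries C n"
proof -
 have S: "assoc_algebra F" by (rule free_algebra_assoc_algebra)
 have RF: "ring F" using S by (simp add: assoc_algebra_def)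
 have ec: "elts (concentrated F) 0 = carrier F" by (simp add: concentrated_def)
 obtain \<eta>V where \<eta>V: "\<eta>V \<in> dga_homs (concentrated F) XV" "\<And>r. r \<in> carrier F ==> fst (\<eta>V 0 r) = \<eta> 0 r"
  "\<And>r. r \<in> carrier F ==> commutator_hom 0 (\<eta>V 0 r) = inner 0 (\<eta> 0 r)" using generator_map_exists by blast
 define \<eta>0 where "\<eta>0 = (%n. compose (elts (concentrated F) n) (inner n) (\<eta> n))"
 have \<eta>0: "\<eta>0 \<in> dga_homs (concentrated F) X0" unfolding \<eta>0_def by (rule concentrated_comp[OF S eta inner_hom])
 have \<eta>0v: "\<eta>0 0 r = inner 0 (\<eta> 0 r)" if "r \<in> carrier F" for r using that unfolding \<eta>0_def ec compose_def by simp
 interpret UV: dga_under XV F \<eta>V by (intro dga_under.intro dga_under_axioms.intro YV.sqz_dga RF \<eta>V(1))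
 interpret U0: dga_under X0 F \<eta>0 by (intro dga_under.intro dga_under_axioms.intro Y0.sqz_dga RF \<eta>0)
 interpret SV: square_zero_under C "fr_cplx {..<m}" fr_left fr_right F \<eta> \<eta>V
  by (intro square_zero_under.intro square_zero_under_axioms.intro YV.dg_bimodule_axioms dga_under_axioms UV.dga_under_axioms \<eta>V(2))
 interpret S0: square_zero_under C "fr_cplx {0}" fr_left fr_right F \<eta> \<eta>0
  by (intro square_zero_under.intro square_zero_under_axioms.intro Y0.dg_bimodule_axioms dga_under_axioms U0.dga_under_axioms)
   (simp add: \<eta>0v inner_0 eta_closed)
 have "\<exists>h :: 'u \<times> (nat \<times> ('u => 'k) => 'u) => 'u. inj_on h (elts C n \<times> fr J n)" for J n
  by (rule fr_card[OF inf, of n J]) blast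
 then have "\<exists>h :: int => 'u \<times> (nat \<times> ('u => 'k) => 'u) => 'u. \<forall>n. inj_on (h n) (elts C n \<times> fr J n)" for J
  by (intro choice) blast
 then obtain gV g0 :: "int => 'u \<times> (nat \<times> ('u => 'k) => 'u) => 'u"
  where g: "\<And>n. inj_on (gV n) (elts C n \<times> fr {..<m} n)" "\<And>n. inj_on (g0 n) (elts C n \<times> fr {0} n)" by metis
 interpret TV: transported XV gV by (intro transported.intro transported_axioms.intro YV.sqz_dga) (simp add: g)
 interpret T0: transported X0 g0 by (intro transported.intro transported_axioms.intro Y0.sqz_dga) (simp add: g)
 define trV where "trV = (%n. restrict (gV n) (elts XV n))"
 define tr0 where "tr0 = (%n. restrict (g0 n) (elts X0 n))"
 define unV where "unV = (%n. restrict (TV.untr n) (elts TV.transport n))"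
 define un0 where "un0 = (%n. restrict (T0.untr n) (elts T0.transport n))"
 note hom = TV.transport_hom[folded trV_def] T0.transport_hom[folded tr0_def] TV.transport_hom_inv[folded unV_def] T0.transport_hom_inv[folded un0_def]
 have inv: "unV n (trV n x) = x" if "x \<in> elts XV n" for n x
  using dga_homsD(5)[OF hom(1) that] that TV.untr[OF that] by (simp add: unV_def trV_def del: YV.sqz_simps(1))
 have inv0: "un0 n (tr0 n x) = x" if "x \<in> elts X0 n" for n x
  using dga_homsD(5)[OF hom(2) that] that T0.untr[OF that] by (simp add: un0_def tr0_def del: Y0.sqz_simps(1))
 define \<theta>V where "\<theta>V = (%n. compose (elts (concentrated F) n) (trV n) (\<eta>V n))"
 define \<theta>0 where "\<theta>0 = (%n. compose (elts (concentrated F) n) (tr0 n) (\<eta>0 n))"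
 have \<theta>v: "\<theta>V 0 r = trV 0 (\<eta>V 0 r)" "\<theta>0 0 r = tr0 0 (\<eta>0 0 r)" if "r \<in> carrier F" for r
  using that unfolding \<theta>V_def \<theta>0_def ec compose_def by simp_all
 have VU: "dga_under TV.transport F \<theta>V" "dga_under T0.transport F \<theta>0"
  unfolding \<theta>V_def \<theta>0_def
  by (intro dga_under.intro dga_under_axioms.intro TV.transport_dga T0.transport_dga RF concentrated_comp[OF S \<eta>V(1) hom(1)] concentrated_comp[OF S \<eta>0 hom(2)])+
 have tru: "trV \<in> under_homs F (XV, \<eta>V) (TV.transport, \<theta>V)" "tr0 \<in> under_homs F (X0, \<eta>0) (T0.transport, \<theta>0)"
  using hom \<theta>v unfolding under_homs_def by simp_all
 define \<alpha> where "\<alpha> = (%n. compose (elts TV.transport n) (tr0 n) (compose (elts TV.transport n) (commutator_hom n) (unV n)))"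
 have \<alpha>h: "\<alpha> \<in> dga_homs TV.transport T0.transport" unfolding \<alpha>_def
  by (rule dga_homs_comp[OF TV.transport_dga dga_homs_comp[OF TV.transport_dga hom(3) commutator_hom] hom(2)])
 have \<alpha>v: "\<alpha> n y = tr0 n (commutator_hom n (unV n y))" if "y \<in> elts TV.transport n" for n y
  using that unfolding \<alpha>_def compose_def by (simp del: TV.transport_simps)
 define s where "s = (%n. compose (elts C n) (tr0 n) (inner n))"
 have sh: "s \<in> dga_homs C T0.transport" unfolding s_def by (rule dga_homs_comp[OF dg_algebra_axioms inner_hom hom(2)])
 have sv: "s n x = tr0 n (inner n x)" if "x \<in> elts C n" for n x using that unfolding s_def compose_def by simp
 have \<alpha>: "\<alpha> \<in> under_homs F (TV.transport, \<theta>V) (T0.transport, \<theta>0)"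
 proof -
  have "\<alpha> 0 (\<theta>V 0 r) = \<theta>0 0 r" if r: "r \<in> carrier F" for r
  proof -
   have e: "\<eta>V 0 r \<in> elts XV 0" by (rule UV.eta_closed[OF r])
   show ?thesis unfolding \<theta>v[OF r] \<alpha>v[OF dga_homsD(5)[OF hom(1) e]] inv[OF e] \<eta>V(3)[OF r] \<eta>0v[OF r] by (rule HOL.refl)
  qed
  then show ?thesis using \<alpha>h unfolding under_homs_def by simp
 qed
 have s: "s \<in> under_homs F (C, \<eta>) (T0.transport, \<theta>0)"
  using sh \<theta>v(2) \<eta>0v sv[OF eta_closed] unfolding under_homs_def by simp
 have solv: "homology_solvable TV.transport (left_act (TV.transport, \<theta>V)) E E' a n \<and> homology_solvable T0.transport (left_act (T0.transport, \<theta>0)) E E' a n"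
  if E: "finite E" "finite E'" and a: "\<And>e f. e \<in> E ==> f \<in> E' ==> a f e \<in> carrier F" and h: "homology_solvable C lft E E' a n"
  for E :: "'p set" and E' :: "'p set" and a n
 proof
  show "homology_solvable TV.transport (left_act (TV.transport, \<theta>V)) E E' a n"
   by (rule solvable_transfer[OF UV.dga_under_axioms VU(1) tru(1) TV.transport_bij[folded trV_def]
    SV.solvable[OF h fr_solvable[OF h E a] E(1) a] E(1) a])
  show "homology_solvable T0.transport (left_act (T0.transport, \<theta>0)) E E' a n"
   by (rule solvable_transfer[OF U0.dga_under_axioms VU(2) tru(2) T0.transport_bij[folded tr0_def]
    S0.solvable[OF h fr_solvable[OF h E a] E(1) a] E(1) a])
 qed
 have test: "x \<in> boundaries C n" if n: "n \<noteq> 0" and x: "x \<in> cycles C n" and y: "y \<in> cycles TV.transport n"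
  and b: "\<alpha> n y \<ominus>[gr T0.transport n] s n x \<in> boundaries T0.transport n" for n x y
 proof -
  interpret VT: dg_algebra TV.transport by (rule TV.transport_dga)
  interpret OT: dg_algebra T0.transport by (rule T0.transport_dga)
  have y': "y \<in> elts TV.transport n" by (rule VT.cycles_elts[OF y])
  have q: "unV n y \<in> cycles XV n"
   by (rule chain_maps_cycles[OF VT.chain_complex_axioms UV.chain_complex_axioms dga_homsD(1)[OF hom(3)] y])
  have c: "commutator_hom n (unV n y) \<in> elts X0 n" "inner n x \<in> elts X0 n"
   by (rule dga_homsD(5)[OF commutator_hom UV.cycles_elts[OF q]], rule dga_homsD(5)[OF inner_hom cycles_elts[OF x]])
  have "un0 n (\<alpha> n y \<ominus>[gr T0.transport n] s n x) \<in> boundaries X0 n"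
   by (rule chain_maps_boundaries[OF OT.chain_complex_axioms U0.chain_complex_axioms dga_homsD(1)[OF hom(4)] b])
  also have "un0 n (\<alpha> n y \<ominus>[gr T0.transport n] s n x) = un0 n (\<alpha> n y) \<ominus>[gr X0 n] un0 n (s n x)"
   by (rule lin_diff[OF OT.vs U0.vs dga_homsD(4)[OF hom(4)] dga_homsD(5)[OF \<alpha>h y'] dga_homsD(5)[OF sh cycles_elts[OF x]]])
  also have "\<dots> = commutator_hom n (unV n y) \<ominus>[gr X0 n] inner n x"
   unfolding \<alpha>v[OF y'] sv[OF cycles_elts[OF x]] inv0[OF c(1)] inv0[OF c(2)] ..
  finally show ?thesis by (rule boundary_if_agree[OF x n q])
 qed
 show ?thesis by (rule that[OF VU \<alpha> s solv test])
qed

end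

section \<open>Multiplicativity of zigzags on \<open>H\<^sub>0\<close>\<close>

abbreviation "hc \<equiv> chain_complex.hcls"

lemma (in dg_algebra) hc_cong:
 assumes c: "x \<in> cycles A 0" "y \<in> cycles A 0" "x' \<in> cycles A 0" "y' \<in> cycles A 0"
  and e: "hc A 0 x = hc A 0 x'" "hc A 0 y = hc A 0 y'"
 shows "hc A 0 (mul A 0 0 x y) = hc A 0 (mul A 0 0 x' y')" "hc A 0 (x \<oplus>[gr A 0] y) = hc A 0 (x' \<oplus>[gr A 0] y')"
proof -
 interpret M: abelian_group "gr A 0" by simp
 note ce = c[THEN cycles_elts]
 have b: "x \<ominus>[gr A 0] x' \<in> boundaries A 0" "y \<ominus>[gr A 0] y' \<in> boundaries A 0"
  using e hcls_eq_iff[OF ce(1,3)] hcls_eq_iff[OF ce(2,4)] by simp_all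
 note be = b[THEN boundaries_elts]
 have m: "mul A 0 0 u v \<in> elts A 0" if "u \<in> elts A 0" "v \<in> elts A 0" for u v using mul_closed[OF that] by simp
 have 1: "mul A 0 0 x y \<ominus>[gr A 0] mul A 0 0 x' y = mul A 0 0 (x \<ominus>[gr A 0] x') y"
  using mul_diff_left[OF ce(1,3,2)] by simp
 have 2: "mul A 0 0 x' y \<ominus>[gr A 0] mul A 0 0 x' y' = mul A 0 0 x' (y \<ominus>[gr A 0] y')"
  using mul_diff_right[OF ce(3,2,4)] by simp
 have "hc A 0 (mul A 0 0 x y) = hc A 0 (mul A 0 0 x' y)"
  unfolding hcls_eq_iff[OF m[OF ce(1,2)] m[OF ce(3,2)]] 1 using boundary_mul_left[OF b(1) c(2)] by simp
 also have "\<dots> = hc A 0 (mul A 0 0 x' y')"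
  unfolding hcls_eq_iff[OF m[OF ce(3,2)] m[OF ce(3,4)]] 2 using boundary_mul_right[OF c(3) b(2)] by simp
 finally show "hc A 0 (mul A 0 0 x y) = hc A 0 (mul A 0 0 x' y')" .
 show "hc A 0 (x \<oplus>[gr A 0] y) = hc A 0 (x' \<oplus>[gr A 0] y')"
  unfolding hcls_eq_iff[OF M.add.m_closed[OF ce(1,2)] M.add.m_closed[OF ce(3,4)]] M.add_diff_add[OF ce]
  by (rule boundaries_ops(2)[OF b])
qed

text \<open>Compatibility with the ring structure of \<open>H\<^sub>0\<close> and with the map from \<open>R\<close>.  It is phrased with representatives, so that
 backward steps of a zigzag can be treated like forward ones.\<close>

definition respects_algebra ::
  "('k::field, 'r) module => ('k, 'r, 'u) dga_under => ('k, 'r, 'u) dga_under => ('u set => 'u set) => bool" where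
 "respects_algebra R U V Z \<longleftrightarrow>
  (\<forall>x\<in>homology (fst U) 0. Z x \<in> homology (fst V) 0) \<and>
  (\<forall>x\<in>cycles (fst U) 0. \<forall>y\<in>cycles (fst U) 0. \<forall>x'\<in>cycles (fst V) 0. \<forall>y'\<in>cycles (fst V) 0.
   Z (hc (fst U) 0 x) = hc (fst V) 0 x' --> Z (hc (fst U) 0 y) = hc (fst V) 0 y' -->
   Z (hc (fst U) 0 (mul (fst U) 0 0 x y)) = hc (fst V) 0 (mul (fst V) 0 0 x' y') \<and>
   Z (hc (fst U) 0 (x \<oplus>[gr (fst U) 0] y)) = hc (fst V) 0 (x' \<oplus>[gr (fst V) 0] y')) \<and>
  (\<forall>r\<in>carrier R. Z (hc (fst U) 0 (snd U 0 r)) = hc (fst V) 0 (snd V 0 r))"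

lemma respectsD:
 assumes "respects_algebra R U V Z"
 shows "c \<in> homology (fst U) 0 ==> Z c \<in> homology (fst V) 0"
  "x \<in> cycles (fst U) 0 ==> y \<in> cycles (fst U) 0 ==> x' \<in> cycles (fst V) 0 ==> y' \<in> cycles (fst V) 0 ==>
   Z (hc (fst U) 0 x) = hc (fst V) 0 x' ==> Z (hc (fst U) 0 y) = hc (fst V) 0 y' ==>
   Z (hc (fst U) 0 (mul (fst U) 0 0 x y)) = hc (fst V) 0 (mul (fst V) 0 0 x' y')"
  "x \<in> cycles (fst U) 0 ==> y \<in> cycles (fst U) 0 ==> x' \<in> cycles (fst V) 0 ==> y' \<in> cycles (fst V) 0 ==>
   Z (hc (fst U) 0 x) = hc (fst V) 0 x' ==> Z (hc (fst U) 0 y) = hc (fst V) 0 y' ==>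
   Z (hc (fst U) 0 (x \<oplus>[gr (fst U) 0] y)) = hc (fst V) 0 (x' \<oplus>[gr (fst V) 0] y')"
  "r \<in> carrier R ==> Z (hc (fst U) 0 (snd U 0 r)) = hc (fst V) 0 (snd V 0 r)"
 using assms unfolding respects_algebra_def by metis+

lemma respects_comp:
 assumes U: "U \<in> Ob (under_cat R)" and V: "V \<in> Ob (under_cat R)"
  and Z: "respects_algebra R U V Z" and Z': "respects_algebra R V W Z'"
 shows "respects_algebra R U W (Z' \<circ> Z)"
proof -
 interpret V: chain_complex "fst V" by (rule under_cat_Ob_cplx[OF V])
 interpret U: chain_complex "fst U" by (rule under_cat_Ob_cplx[OF U])
 note z = respectsD[OF Z] and z' = respectsD[OF Z']
 have lift: "\<exists>u\<in>cycles (fst V) 0. Z (hc (fst U) 0 x) = hc (fst V) 0 u" if "x \<in> cycles (fst U) 0" for x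
  using z(1)[of "hc (fst U) 0 x"] that unfolding V.homology_eq U.homology_eq by blast
 show ?thesis unfolding respects_algebra_def o_apply
 proof (intro conjI ballI impI)
  show "Z' (Z x) \<in> homology (fst W) 0" if "x \<in> homology (fst U) 0" for x by (rule z'(1)[OF z(1)[OF that]])
  show "Z' (Z (hc (fst U) 0 (snd U 0 r))) = hc (fst W) 0 (snd W 0 r)" if "r \<in> carrier R" for r
   unfolding z(4)[OF that] by (rule z'(4)[OF that])
  fix x y x' y'
  assume x: "x \<in> cycles (fst U) 0" "y \<in> cycles (fst U) 0" "x' \<in> cycles (fst W) 0" "y' \<in> cycles (fst W) 0"
   and e: "Z' (Z (hc (fst U) 0 x)) = hc (fst W) 0 x'" "Z' (Z (hc (fst U) 0 y)) = hc (fst W) 0 y'"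
  from lift[OF x(1)] obtain u where u: "u \<in> cycles (fst V) 0" "Z (hc (fst U) 0 x) = hc (fst V) 0 u" by (elim bexE)
  from lift[OF x(2)] obtain v where v: "v \<in> cycles (fst V) 0" "Z (hc (fst U) 0 y) = hc (fst V) 0 v" by (elim bexE)
  note e' = e(1)[unfolded u(2)] e(2)[unfolded v(2)]
  show "Z' (Z (hc (fst U) 0 (mul (fst U) 0 0 x y))) = hc (fst W) 0 (mul (fst W) 0 0 x' y')"
   unfolding z(2)[OF x(1,2) u(1) v(1) u(2) v(2)] by (rule z'(2)[OF u(1) v(1) x(3,4) e'])
  show "Z' (Z (hc (fst U) 0 (x \<oplus>[gr (fst U) 0] y))) = hc (fst W) 0 (x' \<oplus>[gr (fst W) 0] y')"
   unfolding z(3)[OF x(1,2) u(1) v(1) u(2) v(2)] by (rule z'(3)[OF u(1) v(1) x(3,4) e'])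
 qed
qed

lemma respects_id: assumes U: "U \<in> Ob (under_cat R)" shows "respects_algebra R U U id"
proof -
 interpret U: dg_algebra "fst U" by (rule under_cat_Ob_dga[OF U])
 show ?thesis unfolding respects_algebra_def id_apply
 proof (intro conjI ballI impI)
  fix x y x' y'
  assume "x \<in> cycles (fst U) 0" "y \<in> cycles (fst U) 0" "x' \<in> cycles (fst U) 0" "y' \<in> cycles (fst U) 0"
   "hc (fst U) 0 x = hc (fst U) 0 x'" "hc (fst U) 0 y = hc (fst U) 0 y'"
  note c = U.hc_cong[OF this]
  show "hc (fst U) 0 (mul (fst U) 0 0 x y) = hc (fst U) 0 (mul (fst U) 0 0 x' y')" by (rule c(1))
  show "hc (fst U) 0 (x \<oplus>[gr (fst U) 0] y) = hc (fst U) 0 (x' \<oplus>[gr (fst U) 0] y')" by (rule c(2))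
 qed simp_all
qed

context
 fixes R :: "('k::field, 'r) module" and U V :: "('k, 'r, 'u) dga_under" and f
 assumes R: "ring R" and U: "U \<in> Ob (under_cat R)" and V: "V \<in> Ob (under_cat R)" and f: "f \<in> under_homs R U V"
begin

interpretation U: dg_algebra "fst U" by (rule under_cat_Ob_dga[OF U])
interpretation V: dg_algebra "fst V" by (rule under_cat_Ob_dga[OF V])

lemma under_hom_props:
 "x \<in> cycles (fst U) n ==> f n x \<in> cycles (fst V) n"
 "x \<in> elts (fst U) n ==> homology_map (fst V) f n (hc (fst U) n x) = hc (fst V) n (f n x)"
 "x \<in> elts (fst U) 0 ==> y \<in> elts (fst U) 0 ==> f 0 (mul (fst U) 0 0 x y) = mul (fst V) 0 0 (f 0 x) (f 0 y)"
 "x \<in> elts (fst U) 0 ==> y \<in> elts (fst U) 0 ==> f 0 (x \<oplus>[gr (fst U) 0] y) = f 0 x \<oplus>[gr (fst V) 0] f 0 y"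
 "r \<in> carrier R ==> f 0 (snd U 0 r) = snd V 0 r"
 "r \<in> carrier R ==> snd U 0 r \<in> cycles (fst U) 0"
proof -
 have fh: "f \<in> dga_homs (fst U) (fst V)" using f by (simp add: under_homs_def)
 note D = dga_homsD[OF fh]
 show "x \<in> cycles (fst U) n ==> f n x \<in> cycles (fst V) n" by (rule chain_maps_cycles[OF U.chain_complex_axioms V.chain_complex_axioms D(1)])
 show "x \<in> elts (fst U) n ==> homology_map (fst V) f n (hc (fst U) n x) = hc (fst V) n (f n x)"
  by (rule homology_map_hcls[OF U.chain_complex_axioms V.chain_complex_axioms D(1)])
 show "x \<in> elts (fst U) 0 ==> y \<in> elts (fst U) 0 ==> f 0 (mul (fst U) 0 0 x y) = mul (fst V) 0 0 (f 0 x) (f 0 y)"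
  using D(3)[of x 0 y 0] by simp
 show "x \<in> elts (fst U) 0 ==> y \<in> elts (fst U) 0 ==> f 0 (x \<oplus>[gr (fst U) 0] y) = f 0 x \<oplus>[gr (fst V) 0] f 0 y"
  by (rule lin_add[OF D(4)])
 show "r \<in> carrier R ==> f 0 (snd U 0 r) = snd V 0 r" using f by (simp add: under_homs_def)
 interpret DU: dga_under "fst U" R "snd U" using under_cat_Ob[OF R, of "fst U" "snd U"] U by simp
 show "r \<in> carrier R ==> snd U 0 r \<in> cycles (fst U) 0" using DU.eta_closed DU.eta_cycle by (simp add: cycles_def)
qed

lemma respects_hom: "respects_algebra R U V (homology_map (fst V) f 0)"
 unfolding respects_algebra_def
proof (intro conjI ballI impI)
 have ch: "f \<in> chain_maps (fst U) (fst V)" using f by (simp add: under_homs_def dga_homs_def)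
 show "homology_map (fst V) f 0 x \<in> homology (fst V) 0" if "x \<in> homology (fst U) 0" for x
  by (rule homology_map_closed[OF U.chain_complex_axioms V.chain_complex_axioms ch that])
 show "homology_map (fst V) f 0 (hc (fst U) 0 (snd U 0 r)) = hc (fst V) 0 (snd V 0 r)" if r: "r \<in> carrier R" for r
  using under_hom_props(2)[OF U.cycles_elts[OF under_hom_props(6)[OF r]]] under_hom_props(5)[OF r] by simp
 fix x y x' y'
 assume x: "x \<in> cycles (fst U) 0" "y \<in> cycles (fst U) 0" and x': "x' \<in> cycles (fst V) 0" "y' \<in> cycles (fst V) 0"
  and e: "homology_map (fst V) f 0 (hc (fst U) 0 x) = hc (fst V) 0 x'" "homology_map (fst V) f 0 (hc (fst U) 0 y) = hc (fst V) 0 y'"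
 note xe = x[THEN U.cycles_elts]
 have m: "mul (fst U) 0 0 x y \<in> elts (fst U) 0" "x \<oplus>[gr (fst U) 0] y \<in> elts (fst U) 0"
  using U.mul_closed[OF xe] U.add_closed[OF xe] by simp_all
 note e' = e[unfolded under_hom_props(2)[OF xe(1)] under_hom_props(2)[OF xe(2)]]
 note c = V.hc_cong[OF under_hom_props(1)[OF x(1)] under_hom_props(1)[OF x(2)] x' e']
 show "homology_map (fst V) f 0 (hc (fst U) 0 (mul (fst U) 0 0 x y)) = hc (fst V) 0 (mul (fst V) 0 0 x' y')"
  unfolding under_hom_props(2)[OF m(1)] under_hom_props(3)[OF xe] by (rule c(1))
 show "homology_map (fst V) f 0 (hc (fst U) 0 (x \<oplus>[gr (fst U) 0] y)) = hc (fst V) 0 (x' \<oplus>[gr (fst V) 0] y')"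
  unfolding under_hom_props(2)[OF m(2)] under_hom_props(4)[OF xe] by (rule c(2))
qed

lemma respects_inv:
 assumes bij: "bij_betw (homology_map (fst V) f 0) (homology (fst U) 0) (homology (fst V) 0)"
 shows "respects_algebra R V U (inv_into (homology (fst U) 0) (homology_map (fst V) f 0))"
proof -
 let ?h = "homology_map (fst V) f 0" and ?g = "inv_into (homology (fst U) 0) (homology_map (fst V) f 0)"
 have cl: "hc (fst U) 0 x \<in> homology (fst U) 0" if "x \<in> cycles (fst U) 0" for x using that unfolding U.homology_eq by blast
 have clV: "hc (fst V) 0 x \<in> homology (fst V) 0" if "x \<in> cycles (fst V) 0" for x using that unfolding V.homology_eq by blast
 have g: "?g (hc (fst V) 0 x) = hc (fst U) 0 x' \<longleftrightarrow> ?h (hc (fst U) 0 x') = hc (fst V) 0 x"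
  if "x \<in> cycles (fst V) 0" "x' \<in> cycles (fst U) 0" for x x'
  using bij_betw_inv_into_left[OF bij cl[OF that(2)]] bij_betw_inv_into_right[OF bij clV[OF that(1)]] by metis
 have mc: "mul (fst W) 0 0 u v \<in> cycles (fst W) 0" "u \<oplus>[gr (fst W) 0] v \<in> cycles (fst W) 0"
  if "u \<in> cycles (fst W) 0" "v \<in> cycles (fst W) 0" "dg_algebra (fst W)" for W :: "('k, 'r, 'u) dga_under" and u v
  using dg_algebra.mul_cycles[OF that(3,1,2)] chain_complex.cycles_ops(2)[OF dg_algebra.axioms(1)[OF that(3)] that(1,2)] by simp_all
 note h = respectsD[OF respects_hom]
 show ?thesis unfolding respects_algebra_def
 proof (intro conjI ballI impI)
  show "?g x \<in> homology (fst U) 0" if "x \<in> homology (fst V) 0" for x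
   using bij_betw_apply[OF bij_betw_inv_into[OF bij] that] .
  show "?g (hc (fst V) 0 (snd V 0 r)) = hc (fst U) 0 (snd U 0 r)" if r: "r \<in> carrier R" for r
   using h(4)[OF r] bij_betw_inv_into_left[OF bij cl[OF under_hom_props(6)[OF r]]] by simp
  fix x y x' y'
  assume x: "x \<in> cycles (fst V) 0" "y \<in> cycles (fst V) 0" and x': "x' \<in> cycles (fst U) 0" "y' \<in> cycles (fst U) 0"
   and e: "?g (hc (fst V) 0 x) = hc (fst U) 0 x'" "?g (hc (fst V) 0 y) = hc (fst U) 0 y'"
  note e' = e(1)[unfolded g[OF x(1) x'(1)]] e(2)[unfolded g[OF x(2) x'(2)]]
  show "?g (hc (fst V) 0 (mul (fst V) 0 0 x y)) = hc (fst U) 0 (mul (fst U) 0 0 x' y')"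
   unfolding g[OF mc(1)[OF x V.dg_algebra_axioms] mc(1)[OF x' U.dg_algebra_axioms]] by (rule h(2)[OF x' x e'])
  show "?g (hc (fst V) 0 (x \<oplus>[gr (fst V) 0] y)) = hc (fst U) 0 (x' \<oplus>[gr (fst U) 0] y')"
   unfolding g[OF mc(2)[OF x V.dg_algebra_axioms] mc(2)[OF x' U.dg_algebra_axioms]] by (rule h(3)[OF x' x e'])
 qed
qed

end

lemma respects_zigzag:
 assumes R: "ring R" shows "zigzag (under_cat R) U p V ==> respects_algebra R U V (homology_zigzag 0 U p)"
proof (induction p arbitrary: U)
 case Nil then show ?case using respects_id[of V R] by (auto simp: id_def)
next
 case (Cons s p)
 show ?case
 proof (cases s)
  case (Fwd f W)
  have o: "U \<in> Ob (under_cat R)" "W \<in> Ob (under_cat R)" "f \<in> under_homs R U W" "zigzag (under_cat R) W p V"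
   using Cons.prems under_cat_Hom[OF R, of U W f] by (simp_all add: Fwd)
  show ?thesis unfolding Fwd homology_zigzag.simps
   by (rule respects_comp[OF o(1,2) respects_hom[OF R o(1-3)] Cons.IH[OF o(4)]])
 next
  case (Bwd f W)
  have o: "U \<in> Ob (under_cat R)" "W \<in> Ob (under_cat R)" "f \<in> under_homs R W U" "quasi_iso (fst W) (fst U) f" "zigzag (under_cat R) W p V"
   using Cons.prems under_cat_Weq[OF R, of W U f] by (simp_all add: Bwd)
  have b: "bij_betw (homology_map (fst U) f 0) (homology (fst W) 0) (homology (fst U) 0)" using o(4) by (simp add: quasi_iso_def)
  show ?thesis unfolding Bwd homology_zigzag.simps
   by (rule respects_comp[OF o(1,2) respects_inv[OF R o(2,1,3) b] Cons.IH[OF o(5)]])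
 qed
qed

section \<open>Consequences of initiality\<close>

locale initial_inverting = assoc_algebra R for R :: "('k::field, 'r) module" +
 fixes \<Sigma> :: "('r, 'p) arrow set" and L :: "('k, 'u) dga" and \<eta>
 assumes \<Sigma>: "\<Sigma> \<subseteq> fg_free_arrows R" and init: "derived_localization R \<Sigma> (L, \<eta>)"
begin

lemma L_Ob: "(L, \<eta>) \<in> Ob (under_cat R)" and L_inverts: "derived_inverts R \<Sigma> (L, \<eta>)"
 and loc_hom_unique: "V \<in> Ob (under_cat R) ==> derived_inverts R \<Sigma> V ==> \<exists>!\<phi>. \<phi> \<in> loc_hom (under_cat R) (L, \<eta>) V"
 using init unfolding derived_localization_def loc_initial_def by blast+

sublocale D: dga_under L R \<eta> using L_Ob under_cat_Ob[OF ring_axioms] by blast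

sublocale C: connective_over_algebra "connective_cover L" R \<eta>
 by (intro connective_over_algebra.intro connective_under.intro connective_under_axioms.intro D.cc_under assoc_algebra_axioms) simp

abbreviation "CL \<equiv> connective_cover L"

lemma CL_Ob: "(CL, \<eta>) \<in> Ob (under_cat R)" using D.cc_under under_cat_Ob[OF ring_axioms] by blast

lemma CL_inverts: "derived_inverts R \<Sigma> (CL, \<eta>)"
 by (rule derived_inverts_transfer[OF \<Sigma> D.dga_under_axioms D.cc_under L_inverts]) (rule D.cc_solvable)

definition incl :: "int => 'u => 'u" where "incl = (%n. restrict id (elts CL n))"

lemma incl_under: "incl \<in> under_homs R (CL, \<eta>) (L, \<eta>)"
 using D.cc_incl C.eta_closed unfolding under_homs_def incl_def by (simp del: D.cc_simps)

lemma incl: "x \<in> elts CL n ==> incl n x = x" by (simp add: incl_def del: D.cc_simps)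

lemma zigzag_exists:
 assumes "V \<in> Ob (under_cat R)" "derived_inverts R \<Sigma> V" obtains p where "zigzag (under_cat R) (L, \<eta>) p V"
 using loc_hom_unique[OF assms] loc_hom_zigzag by metis

lemma homology_zigzag_unique:
 assumes V: "V \<in> Ob (under_cat R)" "derived_inverts R \<Sigma> V"
  and p: "zigzag (under_cat R) (L, \<eta>) p V" "zigzag (under_cat R) (L, \<eta>) q V" and x: "x \<in> homology L n"
 shows "homology_zigzag n (L, \<eta>) p x = homology_zigzag n (L, \<eta>) q x"
proof -
 interpret W: wcat_functor "under_cat R :: (('k, 'r, 'u) dga_under, int => 'u => 'u) wcat"
  "%U. homology (fst U) n" "%U V f. homology_map (fst V) f n" by (rule under_cat_functor[OF ring_axioms])
 have "zigzag_eq (under_cat R) (L, \<eta>) V p q" by (rule zigzag_eq_loc_homI[OF loc_hom_unique[OF V] p])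
 from W.zigzag_eq_zz[OF this] show ?thesis using x unfolding homology_zigzag_zz[OF ring_axioms] by simp
qed

lemma homology_zigzag_props:
 fixes U V W :: "('k, 'r, 'u) dga_under"
 assumes p: "zigzag (under_cat R) U p V" and x: "x \<in> homology (fst U) n"
 shows "homology_zigzag n U p x \<in> homology (fst V) n"
  "homology_zigzag n U (p @ [Fwd f W]) x = homology_map (fst W) f n (homology_zigzag n U p x)"
proof -
 interpret W: wcat_functor "under_cat R :: (('k, 'r, 'u) dga_under, int => 'u => 'u) wcat"
  "%U. homology (fst U) n" "%U V f. homology_map (fst V) f n" by (rule under_cat_functor[OF ring_axioms])
 show "homology_zigzag n U p x \<in> homology (fst V) n" unfolding homology_zigzag_zz[OF ring_axioms] by (rule W.zz_closed[OF p x])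
 show "homology_zigzag n U (p @ [Fwd f W]) x = homology_map (fst W) f n (homology_zigzag n U p x)"
  unfolding homology_zigzag_zz[OF ring_axioms] W.zz_append[OF p x] by simp
qed

lemma zigzag_Fwd:
 assumes p: "zigzag (under_cat R) U p V" and W: "W \<in> Ob (under_cat R)" and f: "f \<in> under_homs R V W"
 shows "zigzag (under_cat R) U (p @ [Fwd f W]) W"
proof -
 have "V \<in> Ob (under_cat R)" using zigzag_ob[OF p] by simp
 then show ?thesis using W f under_cat_Hom[OF ring_axioms _ W, of V f] by (intro zigzag_append[OF p]) simp
qed

text \<open>The identity of \<open>H\<^sub>n(L)\<close> factors through \<open>H\<^sub>n\<close> of the connective cover, which is zero.\<close>

lemma negative_boundary:
 assumes n: "n < 0" and x: "x \<in> cycles L n" shows "x \<in> boundaries L n"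
proof -
 obtain q where q: "zigzag (under_cat R) (L, \<eta>) q (CL, \<eta>)" by (rule zigzag_exists[OF CL_Ob CL_inverts])
 note q' = zigzag_Fwd[OF q L_Ob incl_under]
 have id: "zigzag (under_cat R) (L, \<eta>) [] (L, \<eta>)" using L_Ob by simp
 have h: "hc L n x \<in> homology L n" using x unfolding D.homology_eq by blast
 then have h': "hc L n x \<in> homology (fst (L, \<eta>)) n" by simp
 have "homology_zigzag n (L, \<eta>) q (hc L n x) \<in> hc CL n ` cycles CL n"
  using homology_zigzag_props(1)[OF q h'] unfolding C.homology_eq[symmetric] by simp
 then obtain y where y: "y \<in> cycles CL n" "homology_zigzag n (L, \<eta>) q (hc L n x) = hc CL n y" by blast
 have y0: "y = \<zero>[gr L n]" using y(1) n unfolding D.cc_cycles by simp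
 have ye: "y \<in> elts CL n" by (rule C.cycles_elts[OF y(1)])
 have "hc L n x = homology_zigzag n (L, \<eta>) (q @ [Fwd incl (L, \<eta>)]) (hc L n x)"
  using homology_zigzag_unique[OF L_Ob L_inverts id q' h] by simp
 also have "\<dots> = homology_map L incl n (hc CL n y)" unfolding homology_zigzag_props(2)[OF q h'] y(2) by simp
 also have "\<dots> = hc L n y" using under_hom_props(2)[OF ring_axioms CL_Ob L_Ob incl_under, of y n] ye incl[OF ye] by simp
 finally have "x \<ominus>[gr L n] \<zero>[gr L n] \<in> boundaries L n"
  using D.hcls_eq_iff[OF D.cycles_elts[OF x] abelian_groupE(2)[OF D.ag]] y0 by simp
 moreover have "x \<ominus>[gr L n] \<zero>[gr L n] = x"
  using abelian_group.diff_eq_iff[OF D.ag[of n] D.cycles_elts[OF x] abelian_groupE(2)[OF D.ag] D.cycles_elts[OF x]]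
   abelian_groupE(5)[OF D.ag D.cycles_elts[OF x]] by simp
 ultimately show ?thesis by simp
qed

lemma incl_bij: "bij_betw (homology_map L incl n) (homology CL n) (homology L n)"
proof -
 have ch: "incl \<in> chain_maps CL L" using under_homs_chain[OF incl_under] by simp
 interpret M: abelian_group "gr L n" by simp
 have r: "y \<ominus>[gr L n] y = \<zero>[gr L n]" if "y \<in> elts L n" for y using that M.diff_eq_iff[of y y "\<zero>[gr L n]"] by simp
 have z: "\<zero>[gr L n] \<in> elts CL n" using C.zero_closed[of n] by simp
 show ?thesis unfolding homology_bij_iff[OF C.chain_complex_axioms D.chain_complex_axioms ch]
 proof (cases "n < 0")
  case True
  have "\<zero>[gr L n] \<ominus>[gr L n] y \<in> boundaries L n" if "y \<in> cycles L n" for y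
   by (rule D.boundaries_ops(5)[OF D.boundaries_ops(1) negative_boundary[OF True that]])
  then show "(\<forall>x\<in>cycles CL n. incl n x \<in> boundaries L n --> x \<in> boundaries CL n) \<and>
   (\<forall>y\<in>cycles L n. \<exists>x\<in>cycles CL n. incl n x \<ominus>[gr L n] y \<in> boundaries L n)"
   using True incl[OF z] unfolding D.cc_cycles D.cc_boundaries by simp
 next
  case False
  have c: "cycles CL n = cycles L n" "boundaries CL n = boundaries L n" using False by (simp_all add: D.cc_cycles D.cc_boundaries)
  have i: "incl n x = x" if "x \<in> cycles L n" for x using incl[OF C.cycles_elts[of x n]] that c by simp
  show "(\<forall>x\<in>cycles CL n. incl n x \<in> boundaries L n --> x \<in> boundaries CL n) \<and>
   (\<forall>y\<in>cycles L n. \<exists>x\<in>cycles CL n. incl n x \<ominus>[gr L n] y \<in> boundaries L n)"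
   unfolding c
  proof (intro conjI ballI impI)
   fix y assume y: "y \<in> cycles L n"
   show "\<exists>x\<in>cycles L n. incl n x \<ominus>[gr L n] y \<in> boundaries L n"
    by (rule bexI[OF _ y]) (simp add: i[OF y] r[OF D.cycles_elts[OF y]] D.boundaries_ops(1))
  qed (simp add: i)
 qed
qed

text \<open>The way in which initiality is used: any zigzag to an inverting \<open>V\<close> induces the same map on homology as any
 given map from the connective cover to \<open>V\<close>.\<close>

lemma homology_zigzag_eq:
 assumes V: "V \<in> Ob (under_cat R)" "derived_inverts R \<Sigma> V" and f: "f \<in> under_homs R (CL, \<eta>) V"
  and p: "zigzag (under_cat R) (L, \<eta>) p V" and x: "x \<in> cycles CL n"
 shows "homology_zigzag n (L, \<eta>) p (hc L n x) = hc (fst V) n (f n x)"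
proof -
 have w: "incl \<in> Weq (under_cat R) (CL, \<eta>) (L, \<eta>)"
  unfolding under_cat_Weq[OF ring_axioms CL_Ob L_Ob] using incl_under incl_bij by (simp add: quasi_iso_def)
 have q: "zigzag (under_cat R) (L, \<eta>) [Bwd incl (CL, \<eta>), Fwd f V] V"
  using w V(1) f under_cat_Hom[OF ring_axioms CL_Ob V(1)] L_Ob CL_Ob by simp
 have xe: "x \<in> elts CL n" by (rule C.cycles_elts[OF x])
 have hC: "hc CL n x \<in> homology CL n" using x unfolding C.homology_eq by blast
 have i: "homology_map L incl n (hc CL n x) = hc L n x"
  using under_hom_props(2)[OF ring_axioms CL_Ob L_Ob incl_under, of x n] xe incl[OF xe] by simp
 have hL: "hc L n x \<in> homology L n" using bij_betw_apply[OF incl_bij hC] i by simp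
 have "inv_into (homology CL n) (homology_map L incl n) (hc L n x) = hc CL n x"
  using bij_betw_inv_into_left[OF incl_bij hC] i by simp
 then have "homology_zigzag n (L, \<eta>) [Bwd incl (CL, \<eta>), Fwd f V] (hc L n x) = homology_map (fst V) f n (hc CL n x)" by simp
 also have "\<dots> = hc (fst V) n (f n x)" using under_hom_props(2)[OF ring_axioms CL_Ob V(1) f, of x n] xe by simp
 finally show ?thesis using homology_zigzag_unique[OF V p q hL] by simp
qed

end

lemma vanishing:
 fixes L :: "('k::field, 'u) dga" and \<Sigma> :: "(nat list \<Rightarrow>\<^sub>0 'k, 'p) arrow set"
 assumes I: "initial_inverting (free_algebra m) \<Sigma> L \<eta>" and inf: "infinite (UNIV :: 'u set)"
  and n: "n \<noteq> 0" and x: "x \<in> cycles (connective_cover L) n"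
 shows "x \<in> boundaries (connective_cover L) n"
proof -
 let ?F = "free_algebra m :: ('k, _) module"
 interpret initial_inverting ?F \<Sigma> L \<eta> by (rule I)
 obtain B \<kappa> where "based_connective CL ?F \<eta> B \<kappa>" by (rule C.ex_based)
 then interpret based_connective CL ?F \<eta> B \<kappa> .
 interpret free_connective CL m \<eta> B \<kappa>
 proof (intro free_connective.intro based_generated.intro based_generated_axioms.intro based_connective_axioms)
  show "\<eta> 0 (generator i) \<in> elts CL 0" if "i < m" for i by (rule C.eta_closed) (use that in simp)
 qed
 obtain TV \<theta>V T0 \<theta>0 \<alpha> s where T: "dga_under (TV :: ('k, 'u) dga) ?F \<theta>V" "dga_under (T0 :: ('k, 'u) dga) ?F \<theta>0"
  "\<alpha> \<in> under_homs ?F (TV, \<theta>V) (T0, \<theta>0)" "s \<in> under_homs ?F (CL, \<eta>) (T0, \<theta>0)"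
  and solv: "\<And>(E :: 'p set) (E' :: 'p set) a n. finite E ==> finite E' ==> (\<And>e f. e \<in> E ==> f \<in> E' ==> a f e \<in> carrier ?F) ==>
   homology_solvable CL (left_act (CL, \<eta>)) E E' a n ==>
   homology_solvable TV (left_act (TV, \<theta>V)) E E' a n \<and> homology_solvable T0 (left_act (T0, \<theta>0)) E E' a n"
  and test: "\<And>n x y. n \<noteq> 0 ==> x \<in> cycles CL n ==> y \<in> cycles TV n ==> \<alpha> n y \<ominus>[gr T0 n] s n x \<in> boundaries T0 n ==> x \<in> boundaries CL n"
  using commutator_test[OF inf, where 'p = 'p] by metis
 have o: "(TV, \<theta>V) \<in> Ob (under_cat ?F)" "(T0, \<theta>0) \<in> Ob (under_cat ?F)"
  using T(1,2) under_cat_Ob[OF ring_axioms] by blast+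
 have iV: "derived_inverts ?F \<Sigma> (TV, \<theta>V)"
  by (rule derived_inverts_transfer[OF \<Sigma> C.dga_under_axioms T(1) CL_inverts]) (rule conjunct1[OF solv])
 have i0: "derived_inverts ?F \<Sigma> (T0, \<theta>0)"
  by (rule derived_inverts_transfer[OF \<Sigma> C.dga_under_axioms T(2) CL_inverts]) (rule conjunct2[OF solv])
 obtain p where p: "zigzag (under_cat ?F) (L, \<eta>) p (TV, \<theta>V)" by (rule zigzag_exists[OF o(1) iV])
 interpret VT: dga_under TV ?F \<theta>V by (rule T(1))
 interpret OT: dga_under T0 ?F \<theta>0 by (rule T(2))
 have xL: "x \<in> cycles L n" using x D.cycles_ops(1)[of n] unfolding D.cc_cycles by (auto split: if_splits)
 have h: "hc L n x \<in> homology (fst (L, \<eta>)) n" using xL unfolding fst_conv D.homology_eq by blast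
 have "homology_zigzag n (L, \<eta>) p (hc L n x) \<in> hc TV n ` cycles TV n"
  using homology_zigzag_props(1)[OF p h] unfolding fst_conv VT.homology_eq .
 then obtain y where y: "y \<in> cycles TV n" "homology_zigzag n (L, \<eta>) p (hc L n x) = hc TV n y" by blast
 have ye: "y \<in> elts TV n" by (rule VT.cycles_elts[OF y(1)])
 have "hc T0 n (s n x) = homology_zigzag n (L, \<eta>) (p @ [Fwd \<alpha> (T0, \<theta>0)]) (hc L n x)"
  using homology_zigzag_eq[OF o(2) i0 T(4) zigzag_Fwd[OF p o(2) T(3)] x] by simp
 also have "\<dots> = homology_map T0 \<alpha> n (hc TV n y)" unfolding homology_zigzag_props(2)[OF p h] y(2) by simp
 also have "\<dots> = hc T0 n (\<alpha> n y)" using under_hom_props(2)[OF ring_axioms o T(3), of y n] ye by simp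
 finally have "hc T0 n (\<alpha> n y) = hc T0 n (s n x)" by simp
 moreover have "\<alpha> n y \<in> elts T0 n" "s n x \<in> elts T0 n"
  using chain_maps_closed[OF under_homs_chain[OF T(3)], of y n] ye
   chain_maps_closed[OF under_homs_chain[OF T(4)], of x n] C.cycles_elts[OF x] by (simp_all del: D.cc_simps)
 ultimately have "\<alpha> n y \<ominus>[gr T0 n] s n x \<in> boundaries T0 n" using OT.hcls_eq_iff by blast
 then show ?thesis by (rule test[OF n x y(1)])
qed

section \<open>Universal localizations\<close>

locale cohn_localization = assoc_algebra R for R :: "('k::field, 'r) module" +
 fixes \<Sigma> :: "('r, 'p) arrow set" and RS :: "'u ring" and lam
 assumes univ: "universal_localization R \<Sigma> RS lam"
begin

lemma RS_ring: "ring RS" and lam: "lam \<in> ring_hom R RS" and lam_inverts: "inverts R \<Sigma> RS lam"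
 using univ unfolding universal_localization_def by blast+

lemma universal_hom:
 assumes "ring S" "\<phi> \<in> ring_hom R S" "inverts R \<Sigma> (S :: 'u ring) \<phi>"
 obtains \<psi> where "\<psi> \<in> ring_hom RS S" "\<And>r. r \<in> carrier R ==> \<psi> (lam r) = \<phi> r"
 using univ assms unfolding universal_localization_def by blast

text \<open>The uniqueness of the universal property, for maps that are not normalized outside the carrier.\<close>

lemma hom_unique:
 assumes S: "ring S" "\<phi> \<in> ring_hom R S" "inverts R \<Sigma> (S :: 'u ring) \<phi>"
  and f: "f \<in> ring_hom RS S" "\<And>r. r \<in> carrier R ==> f (lam r) = \<phi> r"
  and g: "g \<in> ring_hom RS S" "\<And>r. r \<in> carrier R ==> g (lam r) = \<phi> r"
  and x: "x \<in> carrier RS"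
 shows "f x = g x"
proof -
 interpret RS: ring RS by (rule RS_ring)
 have r: "restrict h (carrier RS) \<in> ring_hom RS S \<and> restrict h (carrier RS) \<in> extensional (carrier RS) \<and>
  (\<forall>r\<in>carrier R. restrict h (carrier RS) (lam r) = \<phi> r)"
  if h: "h \<in> ring_hom RS S" "\<And>r. r \<in> carrier R ==> h (lam r) = \<phi> r" for h
  using h ring_hom_closed[OF lam] by (auto simp: ring_hom_def)
 have "\<exists>!\<psi>. \<psi> \<in> ring_hom RS S \<and> \<psi> \<in> extensional (carrier RS) \<and> (\<forall>r\<in>carrier R. \<psi> (lam r) = \<phi> r)"
  using univ S unfolding universal_localization_def by blast
 then have "restrict f (carrier RS) = restrict g (carrier RS)" using r[OF f] r[OF g] by blast
 then have "restrict f (carrier RS) x = restrict g (carrier RS) x" by simp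
 then show ?thesis using x by simp
qed

text \<open>For a scalar \<open>c \<noteq> 0\<close>, conjugation by \<open>lam(c 1)\<close> is an endomorphism of the localization under \<open>R\<close>, hence the identity.\<close>

lemma lam_central:
 assumes x: "x \<in> carrier RS"
 shows "lam (c \<odot>[R] \<one>[R]) \<otimes>[RS] x = x \<otimes>[RS] lam (c \<odot>[R] \<one>[R])"
proof (cases "c = 0")
 interpret RS: ring RS by (rule RS_ring)
 case True
 have "lam \<zero>[R] = \<zero>[RS]" by (rule ring_hom_zero[OF lam ring_axioms RS_ring])
 then show ?thesis using x True by (simp add: vs_zero_scalar[OF vspace])
next
 interpret RS: ring RS by (rule RS_ring)
 case False
 have sc: "d \<odot>[R] \<one>[R] \<in> carrier R" for d by (simp add: vs_smult_closed[OF vspace])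
 define u where "u = lam (c \<odot>[R] \<one>[R])"
 define v where "v = lam (inverse c \<odot>[R] \<one>[R])"
 have uv: "u \<in> carrier RS" "v \<in> carrier RS" unfolding u_def v_def by (rule ring_hom_closed[OF lam sc])+
 have m: "(c \<odot>[R] \<one>[R]) \<otimes>[R] r \<otimes>[R] (d \<odot>[R] \<one>[R]) = (c * d) \<odot>[R] r" if "r \<in> carrier R" for c d r
  using that by (simp add: smult_mult_left smult_mult_right vs_smult_closed[OF vspace] vs_assoc[OF vspace] mult.commute)
 have e: "u \<otimes>[RS] v = \<one>[RS]" "v \<otimes>[RS] u = \<one>[RS]"
  using m[of "\<one>[R]" c "inverse c"] m[of "\<one>[R]" "inverse c" c] False ring_hom_one[OF lam] vs_one[OF vspace one_closed]
  unfolding u_def v_def ring_hom_mult[OF lam sc sc, symmetric] by (simp_all add: sc)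
 \<comment> \<open>conjugation\<close>
 define f where "f = (%x. u \<otimes>[RS] x \<otimes>[RS] v)"
 have ca: "v \<otimes>[RS] (u \<otimes>[RS] y) = y" if "y \<in> carrier RS" for y
  using RS.m_assoc[OF uv(2,1) that] e that by simp
 have "f \<in> ring_hom RS RS"
  by (rule ring_hom_memI) (simp_all add: f_def uv RS.l_distr RS.r_distr RS.m_assoc e ca)
 moreover have "f (lam r) = lam r" if r: "r \<in> carrier R" for r
  using m[OF r, of c "inverse c"] False r vs_one[OF vspace r]
  unfolding f_def u_def v_def ring_hom_mult[OF lam sc r, symmetric] ring_hom_mult[OF lam m_closed[OF sc r] sc, symmetric] by simp
 moreover have "(%x. x) \<in> ring_hom RS RS" by (rule ring_hom_memI) simp_all
 ultimately have "f x = x" using hom_unique[OF RS_ring lam lam_inverts, of f "%x. x" x] x by simp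
 then have "x \<otimes>[RS] u = u \<otimes>[RS] x \<otimes>[RS] v \<otimes>[RS] u" by (simp add: f_def)
 also have "\<dots> = u \<otimes>[RS] x" using RS.m_assoc[of "u \<otimes>[RS] x" v u] uv x e by simp
 finally show ?thesis by (simp add: u_def)
qed

sublocale K: central_ring_under R RS lam
 by (intro central_ring_under.intro central_ring_under_axioms.intro assoc_algebra_axioms RS_ring lam lam_central)

end

section \<open>Comparison of the two localizations\<close>

lemma ring_under_map:
 assumes "central_ring_under R S \<phi>" "central_ring_under R S' \<phi>'"
  and f: "f \<in> ring_hom S S'" "\<And>r. r \<in> carrier R ==> f (\<phi> r) = \<phi>' r"
 shows "(%n. restrict f (if n = 0 then carrier S else {\<zero>[S]})) \<in> under_homs R (ring_under R S \<phi>) (ring_under R S' \<phi>')"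
  (is "?g \<in> _")
proof -
 interpret S: central_ring_under R S \<phi> by fact
 interpret S': central_ring_under R S' \<phi>' by fact
 have f0: "f \<zero>[S] = \<zero>[S']" by (rule ring_hom_zero[OF f(1) S.S.ring_axioms S'.S.ring_axioms])
 note fh = ring_hom_closed[OF f(1)] ring_hom_add[OF f(1)] ring_hom_mult[OF f(1)] ring_hom_one[OF f(1)]
 have lin: "?g n \<in> linear_maps (gr S.SA n) (gr S'.SA n)" for n
  by (cases "n = 0"; rule linear_mapsI) (simp_all add: fh f0 f(2) S.phi_closed S.scalar_closed S'.phi_closed)
 have dif: "?g (n - 1) (dif S.SA n x) = dif S'.SA n (?g n x)" if "x \<in> elts S.SA n" for n x by (simp add: f0)
 have mult: "?g (i + j) (mul S.SA i j x y) = mul S'.SA i j (?g i x) (?g j y)"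
  if "x \<in> elts S.SA i" "y \<in> elts S.SA j" for i j x y using that by (auto simp: fh f0)
 have ext: "?g n \<in> extensional (elts S.SA n)" for n by simp
 have u: "?g 0 (unit S.SA) = unit S'.SA" by (simp add: fh(4))
 have "?g \<in> dga_homs S.SA S'.SA" unfolding dga_homs_def chain_maps_def using lin dif mult ext u by blast
 then show ?thesis unfolding under_homs_def using S.S\<eta>_0 S'.S\<eta>_0 f(2) by (simp add: S.phi_closed)
qed

lemma (in central_ring_under) hc_SA_eq_iff:
 assumes "x \<in> carrier S" "y \<in> carrier S" shows "hc SA 0 x = hc SA 0 y \<longleftrightarrow> x = y"
proof -
 interpret A: dg_algebra SA by (rule SA_dga)
 have "hc SA 0 x = hc SA 0 y \<longleftrightarrow> x \<ominus>[gr SA 0] y = \<zero>[S]" using A.hcls_eq_iff[of x 0 y] assms by (simp add: boundaries_SA)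
 then show ?thesis using assms S.diff_eq_iff[of x y "\<zero>[S]"] by (simp add: SA_minus)
qed

locale comparison = initial_inverting R \<Sigma> L \<eta> + cohn_localization R \<Sigma> RS lam
 for R :: "('k::field, 'r) module" and \<Sigma> :: "('r, 'p) arrow set" and L :: "('k, 'u) dga" and \<eta> and RS :: "'u ring" and lam +
 assumes higher: "n \<noteq> 0 ==> x \<in> cycles CL n ==> x \<in> boundaries CL n"
begin

abbreviation "V \<equiv> ring_under R RS lam"
abbreviation "W \<equiv> ring_under R C.H0 C.\<phi>"

lemma V_Ob: "V \<in> Ob (under_cat R)" using K.SA_under under_cat_Ob[OF ring_axioms, of K.SA K.S\<eta>] by simp
lemma W_Ob: "W \<in> Ob (under_cat R)" using C.H.SA_under under_cat_Ob[OF ring_axioms, of C.H.SA C.H.S\<eta>] by simp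
lemma V_inverts: "derived_inverts R \<Sigma> V" by (rule K.derived_inverts_SA[OF \<Sigma> lam_inverts])
lemma W_ring_inverts: "inverts R \<Sigma> C.H0 C.\<phi>" by (rule C.H0_inverts[OF \<Sigma> CL_inverts])
lemma W_inverts: "derived_inverts R \<Sigma> W" by (rule C.H.derived_inverts_SA[OF \<Sigma> W_ring_inverts])

lemma CL_cycles_0: "x \<in> elts CL 0 \<longleftrightarrow> x \<in> cycles L 0" by simp

lemma nf_eq_hc: "x \<in> elts CL 0 ==> y \<in> elts CL 0 ==> C.nf x = C.nf y \<longleftrightarrow> hc L 0 x = hc L 0 y"
 using C.nf_eq_iff[of x y] D.cc_minus[of x 0 y] D.hcls_eq_iff[of x 0 y] D.cycles_elts[of _ 0] by (simp add: D.cc_boundaries)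

text \<open>\<open>t\<close> is the effect of the zigzag on representatives, \<open>\<theta>\<close> the map \<open>H\<^sub>0(L) \<rightarrow> R\<^sub>\<Sigma>\<close> that it induces, and \<open>\<psi>\<close> the map in the other
 direction.\<close>

lemma degree_zero:
 assumes p: "zigzag (under_cat R) (L, \<eta>) p V"
 shows "bij_betw (homology_zigzag 0 (L, \<eta>) p) (homology L 0) (homology K.SA 0)"
proof -
 interpret A: dg_algebra K.SA by (rule K.SA_dga)
 interpret RS: ring RS by (rule RS_ring)
 interpret H: ring C.H0 by (rule C.H0_ring)
 let ?Z = "homology_zigzag 0 (L, \<eta>) p"
 note Z = respectsD[OF respects_zigzag[OF ring_axioms p], unfolded fst_conv snd_conv]
 have hL: "homology L 0 = hc L 0 ` elts CL 0" unfolding D.homology_eq by simp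
 have hV: "homology K.SA 0 = hc K.SA 0 ` carrier RS" unfolding A.homology_eq K.cycles_SA by simp
 have "\<exists>y. y \<in> carrier RS \<and> ?Z (hc L 0 x) = hc K.SA 0 y" if "x \<in> elts CL 0" for x
  using Z(1)[of "hc L 0 x"] that unfolding hL hV by blast
 then obtain t where t: "\<And>x. x \<in> elts CL 0 ==> t x \<in> carrier RS \<and> ?Z (hc L 0 x) = hc K.SA 0 (t x)" by metis
 have teq: "t x = y" if "x \<in> elts CL 0" "y \<in> carrier RS" "?Z (hc L 0 x) = hc K.SA 0 y" for x y
  using t[OF that(1)] that K.hc_SA_eq_iff by metis
 have cyc: "x \<in> cycles K.SA 0" if "x \<in> carrier RS" for x using that by (simp add: K.cycles_SA)
 have cl: "mul CL 0 0 x y \<in> elts CL 0" "x \<oplus>[gr CL 0] y \<in> elts CL 0" if "x \<in> elts CL 0" "y \<in> elts CL 0" for x y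
  by (rule C.mul0[OF that], rule C.add_closed[OF that])
 have tm: "t (mul CL 0 0 x y) = t x \<otimes>[RS] t y" "t (x \<oplus>[gr CL 0] y) = t x \<oplus>[RS] t y" if x: "x \<in> elts CL 0" "y \<in> elts CL 0" for x y
 proof -
  note tx = t[OF x(1)] and ty = t[OF x(2)]
  note c = x[unfolded CL_cycles_0] cyc[OF conjunct1[OF tx]] cyc[OF conjunct1[OF ty]] conjunct2[OF tx] conjunct2[OF ty]
  show "t (mul CL 0 0 x y) = t x \<otimes>[RS] t y" by (rule teq[OF cl(1)[OF x]]) (use Z(2)[OF c] tx ty in simp_all)
  show "t (x \<oplus>[gr CL 0] y) = t x \<oplus>[RS] t y" by (rule teq[OF cl(2)[OF x]]) (use Z(3)[OF c] tx ty in simp_all)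
 qed
 have t\<eta>: "t (\<eta> 0 r) = lam r" if "r \<in> carrier R" for r
  by (rule teq[OF C.eta_closed[OF that] ring_hom_closed[OF lam that]]) (use Z(4)[OF that] K.S\<eta>_0[OF that] in simp)
 have tnf: "t x = t y" if "x \<in> elts CL 0" "y \<in> elts CL 0" "C.nf x = C.nf y" for x y
  using teq[OF that(1), of "t y"] t[OF that(2)] that nf_eq_hc[OF that(1,2)] by simp
 \<comment> \<open>a choice of preimage, which does not matter by \<open>tnf\<close>\<close>
 define \<theta> where "\<theta> = (%s. t (SOME x. x \<in> elts CL 0 \<and> C.nf x = s))"
 have \<theta>: "\<theta> (C.nf x) = t x" if x: "x \<in> elts CL 0" for x
 proof -
  have "(SOME y. y \<in> elts CL 0 \<and> C.nf y = C.nf x) \<in> elts CL 0 \<and> C.nf (SOME y. y \<in> elts CL 0 \<and> C.nf y = C.nf x) = C.nf x"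
   by (rule someI[where x = x]) (use x in blast)
  then show ?thesis unfolding \<theta>_def using tnf[OF _ x] by blast
 qed
 have \<theta>h: "\<theta> \<in> ring_hom C.H0 RS"
 proof (rule ring_hom_memI)
  fix a b assume "a \<in> carrier C.H0" "b \<in> carrier C.H0"
  then obtain x y where x: "x \<in> elts CL 0" "a = C.nf x" and y: "y \<in> elts CL 0" "b = C.nf y" unfolding C.H0_carrier by (elim imageE)
  show "\<theta> a \<in> carrier RS" using t[OF x(1)] \<theta>[OF x(1)] x(2) by simp
  show "\<theta> (a \<otimes>[C.H0] b) = \<theta> a \<otimes>[RS] \<theta> b" "\<theta> (a \<oplus>[C.H0] b) = \<theta> a \<oplus>[RS] \<theta> b"
   unfolding x(2) y(2) C.nf_mult[OF x(1) y(1), symmetric] C.nf_add[OF x(1) y(1), symmetric]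
    \<theta>[OF cl(1)[OF x(1) y(1)]] \<theta>[OF cl(2)[OF x(1) y(1)]] \<theta>[OF x(1)] \<theta>[OF y(1)]
   by (rule tm[OF x(1) y(1)])+
 next
  have "\<theta> \<one>[C.H0] = t (\<eta> 0 \<one>[R])" unfolding C.H0_one C.eta_one by (rule \<theta>[OF C.unit_closed])
  also have "\<dots> = \<one>[RS]" unfolding t\<eta>[OF one_closed] by (rule ring_hom_one[OF lam])
  finally show "\<theta> \<one>[C.H0] = \<one>[RS]" .
 qed
 have \<theta>\<phi>: "\<theta> (C.\<phi> r) = lam r" if "r \<in> carrier R" for r
  unfolding C.\<phi>_def \<theta>[OF C.eta_closed[OF that]] by (rule t\<eta>[OF that])
 obtain \<psi> where \<psi>: "\<psi> \<in> ring_hom RS C.H0" "\<And>r. r \<in> carrier R ==> \<psi> (lam r) = C.\<phi> r"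
  using universal_hom[OF C.H0_ring C.phi_hom W_ring_inverts] by blast
 have \<theta>\<psi>: "\<theta> (\<psi> y) = y" if y: "y \<in> carrier RS" for y
 proof (rule hom_unique[OF RS_ring lam lam_inverts _ _ _ _ y, where f = "%y. \<theta> (\<psi> y)" and g = "%y. y"])
  show "(%y. \<theta> (\<psi> y)) \<in> ring_hom RS RS"
   using ring_hom_trans[OF \<psi>(1) \<theta>h] by (simp add: comp_def)
  show "\<theta> (\<psi> (lam r)) = lam r" if "r \<in> carrier R" for r unfolding \<psi>(2)[OF that] by (rule \<theta>\<phi>[OF that])
  show "(%y. y) \<in> ring_hom RS RS" by (rule ring_hom_memI) simp_all
 qed simp
 let ?\<Psi> = "%n::int. restrict \<psi> (if n = 0 then carrier RS else {\<zero>[RS]})"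
 have \<Psi>: "?\<Psi> \<in> under_homs R V W" by (rule ring_under_map[OF K.central_ring_under_axioms C.H.central_ring_under_axioms \<psi>])
 have \<psi>t: "\<psi> (t x) = C.nf x" if x: "x \<in> elts CL 0" for x
 proof -
  have xc: "x \<in> cycles CL 0" using x unfolding C.cycles_0 .
  have hx: "hc L 0 x \<in> homology (fst (L, \<eta>)) 0" unfolding fst_conv hL using x by blast
  have tx: "t x \<in> carrier RS" using t[OF x] by blast
  have "hc C.H.SA 0 (C.nf x) = homology_zigzag 0 (L, \<eta>) (p @ [Fwd ?\<Psi> W]) (hc L 0 x)"
   using homology_zigzag_eq[OF W_Ob W_inverts C.pi_hom zigzag_Fwd[OF p W_Ob \<Psi>] xc] C.pi_0[OF x] by simp
  also have "\<dots> = homology_map C.H.SA ?\<Psi> 0 (hc K.SA 0 (t x))" unfolding homology_zigzag_props(2)[OF p hx] using t[OF x] by simp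
  also have "\<dots> = hc C.H.SA 0 (\<psi> (t x))" using under_hom_props(2)[OF ring_axioms V_Ob W_Ob \<Psi>, of "t x" 0] tx by simp
  finally show ?thesis using C.H.hc_SA_eq_iff[OF C.nf_closed[OF x] ring_hom_closed[OF \<psi>(1) tx]] by simp
 qed
 show ?thesis unfolding bij_betw_def
 proof
  show "inj_on ?Z (homology L 0)"
  proof (rule inj_onI)
   fix a b assume ab: "a \<in> homology L 0" "b \<in> homology L 0" "?Z a = ?Z b"
   from ab(1,2) obtain x y where x: "x \<in> elts CL 0" "a = hc L 0 x" and y: "y \<in> elts CL 0" "b = hc L 0 y" unfolding hL by (elim imageE)
   have "t x = t y" using ab(3) t[OF x(1)] t[OF y(1)] K.hc_SA_eq_iff[of "t x" "t y"] unfolding x(2) y(2) by simp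
   then have "C.nf x = C.nf y" using \<psi>t[OF x(1)] \<psi>t[OF y(1)] by simp
   then show "a = b" unfolding x(2) y(2) nf_eq_hc[OF x(1) y(1)] .
  qed
  show "?Z ` homology L 0 = homology K.SA 0"
  proof (rule subset_antisym)
   show "?Z ` homology L 0 \<subseteq> homology K.SA 0" using Z(1) by blast
   show "homology K.SA 0 \<subseteq> ?Z ` homology L 0"
   proof
    fix a assume "a \<in> homology K.SA 0"
    then obtain y where y: "y \<in> carrier RS" "a = hc K.SA 0 y" unfolding hV by (elim imageE)
    have "\<psi> y \<in> C.nf ` elts CL 0" using ring_hom_closed[OF \<psi>(1) y(1)] unfolding C.H0_carrier .
    then obtain x where x: "x \<in> elts CL 0" "\<psi> y = C.nf x" by (elim imageE)
    have "y = t x" using \<theta>\<psi>[OF y(1)] \<theta>[OF x(1)] x(2) by simp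
    then have "a = ?Z (hc L 0 x)" using t[OF x(1)] y(2) by simp
    then show "a \<in> ?Z ` homology L 0" unfolding hL using x(1) by blast
   qed
  qed
 qed
qed

lemma L_boundary: "n \<noteq> 0 ==> x \<in> cycles L n ==> x \<in> boundaries L n"
 using negative_boundary[of n x] higher[of n x] unfolding D.cc_cycles D.cc_boundaries by (cases "n < 0") simp_all

lemma homology_singleton:
 assumes A: "chain_complex A" and c: "cycles A n \<subseteq> boundaries A n" shows "homology A n = {hc A n \<zero>[gr A n]}"
proof -
 interpret chain_complex A by (rule A)
 interpret M: abelian_group "gr A n" by simp
 have "hc A n x = hc A n \<zero>[gr A n]" if x: "x \<in> cycles A n" for x
  unfolding hcls_eq_iff[OF cycles_elts[OF x] M.zero_closed] using boundaries_ops(5)[OF _ boundaries_ops(1)] x c by blast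
 then show ?thesis unfolding homology_eq using cycles_ops(1)[of n] by blast
qed

lemma zigzag_bij:
 assumes p: "zigzag (under_cat R) (L, \<eta>) p V"
 shows "bij_betw (homology_zigzag n (L, \<eta>) p) (homology L n) (homology K.SA n)"
proof (cases "n = 0")
 case True then show ?thesis using degree_zero[OF p] by simp
next
 case False
 interpret A: dg_algebra K.SA by (rule K.SA_dga)
 have 1: "homology L n = {hc L n \<zero>[gr L n]}"
  by (rule homology_singleton[OF D.chain_complex_axioms]) (use L_boundary[OF False] in blast)
 have 2: "homology K.SA n = {hc K.SA n \<zero>[gr K.SA n]}"
  by (rule homology_singleton[OF A.chain_complex_axioms]) (simp add: K.cycles_SA K.boundaries_SA False)
 have "homology_zigzag n (L, \<eta>) p (hc L n \<zero>[gr L n]) \<in> homology K.SA n"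
  using homology_zigzag_props(1)[OF p, of "hc L n \<zero>[gr L n]" n] 1 by simp
 then show ?thesis unfolding 1 2 by (simp add: bij_betw_def)
qed

lemma canonical_quasi_iso: "under_quasi_iso R (L, \<eta>) V (canonical_morphism R (L, \<eta>) V)"
proof -
 have ex1: "\<exists>!\<phi>. \<phi> \<in> loc_hom (under_cat R) (L, \<eta>) V" by (rule loc_hom_unique[OF V_Ob V_inverts])
 have m: "canonical_morphism R (L, \<eta>) V \<in> loc_hom (under_cat R) (L, \<eta>) V"
  unfolding canonical_morphism_def by (rule theI'[OF ex1])
 have "bij_betw (homology_zigzag n (L, \<eta>) q) (homology L n) (homology K.SA n)"
  if q: "q \<in> canonical_morphism R (L, \<eta>) V" for q n
 proof -
  obtain p where "\<And>q. q \<in> canonical_morphism R (L, \<eta>) V ==> zigzag_eq (under_cat R) (L, \<eta>) V p q"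
   by (rule loc_hom_zigzag[OF m]) blast
  then have e: "zigzag_eq (under_cat R) (L, \<eta>) V p q" using q by blast
  interpret W: wcat_functor "under_cat R :: (('k, 'r, 'u) dga_under, int => 'u => 'u) wcat"
   "%U. homology (fst U) n" "%U V f. homology_map (fst V) f n" by (rule under_cat_functor[OF ring_axioms])
  show ?thesis using W.zigzag_eq_zz[OF e] zigzag_bij by blast
 qed
 then show ?thesis unfolding under_quasi_iso_def using m by simp
qed

end

theorem theorem3p4:
  fixes R :: "('k::field, nat list \<Rightarrow>\<^sub>0 'k) module"
    and \<Sigma> :: "(nat list \<Rightarrow>\<^sub>0 'k, 'p) arrow set"
    and RS :: "'u ring" and lam :: "(nat list \<Rightarrow>\<^sub>0 'k) \<Rightarrow> 'u"
    and L :: "('k, nat list \<Rightarrow>\<^sub>0 'k, 'u) dga_under"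
    and m :: nat
  assumes "infinite (UNIV :: 'u set)" and "\<exists>\<iota> :: 'k \<Rightarrow> 'u. inj \<iota>"
    and "R = free_algebra m"
    and "\<Sigma> \<subseteq> fg_free_arrows R"
    and "universal_localization R \<Sigma> RS lam"
    and "derived_localization R \<Sigma> L"
  shows "under_quasi_iso R L (ring_under R RS lam) (canonical_morphism R L (ring_under R RS lam))"
proof -
 obtain A \<eta> where L: "L = (A, \<eta>)" by (cases L)
 have alg: "assoc_algebra R" unfolding assms(3) by (rule free_algebra_assoc_algebra)
 have I: "initial_inverting R \<Sigma> A \<eta>"
  by (intro initial_inverting.intro initial_inverting_axioms.intro alg assms(4) assms(6)[unfolded L])
 interpret comparison R \<Sigma> A \<eta> RS lam
  by (intro comparison.intro comparison_axioms.intro cohn_localization.intro cohn_localization_axioms.intro I alg assms(5))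
   (rule vanishing[OF I[unfolded assms(3)] assms(1)])
 show ?thesis unfolding L by (rule canonical_quasi_iso)
qed

end
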